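(* Let $X$ be a monoid scheme and let $\gamma: X_{\mathbb{Z}}\to\mathrm{SCong}\,X$ be the canonical continuous map factorizing the canonical map $p:X_{\mathbb{Z}}\to X$ as $p=\pi_X\circ\gamma$. Then this factorization induces, for every $x\in X_{\mathbb{Z}}$, an injective morphism of pointed groups $\gamma_x:\kappa(\gamma(x))\to\kappa(x)^\bullet$; that is, the composition $\mathcal{O}_{X,p(x)}\to\mathcal{O}_{X_{\mathbb{Z}},x}^\bullet\to\kappa(x)^\bullet$ factors through the quotient $\mathcal{O}_{X,p(x)}\to\kappa(\gamma(x))$ and the resulting morphism $\gamma_x$ is injective.
   Context: All monoids and rings are commutative with unit. A pointed monoid is a multiplicative monoid $A$ with unit $1$ and absorbing element $0$; morphisms preserve products, $0$ and $1$. A pointed group is a pointed monoid with $A^\times=A\setminus\{0\}$. For a ring $R$, $R^\bullet$ is its multiplicative pointed monoid. A domain is a pointed monoid isomorphic to a pointed submonoid of $K^\bullet$ for some field $K$. A congruence on $A$ is an equivalence relation $\mathfrak{c}\subseteq A\times A$ such that $(a,b)\in\mathfrak{c}$ implies $(\lambda a,\lambda b)\in\mathfrak{c}$ for all $\lambda\in A$; it is a strong prime congruence if $A/\mathfrak{c}$ is a domain. Its null ideal is $I_{\mathfrak{c}}=\{a:(a,0)\in\mathfrak{c}\}$. $\mathrm{SCong}\,A$ is the set of strong prime congruences of $A$ with the topology generated by the sets $\{\mathfrak{c}:(a,b)\notin\mathfrak{c}\}$. An ideal of $A$ is a subset $I\ni0$ with $AI\subseteq I$; it is prime if it is proper and $ab\in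 I$ implies $a\in I$ or $b\in I$. $\mathrm{MSpec}\,A$ is the set of prime ideals with basis of opens $U_h=\{P:h\notin P\}$ and sheaf of pointed monoids with $\Gamma(U_h)=A[h^{-1}]$. A monoid scheme is a topological space with a sheaf of pointed monoids, locally isomorphic to $\mathrm{MSpec}\,A$'s (morphisms are local on stalks). $\mathrm{SCong}\,X=\mathrm{colim}_U\,\mathrm{SCong}\,\Gamma U$ over affine opens $U\subseteq X$ with inclusions (transition maps: pullback of congruences); each $\mathrm{SCong}\,U=\mathrm{SCong}\,\Gamma U$ is open in it. $\pi_X:\mathrm{SCong}\,X\to X$ sends $\mathfrak{c}\in\mathrm{SCong}\,\Gamma U$ to $I_{\mathfrak{c}}\in U$. Residue pointed group: for $\tilde{x}\in\mathrm{SCong}\,X$ with $x=\pi_X(\tilde{x})$ and an affine open $U\ni x$, let $\mathfrak{c}_{\tilde{x},U}$ be the congruence on $\Gamma U$ corresponding to $\tilde{x}$ and let $\mathfrak{c}_{\tilde{x}}$ be the congruence on the stalk $\mathcal{O}_{X,x}$ generated by the images of the pairs in $\mathfrak{c}_{\tilde{x},U}$ (independent of $U$). Then $\kappa(\tilde{x})=\mathcal{O}_{X,x}/\mathfrak{c}_{\tilde{x}}$, which is a pointed group isomorphic to $\mathrm{Frac}(\Gamma U/\mathfrak{c}_{\tilde{x},U})$, where $\mathrm{Frac}(B)=(B\setminus\{0\})^{-1}B$. For a pointed monoid $A$, $A_{\mathbb{Z}}=\mathbb{Z}[A]/\langle1_{\mathbb{Z}}0_A\rangle$ (monoid ring modulo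 the absorbing element of $A$); for $U=\mathrm{MSpec}\,A$, $U_{\mathbb{Z}}=\mathrm{Spec}\,A_{\mathbb{Z}}$; $X_{\mathbb{Z}}=\mathrm{colim}_U\,U_{\mathbb{Z}}$ over affine opens $U\subseteq X$, a scheme covered by the opens $U_{\mathbb{Z}}$. $p:X_{\mathbb{Z}}^\bullet\to X$ is the morphism of spaces with sheaves of pointed monoids given on $U_{\mathbb{Z}}=p^{-1}(U)$, $U=\mathrm{MSpec}\,A$, by $\mathfrak{p}\mapsto\mathfrak{p}\cap A$ and on sections by $A\to A_{\mathbb{Z}}^\bullet$. The map $\gamma$ is given on $U_{\mathbb{Z}}$ by $\mathfrak{p}\mapsto\{(a,b)\in A\times A:\overline{a}=\overline{b}\text{ in }A_{\mathbb{Z}}/\mathfrak{p}\}\in\mathrm{SCong}\,U$. For $x\in X_{\mathbb{Z}}$, $\kappa(x)$ is the usual residue field. *)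

theory Defs
  imports
    "HOL-Algebra.Subrings"
    "HOL-Algebra.Weak_Morphisms"
    "HOL-Library.Poly_Mapping"
    "HOL-Analysis.Abstract_Topology"
begin

section \<open>Pointed monoids\<close>

record 'a pmonoid = "'a monoid" +
  pzero :: 'a

locale pointed_monoid = comm_monoid A for A (structure) +
  assumes pzero_closed: "pzero A \<in> carrier A"
    and pzero_absorb: "a \<in> carrier A \<Longrightarrow> a \<otimes> pzero A = pzero A"

definition pm_hom :: "'a pmonoid \<Rightarrow> 'b pmonoid \<Rightarrow> ('a \<Rightarrow> 'b) set" where
  "pm_hom A B = {h \<in> hom A B. h \<one>\<^bsub>A\<^esub> = \<one>\<^bsub>B\<^esub> \<and> h (pzero A) = pzero B}"

definition pm_iso :: "'a pmonoid \<Rightarrow> 'b pmonoid \<Rightarrow> ('a \<Rightarrow> 'b) set" where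
  "pm_iso A B = {h \<in> pm_hom A B. bij_betw h (carrier A) (carrier B)}"

definition pointed_group :: "'a pmonoid \<Rightarrow> bool" where
  "pointed_group G \<longleftrightarrow> pointed_monoid G \<and> Units G = carrier G - {pzero G}"

definition mult_pmonoid :: "'a ring \<Rightarrow> 'a pmonoid" where
  "mult_pmonoid R =
     \<lparr>carrier = carrier R, mult = mult R, one = one R, pzero = zero R\<rparr>"

text \<open>
  A domain is a pointed monoid isomorphic to a pointed submonoid of \<open>K\<^sup>\<bullet>\<close> for some field \<open>K\<close>.
  Since a formula cannot quantify over types, the elements of \<open>K\<close> are taken from one fixed type,
  the formal quotients of finite signed sums of elements of \<open>B\<close>.  This is no restriction: by
  \<open>pointed_domainI\<close> below, a field with elements of any other type may be used just as well, as
  the subfield generated by the image of \<open>B\<close> can be moved to the fixed type.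
\<close>

type_synonym 'b signed_sum = "(bool \<times> 'b) list"

definition pointed_domain :: "'b pmonoid \<Rightarrow> bool" where
  "pointed_domain B \<longleftrightarrow> pointed_monoid B \<and>
     (\<exists>(K :: ('b signed_sum \<times> 'b signed_sum) ring) S.
        field K \<and> submonoid S K \<and> \<zero>\<^bsub>K\<^esub> \<in> S \<and>
        (\<exists>h. h \<in> pm_iso B ((mult_pmonoid K)\<lparr>carrier := S\<rparr>)))"


primrec signed_sum :: "'k ring \<Rightarrow> ('b \<Rightarrow> 'k) \<Rightarrow> 'b signed_sum \<Rightarrow> 'k" where
  "signed_sum K h [] = \<zero>\<^bsub>K\<^esub>"
| "signed_sum K h (x # l) =
     (if fst x then h (snd x) else \<ominus>\<^bsub>K\<^esub> h (snd x)) \<oplus>\<^bsub>K\<^esub> signed_sum K h l"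

lemma pointed_domainI:
  fixes K :: "'k ring" and B :: "'b pmonoid"
  assumes "pointed_monoid B" and "field K"
    and h: "h \<in> pm_hom B (mult_pmonoid K)" and inj: "inj_on h (carrier B)"
  shows "pointed_domain B"
proof -
  interpret B: pointed_monoid B by fact
  interpret K: field K by fact
  have h_cl: "h b \<in> carrier K" if "b \<in> carrier B" for b
    using h that by (auto simp: pm_hom_def hom_def mult_pmonoid_def)
  have h_mult: "h (b \<otimes>\<^bsub>B\<^esub> c) = h b \<otimes>\<^bsub>K\<^esub> h c" if "b \<in> carrier B" "c \<in> carrier B" for b c
    using h that by (auto simp: pm_hom_def hom_def mult_pmonoid_def)
  have h_one: "h \<one>\<^bsub>B\<^esub> = \<one>\<^bsub>K\<^esub>" and h_zero: "h (pzero B) = \<zero>\<^bsub>K\<^esub>"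
    using h by (auto simp: pm_hom_def mult_pmonoid_def)
  define L :: "'b signed_sum set" where "L = {l. snd ` set l \<subseteq> carrier B}"
  define E where "E = signed_sum K h ` L"
  have E_cl: "E \<subseteq> carrier K"
  proof -
    have "signed_sum K h l \<in> carrier K" if "snd ` set l \<subseteq> carrier B" for l
      using that by (induction l) (auto simp: h_cl)
    then show ?thesis by (auto simp: E_def L_def)
  qed
  note E_c [simp] = subsetD [OF E_cl]
  have E_zero: "\<zero>\<^bsub>K\<^esub> \<in> E"
    unfolding E_def by (rule image_eqI [of _ _ "[]"]) (auto simp: L_def)
  have E_h: "h b \<in> E" if "b \<in> carrier B" for b
    unfolding E_def using that
    by (intro image_eqI [of _ _ "[(True, b)]"]) (auto simp: L_def h_cl)
  have E_step: "h b \<oplus>\<^bsub>K\<^esub> x \<in> E" "(\<ominus>\<^bsub>K\<^esub> h b) \<oplus>\<^bsub>K\<^esub> x \<in> E" if "b \<in> carrier B" "x \<in> E" for b x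
  proof -
    from that(2) obtain l where l: "l \<in> L" "x = signed_sum K h l" by (auto simp: E_def)
    show "h b \<oplus>\<^bsub>K\<^esub> x \<in> E" unfolding E_def
      by (rule image_eqI [of _ _ "(True, b) # l"]) (use l that in \<open>auto simp: L_def\<close>)
    show "(\<ominus>\<^bsub>K\<^esub> h b) \<oplus>\<^bsub>K\<^esub> x \<in> E" unfolding E_def
      by (rule image_eqI [of _ _ "(False, b) # l"]) (use l that in \<open>auto simp: L_def\<close>)
  qed
  have E_induct: "P x" if x: "x \<in> E" and P0: "P \<zero>\<^bsub>K\<^esub>"
    and P1: "\<And>b x. b \<in> carrier B \<Longrightarrow> x \<in> E \<Longrightarrow> P x \<Longrightarrow> P (h b \<oplus>\<^bsub>K\<^esub> x)"
    and P2: "\<And>b x. b \<in> carrier B \<Longrightarrow> x \<in> E \<Longrightarrow> P x \<Longrightarrow> P ((\<ominus>\<^bsub>K\<^esub> h b) \<oplus>\<^bsub>K\<^esub> x)" for P x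
  proof -
    have "snd ` set l \<subseteq> carrier B \<Longrightarrow> P (signed_sum K h l)" for l
    proof (induction l)
      case Nil then show ?case by (simp add: P0)
    next
      case (Cons y l)
      then have "signed_sum K h l \<in> E" by (auto simp: E_def L_def)
      then show ?case using Cons P1 P2 by auto
    qed
    then show ?thesis using x by (auto simp: E_def L_def)
  qed
  have E_add: "x \<oplus>\<^bsub>K\<^esub> y \<in> E" if "x \<in> E" "y \<in> E" for x y
    by (rule E_induct [where P = "\<lambda>x. x \<oplus>\<^bsub>K\<^esub> y \<in> E", OF that(1)]) (use that(2) in \<open>auto simp: h_cl K.a_assoc E_step\<close>)
  have E_neg: "\<ominus>\<^bsub>K\<^esub> x \<in> E" if "x \<in> E" for x
    by (rule E_induct [where P = "\<lambda>x. \<ominus>\<^bsub>K\<^esub> x \<in> E", OF that]) (auto simp: h_cl E_zero E_step K.minus_add)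
  have E_hm: "h b \<otimes>\<^bsub>K\<^esub> x \<in> E" if "b \<in> carrier B" "x \<in> E" for b x
    by (rule E_induct [where P = "\<lambda>x. h b \<otimes>\<^bsub>K\<^esub> x \<in> E", OF that(2)]) (use that(1) in \<open>auto simp: h_cl E_zero E_step K.r_distr K.r_minus simp flip: h_mult\<close>)
  have E_mult: "x \<otimes>\<^bsub>K\<^esub> y \<in> E" if "x \<in> E" "y \<in> E" for x y
    by (rule E_induct [where P = "\<lambda>x. x \<otimes>\<^bsub>K\<^esub> y \<in> E", OF that(1)]) (use that(2) in \<open>auto simp: h_cl E_zero E_add E_neg E_hm K.l_distr K.l_minus\<close>)
  have E_one: "\<one>\<^bsub>K\<^esub> \<in> E" using E_h [OF B.one_closed] by (simp add: h_one)
  have inv_cl: "inv\<^bsub>K\<^esub> y \<in> carrier K" "y \<otimes>\<^bsub>K\<^esub> inv\<^bsub>K\<^esub> y = \<one>\<^bsub>K\<^esub>" if "y \<in> carrier K" "y \<noteq> \<zero>\<^bsub>K\<^esub>" for y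
    using that K.field_Units by (auto intro: K.Units_r_inv)
  define quo where "quo = (\<lambda>(l, m). signed_sum K h l \<otimes>\<^bsub>K\<^esub> inv\<^bsub>K\<^esub> signed_sum K h m)"
  define D where "D = {(l, m). l \<in> L \<and> m \<in> L \<and> signed_sum K h m \<noteq> \<zero>\<^bsub>K\<^esub>}"
  define F where "F = quo ` D"
  have F_iff: "z \<in> F \<longleftrightarrow> z \<in> carrier K \<and> (\<exists>y\<in>E. y \<noteq> \<zero>\<^bsub>K\<^esub> \<and> z \<otimes>\<^bsub>K\<^esub> y \<in> E)" for z
  proof
    assume "z \<in> F"
    then obtain l m where lm: "l \<in> L" "m \<in> L" "signed_sum K h m \<noteq> \<zero>\<^bsub>K\<^esub>"
        "z = signed_sum K h l \<otimes>\<^bsub>K\<^esub> inv\<^bsub>K\<^esub> signed_sum K h m"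
      by (auto simp: F_def D_def quo_def)
    then have mem: "signed_sum K h l \<in> E" "signed_sum K h m \<in> E" by (auto simp: E_def)
    note i = inv_cl [OF E_c [OF mem(2)] lm(3)]
    have "z \<otimes>\<^bsub>K\<^esub> signed_sum K h m = signed_sum K h l"
      using i mem lm(4) by (simp add: K.m_assoc K.m_comm [of "inv\<^bsub>K\<^esub> signed_sum K h m"])
    then show "z \<in> carrier K \<and> (\<exists>y\<in>E. y \<noteq> \<zero>\<^bsub>K\<^esub> \<and> z \<otimes>\<^bsub>K\<^esub> y \<in> E)"
      using mem lm i(1) by auto
  next
    assume "z \<in> carrier K \<and> (\<exists>y\<in>E. y \<noteq> \<zero>\<^bsub>K\<^esub> \<and> z \<otimes>\<^bsub>K\<^esub> y \<in> E)"
    then obtain m l where lm: "l \<in> L" "m \<in> L" "signed_sum K h m \<noteq> \<zero>\<^bsub>K\<^esub>" "z \<in> carrier K"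
        "z \<otimes>\<^bsub>K\<^esub> signed_sum K h m = signed_sum K h l"
      by (auto simp: E_def)
    then have mem: "signed_sum K h m \<in> E" by (auto simp: E_def)
    note i = inv_cl [OF E_c [OF mem] lm(3)]
    have "z = signed_sum K h l \<otimes>\<^bsub>K\<^esub> inv\<^bsub>K\<^esub> signed_sum K h m"
      using i mem lm(4) by (simp add: K.m_assoc flip: lm(5))
    then show "z \<in> F" using lm by (auto simp: F_def D_def quo_def intro!: image_eqI [of _ _ "(l, m)"])
  qed
  have E_F: "x \<in> F" if "x \<in> E" for x
    using that E_one by (auto simp: F_iff intro!: bexI [of _ "\<one>\<^bsub>K\<^esub>"])
  have "subring F K"
  proof (rule K.subringI)
    show "F \<subseteq> carrier K" by (auto simp: F_iff)
    show "\<one>\<^bsub>K\<^esub> \<in> F" by (rule E_F [OF E_one])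
  next
    fix z assume "z \<in> F"
    then obtain y where "z \<in> carrier K" "y \<in> E" "y \<noteq> \<zero>\<^bsub>K\<^esub>" "z \<otimes>\<^bsub>K\<^esub> y \<in> E" by (auto simp: F_iff)
    then show "\<ominus>\<^bsub>K\<^esub> z \<in> F"
      by (auto simp: F_iff K.l_minus intro!: bexI [of _ y] E_neg)
  next
    fix z w assume "z \<in> F" "w \<in> F"
    then obtain y v where y: "z \<in> carrier K" "y \<in> E" "y \<noteq> \<zero>\<^bsub>K\<^esub>" "z \<otimes>\<^bsub>K\<^esub> y \<in> E"
      and v: "w \<in> carrier K" "v \<in> E" "v \<noteq> \<zero>\<^bsub>K\<^esub>" "w \<otimes>\<^bsub>K\<^esub> v \<in> E"
      by (auto simp: F_iff)
    have nz: "y \<otimes>\<^bsub>K\<^esub> v \<noteq> \<zero>\<^bsub>K\<^esub>" using y v by (auto dest!: K.integral)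
    have "(z \<otimes>\<^bsub>K\<^esub> w) \<otimes>\<^bsub>K\<^esub> (y \<otimes>\<^bsub>K\<^esub> v) = (z \<otimes>\<^bsub>K\<^esub> y) \<otimes>\<^bsub>K\<^esub> (w \<otimes>\<^bsub>K\<^esub> v)"
      using y(1) v(1) E_c [OF y(2)] E_c [OF v(2)] by algebra
    then have "(z \<otimes>\<^bsub>K\<^esub> w) \<otimes>\<^bsub>K\<^esub> (y \<otimes>\<^bsub>K\<^esub> v) \<in> E" using E_mult y v by simp
    then show "z \<otimes>\<^bsub>K\<^esub> w \<in> F"
      using nz y v E_mult by (auto simp: F_iff)
    have "(z \<oplus>\<^bsub>K\<^esub> w) \<otimes>\<^bsub>K\<^esub> (y \<otimes>\<^bsub>K\<^esub> v) = (z \<otimes>\<^bsub>K\<^esub> y) \<otimes>\<^bsub>K\<^esub> v \<oplus>\<^bsub>K\<^esub> (w \<otimes>\<^bsub>K\<^esub> v) \<otimes>\<^bsub>K\<^esub> y"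
      using y(1) v(1) E_c [OF y(2)] E_c [OF v(2)] by algebra
    then have "(z \<oplus>\<^bsub>K\<^esub> w) \<otimes>\<^bsub>K\<^esub> (y \<otimes>\<^bsub>K\<^esub> v) \<in> E" using E_mult E_add y v by simp
    then show "z \<oplus>\<^bsub>K\<^esub> w \<in> F"
      using nz y v E_mult by (auto simp: F_iff)
  qed
  moreover have "inv\<^bsub>K\<^esub> k \<in> F" if "k \<in> F - {\<zero>\<^bsub>K\<^esub>}" for k
  proof -
    from that obtain y where y: "k \<in> carrier K" "k \<noteq> \<zero>\<^bsub>K\<^esub>" "y \<in> E" "y \<noteq> \<zero>\<^bsub>K\<^esub>" "k \<otimes>\<^bsub>K\<^esub> y \<in> E"
      by (auto simp: F_iff)
    note i = inv_cl [OF y(1,2)]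
    have "inv\<^bsub>K\<^esub> k \<otimes>\<^bsub>K\<^esub> (k \<otimes>\<^bsub>K\<^esub> y) = y"
      using i y E_c [OF y(3)] by (simp add: K.m_comm [of "inv\<^bsub>K\<^esub> k" k] flip: K.m_assoc)
    then show ?thesis
      using i y by (auto simp: F_iff dest!: K.integral intro!: bexI [of _ "k \<otimes>\<^bsub>K\<^esub> y"])
  qed
  ultimately have "subfield F K" by (rule K.subfieldI')
  then interpret F: field "K\<lparr>carrier := F\<rparr>" by (rule K.subfield_iff(2))
  define enc where "enc = inv_into D quo"
  have enc: "inj_on enc F" unfolding enc_def F_def by (rule inj_on_inv_into) simp
  define K' where "K' = image_ring enc (K\<lparr>carrier := F\<rparr>)"
  have K': "field K'" unfolding K'_def by (rule F.inj_imp_image_ring_is_field) (simp add: enc)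
  have iso: "enc \<in> ring_iso (K\<lparr>carrier := F\<rparr>) K'"
    unfolding K'_def by (rule inj_imp_image_ring_iso) (simp add: enc)
  have h_F: "h b \<in> F" if "b \<in> carrier B" for b using E_F [OF E_h [OF that]] .
  define S where "S = enc ` h ` carrier B"
  have e_mult: "enc (x \<otimes>\<^bsub>K\<^esub> y) = enc x \<otimes>\<^bsub>K'\<^esub> enc y" if "x \<in> F" "y \<in> F" for x y
    using ring_iso_memE(2) [OF iso] that by simp
  have e_one: "enc \<one>\<^bsub>K\<^esub> = \<one>\<^bsub>K'\<^esub>" using ring_iso_memE(4) [OF iso] by simp
  have e_zero: "enc \<zero>\<^bsub>K\<^esub> = \<zero>\<^bsub>K'\<^esub>" by (simp add: K'_def image_ring_zero)
  have "submonoid S K'"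
  proof
    show "S \<subseteq> carrier K'"
      using ring_iso_memE(1) [OF iso] h_F by (auto simp: S_def)
    show "\<one>\<^bsub>K'\<^esub> \<in> S"
      unfolding S_def image_image
      by (rule image_eqI [of _ _ "\<one>\<^bsub>B\<^esub>"]) (auto simp: h_one e_one)
    fix x y assume "x \<in> S" "y \<in> S"
    then obtain b c where "b \<in> carrier B" "c \<in> carrier B" "x = enc (h b)" "y = enc (h c)"
      by (auto simp: S_def)
    then have "x \<otimes>\<^bsub>K'\<^esub> y = enc (h (b \<otimes>\<^bsub>B\<^esub> c))" "b \<otimes>\<^bsub>B\<^esub> c \<in> carrier B"
      by (simp_all add: h_mult e_mult h_F)
    then show "x \<otimes>\<^bsub>K'\<^esub> y \<in> S" by (auto simp: S_def)
  qed
  moreover have "\<zero>\<^bsub>K'\<^esub> \<in> S"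
    unfolding S_def image_image
    by (rule image_eqI [of _ _ "pzero B"]) (auto simp: h_zero e_zero B.pzero_closed)
  moreover have "enc \<circ> h \<in> pm_iso B ((mult_pmonoid K')\<lparr>carrier := S\<rparr>)"
  proof -
    have "inj_on (enc \<circ> h) (carrier B)"
      by (rule comp_inj_on [OF inj]) (use enc h_F in \<open>auto intro: inj_on_subset\<close>)
    then show ?thesis
      by (auto simp: pm_iso_def pm_hom_def hom_def mult_pmonoid_def bij_betw_def S_def
          h_mult e_mult h_F h_one e_one h_zero e_zero image_image)
  qed
  ultimately show ?thesis
    unfolding pointed_domain_def using K' \<open>pointed_monoid B\<close> by blast
qed


subsection \<open>Congruences\<close>

definition congruence :: "'a pmonoid \<Rightarrow> ('a \<times> 'a) set \<Rightarrow> bool" where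
  "congruence A c \<longleftrightarrow> equiv (carrier A) c \<and>
     (\<forall>(a, b) \<in> c. \<forall>l \<in> carrier A. (l \<otimes>\<^bsub>A\<^esub> a, l \<otimes>\<^bsub>A\<^esub> b) \<in> c)"

definition generated_congruence :: "'a pmonoid \<Rightarrow> ('a \<times> 'a) set \<Rightarrow> ('a \<times> 'a) set" where
  "generated_congruence A r = \<Inter>{c. congruence A c \<and> r \<subseteq> c}"

definition pm_quot :: "'a pmonoid \<Rightarrow> ('a \<times> 'a) set \<Rightarrow> 'a set pmonoid" where
  "pm_quot A c =
     \<lparr>carrier = carrier A // c,
      mult = (\<lambda>B C. \<Union>a\<in>B. \<Union>b\<in>C. c `` {a \<otimes>\<^bsub>A\<^esub> b}),
      one = c `` {\<one>\<^bsub>A\<^esub>},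
      pzero = c `` {pzero A}\<rparr>"

definition strong_prime_congruence :: "'a pmonoid \<Rightarrow> ('a \<times> 'a) set \<Rightarrow> bool" where
  "strong_prime_congruence A c \<longleftrightarrow> congruence A c \<and> pointed_domain (pm_quot A c)"

definition null_ideal :: "'a pmonoid \<Rightarrow> ('a \<times> 'a) set \<Rightarrow> 'a set" where
  "null_ideal A c = {a \<in> carrier A. (a, pzero A) \<in> c}"

definition congruence_pullback ::
    "'a pmonoid \<Rightarrow> ('a \<Rightarrow> 'b) \<Rightarrow> ('b \<times> 'b) set \<Rightarrow> ('a \<times> 'a) set" where
  "congruence_pullback A \<phi> c =
     {(a, b). a \<in> carrier A \<and> b \<in> carrier A \<and> (\<phi> a, \<phi> b) \<in> c}"

definition SCong :: "'a pmonoid \<Rightarrow> ('a \<times> 'a) set topology" where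
  "SCong A = topology_generated_by
     {{c. strong_prime_congruence A c \<and> (a, b) \<notin> c} | a b. a \<in> carrier A \<and> b \<in> carrier A}"


section \<open>Localization\<close>

text \<open>
  The fraction \<open>a/s\<close> with denominators in \<open>S\<close>, as an equivalence class.  Only the multiplication
  of \<open>A\<close> is used, so that the construction serves both pointed monoids and rings.
\<close>

definition fraction ::
    "('a, 'm) monoid_scheme \<Rightarrow> 'a set \<Rightarrow> 'a \<Rightarrow> 'a \<Rightarrow> ('a \<times> 'a) set" where
  "fraction A S a s = {(b, t). b \<in> carrier A \<and> t \<in> S \<and>
     (\<exists>u\<in>S. u \<otimes>\<^bsub>A\<^esub> (a \<otimes>\<^bsub>A\<^esub> t) = u \<otimes>\<^bsub>A\<^esub> (b \<otimes>\<^bsub>A\<^esub> s))}"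

definition fraction_carrier :: "('a, 'm) monoid_scheme \<Rightarrow> 'a set \<Rightarrow> ('a \<times> 'a) set set" where
  "fraction_carrier A S = {fraction A S a s | a s. a \<in> carrier A \<and> s \<in> S}"

definition fraction_mult ::
    "('a, 'm) monoid_scheme \<Rightarrow> 'a set \<Rightarrow> ('a \<times> 'a) set \<Rightarrow> ('a \<times> 'a) set \<Rightarrow> ('a \<times> 'a) set" where
  "fraction_mult A S x y =
     (\<Union>(a, s)\<in>x. \<Union>(b, t)\<in>y. fraction A S (a \<otimes>\<^bsub>A\<^esub> b) (s \<otimes>\<^bsub>A\<^esub> t))"

definition pm_loc :: "'a pmonoid \<Rightarrow> 'a set \<Rightarrow> ('a \<times> 'a) set pmonoid" where
  "pm_loc A S =
     \<lparr>carrier = fraction_carrier A S, mult = fraction_mult A S,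
      one = fraction A S \<one>\<^bsub>A\<^esub> \<one>\<^bsub>A\<^esub>, pzero = fraction A S (pzero A) \<one>\<^bsub>A\<^esub>\<rparr>"

definition ring_loc :: "'a ring \<Rightarrow> 'a set \<Rightarrow> ('a \<times> 'a) set ring" where
  "ring_loc R S =
     \<lparr>carrier = fraction_carrier R S, mult = fraction_mult R S,
      one = fraction R S \<one>\<^bsub>R\<^esub> \<one>\<^bsub>R\<^esub>,
      zero = fraction R S \<zero>\<^bsub>R\<^esub> \<one>\<^bsub>R\<^esub>,
      add = (\<lambda>x y. \<Union>(a, s)\<in>x. \<Union>(b, t)\<in>y.
               fraction R S ((a \<otimes>\<^bsub>R\<^esub> t) \<oplus>\<^bsub>R\<^esub> (b \<otimes>\<^bsub>R\<^esub> s)) (s \<otimes>\<^bsub>R\<^esub> t))\<rparr>"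


section \<open>Spaces with a sheaf of algebraic structures\<close>

text \<open>
  \<open>sec X U\<close> and \<open>res X U V\<close> are meaningful for open sets \<open>V \<subseteq> U\<close> only.  That the sections over
  all open sets have elements of a common type costs no generality up to isomorphism.
\<close>

record ('p, 's, 'alg) sheafed_space =
  spc :: "'p topology"
  sec :: "'p set \<Rightarrow> 'alg"
  res :: "'p set \<Rightarrow> 'p set \<Rightarrow> 's \<Rightarrow> 's"

type_synonym ('p, 's) pm_space = "('p, 's, 's pmonoid) sheafed_space"
type_synonym ('p, 's) ringed_space = "('p, 's, 's ring) sheafed_space"

locale pm_sheaf =
  fixes X :: "('p, 's) pm_space"
  assumes sec_pointed_monoid: "openin (spc X) U \<Longrightarrow> pointed_monoid (sec X U)"
    and res_hom: "\<lbrakk>openin (spc X) U; openin (spc X) V; V \<subseteq> U\<rbrakk> \<Longrightarrow>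
          res X U V \<in> pm_hom (sec X U) (sec X V)"
    and res_id: "\<lbrakk>openin (spc X) U; s \<in> carrier (sec X U)\<rbrakk> \<Longrightarrow> res X U U s = s"
    and res_comp: "\<lbrakk>openin (spc X) U; openin (spc X) V; openin (spc X) W; W \<subseteq> V; V \<subseteq> U;
          s \<in> carrier (sec X U)\<rbrakk> \<Longrightarrow> res X V W (res X U V s) = res X U W s"
    and locality: "\<lbrakk>\<And>V. V \<in> \<V> \<Longrightarrow> openin (spc X) V; s \<in> carrier (sec X (\<Union>\<V>));
          t \<in> carrier (sec X (\<Union>\<V>));
          \<And>V. V \<in> \<V> \<Longrightarrow> res X (\<Union>\<V>) V s = res X (\<Union>\<V>) V t\<rbrakk> \<Longrightarrow> s = t"
    and gluing: "\<lbrakk>\<And>V. V \<in> \<V> \<Longrightarrow> openin (spc X) V;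
          \<And>V. V \<in> \<V> \<Longrightarrow> f V \<in> carrier (sec X V);
          \<And>V W. V \<in> \<V> \<Longrightarrow> W \<in> \<V> \<Longrightarrow> res X V (V \<inter> W) (f V) = res X W (V \<inter> W) (f W)\<rbrakk> \<Longrightarrow>
          \<exists>s \<in> carrier (sec X (\<Union>\<V>)). \<forall>V\<in>\<V>. res X (\<Union>\<V>) V s = f V"

definition open_subspace :: "('p, 's, 'alg) sheafed_space \<Rightarrow> 'p set \<Rightarrow> ('p, 's, 'alg) sheafed_space"
  where "open_subspace X U = X\<lparr>spc := subtopology (spc X) U\<rparr>"

definition pm_space_iso ::
    "('p, 's) pm_space \<Rightarrow> ('q, 't) pm_space \<Rightarrow> ('p \<Rightarrow> 'q) \<Rightarrow> ('q set \<Rightarrow> 't \<Rightarrow> 's) \<Rightarrow> bool" where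
  "pm_space_iso X Y \<phi> \<psi> \<longleftrightarrow>
     homeomorphic_map (spc X) (spc Y) \<phi> \<and>
     (let pre = (\<lambda>W. {x \<in> topspace (spc X). \<phi> x \<in> W}) in
        (\<forall>W. openin (spc Y) W \<longrightarrow> \<psi> W \<in> pm_iso (sec Y W) (sec X (pre W))) \<and>
        (\<forall>V W. openin (spc Y) V \<and> openin (spc Y) W \<and> W \<subseteq> V \<longrightarrow>
           (\<forall>s \<in> carrier (sec Y V).
              \<psi> W (res Y V W s) = res X (pre V) (pre W) (\<psi> V s))))"


subsection \<open>Stalks\<close>

definition germ ::
    "('p, 's, ('s, 'm) monoid_scheme) sheafed_space \<Rightarrow> 'p \<Rightarrow> 'p set \<Rightarrow> 's \<Rightarrow> ('p set \<times> 's) set" where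
  "germ X x U s = {(V, t). openin (spc X) V \<and> x \<in> V \<and> t \<in> carrier (sec X V) \<and>
     (\<exists>W. openin (spc X) W \<and> x \<in> W \<and> W \<subseteq> U \<inter> V \<and> res X U W s = res X V W t)}"

definition stalk_carrier ::
    "('p, 's, ('s, 'm) monoid_scheme) sheafed_space \<Rightarrow> 'p \<Rightarrow> ('p set \<times> 's) set set" where
  "stalk_carrier X x =
     {germ X x U s | U s. openin (spc X) U \<and> x \<in> U \<and> s \<in> carrier (sec X U)}"

definition stalk_op ::
    "('p, 's, ('s, 'm) monoid_scheme) sheafed_space \<Rightarrow> 'p \<Rightarrow> ('p set \<Rightarrow> 's \<Rightarrow> 's \<Rightarrow> 's) \<Rightarrow>
     ('p set \<times> 's) set \<Rightarrow> ('p set \<times> 's) set \<Rightarrow> ('p set \<times> 's) set" where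
  "stalk_op X x f g h = (\<Union>(U, s)\<in>g. \<Union>(V, t)\<in>h.
     germ X x (U \<inter> V) (f (U \<inter> V) (res X U (U \<inter> V) s) (res X V (U \<inter> V) t)))"

definition pm_stalk :: "('p, 's) pm_space \<Rightarrow> 'p \<Rightarrow> ('p set \<times> 's) set pmonoid" where
  "pm_stalk X x =
     \<lparr>carrier = stalk_carrier X x,
      mult = stalk_op X x (\<lambda>U. mult (sec X U)),
      one = germ X x (topspace (spc X)) (one (sec X (topspace (spc X)))),
      pzero = germ X x (topspace (spc X)) (pzero (sec X (topspace (spc X))))\<rparr>"

definition ring_stalk :: "('p, 's) ringed_space \<Rightarrow> 'p \<Rightarrow> ('p set \<times> 's) set ring" where
  "ring_stalk X x =
     \<lparr>carrier = stalk_carrier X x,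
      mult = stalk_op X x (\<lambda>U. mult (sec X U)),
      one = germ X x (topspace (spc X)) (one (sec X (topspace (spc X)))),
      zero = germ X x (topspace (spc X)) (zero (sec X (topspace (spc X)))),
      add = stalk_op X x (\<lambda>U. add (sec X U))\<rparr>"

definition stalk_maximal_ideal :: "('p, 's) ringed_space \<Rightarrow> 'p \<Rightarrow> ('p set \<times> 's) set set" where
  "stalk_maximal_ideal X x = carrier (ring_stalk X x) - Units (ring_stalk X x)"

definition residue_field :: "('p, 's) ringed_space \<Rightarrow> 'p \<Rightarrow> ('p set \<times> 's) set set ring" where
  "residue_field X x = ring_stalk X x Quot stalk_maximal_ideal X x"

definition residue_map ::
    "('p, 's) ringed_space \<Rightarrow> 'p \<Rightarrow> ('p set \<times> 's) set \<Rightarrow> ('p set \<times> 's) set set" where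
  "residue_map X x g = stalk_maximal_ideal X x +>\<^bsub>ring_stalk X x\<^esub> g"


section \<open>Affine monoid schemes and affine schemes\<close>

text \<open>
  Sections over \<open>V\<close> of the structure sheaf of a spectrum: functions assigning to each prime
  \<open>P \<in> V\<close> an element of the localization at \<open>P\<close> that are given locally by a single fraction.
  In the monoid case this yields \<open>\<Gamma>(U\<^sub>h) = A[h\<^sup>-\<^sup>1]\<close>: a prime avoiding \<open>h\<close> that contains all
  others exists, and every neighbourhood of it contains \<open>U\<^sub>h\<close>.
\<close>

definition local_fractions ::
    "('a, 'm) monoid_scheme \<Rightarrow> 'a set topology \<Rightarrow> 'a set set \<Rightarrow>
     ('a set \<Rightarrow> ('a \<times> 'a) set) set" where
  "local_fractions A T V = {s \<in> extensional V.
     \<forall>P\<in>V. \<exists>W. openin T W \<and> P \<in> W \<and> W \<subseteq> V \<and>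
       (\<exists>a \<in> carrier A. \<exists>h \<in> carrier A.
          \<forall>Q\<in>W. h \<notin> Q \<and> s Q = fraction A (carrier A - Q) a h)}"

definition pm_ideal :: "'a pmonoid \<Rightarrow> 'a set \<Rightarrow> bool" where
  "pm_ideal A I \<longleftrightarrow> I \<subseteq> carrier A \<and> pzero A \<in> I \<and>
     (\<forall>a \<in> carrier A. \<forall>i \<in> I. a \<otimes>\<^bsub>A\<^esub> i \<in> I)"

definition pm_prime_ideal :: "'a pmonoid \<Rightarrow> 'a set \<Rightarrow> bool" where
  "pm_prime_ideal A P \<longleftrightarrow> pm_ideal A P \<and> P \<noteq> carrier A \<and>
     (\<forall>a \<in> carrier A. \<forall>b \<in> carrier A. a \<otimes>\<^bsub>A\<^esub> b \<in> P \<longrightarrow> a \<in> P \<or> b \<in> P)"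

definition MSpec_top :: "'a pmonoid \<Rightarrow> 'a set topology" where
  "MSpec_top A = topology_generated_by
     {{P. pm_prime_ideal A P \<and> h \<notin> P} | h. h \<in> carrier A}"

definition MSpec :: "'a pmonoid \<Rightarrow> ('a set, 'a set \<Rightarrow> ('a \<times> 'a) set) pm_space" where
  "MSpec A =
     \<lparr>spc = MSpec_top A,
      sec = (\<lambda>V.
        \<lparr>carrier = local_fractions A (MSpec_top A) V,
         mult = (\<lambda>s t. \<lambda>P\<in>V. s P \<otimes>\<^bsub>pm_loc A (carrier A - P)\<^esub> t P),
         one = (\<lambda>P\<in>V. \<one>\<^bsub>pm_loc A (carrier A - P)\<^esub>),
         pzero = (\<lambda>P\<in>V. pzero (pm_loc A (carrier A - P)))\<rparr>),
      res = (\<lambda>V W s. restrict s W)\<rparr>"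

definition Spec_top :: "'a ring \<Rightarrow> 'a set topology" where
  "Spec_top R = topology_generated_by {{P. primeideal P R \<and> f \<notin> P} | f. f \<in> carrier R}"

definition Spec :: "'a ring \<Rightarrow> ('a set, 'a set \<Rightarrow> ('a \<times> 'a) set) ringed_space" where
  "Spec R =
     \<lparr>spc = Spec_top R,
      sec = (\<lambda>V.
        \<lparr>carrier = local_fractions R (Spec_top R) V,
         mult = (\<lambda>s t. \<lambda>P\<in>V. s P \<otimes>\<^bsub>ring_loc R (carrier R - P)\<^esub> t P),
         one = (\<lambda>P\<in>V. \<one>\<^bsub>ring_loc R (carrier R - P)\<^esub>),
         zero = (\<lambda>P\<in>V. \<zero>\<^bsub>ring_loc R (carrier R - P)\<^esub>),
         add = (\<lambda>s t. \<lambda>P\<in>V. s P \<oplus>\<^bsub>ring_loc R (carrier R - P)\<^esub> t P)\<rparr>),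
      res = (\<lambda>V W s. restrict s W)\<rparr>"

text \<open>
  The morphism of affine schemes induced by \<open>\<phi> : R \<rightarrow> S\<close>, on points and on sections (\<open>N\<close> being
  the preimage of the open set on which \<open>s\<close> is defined).
\<close>

definition Spec_map :: "'a ring \<Rightarrow> ('a \<Rightarrow> 'b) \<Rightarrow> 'b set \<Rightarrow> 'a set" where
  "Spec_map R \<phi> Q = {a \<in> carrier R. \<phi> a \<in> Q}"

definition Spec_pullback ::
    "'a ring \<Rightarrow> 'b ring \<Rightarrow> ('a \<Rightarrow> 'b) \<Rightarrow> 'b set set \<Rightarrow>
     ('a set \<Rightarrow> ('a \<times> 'a) set) \<Rightarrow> ('b set \<Rightarrow> ('b \<times> 'b) set)" where
  "Spec_pullback R S \<phi> N s =
     (\<lambda>Q\<in>N. \<Union>(a, h) \<in> s (Spec_map R \<phi> Q). fraction S (carrier S - Q) (\<phi> a) (\<phi> h))"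


section \<open>Monoid schemes\<close>

text \<open>
  If \<open>U\<close> is isomorphic to \<open>MSpec A\<close> then \<open>A\<close> is isomorphic to \<open>sec X U\<close>, so nothing is lost by
  taking \<open>A\<close> over the type of the sections of \<open>X\<close>.
\<close>

definition affine_opens :: "('p, 's) pm_space \<Rightarrow> 'p set set" where
  "affine_opens X = {U. openin (spc X) U \<and>
     (\<exists>(A :: 's pmonoid) \<phi> \<psi>.
        pointed_monoid A \<and> pm_space_iso (open_subspace X U) (MSpec A) \<phi> \<psi>)}"

locale monoid_scheme = pm_sheaf X for X :: "('p, 's) pm_space" +
  assumes locally_affine: "x \<in> topspace (spc X) \<Longrightarrow> \<exists>U \<in> affine_opens X. x \<in> U"

text \<open>
  The canonical identification of an affine open \<open>U\<close> with \<open>MSpec (\<Gamma> U)\<close>: a point \<open>u\<close> corresponds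
  to the prime ideal of those sections over \<open>U\<close> whose germ at \<open>u\<close> lies in the maximal ideal of
  the stalk, that is, is not a unit.
\<close>

definition prime_of_point :: "('p, 's) pm_space \<Rightarrow> 'p set \<Rightarrow> 'p \<Rightarrow> 's set" where
  "prime_of_point X U u = {f \<in> carrier (sec X U). germ X u U f \<notin> Units (pm_stalk X u)}"

definition point_of_prime :: "('p, 's) pm_space \<Rightarrow> 'p set \<Rightarrow> 's set \<Rightarrow> 'p" where
  "point_of_prime X U P = (THE u. u \<in> U \<and> prime_of_point X U u = P)"


section \<open>Colimits of topological spaces indexed by open sets\<close>

text \<open>
  The colimit of the spaces \<open>T U\<close> for \<open>U \<in> \<U>\<close> along transition maps \<open>t V U : T V \<rightarrow> T U\<close> for
  \<open>V \<subseteq> U\<close>: the disjoint union modulo the generated equivalence relation, with the final topology.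
\<close>

definition colim_union :: "'u set set \<Rightarrow> ('u set \<Rightarrow> 'e topology) \<Rightarrow> ('u set \<times> 'e) set" where
  "colim_union \<U> T = (SIGMA U:\<U>. topspace (T U))"

definition colim_rel ::
    "'u set set \<Rightarrow> ('u set \<Rightarrow> 'e topology) \<Rightarrow> ('u set \<Rightarrow> 'u set \<Rightarrow> 'e \<Rightarrow> 'e) \<Rightarrow>
     (('u set \<times> 'e) \<times> ('u set \<times> 'e)) set" where
  "colim_rel \<U> T t =
     (let R = {((V, e), (U, t V U e)) | U V e.
                 U \<in> \<U> \<and> V \<in> \<U> \<and> V \<subseteq> U \<and> e \<in> topspace (T V)}
      in Restr ((R \<union> R\<inverse>)\<^sup>*) (colim_union \<U> T))"

definition colim_in ::
    "'u set set \<Rightarrow> ('u set \<Rightarrow> 'e topology) \<Rightarrow> ('u set \<Rightarrow> 'u set \<Rightarrow> 'e \<Rightarrow> 'e) \<Rightarrow>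
     'u set \<Rightarrow> 'e \<Rightarrow> ('u set \<times> 'e) set" where
  "colim_in \<U> T t U e = colim_rel \<U> T t `` {(U, e)}"

definition colim_top ::
    "'u set set \<Rightarrow> ('u set \<Rightarrow> 'e topology) \<Rightarrow> ('u set \<Rightarrow> 'u set \<Rightarrow> 'e \<Rightarrow> 'e) \<Rightarrow>
     ('u set \<times> 'e) set topology" where
  "colim_top \<U> T t = topology (\<lambda>W. W \<subseteq> colim_union \<U> T // colim_rel \<U> T t \<and>
     (\<forall>U\<in>\<U>. openin (T U) {e \<in> topspace (T U). colim_in \<U> T t U e \<in> W}))"


section \<open>The space of strong prime congruences of a monoid scheme\<close>

type_synonym ('p, 's) scong_pt = "('p set \<times> ('s \<times> 's) set) set"

definition SCong_X :: "('p, 's) pm_space \<Rightarrow> ('p, 's) scong_pt topology" where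
  "SCong_X X = colim_top (affine_opens X) (\<lambda>U. SCong (sec X U))
     (\<lambda>V U. congruence_pullback (sec X U) (res X U V))"

definition SCong_in :: "('p, 's) pm_space \<Rightarrow> 'p set \<Rightarrow> ('s \<times> 's) set \<Rightarrow> ('p, 's) scong_pt" where
  "SCong_in X = colim_in (affine_opens X) (\<lambda>U. SCong (sec X U))
     (\<lambda>V U. congruence_pullback (sec X U) (res X U V))"

definition SCong_proj :: "('p, 's) pm_space \<Rightarrow> ('p, 's) scong_pt \<Rightarrow> 'p" where
  "SCong_proj X xt = the_elem ((\<lambda>(U, c). point_of_prime X U (null_ideal (sec X U) c)) ` xt)"

text \<open>
  \<open>scong_at X xt U\<close> is the congruence on \<open>\<Gamma> U\<close> corresponding to the point \<open>xt\<close>, and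
  \<open>stalk_congruence X xt U\<close> is the congruence it generates on the stalk at the image of \<open>xt\<close>;
  they are meaningful for an affine open \<open>U\<close> that contains this image.
\<close>

definition scong_at :: "('p, 's) pm_space \<Rightarrow> ('p, 's) scong_pt \<Rightarrow> 'p set \<Rightarrow> ('s \<times> 's) set" where
  "scong_at X xt U = (THE c. c \<in> topspace (SCong (sec X U)) \<and> SCong_in X U c = xt)"

definition stalk_congruence ::
    "('p, 's) pm_space \<Rightarrow> ('p, 's) scong_pt \<Rightarrow> 'p set \<Rightarrow>
     (('p set \<times> 's) set \<times> ('p set \<times> 's) set) set" where
  "stalk_congruence X xt U =
     (let x = SCong_proj X xt in
      generated_congruence (pm_stalk X x)
        {(germ X x U a, germ X x U b) | a b. (a, b) \<in> scong_at X xt U})"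

definition residue_pgroup ::
    "('p, 's) pm_space \<Rightarrow> ('p, 's) scong_pt \<Rightarrow> 'p set \<Rightarrow> ('p set \<times> 's) set set pmonoid" where
  "residue_pgroup X xt U = pm_quot (pm_stalk X (SCong_proj X xt)) (stalk_congruence X xt U)"

definition residue_pgroup_map ::
    "('p, 's) pm_space \<Rightarrow> ('p, 's) scong_pt \<Rightarrow> 'p set \<Rightarrow> ('p set \<times> 's) set \<Rightarrow>
     ('p set \<times> 's) set set" where
  "residue_pgroup_map X xt U g = stalk_congruence X xt U `` {g}"


section \<open>Base change to the integers\<close>

definition monoid_ring :: "'a pmonoid \<Rightarrow> ('a \<Rightarrow>\<^sub>0 int) ring" where
  "monoid_ring A =
     \<lparr>carrier = {f. Poly_Mapping.keys f \<subseteq> carrier A},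
      mult = (\<lambda>f g. frag_extend (\<lambda>a. frag_extend (\<lambda>b. frag_of (a \<otimes>\<^bsub>A\<^esub> b)) g) f),
      one = frag_of \<one>\<^bsub>A\<^esub>, zero = 0, add = (+)\<rparr>"

definition pzero_ideal :: "'a pmonoid \<Rightarrow> ('a \<Rightarrow>\<^sub>0 int) set" where
  "pzero_ideal A = Idl\<^bsub>monoid_ring A\<^esub> {frag_of (pzero A)}"

type_synonym 'a zelem = "('a \<Rightarrow>\<^sub>0 int) set"

definition Z_ring :: "'a pmonoid \<Rightarrow> 'a zelem ring" where
  "Z_ring A = monoid_ring A Quot pzero_ideal A"

definition to_Z :: "'a pmonoid \<Rightarrow> 'a \<Rightarrow> 'a zelem" where
  "to_Z A a = pzero_ideal A +>\<^bsub>monoid_ring A\<^esub> frag_of a"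

definition Z_map :: "'b pmonoid \<Rightarrow> ('a \<Rightarrow> 'b) \<Rightarrow> 'a zelem \<Rightarrow> 'b zelem" where
  "Z_map B \<phi> C = (\<Union>f\<in>C. pzero_ideal B +>\<^bsub>monoid_ring B\<^esub> frag_extend (\<lambda>a. frag_of (\<phi> a)) f)"

definition Z_contract :: "'a pmonoid \<Rightarrow> 'a zelem set \<Rightarrow> 'a set" where
  "Z_contract A Q = {a \<in> carrier A. to_Z A a \<in> Q}"

type_synonym ('p, 's) bc_pt = "('p set \<times> 's zelem set) set"

definition bc_top :: "('p, 's) pm_space \<Rightarrow> ('p, 's) bc_pt topology" where
  "bc_top X = colim_top (affine_opens X) (\<lambda>U. Spec_top (Z_ring (sec X U)))
     (\<lambda>V U. Spec_map (Z_ring (sec X U)) (Z_map (sec X V) (res X U V)))"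

definition bc_in :: "('p, 's) pm_space \<Rightarrow> 'p set \<Rightarrow> 's zelem set \<Rightarrow> ('p, 's) bc_pt" where
  "bc_in X = colim_in (affine_opens X) (\<lambda>U. Spec_top (Z_ring (sec X U)))
     (\<lambda>V U. Spec_map (Z_ring (sec X U)) (Z_map (sec X V) (res X U V)))"

definition bc_pre :: "('p, 's) pm_space \<Rightarrow> 'p set \<Rightarrow> ('p, 's) bc_pt set \<Rightarrow> 's zelem set set" where
  "bc_pre X U W = {Q \<in> topspace (Spec_top (Z_ring (sec X U))). bc_in X U Q \<in> W}"

type_synonym ('p, 's) bc_sec = "'p set \<Rightarrow> 's zelem set \<Rightarrow> ('s zelem \<times> 's zelem) set"

text \<open>
  Structure sheaf of the colimit of the \<open>Spec (\<Gamma> U)\<^sub>\<int>\<close>: the limit of the direct image sheaves,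
  so that a section is a compatible family of sections on the charts.
\<close>

definition bc_sec_carrier :: "('p, 's) pm_space \<Rightarrow> ('p, 's) bc_pt set \<Rightarrow> ('p, 's) bc_sec set" where
  "bc_sec_carrier X W = {s \<in> extensional (affine_opens X).
     (\<forall>U \<in> affine_opens X. s U \<in> carrier (sec (Spec (Z_ring (sec X U))) (bc_pre X U W))) \<and>
     (\<forall>U \<in> affine_opens X. \<forall>V \<in> affine_opens X. V \<subseteq> U \<longrightarrow>
        Spec_pullback (Z_ring (sec X U)) (Z_ring (sec X V)) (Z_map (sec X V) (res X U V))
          (bc_pre X V W) (s U) = s V)}"

definition base_change :: "('p, 's) pm_space \<Rightarrow> (('p, 's) bc_pt, ('p, 's) bc_sec) ringed_space"
  where
  "base_change X =
     (let chart = (\<lambda>W U. sec (Spec (Z_ring (sec X U))) (bc_pre X U W)) in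
      \<lparr>spc = bc_top X,
       sec = (\<lambda>W.
         \<lparr>carrier = bc_sec_carrier X W,
          mult = (\<lambda>s t. \<lambda>U\<in>affine_opens X. s U \<otimes>\<^bsub>chart W U\<^esub> t U),
          one = (\<lambda>U\<in>affine_opens X. \<one>\<^bsub>chart W U\<^esub>),
          zero = (\<lambda>U\<in>affine_opens X. \<zero>\<^bsub>chart W U\<^esub>),
          add = (\<lambda>s t. \<lambda>U\<in>affine_opens X. s U \<oplus>\<^bsub>chart W U\<^esub> t U)\<rparr>),
       res = (\<lambda>W W' s. \<lambda>U\<in>affine_opens X. restrict (s U) (bc_pre X U W'))\<rparr>)"


subsection \<open>The morphism \<open>p : X\<^sub>\<int>\<^sup>\<bullet> \<rightarrow> X\<close>\<close>

definition bc_proj :: "('p, 's) pm_space \<Rightarrow> ('p, 's) bc_pt \<Rightarrow> 'p" where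
  "bc_proj X x = the_elem ((\<lambda>(U, Q). point_of_prime X U (Z_contract (sec X U) Q)) ` x)"

definition bc_proj_pre :: "('p, 's) pm_space \<Rightarrow> 'p set \<Rightarrow> ('p, 's) bc_pt set" where
  "bc_proj_pre X V = {x \<in> topspace (bc_top X). bc_proj X x \<in> V}"

text \<open>
  On a chart \<open>U\<close> the morphism is given by \<open>A = \<Gamma> U \<rightarrow> A\<^sub>\<int>\<close>, hence it sends \<open>f \<in> \<Gamma> V\<close> to the
  section with the following value at \<open>Q\<close>: if \<open>u \<in> U\<close> is the image of \<open>Q\<close>, then the germ of \<open>f\<close>
  at \<open>u\<close> is a fraction \<open>a/h\<close> of elements of \<open>A\<close> with \<open>h\<close> outside the prime ideal of \<open>u\<close>, and the
  value is the image of \<open>a/h\<close> in the localization of \<open>A\<^sub>\<int>\<close> at \<open>Q\<close>.  For \<open>V = U\<close> this is the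
  image of \<open>f\<close> in \<open>A\<^sub>\<int>\<close>.
\<close>

definition bc_proj_value ::
    "('p, 's) pm_space \<Rightarrow> 'p set \<Rightarrow> 's \<Rightarrow> 'p set \<Rightarrow> 's zelem set \<Rightarrow> ('s zelem \<times> 's zelem) set" where
  "bc_proj_value X V f U Q =
     (let A = sec X U; u = point_of_prime X U (Z_contract A Q) in
      (THE r. \<exists>a \<in> carrier A. \<exists>h \<in> carrier A.
         to_Z A h \<notin> Q \<and>
         germ X u V f \<otimes>\<^bsub>pm_stalk X u\<^esub> germ X u U h = germ X u U a \<and>
         r = fraction (Z_ring A) (carrier (Z_ring A) - Q) (to_Z A a) (to_Z A h)))"

definition bc_proj_sec :: "('p, 's) pm_space \<Rightarrow> 'p set \<Rightarrow> 's \<Rightarrow> ('p, 's) bc_sec" where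
  "bc_proj_sec X V f =
     (\<lambda>U\<in>affine_opens X. \<lambda>Q\<in>bc_pre X U (bc_proj_pre X V). bc_proj_value X V f U Q)"

definition bc_proj_stalk ::
    "('p, 's) pm_space \<Rightarrow> ('p, 's) bc_pt \<Rightarrow> ('p set \<times> 's) set \<Rightarrow>
     (('p, 's) bc_pt set \<times> ('p, 's) bc_sec) set" where
  "bc_proj_stalk X x g =
     (\<Union>(V, f)\<in>g. germ (base_change X) x (bc_proj_pre X V) (bc_proj_sec X V f))"


subsection \<open>The map \<open>\<gamma> : X\<^sub>\<int> \<rightarrow> SCong X\<close>\<close>

definition gamma_affine :: "'a pmonoid \<Rightarrow> 'a zelem set \<Rightarrow> ('a \<times> 'a) set" where
  "gamma_affine A Q = {(a, b). a \<in> carrier A \<and> b \<in> carrier A \<and>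
     Q +>\<^bsub>Z_ring A\<^esub> to_Z A a = Q +>\<^bsub>Z_ring A\<^esub> to_Z A b}"

definition gamma :: "('p, 's) pm_space \<Rightarrow> ('p, 's) bc_pt \<Rightarrow> ('p, 's) scong_pt" where
  "gamma X x = the_elem ((\<lambda>(U, Q). SCong_in X U (gamma_affine (sec X U) Q)) ` x)"

end

theory Submission
  imports Defs
begin

text \<open>
  A point \<open>x\<close> of \<open>X\<^sub>\<int>\<close> over \<open>u\<close> corresponds to a prime \<open>q\<close> of the base change of the stalk \<open>A\<close> of \<open>X\<close>
  at \<open>u\<close>, namely one with \<open>q \<inter> A = A - A\<^sup>\<times>\<close>, and the stalk of \<open>X\<^sub>\<int>\<close> at \<open>x\<close> is the localization of
  \<open>A\<^sub>\<int>\<close> at \<open>q\<close>.  The map from \<open>A\<close> to the residue field therefore identifies \<open>a\<close> and \<open>b\<close> precisely when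
  \<open>a - b \<in> q\<close>.  On an affine neighbourhood the same relation defines \<open>\<gamma>\<close>, and as every element of \<open>A\<close> is
  a fraction of sections over that neighbourhood, the congruence \<open>\<gamma>\<close> generates on \<open>A\<close> is the whole kernel.
  The quotient is a pointed group because every element of \<open>A\<close> outside \<open>q\<close> is a unit.
\<close>

section \<open>Localization\<close>

text \<open>Two features of the definitions shape the argument. Points of X_Z and of SCong X are
  classes of an equivalence relation generated by the transition maps, so they can be told apart
  only by functions that every transition map preserves. On X_Z such an invariant is the pair
  \<open>(u, q)\<close>; on SCong X it is the image point together with the extension of the
  congruence to the stalk. These make \<open>bc_proj\<close> and \<open>scong_at\<close> computable.
  Secondly, stalks and section monoids are isomorphic to localizations but not equal to them; hence
  localization is treated as a property of a homomorphism, and this property is shown to survive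
  base change to the integers. Monoids help at one place where rings would not: a nonempty affine
  open has a point whose only open neighbourhood in it is the whole, so its sections form a stalk.
  It follows that an affine open inside another one is basic open and that its sections are a
  localization. Finally, a section of X_Z is a compatible family over all charts, and its germ
  becomes tractable as one fraction that is valid in every chart over a whole neighbourhood.\<close>

locale mult_set = comm_monoid A for A (structure) and S +
  assumes S_sub: "S \<subseteq> carrier A" and S_one: "\<one> \<in> S"
    and S_mult: "\<lbrakk>s \<in> S; t \<in> S\<rbrakk> \<Longrightarrow> s \<otimes> t \<in> S"
begin

lemma S_closed [simp]: "s \<in> S \<Longrightarrow> s \<in> carrier A"
  using S_sub by auto

lemma fraction_self: "\<lbrakk>a \<in> carrier A; s \<in> S\<rbrakk> \<Longrightarrow> (a, s) \<in> fraction A S a s"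
  using S_one by (auto simp: fraction_def)

text \<open>Transitivity of the relation on fractions. There is no cancellation, so the middle
  denominator \<open>s\<close> has to be absorbed into the multiplier:
  \<open>u \<otimes> v \<otimes> s\<close> works.\<close>

lemma fraction_mono:
  assumes "a \<in> carrier A" "b \<in> carrier A" "s \<in> S" "t \<in> S" "u \<in> S"
    and eq: "u \<otimes> (a \<otimes> t) = u \<otimes> (b \<otimes> s)"
  shows "fraction A S a s \<subseteq> fraction A S b t"
proof (clarsimp simp: fraction_def)
  fix c r v assume c: "c \<in> carrier A" "r \<in> S" "v \<in> S" "v \<otimes> (a \<otimes> r) = v \<otimes> (c \<otimes> s)"
  have "(u \<otimes> v \<otimes> s) \<otimes> (b \<otimes> r) = (v \<otimes> r) \<otimes> (u \<otimes> (b \<otimes> s))"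
    using assms(1-5) c(1-3) by (simp add: m_ac)
  also have "\<dots> = (u \<otimes> t) \<otimes> (v \<otimes> (a \<otimes> r))"
    unfolding eq [symmetric] using assms(1-5) c(1-3) by (simp add: m_ac)
  also have "\<dots> = (u \<otimes> v \<otimes> s) \<otimes> (c \<otimes> t)"
    unfolding c(4) using assms(1-5) c(1-3) by (simp add: m_ac)
  finally show "\<exists>u\<in>S. u \<otimes> (b \<otimes> r) = u \<otimes> (c \<otimes> t)"
    using assms c by (intro bexI [of _ "u \<otimes> v \<otimes> s"]) (auto intro: S_mult)
qed

lemma fraction_eq_iff:
  assumes "a \<in> carrier A" "b \<in> carrier A" "s \<in> S" "t \<in> S"
  shows "fraction A S a s = fraction A S b t \<longleftrightarrow> (\<exists>u\<in>S. u \<otimes> (a \<otimes> t) = u \<otimes> (b \<otimes> s))"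
proof
  assume "fraction A S a s = fraction A S b t"
  then have "(b, t) \<in> fraction A S a s" using fraction_self assms by auto
  then show "\<exists>u\<in>S. u \<otimes> (a \<otimes> t) = u \<otimes> (b \<otimes> s)" by (auto simp: fraction_def)
next
  assume "\<exists>u\<in>S. u \<otimes> (a \<otimes> t) = u \<otimes> (b \<otimes> s)"
  then obtain u where "u \<in> S" "u \<otimes> (a \<otimes> t) = u \<otimes> (b \<otimes> s)" by blast
  then show "fraction A S a s = fraction A S b t"
    using fraction_mono [of a b s t u] fraction_mono [of b a t s u] assms by auto
qed

lemma fraction_eqI:
  assumes "a \<in> carrier A" "b \<in> carrier A" "s \<in> S" "t \<in> S" "a \<otimes> t = b \<otimes> s"
  shows "fraction A S a s = fraction A S b t"
  using assms S_one by (auto simp: fraction_eq_iff)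

lemma mem_fraction_iff:
  assumes "a \<in> carrier A" "s \<in> S"
  shows "(b, t) \<in> fraction A S a s \<longleftrightarrow>
    b \<in> carrier A \<and> t \<in> S \<and> fraction A S b t = fraction A S a s"
proof (cases "b \<in> carrier A \<and> t \<in> S")
  case True
  then show ?thesis
    using fraction_eq_iff [of a b s t] assms by (simp add: fraction_def [of A S a s]) blast
qed (auto simp: fraction_def)

text \<open>\<open>fraction_mult\<close> is a union over all representatives. Every pair of
  representatives contributes the same class, and a class is nonempty because it contains the
  fraction that names it, so the union is that class.\<close>

lemma fraction_mult_eq:
  assumes "a \<in> carrier A" "b \<in> carrier A" "s \<in> S" "t \<in> S"
  shows "fraction_mult A S (fraction A S a s) (fraction A S b t) = fraction A S (a \<otimes> b) (s \<otimes> t)"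
proof -
  have "fraction A S (a' \<otimes> b') (s' \<otimes> t') = fraction A S (a \<otimes> b) (s \<otimes> t)"
    if "(a', s') \<in> fraction A S a s" "(b', t') \<in> fraction A S b t" for a' s' b' t'
  proof -
    from that obtain u v where *: "a' \<in> carrier A" "s' \<in> S" "u \<in> S" "b' \<in> carrier A" "t' \<in> S" "v \<in> S"
      and u: "u \<otimes> (a \<otimes> s') = u \<otimes> (a' \<otimes> s)" and v: "v \<otimes> (b \<otimes> t') = v \<otimes> (b' \<otimes> t)"
      by (auto simp: fraction_def)
    have "(u \<otimes> v) \<otimes> ((a' \<otimes> b') \<otimes> (s \<otimes> t)) = (u \<otimes> (a' \<otimes> s)) \<otimes> (v \<otimes> (b' \<otimes> t))"
      using * assms by (simp add: m_ac)
    also have "\<dots> = (u \<otimes> v) \<otimes> ((a \<otimes> b) \<otimes> (s' \<otimes> t'))"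
      unfolding u [symmetric] v [symmetric] using * assms by (simp add: m_ac)
    finally show ?thesis
      using * assms by (subst fraction_eq_iff) (auto intro: S_mult)
  qed
  then have "(case p of (a', s') \<Rightarrow> \<Union>(b', t')\<in>fraction A S b t. fraction A S (a' \<otimes> b') (s' \<otimes> t'))
      = fraction A S (a \<otimes> b) (s \<otimes> t)" if "p \<in> fraction A S a s" for p
    using that fraction_self [of b t] assms by (cases p) fastforce
  then show ?thesis
    unfolding fraction_mult_def using fraction_self [of a s] assms by blast
qed

end

locale ring_mult_set = cring A + mult_set A S for A :: "'a ring" (structure) and S
begin

abbreviation "L \<equiv> ring_loc A S"
abbreviation "fr \<equiv> fraction A S"

lemma ring_loc_carrier: "carrier L = {fr a s | a s. a \<in> carrier A \<and> s \<in> S}"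
  by (simp add: ring_loc_def fraction_carrier_def)

lemma ring_loc_cases:
  assumes "z \<in> carrier L" obtains a s where "a \<in> carrier A" "s \<in> S" "z = fr a s"
  using assms by (auto simp: ring_loc_carrier)

lemma fr_closed [simp]: "\<lbrakk>a \<in> carrier A; s \<in> S\<rbrakk> \<Longrightarrow> fr a s \<in> carrier L"
  by (auto simp: ring_loc_carrier)

lemma fr_mult:
  assumes "a \<in> carrier A" "b \<in> carrier A" "s \<in> S" "t \<in> S"
  shows "fr a s \<otimes>\<^bsub>L\<^esub> fr b t = fr (a \<otimes> b) (s \<otimes> t)"
  using fraction_mult_eq [OF assms] by (simp add: ring_loc_def)

lemma fr_add:
  assumes "a \<in> carrier A" "b \<in> carrier A" "s \<in> S" "t \<in> S"
  shows "fr a s \<oplus>\<^bsub>L\<^esub> fr b t = fr ((a \<otimes> t) \<oplus> (b \<otimes> s)) (s \<otimes> t)"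
proof -
  have "fr ((a' \<otimes> t') \<oplus> (b' \<otimes> s')) (s' \<otimes> t') = fr ((a \<otimes> t) \<oplus> (b \<otimes> s)) (s \<otimes> t)"
    if "(a', s') \<in> fr a s" "(b', t') \<in> fr b t" for a' s' b' t'
  proof -
    from that obtain u v where *: "a' \<in> carrier A" "s' \<in> S" "u \<in> S" "b' \<in> carrier A" "t' \<in> S" "v \<in> S"
      and u: "u \<otimes> (a \<otimes> s') = u \<otimes> (a' \<otimes> s)" and v: "v \<otimes> (b \<otimes> t') = v \<otimes> (b' \<otimes> t)"
      by (auto simp: fraction_def)
    have "(u \<otimes> v) \<otimes> (((a' \<otimes> t') \<oplus> (b' \<otimes> s')) \<otimes> (s \<otimes> t)) =
        (u \<otimes> (a' \<otimes> s)) \<otimes> (v \<otimes> (t \<otimes> t')) \<oplus> (v \<otimes> (b' \<otimes> t)) \<otimes> (u \<otimes> (s \<otimes> s'))"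
      using * assms by (simp add: m_ac l_distr r_distr)
    also have "\<dots> = (u \<otimes> v) \<otimes> (((a \<otimes> t) \<oplus> (b \<otimes> s)) \<otimes> (s' \<otimes> t'))"
      unfolding u [symmetric] v [symmetric] using * assms by (simp add: m_ac l_distr r_distr)
    finally show ?thesis
      using * assms by (subst fraction_eq_iff) (auto intro: S_mult)
  qed
  then have "(case p of (a', s') \<Rightarrow> \<Union>(b', t')\<in>fr b t. fr ((a' \<otimes> t') \<oplus> (b' \<otimes> s')) (s' \<otimes> t'))
      = fr ((a \<otimes> t) \<oplus> (b \<otimes> s)) (s \<otimes> t)" if "p \<in> fr a s" for p
    using that fraction_self [of b t] assms by (cases p) fastforce
  then show ?thesis
    unfolding ring_loc_def using fraction_self [of a s] assms by simp blast
qed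

lemma ring_loc_one: "\<one>\<^bsub>L\<^esub> = fr \<one> \<one>"
  and ring_loc_zero: "\<zero>\<^bsub>L\<^esub> = fr \<zero> \<one>"
  by (simp_all add: ring_loc_def)

lemma ring_loc_cring: "cring L"
proof (rule cringI)
  show "abelian_group L"
  proof (rule abelian_groupI)
    fix x y assume "x \<in> carrier L" "y \<in> carrier L"
    then show "x \<oplus>\<^bsub>L\<^esub> y \<in> carrier L"
      by (elim ring_loc_cases) (simp add: fr_add S_mult)
  next
    show "\<zero>\<^bsub>L\<^esub> \<in> carrier L" by (simp add: ring_loc_zero S_one)
  next
    fix x y z assume "x \<in> carrier L" "y \<in> carrier L" "z \<in> carrier L"
    then show "x \<oplus>\<^bsub>L\<^esub> y \<oplus>\<^bsub>L\<^esub> z = x \<oplus>\<^bsub>L\<^esub> (y \<oplus>\<^bsub>L\<^esub> z)"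
      by (elim ring_loc_cases) (simp add: fr_add S_mult m_ac a_ac l_distr r_distr)
  next
    fix x y assume "x \<in> carrier L" "y \<in> carrier L"
    then show "x \<oplus>\<^bsub>L\<^esub> y = y \<oplus>\<^bsub>L\<^esub> x"
      by (elim ring_loc_cases) (simp add: fr_add m_comm a_comm)
  next
    fix x assume "x \<in> carrier L"
    then show "\<zero>\<^bsub>L\<^esub> \<oplus>\<^bsub>L\<^esub> x = x"
      by (elim ring_loc_cases) (simp add: fr_add ring_loc_zero S_one)
  next
    fix x assume "x \<in> carrier L"
    then obtain a s where "a \<in> carrier A" "s \<in> S" "x = fr a s" by (elim ring_loc_cases)
    moreover have "fr ((\<ominus> a \<otimes> s) \<oplus> (a \<otimes> s)) (s \<otimes> s) = fr \<zero> \<one>"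
      using calculation by (intro fraction_eqI) (auto simp: S_mult S_one l_minus l_neg)
    ultimately show "\<exists>y\<in>carrier L. y \<oplus>\<^bsub>L\<^esub> x = \<zero>\<^bsub>L\<^esub>"
      by (intro bexI [of _ "fr (\<ominus> a) s"]) (simp_all add: fr_add ring_loc_zero)
  qed
  show "Group.comm_monoid L"
  proof (rule comm_monoidI)
    fix x y assume "x \<in> carrier L" "y \<in> carrier L"
    then show "x \<otimes>\<^bsub>L\<^esub> y \<in> carrier L" "x \<otimes>\<^bsub>L\<^esub> y = y \<otimes>\<^bsub>L\<^esub> x"
      by (elim ring_loc_cases, simp add: fr_mult S_mult m_comm)+
  next
    show "\<one>\<^bsub>L\<^esub> \<in> carrier L" by (simp add: ring_loc_one S_one)
  next
    fix x y z assume "x \<in> carrier L" "y \<in> carrier L" "z \<in> carrier L"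
    then show "x \<otimes>\<^bsub>L\<^esub> y \<otimes>\<^bsub>L\<^esub> z = x \<otimes>\<^bsub>L\<^esub> (y \<otimes>\<^bsub>L\<^esub> z)"
      by (elim ring_loc_cases) (simp add: fr_mult S_mult m_ac)
  next
    fix x assume "x \<in> carrier L"
    then show "\<one>\<^bsub>L\<^esub> \<otimes>\<^bsub>L\<^esub> x = x"
      by (elim ring_loc_cases) (simp add: fr_mult ring_loc_one S_one)
  qed
  fix x y z assume "x \<in> carrier L" "y \<in> carrier L" "z \<in> carrier L"
  then obtain a s b t c r where *: "a \<in> carrier A" "s \<in> S" "b \<in> carrier A" "t \<in> S" "c \<in> carrier A" "r \<in> S"
    and "x = fr a s" "y = fr b t" "z = fr c r" by (elim ring_loc_cases)
  \<comment> \<open>The two sides of distributivity come out with the denominators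
    \<open>s \<otimes> t \<otimes> r\<close> and
    \<open>s \<otimes> r \<otimes> (t \<otimes> r)\<close>; the extra factor \<open>r\<close>
    disappears only as an equality of fractions.\<close>
  moreover have "fr ((a \<otimes> t \<oplus> b \<otimes> s) \<otimes> c) (s \<otimes> t \<otimes> r) =
      fr (a \<otimes> c \<otimes> (t \<otimes> r) \<oplus> b \<otimes> c \<otimes> (s \<otimes> r)) (s \<otimes> r \<otimes> (t \<otimes> r))"
    using * by (intro fraction_eqI) (auto simp: S_mult m_ac l_distr r_distr)
  ultimately show "(x \<oplus>\<^bsub>L\<^esub> y) \<otimes>\<^bsub>L\<^esub> z = x \<otimes>\<^bsub>L\<^esub> z \<oplus>\<^bsub>L\<^esub> y \<otimes>\<^bsub>L\<^esub> z"
    by (simp add: fr_add fr_mult S_mult)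
qed

end

section \<open>Units, local rings and the localization of a ring at a prime\<close>

lemma (in comm_monoid) Units_mult_iff:
  assumes "a \<in> carrier G" "b \<in> carrier G"
  shows "a \<otimes> b \<in> Units G \<longleftrightarrow> a \<in> Units G \<and> b \<in> Units G"
proof
  assume "a \<otimes> b \<in> Units G"
  then obtain i where i: "i \<in> carrier G" "i \<otimes> (a \<otimes> b) = \<one>" by (auto simp: Units_def)
  have "(i \<otimes> b) \<otimes> a = \<one>" "(i \<otimes> a) \<otimes> b = \<one>" using i assms by (simp_all add: m_ac)
  moreover have "a \<otimes> (i \<otimes> b) = (i \<otimes> b) \<otimes> a" "b \<otimes> (i \<otimes> a) = (i \<otimes> a) \<otimes> b"
    using i(1) assms by (simp_all only: m_comm m_closed)
  ultimately have "\<exists>x\<in>carrier G. x \<otimes> a = \<one> \<and> a \<otimes> x = \<one>" "\<exists>x\<in>carrier G. x \<otimes> b = \<one> \<and> b \<otimes> x = \<one>"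
    using i(1) assms by (metis m_closed)+
  then have "a \<in> Units G" "b \<in> Units G" using assms by (auto simp: Units_def)
  then show "a \<in> Units G \<and> b \<in> Units G" by blast
qed auto

text \<open>The usual criterion for a local ring. Products with a nonunit are nonunits by
  \<open>Units_mult_iff\<close>, so only sums have to be controlled; an ideal larger than the set of
  nonunits contains a unit and hence \<open>\<one>\<close>.\<close>

lemma (in cring) nonunits_maximalideal:
  assumes "\<one> \<noteq> \<zero>" and add: "\<And>x y. \<lbrakk>x \<in> carrier R - Units R; y \<in> carrier R - Units R\<rbrakk> \<Longrightarrow> x \<oplus> y \<notin> Units R"
  shows "maximalideal (carrier R - Units R) R"
proof (rule maximalidealI)
  have z: "\<zero> \<notin> Units R"
    using assms(1) by (auto simp: Units_def)
  have mult: "x \<otimes> a \<notin> Units R" if "a \<in> carrier R - Units R" "x \<in> carrier R" for a x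
    using that by (auto simp: Units_mult_iff)
  have "subgroup (carrier R - Units R) (add_monoid R)"
  proof (rule add.subgroupI)
    fix a assume a: "a \<in> carrier R - Units R"
    then have "\<ominus> \<one> \<otimes> a \<notin> Units R" by (intro mult) auto
    then show "\<ominus> a \<in> carrier R - Units R" using a by (auto simp: l_minus)
  qed (use z add in auto)
  then show "ideal (carrier R - Units R) R"
    by (rule idealI [OF local.ring_axioms]) (use mult m_comm in auto)
  show "carrier R \<noteq> carrier R - Units R" using Units_one_closed by blast
  fix J assume "ideal J R" and J: "carrier R - Units R \<subseteq> J" "J \<subseteq> carrier R"
  then interpret J: ideal J R by simp
  show "J = carrier R - Units R \<or> J = carrier R"
  proof (cases "J \<inter> Units R = {}")
    case False
    then obtain u where u: "u \<in> J" "u \<in> Units R" by blast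
    then have "inv u \<otimes> u \<in> J" by (intro J.I_l_closed) auto
    then show ?thesis using u J.one_imp_carrier by simp
  qed (use J in blast)
qed

context primeideal
begin

lemma one_notin: "\<one> \<notin> I"
  using one_imp_carrier I_notcarr by auto

lemma Units_notin: "u \<in> Units R \<Longrightarrow> u \<notin> I"
  using I_l_closed [of u "inv u"] one_notin by auto

end

locale ring_prime = primeideal I R for I and R :: "'a ring" (structure)
begin

lemma prime_complement: "ring_mult_set R (carrier R - I)"
proof unfold_locales
  show "\<one> \<in> carrier R - I" using one_imp_carrier I_notcarr by auto
qed (use I_prime in auto)

abbreviation "Loc \<equiv> ring_loc R (carrier R - I)"
abbreviation "fr \<equiv> fraction R (carrier R - I)"

text \<open>If \<open>fr b t\<close> inverts \<open>fr a s\<close>, then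
  \<open>u \<otimes> (b \<otimes> a) = u \<otimes> (t \<otimes> s)\<close> with \<open>u\<close>,
  \<open>t\<close> and \<open>s\<close> outside the prime, so \<open>a\<close> cannot lie in it.
  Conversely \<open>fr s a\<close> is an inverse.\<close>

lemma Loc_Units:
  assumes "a \<in> carrier R" "s \<in> carrier R - I"
  shows "fr a s \<in> Units Loc \<longleftrightarrow> a \<notin> I"
proof
  interpret L: ring_mult_set R "carrier R - I" by (rule prime_complement)
  interpret Lc: cring Loc by (rule L.ring_loc_cring)
  {
    assume "fr a s \<in> Units Loc"
    then obtain z where "z \<in> carrier Loc" "z \<otimes>\<^bsub>Loc\<^esub> fr a s = \<one>\<^bsub>Loc\<^esub>"
      unfolding Units_def by auto
    then obtain b t where b: "b \<in> carrier R" "t \<in> carrier R - I" "fr (b \<otimes> a) (t \<otimes> s) = fr \<one> \<one>"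
      using assms by (auto elim!: L.ring_loc_cases simp: L.fr_mult L.ring_loc_one)
    moreover have "t \<otimes> s \<in> carrier R - I" by (intro L.S_mult) (use b assms in auto)
    ultimately obtain u where u: "u \<in> carrier R - I" "u \<otimes> (b \<otimes> a) = u \<otimes> (t \<otimes> s)"
      using assms L.S_one by (auto simp: L.fraction_eq_iff)
    show "a \<notin> I"
    proof
      assume "a \<in> I"
      then have "u \<otimes> (b \<otimes> a) \<in> I" using u(1) b(1) by (auto intro!: I_l_closed)
      then have "u \<otimes> (t \<otimes> s) \<in> I" using u(2) by simp
      then show False using u(1) \<open>t \<otimes> s \<in> carrier R - I\<close> I_prime [of u "t \<otimes> s"] by blast
    qed
  }
  assume a: "a \<notin> I"
  have "fr a s \<otimes>\<^bsub>Loc\<^esub> fr s a = \<one>\<^bsub>Loc\<^esub>"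
  proof -
    have "a \<otimes> s \<in> carrier R - I" by (intro L.S_mult) (use a assms in auto)
    then have "fr (a \<otimes> s) (s \<otimes> a) = fr \<one> \<one>"
      using assms a L.S_one by (intro L.fraction_eqI) (auto simp: m_comm)
    then show ?thesis using a assms by (simp add: L.fr_mult L.ring_loc_one)
  qed
  then show "fr a s \<in> Units Loc"
    using a assms Lc.m_comm [of "fr a s" "fr s a"] unfolding Units_def by (auto intro!: bexI [of _ "fr s a"])
qed

lemma Loc_cring: "cring Loc"
  using ring_mult_set.ring_loc_cring [OF prime_complement] .

lemma Loc_nonunit_add:
  assumes "x \<in> carrier Loc - Units Loc" "y \<in> carrier Loc - Units Loc"
  shows "x \<oplus>\<^bsub>Loc\<^esub> y \<in> carrier Loc - Units Loc"
proof -
  interpret L: ring_mult_set R "carrier R - I" by (rule prime_complement)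
  from assms obtain a s b t where *: "a \<in> carrier R" "s \<in> carrier R - I" "b \<in> carrier R" "t \<in> carrier R - I"
    "x = fr a s" "y = fr b t" by (auto elim!: L.ring_loc_cases)
  then have "a \<in> I" "b \<in> I" using assms Loc_Units by auto
  then have "a \<otimes> t \<oplus> b \<otimes> s \<in> I" using * by (auto intro: I_r_closed)
  moreover have "s \<otimes> t \<in> carrier R - I" by (intro L.S_mult) (use * in auto)
  ultimately show ?thesis using * Loc_Units [of "a \<otimes> t \<oplus> b \<otimes> s" "s \<otimes> t"] by (simp add: L.fr_add)
qed

lemma Loc_one_not_zero: "\<one>\<^bsub>Loc\<^esub> \<noteq> \<zero>\<^bsub>Loc\<^esub>"
proof
  interpret L: ring_mult_set R "carrier R - I" by (rule prime_complement)
  assume "\<one>\<^bsub>Loc\<^esub> = \<zero>\<^bsub>Loc\<^esub>"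
  then have "fr \<zero> \<one> \<in> Units Loc"
    using monoid.Units_one_closed [of Loc] Loc_cring
    by (simp add: L.ring_loc_zero cring_def comm_monoid_def)
  then show False using Loc_Units [of \<zero> \<one>] one_notin by simp
qed

text \<open>Turns equality of residues in the local ring into membership of a difference in the
  prime, the form in which \<open>gamma_affine\<close> is later compared with the residue
  field.\<close>

lemma Loc_diff_nonunit_iff:
  assumes "a \<in> carrier R" "b \<in> carrier R"
  shows "fr a \<one> \<ominus>\<^bsub>Loc\<^esub> fr b \<one> \<in> carrier Loc - Units Loc \<longleftrightarrow> a \<ominus> b \<in> I"
proof -
  interpret L: ring_mult_set R "carrier R - I" by (rule prime_complement)
  interpret Lc: cring Loc by (rule L.ring_loc_cring)
  have m: "\<ominus>\<^bsub>Loc\<^esub> fr b \<one> = fr (\<ominus> b) \<one>"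
  proof (rule Lc.minus_equality)
    show "fr (\<ominus> b) \<one> \<oplus>\<^bsub>Loc\<^esub> fr b \<one> = \<zero>\<^bsub>Loc\<^esub>"
      using assms L.S_one one_notin by (simp add: L.fr_add L.ring_loc_zero l_neg)
  qed (use assms one_notin in auto)
  show ?thesis
    using assms one_notin Loc_Units [of "a \<ominus> b" \<one>]
    by (auto simp: Lc.minus_eq m L.fr_add a_minus_def intro!: L.fr_closed)
qed

end

text \<open>\<open>\<phi>\<close> exhibits \<open>B\<close> as \<open>A\<close> with those elements
  inverted whose image is a unit: each element of \<open>B\<close> is a fraction, and equality in
  \<open>B\<close> is equality in \<open>A\<close> up to a denominator. A property is used because
  stalks and section monoids are not literally sets of fractions. Only multiplication occurs, so it
  applies to monoids and to rings.\<close>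

definition localization :: "('a, 'm) monoid_scheme \<Rightarrow> ('b, 'n) monoid_scheme \<Rightarrow> ('a \<Rightarrow> 'b) \<Rightarrow> bool"
  where "localization A B \<phi> \<longleftrightarrow> \<phi> \<in> hom A B \<and>
    (\<forall>b\<in>carrier B. \<exists>a\<in>carrier A. \<exists>s\<in>carrier A. \<phi> s \<in> Units B \<and> b \<otimes>\<^bsub>B\<^esub> \<phi> s = \<phi> a) \<and>
    (\<forall>a\<in>carrier A. \<forall>b\<in>carrier A. \<phi> a = \<phi> b \<longrightarrow>
      (\<exists>s\<in>carrier A. \<phi> s \<in> Units B \<and> s \<otimes>\<^bsub>A\<^esub> a = s \<otimes>\<^bsub>A\<^esub> b))"

lemma localization_surj:
  assumes "localization A B \<phi>" "b \<in> carrier B"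
  obtains a s where "a \<in> carrier A" "s \<in> carrier A" "\<phi> s \<in> Units B" "b \<otimes>\<^bsub>B\<^esub> \<phi> s = \<phi> a"
  using assms unfolding localization_def by blast

lemma localization_eq:
  assumes "localization A B \<phi>" "a \<in> carrier A" "b \<in> carrier A" "\<phi> a = \<phi> b"
  obtains s where "s \<in> carrier A" "\<phi> s \<in> Units B" "s \<otimes>\<^bsub>A\<^esub> a = s \<otimes>\<^bsub>A\<^esub> b"
  using assms unfolding localization_def by blast

lemma localization_closed: "\<lbrakk>localization A B \<phi>; a \<in> carrier A\<rbrakk> \<Longrightarrow> \<phi> a \<in> carrier B"
  and localization_mult: "\<lbrakk>localization A B \<phi>; a \<in> carrier A; b \<in> carrier A\<rbrakk> \<Longrightarrow> \<phi> (a \<otimes>\<^bsub>A\<^esub> b) = \<phi> a \<otimes>\<^bsub>B\<^esub> \<phi> b"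
  by (auto simp: localization_def hom_def)

text \<open>Serves sums, products and congruent pairs, where two elements must be written over one
  denominator.\<close>

lemma localization_common_denominator:
  assumes "comm_monoid A" "comm_monoid B" and loc: "localization A B \<phi>"
    and "b \<in> carrier B" "c \<in> carrier B"
  obtains a d s where "a \<in> carrier A" "d \<in> carrier A" "s \<in> carrier A" "\<phi> s \<in> Units B"
    "b \<otimes>\<^bsub>B\<^esub> \<phi> s = \<phi> a" "c \<otimes>\<^bsub>B\<^esub> \<phi> s = \<phi> d"
proof -
  interpret A: comm_monoid A by fact
  interpret B: comm_monoid B by fact
  obtain a s where a: "a \<in> carrier A" "s \<in> carrier A" "\<phi> s \<in> Units B" "b \<otimes>\<^bsub>B\<^esub> \<phi> s = \<phi> a"
    using localization_surj [OF loc assms(4)] .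
  obtain d t where d: "d \<in> carrier A" "t \<in> carrier A" "\<phi> t \<in> Units B" "c \<otimes>\<^bsub>B\<^esub> \<phi> t = \<phi> d"
    using localization_surj [OF loc assms(5)] .
  note l = localization_closed [OF loc] localization_mult [OF loc]
  have "b \<otimes>\<^bsub>B\<^esub> \<phi> (s \<otimes>\<^bsub>A\<^esub> t) = \<phi> (a \<otimes>\<^bsub>A\<^esub> t)"
    using a d assms(4) by (simp add: l B.m_assoc [symmetric])
  moreover have "c \<otimes>\<^bsub>B\<^esub> \<phi> (s \<otimes>\<^bsub>A\<^esub> t) = \<phi> (d \<otimes>\<^bsub>A\<^esub> s)"
    using a d assms(5) by (simp add: l B.m_ac flip: d(4))
  ultimately show thesis
    using a d by (intro that [of "a \<otimes>\<^bsub>A\<^esub> t" "d \<otimes>\<^bsub>A\<^esub> s" "s \<otimes>\<^bsub>A\<^esub> t"]) (auto simp: l)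
qed

text \<open>Localizing \<open>B\<close> further at \<open>T\<close> amounts to localizing
  \<open>A\<close> at the preimage of \<open>T\<close>. In the applications \<open>A\<close> is the
  base change of a chart, \<open>B\<close> that of a stalk, and \<open>T\<close> the complement of a
  prime.\<close>

lemma fraction_localization_eq:
  assumes "comm_monoid A" "mult_set B T" and loc: "localization A B \<phi>" and "Units B \<subseteq> T"
    and S: "mult_set A S" "S = {a \<in> carrier A. \<phi> a \<in> T}"
    and "a \<in> carrier A" "b \<in> carrier A" "h \<in> S" "k \<in> S"
  shows "fraction B T (\<phi> a) (\<phi> h) = fraction B T (\<phi> b) (\<phi> k) \<longleftrightarrow> fraction A S a h = fraction A S b k"
proof -
  interpret A: mult_set A S by fact
  interpret B: mult_set B T by fact
  note l = localization_closed [OF loc] localization_mult [OF loc]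
  have S_iff: "x \<in> S \<longleftrightarrow> x \<in> carrier A \<and> \<phi> x \<in> T" for x
    unfolding S(2) by (rule mem_Collect_eq)
  have hk: "\<phi> h \<in> T" "\<phi> k \<in> T" "h \<in> carrier A" "k \<in> carrier A"
    using assms(9,10) S_iff by blast+
  have "(\<exists>u\<in>S. u \<otimes>\<^bsub>A\<^esub> (a \<otimes>\<^bsub>A\<^esub> k) = u \<otimes>\<^bsub>A\<^esub> (b \<otimes>\<^bsub>A\<^esub> h)) \<longleftrightarrow>
    (\<exists>w\<in>T. w \<otimes>\<^bsub>B\<^esub> (\<phi> a \<otimes>\<^bsub>B\<^esub> \<phi> k) = w \<otimes>\<^bsub>B\<^esub> (\<phi> b \<otimes>\<^bsub>B\<^esub> \<phi> h))"
  proof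
    assume "\<exists>u\<in>S. u \<otimes>\<^bsub>A\<^esub> (a \<otimes>\<^bsub>A\<^esub> k) = u \<otimes>\<^bsub>A\<^esub> (b \<otimes>\<^bsub>A\<^esub> h)"
    then obtain u where u: "u \<in> carrier A" "\<phi> u \<in> T" "u \<otimes>\<^bsub>A\<^esub> (a \<otimes>\<^bsub>A\<^esub> k) = u \<otimes>\<^bsub>A\<^esub> (b \<otimes>\<^bsub>A\<^esub> h)"
      using S_iff by (elim bexE) blast
    have "\<phi> u \<otimes>\<^bsub>B\<^esub> (\<phi> a \<otimes>\<^bsub>B\<^esub> \<phi> k) = \<phi> u \<otimes>\<^bsub>B\<^esub> (\<phi> b \<otimes>\<^bsub>B\<^esub> \<phi> h)"
      using arg_cong [OF u(3), of \<phi>] assms(7,8) hk u(1) by (simp add: l)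
    then show "\<exists>w\<in>T. w \<otimes>\<^bsub>B\<^esub> (\<phi> a \<otimes>\<^bsub>B\<^esub> \<phi> k) = w \<otimes>\<^bsub>B\<^esub> (\<phi> b \<otimes>\<^bsub>B\<^esub> \<phi> h)"
      using u by blast
  next
    assume "\<exists>w\<in>T. w \<otimes>\<^bsub>B\<^esub> (\<phi> a \<otimes>\<^bsub>B\<^esub> \<phi> k) = w \<otimes>\<^bsub>B\<^esub> (\<phi> b \<otimes>\<^bsub>B\<^esub> \<phi> h)"
    then obtain w where w: "w \<in> T" "w \<otimes>\<^bsub>B\<^esub> (\<phi> a \<otimes>\<^bsub>B\<^esub> \<phi> k) = w \<otimes>\<^bsub>B\<^esub> (\<phi> b \<otimes>\<^bsub>B\<^esub> \<phi> h)" by blast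
    \<comment> \<open>The multiplier \<open>w\<close> lives in \<open>B\<close>. Clearing its
      denominator replaces it by the image of \<open>v\<close>; the equality then holds between
      images of elements of \<open>A\<close>, and \<open>t\<close> below pulls it back.\<close>
    obtain v s where v: "v \<in> carrier A" "s \<in> carrier A" "\<phi> s \<in> Units B" "w \<otimes>\<^bsub>B\<^esub> \<phi> s = \<phi> v"
      using localization_surj [OF loc B.S_closed [OF w(1)]] .
    have vT: "\<phi> v \<in> T" using v w assms(4) B.S_mult by (auto simp flip: v(4))
    have e: "x \<otimes>\<^bsub>B\<^esub> \<phi> s \<otimes>\<^bsub>B\<^esub> y = \<phi> s \<otimes>\<^bsub>B\<^esub> (x \<otimes>\<^bsub>B\<^esub> y)" if "x \<in> carrier B" "y \<in> carrier B" for x y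
      using that localization_closed [OF loc v(2)] by (simp add: B.m_ac)
    have "\<phi> (v \<otimes>\<^bsub>A\<^esub> (a \<otimes>\<^bsub>A\<^esub> k)) = \<phi> (v \<otimes>\<^bsub>A\<^esub> (b \<otimes>\<^bsub>A\<^esub> h))"
      using v(1,2) assms(7,8) hk w by (simp add: l e flip: v(4))
    then obtain t where t: "t \<in> carrier A" "\<phi> t \<in> Units B"
      "t \<otimes>\<^bsub>A\<^esub> (v \<otimes>\<^bsub>A\<^esub> (a \<otimes>\<^bsub>A\<^esub> k)) = t \<otimes>\<^bsub>A\<^esub> (v \<otimes>\<^bsub>A\<^esub> (b \<otimes>\<^bsub>A\<^esub> h))"
      using v(1) hk assms(7,8) by (elim localization_eq [OF loc, rotated 2]) auto
    then have "t \<otimes>\<^bsub>A\<^esub> v \<in> S" "(t \<otimes>\<^bsub>A\<^esub> v) \<otimes>\<^bsub>A\<^esub> (a \<otimes>\<^bsub>A\<^esub> k) = (t \<otimes>\<^bsub>A\<^esub> v) \<otimes>\<^bsub>A\<^esub> (b \<otimes>\<^bsub>A\<^esub> h)"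
      using v(1) hk assms(4,7,8) vT by (auto simp: S_iff A.m_assoc l intro!: B.S_mult)
    then show "\<exists>u\<in>S. u \<otimes>\<^bsub>A\<^esub> (a \<otimes>\<^bsub>A\<^esub> k) = u \<otimes>\<^bsub>A\<^esub> (b \<otimes>\<^bsub>A\<^esub> h)" by blast
  qed
  then show ?thesis
    using assms(7-10) hk by (simp add: A.fraction_eq_iff B.fraction_eq_iff localization_closed [OF loc])
qed

text \<open>Multiply numerator and denominator by one \<open>\<phi> s\<close> that brings both into
  the image of \<open>A\<close>.\<close>

lemma fraction_localization_surj:
  assumes "comm_monoid A" "mult_set B T" and loc: "localization A B \<phi>" and "Units B \<subseteq> T"
    and b: "b \<in> carrier B" "t \<in> T"
  obtains a h where "a \<in> carrier A" "h \<in> carrier A" "\<phi> h \<in> T"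
    "fraction B T b t = fraction B T (\<phi> a) (\<phi> h)"
proof -
  interpret A: comm_monoid A by fact
  interpret B: mult_set B T by fact
  obtain a h s where a: "a \<in> carrier A" "h \<in> carrier A" "s \<in> carrier A" "\<phi> s \<in> Units B"
    "b \<otimes>\<^bsub>B\<^esub> \<phi> s = \<phi> a" "t \<otimes>\<^bsub>B\<^esub> \<phi> s = \<phi> h"
    using localization_common_denominator [OF assms(1) B.comm_monoid_axioms loc b(1) B.S_closed [OF b(2)]] .
  have h: "\<phi> h \<in> T" using a assms B.S_mult by (auto simp flip: a(6))
  have "b \<otimes>\<^bsub>B\<^esub> \<phi> h = \<phi> a \<otimes>\<^bsub>B\<^esub> t"
    using a(1-4) b localization_closed [OF loc a(3)] by (simp add: B.m_ac flip: a(5,6))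
  then have "fraction B T b t = fraction B T (\<phi> a) (\<phi> h)"
    using a b h localization_closed [OF loc] by (intro B.fraction_eqI) auto
  then show thesis using that a h by blast
qed

section \<open>Spectra\<close>

text \<open>\<open>topology_generated_by\<close> takes a subbasis. Closure of the sets
  \<open>B f\<close> under pairwise intersection makes it a basis, which gives the pointwise
  description of open sets.\<close>

lemma openin_generated_basis:
  assumes "\<And>f g. \<lbrakk>f \<in> F; g \<in> F\<rbrakk> \<Longrightarrow> \<exists>h\<in>F. B h = B f \<inter> B g"
  shows "openin (topology_generated_by {B f | f. f \<in> F}) W \<longleftrightarrow> (\<forall>x\<in>W. \<exists>f\<in>F. x \<in> B f \<and> B f \<subseteq> W)"
    (is "?l \<longleftrightarrow> ?r W")
proof
  assume ?l
  then have "generate_topology_on {B f | f. f \<in> F} W" by (simp add: openin_topology_generated_by_iff)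
  then show "?r W"
  proof induction
    case (Int a b)
    show ?case
    proof
      fix x assume "x \<in> a \<inter> b"
      then obtain f g where "f \<in> F" "x \<in> B f" "B f \<subseteq> a" "g \<in> F" "x \<in> B g" "B g \<subseteq> b"
        using Int by blast
      then show "\<exists>f\<in>F. x \<in> B f \<and> B f \<subseteq> a \<inter> b" using assms [of f g] by (auto; blast)
    qed
  next
    case (UN K)
    then show ?case by (meson Union_iff Union_upper subset_trans)
  qed auto
next
  assume r: "?r W"
  have "W = \<Union>{B f | f. f \<in> F \<and> B f \<subseteq> W}" using r by blast
  also have "openin (topology_generated_by {B f | f. f \<in> F}) \<dots>"
    by (rule openin_Union) (auto intro: topology_generated_by_Basis)
  finally show ?l .
qed

text \<open>\<open>\<one>\<close> lies in no prime, so its basic open set already contains every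
  prime.\<close>

lemma topspace_Spec: "cring R \<Longrightarrow> topspace (Spec_top R) = {Q. primeideal Q R}"
proof (auto simp: Spec_top_def)
  fix Q assume "cring R" "primeideal Q R"
  then show "\<exists>x. (\<exists>f. x = {P. primeideal P R \<and> f \<notin> P} \<and> f \<in> carrier R) \<and> Q \<in> x"
    by (intro exI [of _ "{P. primeideal P R \<and> \<one>\<^bsub>R\<^esub> \<notin> P}"])
      (auto simp: primeideal.one_notin cring_def ring_def intro!: exI [of _ "\<one>\<^bsub>R\<^esub>"] monoid.one_closed)
qed

text \<open>The basic open sets of two elements intersect in that of their product, so they form a
  basis.\<close>

lemma openin_Spec:
  assumes "cring R"
  shows "openin (Spec_top R) W \<longleftrightarrow> (\<forall>Q\<in>W. primeideal Q R \<and>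
    (\<exists>f\<in>carrier R. f \<notin> Q \<and> (\<forall>Q'. primeideal Q' R \<longrightarrow> f \<notin> Q' \<longrightarrow> Q' \<in> W)))"
proof -
  interpret cring R by fact
  have "\<exists>h\<in>carrier R. {P. primeideal P R \<and> h \<notin> P} = {P. primeideal P R \<and> f \<notin> P} \<inter> {P. primeideal P R \<and> g \<notin> P}"
    if "f \<in> carrier R" "g \<in> carrier R" for f g
    using that by (intro bexI [of _ "f \<otimes>\<^bsub>R\<^esub> g"])
      (auto dest: primeideal.I_prime ideal.I_l_closed [OF primeideal.axioms(1)] ideal.I_r_closed [OF primeideal.axioms(1)])
  then have "openin (Spec_top R) W \<longleftrightarrow> (\<forall>x\<in>W. \<exists>f\<in>carrier R.
      x \<in> {P. primeideal P R \<and> f \<notin> P} \<and> {P. primeideal P R \<and> f \<notin> P} \<subseteq> W)"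
    unfolding Spec_top_def by (rule openin_generated_basis)
  then show ?thesis by blast
qed

lemma pm_prime_ideal_one: "\<lbrakk>pointed_monoid A; pm_prime_ideal A P\<rbrakk> \<Longrightarrow> \<one>\<^bsub>A\<^esub> \<notin> P"
proof
  assume A: "pointed_monoid A" "pm_prime_ideal A P" "\<one>\<^bsub>A\<^esub> \<in> P"
  then have "a \<otimes>\<^bsub>A\<^esub> \<one>\<^bsub>A\<^esub> \<in> P" if "a \<in> carrier A" for a
    using that by (auto simp: pm_prime_ideal_def pm_ideal_def)
  moreover have "a \<otimes>\<^bsub>A\<^esub> \<one>\<^bsub>A\<^esub> = a" if "a \<in> carrier A" for a
    using A that by (simp add: pointed_monoid_def comm_monoid_def monoid.r_one)
  ultimately show False using A by (auto simp: pm_prime_ideal_def pm_ideal_def)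
qed

lemma topspace_MSpec: "pointed_monoid A \<Longrightarrow> topspace (MSpec_top A) = {P. pm_prime_ideal A P}"
proof (auto simp: MSpec_top_def)
  fix P assume "pointed_monoid A" "pm_prime_ideal A P"
  then show "\<exists>x. (\<exists>h. x = {P. pm_prime_ideal A P \<and> h \<notin> P} \<and> h \<in> carrier A) \<and> P \<in> x"
    by (intro exI [of _ "{P. pm_prime_ideal A P \<and> \<one>\<^bsub>A\<^esub> \<notin> P}"])
      (auto simp: pm_prime_ideal_one pointed_monoid_def comm_monoid_def intro!: exI [of _ "\<one>\<^bsub>A\<^esub>"] monoid.one_closed)
qed

lemma pm_prime_mult_iff:
  assumes "pointed_monoid A" "pm_prime_ideal A P" "a \<in> carrier A" "b \<in> carrier A"
  shows "a \<otimes>\<^bsub>A\<^esub> b \<in> P \<longleftrightarrow> a \<in> P \<or> b \<in> P"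
proof -
  interpret pointed_monoid A by fact
  have "a \<otimes>\<^bsub>A\<^esub> b \<in> P" if "a \<in> P"
    unfolding m_comm [OF assms(3,4)] using assms that by (auto simp: pm_prime_ideal_def pm_ideal_def)
  then show ?thesis using assms by (auto simp: pm_prime_ideal_def pm_ideal_def)
qed

lemma openin_MSpec:
  assumes "pointed_monoid A"
  shows "openin (MSpec_top A) W \<longleftrightarrow> (\<forall>P\<in>W. pm_prime_ideal A P \<and>
    (\<exists>h\<in>carrier A. h \<notin> P \<and> (\<forall>P'. pm_prime_ideal A P' \<longrightarrow> h \<notin> P' \<longrightarrow> P' \<in> W)))"
proof -
  interpret pointed_monoid A by fact
  have "\<exists>h\<in>carrier A. {P. pm_prime_ideal A P \<and> h \<notin> P} = {P. pm_prime_ideal A P \<and> f \<notin> P} \<inter> {P. pm_prime_ideal A P \<and> g \<notin> P}"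
    if "f \<in> carrier A" "g \<in> carrier A" for f g
    using that assms by (intro bexI [of _ "f \<otimes>\<^bsub>A\<^esub> g"]) (auto simp: pm_prime_mult_iff)
  then have "openin (MSpec_top A) W \<longleftrightarrow> (\<forall>x\<in>W. \<exists>f\<in>carrier A.
      x \<in> {P. pm_prime_ideal A P \<and> f \<notin> P} \<and> {P. pm_prime_ideal A P \<and> f \<notin> P} \<subseteq> W)"
    unfolding MSpec_top_def by (rule openin_generated_basis)
  then show ?thesis by blast
qed

lemma pm_prime_mult_set:
  assumes "pointed_monoid A" "pm_prime_ideal A P"
  shows "mult_set A (carrier A - P)"
proof -
  interpret pointed_monoid A by fact
  show ?thesis
    using assms pm_prime_ideal_one [OF assms] by unfold_locales (auto simp: pm_prime_ideal_def)
qed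

section \<open>Primes under pullback along a ring homomorphism\<close>

lemma Spec_map_primeideal:
  assumes "cring R" "cring S" "\<phi> \<in> ring_hom R S" "primeideal Q S"
  shows "primeideal (Spec_map R \<phi> Q) R"
proof -
  interpret R: cring R by fact
  interpret S: cring S by fact
  interpret Q: primeideal Q S by fact
  interpret h: ring_hom_cring R S \<phi> by unfold_locales fact
  have "ideal (Spec_map R \<phi> Q) R"
    using h.ring.ideal_vimage [OF Q.is_ideal] by (simp add: Spec_map_def)
  then show ?thesis
  proof (rule primeidealI [OF _ \<open>cring R\<close>])
    have "\<one>\<^bsub>R\<^esub> \<notin> Spec_map R \<phi> Q" using Q.one_notin by (simp add: Spec_map_def)
    then show "carrier R \<noteq> Spec_map R \<phi> Q" using R.one_closed by metis
    fix a b assume "a \<in> carrier R" "b \<in> carrier R" "a \<otimes>\<^bsub>R\<^esub> b \<in> Spec_map R \<phi> Q"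
    then show "a \<in> Spec_map R \<phi> Q \<or> b \<in> Spec_map R \<phi> Q"
      using Q.I_prime [of "\<phi> a" "\<phi> b"] by (auto simp: Spec_map_def)
  qed
qed

text \<open>If \<open>b\<close> times the unit \<open>\<phi> s\<close> is \<open>\<phi> a\<close>,
  then \<open>b\<close> lies in a prime exactly when \<open>a\<close> lies in its contraction; so
  the contraction determines the prime.\<close>

lemma Spec_map_localization_inj:
  assumes "cring R" "cring S" "localization R S \<phi>" "primeideal P S" "primeideal Q S"
    and eq: "Spec_map R \<phi> P = Spec_map R \<phi> Q"
  shows "P = Q"
proof -
  have "P \<subseteq> Q" if "primeideal P S" "primeideal Q S" "Spec_map R \<phi> P = Spec_map R \<phi> Q" for P Q
  proof
    interpret P: primeideal P S by fact
    interpret Q: primeideal Q S by fact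
    fix b assume b: "b \<in> P"
    obtain a s where a: "a \<in> carrier R" "s \<in> carrier R" "\<phi> s \<in> Units S" "b \<otimes>\<^bsub>S\<^esub> \<phi> s = \<phi> a"
      using localization_surj [OF assms(3) P.Icarr [OF b]] .
    then have "\<phi> a \<in> P" using b by (auto simp flip: a(4) intro: P.I_r_closed)
    then have "a \<in> Spec_map R \<phi> Q" using a that(3) by (auto simp: Spec_map_def)
    then have "b \<otimes>\<^bsub>S\<^esub> \<phi> s \<in> Q" by (simp add: Spec_map_def a)
    then show "b \<in> Q" using a b Q.I_prime [of b "\<phi> s"] Q.Units_notin P.Icarr by blast
  qed
  then show ?thesis using assms by blast
qed

text \<open>The wanted prime is the extension of \<open>P\<close>, written down as the set of
  fractions with numerator in \<open>P\<close>. That it contracts back to \<open>P\<close> is where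
  the disjointness from the denominators enters.\<close>

lemma Spec_map_localization_surj:
  assumes "cring R" "cring S" and hom: "\<phi> \<in> ring_hom R S" and loc: "localization R S \<phi>"
    and "primeideal P R" and disj: "\<And>s. s \<in> P \<Longrightarrow> \<phi> s \<notin> Units S"
  obtains Q where "primeideal Q S" "Spec_map R \<phi> Q = P"
proof -
  interpret R: cring R by fact
  interpret S: cring S by fact
  interpret P: primeideal P R by fact
  interpret h: ring_hom_cring R S \<phi> by unfold_locales fact
  define Q where "Q = {b \<in> carrier S. \<exists>a\<in>P. \<exists>s\<in>carrier R. \<phi> s \<in> Units S \<and> b \<otimes>\<^bsub>S\<^esub> \<phi> s = \<phi> a}"
  have img: "a \<in> P" if a: "a \<in> carrier R" "\<phi> a \<in> Q" for a
  proof -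
    from a obtain c s where c: "c \<in> P" "s \<in> carrier R" "\<phi> s \<in> Units S" "\<phi> (a \<otimes>\<^bsub>R\<^esub> s) = \<phi> c"
      by (auto simp: Q_def)
    obtain t where t: "t \<in> carrier R" "\<phi> t \<in> Units S" "t \<otimes>\<^bsub>R\<^esub> (a \<otimes>\<^bsub>R\<^esub> s) = t \<otimes>\<^bsub>R\<^esub> c"
      by (rule localization_eq [OF loc _ _ c(4)]) (use c a in auto)
    have "t \<otimes>\<^bsub>R\<^esub> (a \<otimes>\<^bsub>R\<^esub> s) \<in> P" unfolding t(3) using t c by (auto intro: P.I_l_closed)
    moreover have "t \<notin> P" "s \<notin> P" using disj c t by auto
    ultimately show ?thesis using P.I_prime [of t "a \<otimes>\<^bsub>R\<^esub> s"] P.I_prime [of a s] t c that by auto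
  qed
  \<comment> \<open>\<open>Q\<close> asks for some representation with numerator in
    \<open>P\<close>; here any representation is shown to decide membership. The ideal and primality
    axioms below then reduce to those of \<open>P\<close>.\<close>
  have Q_iff: "b \<in> Q \<longleftrightarrow> a \<in> P"
    if "b \<in> carrier S" "a \<in> carrier R" "s \<in> carrier R" "\<phi> s \<in> Units S" "b \<otimes>\<^bsub>S\<^esub> \<phi> s = \<phi> a" for a b s
  proof
    assume "a \<in> P" then show "b \<in> Q" using that by (auto simp: Q_def)
  next
    assume "b \<in> Q"
    then obtain c t where c: "c \<in> P" "t \<in> carrier R" "\<phi> t \<in> Units S" "b \<otimes>\<^bsub>S\<^esub> \<phi> t = \<phi> c"
      by (auto simp: Q_def)
    have "\<phi> a \<otimes>\<^bsub>S\<^esub> \<phi> t = \<phi> (c \<otimes>\<^bsub>R\<^esub> s)"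
      using c that by (simp add: S.m_ac flip: c(4) that(5))
    moreover have "c \<otimes>\<^bsub>R\<^esub> s \<in> P" using c that by (auto intro: P.I_r_closed)
    moreover have "\<phi> a \<in> carrier S" using that by simp
    ultimately have "\<phi> a \<in> Q" using c(2,3) unfolding Q_def by blast
    then show "a \<in> P" using img that by auto
  qed
  have "ideal Q S"
  proof (rule idealI [OF S.ring_axioms])
    show "subgroup Q (add_monoid S)"
    proof (rule S.add.subgroupI)
      show "Q \<subseteq> carrier S" by (auto simp: Q_def)
      have "\<zero>\<^bsub>S\<^esub> \<in> Q" using Q_iff [of "\<zero>\<^bsub>S\<^esub>" "\<zero>\<^bsub>R\<^esub>" "\<one>\<^bsub>R\<^esub>"] by simp
      then show "Q \<noteq> {}" by blast
    next
      fix b assume b: "b \<in> Q"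
      then obtain a s where a: "a \<in> P" "s \<in> carrier R" "\<phi> s \<in> Units S" "b \<otimes>\<^bsub>S\<^esub> \<phi> s = \<phi> a" "b \<in> carrier S"
        by (auto simp: Q_def)
      then show "\<ominus>\<^bsub>S\<^esub> b \<in> Q" using Q_iff [of "\<ominus>\<^bsub>S\<^esub> b" "\<ominus>\<^bsub>R\<^esub> a" s] by (simp add: S.l_minus)
    next
      fix b c assume b: "b \<in> Q" "c \<in> Q"
      then have bc: "b \<in> carrier S" "c \<in> carrier S" by (auto simp: Q_def)
      obtain a d s where a: "a \<in> carrier R" "d \<in> carrier R" "s \<in> carrier R" "\<phi> s \<in> Units S"
        "b \<otimes>\<^bsub>S\<^esub> \<phi> s = \<phi> a" "c \<otimes>\<^bsub>S\<^esub> \<phi> s = \<phi> d"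
        using localization_common_denominator [OF R.comm_monoid_axioms S.comm_monoid_axioms loc bc] .
      then have "a \<in> P" "d \<in> P" using Q_iff b bc by auto
      then show "b \<oplus>\<^bsub>S\<^esub> c \<in> Q"
        using Q_iff [of "b \<oplus>\<^bsub>S\<^esub> c" "a \<oplus>\<^bsub>R\<^esub> d" s] a bc by (simp add: S.l_distr)
    qed
    have *: "x \<otimes>\<^bsub>S\<^esub> b \<in> Q" if b: "b \<in> Q" and x: "x \<in> carrier S" for b x
    proof -
      obtain a s where a: "a \<in> P" "s \<in> carrier R" "\<phi> s \<in> Units S" "b \<otimes>\<^bsub>S\<^esub> \<phi> s = \<phi> a" "b \<in> carrier S"
        using b by (auto simp: Q_def)
      obtain y t where y: "y \<in> carrier R" "t \<in> carrier R" "\<phi> t \<in> Units S" "x \<otimes>\<^bsub>S\<^esub> \<phi> t = \<phi> y"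
        using localization_surj [OF loc x] .
      have "(x \<otimes>\<^bsub>S\<^esub> b) \<otimes>\<^bsub>S\<^esub> \<phi> (t \<otimes>\<^bsub>R\<^esub> s) = \<phi> (y \<otimes>\<^bsub>R\<^esub> a)"
        using a y that by (simp add: S.m_ac flip: y(4) a(4))
      then show ?thesis
        using Q_iff [of "x \<otimes>\<^bsub>S\<^esub> b" "y \<otimes>\<^bsub>R\<^esub> a" "t \<otimes>\<^bsub>R\<^esub> s"] a y that by (auto intro: P.I_l_closed)
    qed
    then show "x \<otimes>\<^bsub>S\<^esub> b \<in> Q" "b \<otimes>\<^bsub>S\<^esub> x \<in> Q" if "b \<in> Q" "x \<in> carrier S" for b x
      using that S.m_comm [of b x] by (auto simp: Q_def)
  qed
  then have "primeideal Q S"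
  proof (rule primeidealI [OF _ \<open>cring S\<close>])
    have "\<one>\<^bsub>S\<^esub> \<notin> Q" using img [of "\<one>\<^bsub>R\<^esub>"] P.one_notin by auto
    then show "carrier S \<noteq> Q" by auto
    fix b c assume b: "b \<in> carrier S" "c \<in> carrier S" "b \<otimes>\<^bsub>S\<^esub> c \<in> Q"
    obtain a d s where a: "a \<in> carrier R" "d \<in> carrier R" "s \<in> carrier R" "\<phi> s \<in> Units S"
      "b \<otimes>\<^bsub>S\<^esub> \<phi> s = \<phi> a" "c \<otimes>\<^bsub>S\<^esub> \<phi> s = \<phi> d"
      using localization_common_denominator [OF R.comm_monoid_axioms S.comm_monoid_axioms loc b(1,2)] .
    have "(b \<otimes>\<^bsub>S\<^esub> c) \<otimes>\<^bsub>S\<^esub> \<phi> (s \<otimes>\<^bsub>R\<^esub> s) = \<phi> (a \<otimes>\<^bsub>R\<^esub> d)"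
      using a b by (simp add: S.m_ac flip: a(5,6))
    then have "a \<otimes>\<^bsub>R\<^esub> d \<in> P" using Q_iff [of "b \<otimes>\<^bsub>S\<^esub> c" "a \<otimes>\<^bsub>R\<^esub> d" "s \<otimes>\<^bsub>R\<^esub> s"] a b by auto
    then show "b \<in> Q \<or> c \<in> Q" using P.I_prime a b Q_iff by blast
  qed
  moreover have "Spec_map R \<phi> Q = P"
    using img Q_iff [of _ _ "\<one>\<^bsub>R\<^esub>"] by (auto simp: Spec_map_def)
  ultimately show thesis using that by blast
qed

text \<open>As a rewrite rule \<open>S_closed\<close> makes the simplifier loop when \<open>S\<close> is a complement \<open>carrier A - P\<close>.\<close>

declare (in mult_set) S_closed [simp del]

section \<open>Pointed monoids and their quotients\<close>

lemma pointed_monoidD: "pointed_monoid A \<Longrightarrow> comm_monoid A"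
  by (simp add: pointed_monoid_def)

lemma pm_homD:
  assumes "h \<in> pm_hom A B"
  shows "a \<in> carrier A \<Longrightarrow> h a \<in> carrier B"
    and "\<lbrakk>a \<in> carrier A; b \<in> carrier A\<rbrakk> \<Longrightarrow> h (a \<otimes>\<^bsub>A\<^esub> b) = h a \<otimes>\<^bsub>B\<^esub> h b"
    and "h \<one>\<^bsub>A\<^esub> = \<one>\<^bsub>B\<^esub>" and "h (pzero A) = pzero B"
  using assms by (auto simp: pm_hom_def hom_def)

lemma pm_homI:
  assumes "\<And>a. a \<in> carrier A \<Longrightarrow> h a \<in> carrier B"
    and "\<And>a b. \<lbrakk>a \<in> carrier A; b \<in> carrier A\<rbrakk> \<Longrightarrow> h (a \<otimes>\<^bsub>A\<^esub> b) = h a \<otimes>\<^bsub>B\<^esub> h b"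
    and "h \<one>\<^bsub>A\<^esub> = \<one>\<^bsub>B\<^esub>" and "h (pzero A) = pzero B"
  shows "h \<in> pm_hom A B"
  using assms by (auto simp: pm_hom_def hom_def)

lemma hom_Units:
  assumes "comm_monoid A" "comm_monoid B" "h \<in> hom A B" "h \<one>\<^bsub>A\<^esub> = \<one>\<^bsub>B\<^esub>" "u \<in> Units A"
  shows "h u \<in> Units B"
proof -
  obtain v where v: "u \<in> carrier A" "v \<in> carrier A" "v \<otimes>\<^bsub>A\<^esub> u = \<one>\<^bsub>A\<^esub>" "u \<otimes>\<^bsub>A\<^esub> v = \<one>\<^bsub>A\<^esub>"
    using assms(5) by (auto simp: Units_def)
  then have "h v \<otimes>\<^bsub>B\<^esub> h u = \<one>\<^bsub>B\<^esub>" "h u \<otimes>\<^bsub>B\<^esub> h v = \<one>\<^bsub>B\<^esub>"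
    using assms(3,4) by (auto simp: hom_mult [symmetric])
  then show ?thesis using v assms(3) by (auto simp: Units_def hom_def)
qed

lemma pm_hom_Units:
  "\<lbrakk>pointed_monoid A; pointed_monoid B; h \<in> pm_hom A B; u \<in> Units A\<rbrakk> \<Longrightarrow> h u \<in> Units B"
  using hom_Units [of A B h u] by (auto simp: pointed_monoidD pm_hom_def)

lemma mult_pmonoid_simps [simp]:
  "carrier (mult_pmonoid R) = carrier R" "mult (mult_pmonoid R) = mult R"
  "\<one>\<^bsub>mult_pmonoid R\<^esub> = \<one>\<^bsub>R\<^esub>" "pzero (mult_pmonoid R) = \<zero>\<^bsub>R\<^esub>"
  by (simp_all add: mult_pmonoid_def)

lemma mult_pmonoid_pointed: "cring R \<Longrightarrow> pointed_monoid (mult_pmonoid R)"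
proof -
  assume "cring R"
  then interpret cring R .
  show ?thesis
    by unfold_locales (auto simp: m_ac)
qed

lemma pointed_group_field:
  assumes "field K" shows "pointed_group (mult_pmonoid K)"
proof -
  interpret field K by fact
  have "Units (mult_pmonoid K) = Units K" by (simp add: Units_def)
  then show ?thesis
    using mult_pmonoid_pointed [OF is_cring] field_Units by (simp add: pointed_group_def)
qed

text \<open>The homomorphism theorem for the kernel congruence of \<open>h\<close>. It is used with
  a residue field as target, both to see that a congruence is strongly prime and to construct the
  map \<open>\<gamma>\<^sub>x\<close>.\<close>

lemma pm_quot_induced:
  assumes "pointed_monoid A" "pointed_monoid G" and h: "h \<in> pm_hom A G"
    and c: "c = {(a, b). a \<in> carrier A \<and> b \<in> carrier A \<and> h a = h b}"
  shows "congruence A c" "pointed_monoid (pm_quot A c)"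
    "\<And>a b. \<lbrakk>a \<in> carrier A; b \<in> carrier A\<rbrakk> \<Longrightarrow> c `` {a} \<otimes>\<^bsub>pm_quot A c\<^esub> c `` {b} = c `` {a \<otimes>\<^bsub>A\<^esub> b}"
    "\<exists>k \<in> pm_hom (pm_quot A c) G. (\<forall>a\<in>carrier A. k (c `` {a}) = h a) \<and> inj_on k (carrier (pm_quot A c))"
proof -
  interpret A: pointed_monoid A by fact
  interpret G: pointed_monoid G by fact
  note hD = pm_homD [OF h]
  let ?Q = "pm_quot A c"
  have eq: "c `` {a} = c `` {b} \<longleftrightarrow> h a = h b" if "a \<in> carrier A" "b \<in> carrier A" for a b
    using that by (auto simp: c)
  have car: "carrier ?Q = {c `` {a} | a. a \<in> carrier A}" by (auto simp: pm_quot_def quotient_def)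
  show "congruence A c"
    unfolding congruence_def equiv_def refl_on_def sym_on_def trans_on_def
    by (auto simp: c hD)
  show mult: "c `` {a} \<otimes>\<^bsub>?Q\<^esub> c `` {b} = c `` {a \<otimes>\<^bsub>A\<^esub> b}" if ab: "a \<in> carrier A" "b \<in> carrier A" for a b
  proof -
    have "c `` {a' \<otimes>\<^bsub>A\<^esub> b'} = c `` {a \<otimes>\<^bsub>A\<^esub> b}" if "a' \<in> c `` {a}" "b' \<in> c `` {b}" for a' b'
      using that ab by (subst eq) (auto simp: c hD)
    note * = this
    have "a \<in> c `` {a}" "b \<in> c `` {b}" using ab by (auto simp: c)
    then have ne: "c `` {a} \<noteq> {}" "c `` {b} \<noteq> {}" by blast+
    have "c `` {a} \<otimes>\<^bsub>?Q\<^esub> c `` {b} = (\<Union>a'\<in>c `` {a}. \<Union>b'\<in>c `` {b}. c `` {a' \<otimes>\<^bsub>A\<^esub> b'})"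
      by (simp add: pm_quot_def)
    also have "\<dots> = (\<Union>a'\<in>c `` {a}. \<Union>b'\<in>c `` {b}. c `` {a \<otimes>\<^bsub>A\<^esub> b})"
      by (intro SUP_cong refl *)
    also have "\<dots> = c `` {a \<otimes>\<^bsub>A\<^esub> b}" using ne by simp
    finally show ?thesis .
  qed
  have one: "\<one>\<^bsub>?Q\<^esub> = c `` {\<one>\<^bsub>A\<^esub>}" and zero: "pzero ?Q = c `` {pzero A}"
    by (simp_all add: pm_quot_def)
  show "pointed_monoid ?Q"
  proof (intro pointed_monoid.intro pointed_monoid_axioms.intro comm_monoidI)
    show "pzero ?Q \<in> carrier ?Q" "\<one>\<^bsub>?Q\<^esub> \<in> carrier ?Q" using A.pzero_closed by (auto simp: car one zero)
  next
    fix x y assume "x \<in> carrier ?Q" "y \<in> carrier ?Q"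
    then obtain a b where ab: "a \<in> carrier A" "b \<in> carrier A" "x = c `` {a}" "y = c `` {b}" by (auto simp: car)
    then show "x \<otimes>\<^bsub>?Q\<^esub> y = y \<otimes>\<^bsub>?Q\<^esub> x" by (simp add: mult A.m_comm [of a b])
    show "x \<otimes>\<^bsub>?Q\<^esub> y \<in> carrier ?Q" using ab by (auto simp: mult car)
  qed (auto simp: car mult one zero A.m_assoc A.pzero_closed A.pzero_absorb)
  \<comment> \<open>\<open>h\<close> is constant on each class, so the image of a class under
    \<open>h\<close> is a singleton.\<close>
  define k where "k C = the_elem (h ` C)" for C
  have k: "k (c `` {a}) = h a" if "a \<in> carrier A" for a
  proof -
    have "h ` (c `` {a}) = {h a}" using that by (auto simp: c)
    then show ?thesis by (simp add: k_def)
  qed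
  have "k \<in> pm_hom ?Q G"
    by (rule pm_homI) (auto simp: car mult one zero k hD A.pzero_closed)
  moreover have "inj_on k (carrier ?Q)"
    unfolding inj_on_def car by (clarsimp simp: k eq)
  ultimately show "\<exists>k \<in> pm_hom ?Q G. (\<forall>a\<in>carrier A. k (c `` {a}) = h a) \<and> inj_on k (carrier ?Q)"
    using k by blast
qed

section \<open>Base change of pointed monoids\<close>

text \<open>The product of \<open>monoid_ring A\<close> as an operation on all finitely supported
  functions, so that its bilinearity holds without carrier conditions and fits
  \<open>frag_induction\<close>.\<close>

definition mr_mult :: "'a pmonoid \<Rightarrow> ('a \<Rightarrow>\<^sub>0 int) \<Rightarrow> ('a \<Rightarrow>\<^sub>0 int) \<Rightarrow> ('a \<Rightarrow>\<^sub>0 int)" where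
  "mr_mult A f g = frag_extend (\<lambda>a. frag_extend (\<lambda>b. frag_of (a \<otimes>\<^bsub>A\<^esub> b)) g) f"

definition mr_map :: "('a \<Rightarrow> 'b) \<Rightarrow> ('a \<Rightarrow>\<^sub>0 int) \<Rightarrow> ('b \<Rightarrow>\<^sub>0 int)" where
  "mr_map \<phi> f = frag_extend (\<lambda>a. frag_of (\<phi> a)) f"

lemma monoid_ring_simps:
  "carrier (monoid_ring A) = {f. Poly_Mapping.keys f \<subseteq> carrier A}"
  "f \<otimes>\<^bsub>monoid_ring A\<^esub> g = mr_mult A f g" "\<one>\<^bsub>monoid_ring A\<^esub> = frag_of \<one>\<^bsub>A\<^esub>"
  "\<zero>\<^bsub>monoid_ring A\<^esub> = 0" "f \<oplus>\<^bsub>monoid_ring A\<^esub> g = f + g"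
  by (simp_all add: monoid_ring_def mr_mult_def)

lemma frag_extend_minus_fun: "frag_extend (\<lambda>a. h a - k a) f = frag_extend h f - frag_extend k f"
  using subset_UNIV by (induction f rule: frag_induction) (auto simp: frag_extend_diff)

lemma mr_mult_lin [simp]:
  "mr_mult A 0 g = 0" "mr_mult A f 0 = 0"
  "mr_mult A (f - f') g = mr_mult A f g - mr_mult A f' g"
  "mr_mult A f (g - g') = mr_mult A f g - mr_mult A f g'"
  "mr_mult A (frag_of a) (frag_of b) = frag_of (a \<otimes>\<^bsub>A\<^esub> b)"
  by (simp_all add: mr_mult_def frag_extend_diff frag_extend_minus_fun frag_extend_eq_0)

lemma mr_mult_add:
  "mr_mult A (f + f') g = mr_mult A f g + mr_mult A f' g"
  \<comment> \<open>Additivity is derived from compatibility with differences, the form that matches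
    \<open>frag_induction\<close>, by writing \<open>f\<close> as
    \<open>(f + f') - f'\<close>.\<close>
  using mr_mult_lin(3) [of A "f + f'" f' g] by (simp add: algebra_simps)

lemma mr_map_lin [simp]:
  "mr_map \<phi> 0 = 0" "mr_map \<phi> (f - g) = mr_map \<phi> f - mr_map \<phi> g" "mr_map \<phi> (f + g) = mr_map \<phi> f + mr_map \<phi> g"
  "mr_map \<phi> (frag_of a) = frag_of (\<phi> a)"
  by (simp_all add: mr_map_def frag_extend_diff frag_extend_add)

lemma keys_diff_subset: "\<lbrakk>Poly_Mapping.keys f \<subseteq> S; Poly_Mapping.keys g \<subseteq> S\<rbrakk> \<Longrightarrow> Poly_Mapping.keys (f - g) \<subseteq> S"
  using keys_diff [of f g] by blast

lemma keys_mr_mult: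
  assumes "Poly_Mapping.keys f \<subseteq> S" "Poly_Mapping.keys g \<subseteq> T" "\<And>a b. \<lbrakk>a \<in> S; b \<in> T\<rbrakk> \<Longrightarrow> a \<otimes>\<^bsub>A\<^esub> b \<in> U"
  shows "Poly_Mapping.keys (mr_mult A f g) \<subseteq> U"
  using assms(1)
proof (induction f rule: frag_induction)
  case (one a)
  show ?case using assms(2)
    by (induction g rule: frag_induction) (use one assms(3) in \<open>auto simp del: keys_diff intro: keys_diff_subset [THEN subsetD]\<close>)
qed (auto intro: keys_diff_subset [THEN subsetD])

lemma keys_mr_map: "Poly_Mapping.keys (mr_map \<phi> f) \<subseteq> \<phi> ` Poly_Mapping.keys f"
  unfolding mr_map_def using keys_frag_extend [of "\<lambda>a. frag_of (\<phi> a)" f] by auto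

locale pm = pointed_monoid A for A :: "'a pmonoid" (structure)
begin

lemma mr_assoc:
  assumes f: "Poly_Mapping.keys f \<subseteq> carrier A" and g: "Poly_Mapping.keys g \<subseteq> carrier A"
    and h: "Poly_Mapping.keys h \<subseteq> carrier A"
  shows "mr_mult A (mr_mult A f g) h = mr_mult A f (mr_mult A g h)"
  using f
proof (induction f rule: frag_induction)
  case (one a)
  show ?case using g
  proof (induction g rule: frag_induction)
    case (one b)
    show ?case using h
      by (induction h rule: frag_induction) (use one \<open>a \<in> carrier A\<close> in \<open>auto simp: m_assoc\<close>)
  qed auto
qed auto

lemma mr_comm:
  assumes f: "Poly_Mapping.keys f \<subseteq> carrier A" and g: "Poly_Mapping.keys g \<subseteq> carrier A"
  shows "mr_mult A f g = mr_mult A g f"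
  using f
proof (induction f rule: frag_induction)
  case (one a)
  show ?case using g
    by (induction g rule: frag_induction) (use one in \<open>auto simp: m_comm\<close>)
qed auto

lemma mr_one:
  assumes "Poly_Mapping.keys f \<subseteq> carrier A" shows "mr_mult A (frag_of \<one>) f = f"
  using assms by (induction f rule: frag_induction) auto

lemma monoid_ring_cring: "cring (monoid_ring A)"
proof (rule cringI)
  show "abelian_group (monoid_ring A)"
  proof (rule abelian_groupI)
    fix x assume "x \<in> carrier (monoid_ring A)"
    then show "\<exists>y\<in>carrier (monoid_ring A). y \<oplus>\<^bsub>monoid_ring A\<^esub> x = \<zero>\<^bsub>monoid_ring A\<^esub>"
      by (intro bexI [of _ "- x"]) (auto simp: monoid_ring_simps)
  qed (auto simp: monoid_ring_simps add_ac dest!: keys_add [THEN subsetD])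
  show "Group.comm_monoid (monoid_ring A)"
  proof (rule comm_monoidI)
    fix x y assume "x \<in> carrier (monoid_ring A)" "y \<in> carrier (monoid_ring A)"
    then show "x \<otimes>\<^bsub>monoid_ring A\<^esub> y \<in> carrier (monoid_ring A)"
      using keys_mr_mult [of x "carrier A" y "carrier A" A "carrier A"] by (simp add: monoid_ring_simps)
    show "x \<otimes>\<^bsub>monoid_ring A\<^esub> y = y \<otimes>\<^bsub>monoid_ring A\<^esub> x"
      using \<open>x \<in> _\<close> \<open>y \<in> _\<close> mr_comm by (simp add: monoid_ring_simps)
  qed (simp_all add: monoid_ring_simps mr_assoc mr_one)
qed (auto simp: monoid_ring_simps mr_mult_add)

text \<open>The zero of \<open>A\<close> is absorbing, so every multiple of
  \<open>frag_of (pzero A)\<close> is again supported on \<open>pzero A\<close>, and the ideal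
  consists of the integer multiples of one basis element. Equality in the base change thus ignores
  exactly one coefficient, which is what \<open>zcl_eq_iff\<close> records.\<close>

lemma pzero_ideal_eq: "pzero_ideal A = {f. Poly_Mapping.keys f \<subseteq> {pzero A}}"
proof -
  interpret M: cring "monoid_ring A" by (rule monoid_ring_cring)
  have "pzero_ideal A = {x \<otimes>\<^bsub>monoid_ring A\<^esub> frag_of (pzero A) | x. x \<in> carrier (monoid_ring A)}"
    unfolding pzero_ideal_def using pzero_closed
    by (subst M.cgenideal_eq_genideal [symmetric]) (auto simp: monoid_ring_simps cgenideal_def)
  moreover have "Poly_Mapping.keys (mr_mult A f (frag_of (pzero A))) \<subseteq> {pzero A}"
    if "Poly_Mapping.keys f \<subseteq> carrier A" for f
    using that by (rule keys_mr_mult [where T = "{pzero A}"]) (auto simp: pzero_absorb)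
  moreover have "mr_mult A f (frag_of (pzero A)) = f" if "Poly_Mapping.keys f \<subseteq> {pzero A}" for f
    using that by (induction f rule: frag_induction) (auto simp: pzero_absorb pzero_closed)
  moreover have "Poly_Mapping.keys f \<subseteq> carrier A" if "Poly_Mapping.keys f \<subseteq> {pzero A}" for f
    using that pzero_closed by auto
  note eq = calculation
  show ?thesis
  proof (intro equalityI subsetI)
    fix f :: "'a \<Rightarrow>\<^sub>0 int" assume "f \<in> pzero_ideal A"
    then show "f \<in> {f. Poly_Mapping.keys f \<subseteq> {pzero A}}"
      unfolding eq(1) monoid_ring_simps using eq(2) by blast
  next
    fix f :: "'a \<Rightarrow>\<^sub>0 int" assume "f \<in> {f. Poly_Mapping.keys f \<subseteq> {pzero A}}"
    then have f: "Poly_Mapping.keys f \<subseteq> {pzero A}" by simp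
    then show "f \<in> pzero_ideal A"
      unfolding eq(1) monoid_ring_simps using eq(3) [OF f] f pzero_closed by (intro CollectI exI [of _ f]) auto
  qed
qed

lemma pzero_ideal_ideal: "ideal (pzero_ideal A) (monoid_ring A)"
proof -
  interpret M: cring "monoid_ring A" by (rule monoid_ring_cring)
  show ?thesis
    unfolding pzero_ideal_def by (rule M.genideal_ideal) (auto simp: monoid_ring_simps pzero_closed)
qed

lemma Z_ring_cring: "cring (Z_ring A)"
  unfolding Z_ring_def by (rule ideal.quotient_is_cring [OF pzero_ideal_ideal monoid_ring_cring])

definition zcl :: "('a \<Rightarrow>\<^sub>0 int) \<Rightarrow> 'a zelem" where
  "zcl f = pzero_ideal A +>\<^bsub>monoid_ring A\<^esub> f"

lemma zcl_hom: "zcl \<in> ring_hom (monoid_ring A) (Z_ring A)"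
  unfolding zcl_def [abs_def] Z_ring_def by (rule ideal.rcos_ring_hom [OF pzero_ideal_ideal])

lemma Z_ring_carrier: "carrier (Z_ring A) = {zcl f | f. Poly_Mapping.keys f \<subseteq> carrier A}"
  by (auto simp: Z_ring_def FactRing_def A_RCOSETS_def' zcl_def monoid_ring_simps)

lemma Z_ring_cases:
  assumes "z \<in> carrier (Z_ring A)" obtains f where "Poly_Mapping.keys f \<subseteq> carrier A" "z = zcl f"
  using assms by (auto simp: Z_ring_carrier)

lemma zcl_closed [simp]: "Poly_Mapping.keys f \<subseteq> carrier A \<Longrightarrow> zcl f \<in> carrier (Z_ring A)"
  by (auto simp: Z_ring_carrier)

lemma zcl_mult: "\<lbrakk>Poly_Mapping.keys f \<subseteq> carrier A; Poly_Mapping.keys g \<subseteq> carrier A\<rbrakk> \<Longrightarrow>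
    zcl f \<otimes>\<^bsub>Z_ring A\<^esub> zcl g = zcl (mr_mult A f g)"
  using ring_hom_mult [OF zcl_hom, of f g] by (simp add: monoid_ring_simps)

lemma zcl_add: "\<lbrakk>Poly_Mapping.keys f \<subseteq> carrier A; Poly_Mapping.keys g \<subseteq> carrier A\<rbrakk> \<Longrightarrow>
    zcl f \<oplus>\<^bsub>Z_ring A\<^esub> zcl g = zcl (f + g)"
  using ring_hom_add [OF zcl_hom, of f g] by (simp add: monoid_ring_simps)

lemma zcl_one: "\<one>\<^bsub>Z_ring A\<^esub> = zcl (frag_of \<one>)"
  using ring_hom_one [OF zcl_hom] by (simp add: monoid_ring_simps)

lemma mr_minus:
  assumes "Poly_Mapping.keys f \<subseteq> carrier A" "Poly_Mapping.keys g \<subseteq> carrier A"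
  shows "f \<ominus>\<^bsub>monoid_ring A\<^esub> g = f - g"
proof -
  interpret M: cring "monoid_ring A" by (rule monoid_ring_cring)
  have "\<ominus>\<^bsub>monoid_ring A\<^esub> g = - g"
    by (rule M.minus_equality) (use assms in \<open>auto simp: monoid_ring_simps\<close>)
  then show ?thesis by (simp add: M.minus_eq monoid_ring_simps)
qed

lemma zcl_eq_iff:
  assumes "Poly_Mapping.keys f \<subseteq> carrier A" "Poly_Mapping.keys g \<subseteq> carrier A"
  shows "zcl f = zcl g \<longleftrightarrow> Poly_Mapping.keys (f - g) \<subseteq> {pzero A}"
proof -
  interpret M: cring "monoid_ring A" by (rule monoid_ring_cring)
  show ?thesis
    using M.quotient_eq_iff_same_a_r_cos [OF pzero_ideal_ideal, of f g] assms
    by (simp add: zcl_def mr_minus pzero_ideal_eq monoid_ring_simps)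
qed

text \<open>Read off by cancellation, since \<open>zcl 0\<close> added to itself gives
  \<open>zcl 0\<close>.\<close>

lemma zcl_zero: "\<zero>\<^bsub>Z_ring A\<^esub> = zcl 0"
proof -
  interpret M: cring "monoid_ring A" by (rule monoid_ring_cring)
  interpret Z: cring "Z_ring A" by (rule Z_ring_cring)
  have "zcl 0 \<oplus>\<^bsub>Z_ring A\<^esub> zcl 0 = zcl 0" by (simp add: zcl_add)
  then show ?thesis using Z.add.r_cancel_one [of "zcl 0" "zcl 0"] by simp
qed

lemma to_Z_zcl: "to_Z A a = zcl (frag_of a)"
  by (simp add: to_Z_def zcl_def)

lemma to_Z_hom: "to_Z A \<in> pm_hom A (mult_pmonoid (Z_ring A))"
  by (rule pm_homI) (auto simp: to_Z_zcl zcl_mult zcl_one zcl_zero zcl_eq_iff pzero_closed)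

lemmas to_Z_closed = pm_homD(1) [OF to_Z_hom, simplified]
  and to_Z_mult = pm_homD(2) [OF to_Z_hom, simplified]
  and to_Z_one = pm_homD(3) [OF to_Z_hom, simplified]
  and to_Z_zero = pm_homD(4) [OF to_Z_hom, simplified]

lemma to_Z_Units: "u \<in> Units A \<Longrightarrow> to_Z A u \<in> Units (Z_ring A)"
  using pm_hom_Units [OF pointed_monoid_axioms mult_pmonoid_pointed [OF Z_ring_cring] to_Z_hom]
  by (simp add: Units_def)

lemma Z_contract_prime:
  assumes "primeideal Q (Z_ring A)" shows "pm_prime_ideal A (Z_contract A Q)"
proof -
  interpret Q: primeideal Q "Z_ring A" by fact
  show ?thesis
    unfolding pm_prime_ideal_def pm_ideal_def
  proof (intro conjI ballI impI)
    show "Z_contract A Q \<noteq> carrier A" using Q.one_notin one_closed by (auto simp: Z_contract_def to_Z_one [symmetric])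
    fix a b assume ab: "a \<in> carrier A" "b \<in> carrier A" "a \<otimes> b \<in> Z_contract A Q"
    then show "a \<in> Z_contract A Q \<or> b \<in> Z_contract A Q"
      using Q.I_prime [of "to_Z A a" "to_Z A b"] by (auto simp: Z_contract_def to_Z_mult to_Z_closed)
  qed (auto simp: Z_contract_def pzero_closed to_Z_zero to_Z_mult to_Z_closed intro: Q.I_l_closed)
qed

end

section \<open>Functoriality of the base change\<close>

locale pm_morphism = A: pm A + B: pm B for A :: "'a pmonoid" (structure) and B :: "'b pmonoid" (structure) +
  fixes \<phi> assumes hom: "\<phi> \<in> pm_hom A B"
begin

lemma mr_map_closed: "Poly_Mapping.keys f \<subseteq> carrier A \<Longrightarrow> Poly_Mapping.keys (mr_map \<phi> f) \<subseteq> carrier B"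
  using keys_mr_map [of \<phi> f] pm_homD(1) [OF hom] by blast

lemma mr_map_mult:
  assumes "Poly_Mapping.keys f \<subseteq> carrier A" "Poly_Mapping.keys g \<subseteq> carrier A"
  shows "mr_map \<phi> (mr_mult A f g) = mr_mult B (mr_map \<phi> f) (mr_map \<phi> g)"
  using assms(1)
proof (induction f rule: frag_induction)
  case (one a)
  show ?case using assms(2)
    by (induction g rule: frag_induction) (use one in \<open>auto simp: pm_homD [OF hom]\<close>)
qed auto

text \<open>\<open>Z_map\<close> is a union over the representatives of a coset. Two representatives
  differ by a multiple of the absorbing element, which \<open>\<phi>\<close> sends to a multiple of
  the absorbing element of \<open>B\<close>, so all of them give the same coset.\<close>

lemma Z_map_zcl:
  assumes "Poly_Mapping.keys f \<subseteq> carrier A"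
  shows "Z_map B \<phi> (A.zcl f) = B.zcl (mr_map \<phi> f)"
proof -
  interpret M: cring "monoid_ring A" by (rule A.monoid_ring_cring)
  interpret I: ideal "pzero_ideal A" "monoid_ring A" by (rule A.pzero_ideal_ideal)
  have mem: "g \<in> A.zcl f \<longleftrightarrow> Poly_Mapping.keys g \<subseteq> carrier A \<and> Poly_Mapping.keys (g - f) \<subseteq> {pzero A}" for g
  proof (cases "Poly_Mapping.keys g \<subseteq> carrier A")
    case True
    then show ?thesis
      using I.a_rcos_module_minus [OF M.ring_axioms, of f g] assms
      by (simp add: A.zcl_def A.mr_minus A.pzero_ideal_eq monoid_ring_simps)
  next
    case False
    then show ?thesis using I.a_elemrcos_carrier [of f g] assms
      by (auto simp: A.zcl_def monoid_ring_simps)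
  qed
  have "B.zcl (mr_map \<phi> g) = B.zcl (mr_map \<phi> f)" if "g \<in> A.zcl f" for g
  proof -
    have g: "Poly_Mapping.keys g \<subseteq> carrier A" "Poly_Mapping.keys (g - f) \<subseteq> {pzero A}" using that mem by auto
    then have "Poly_Mapping.keys (mr_map \<phi> (g - f)) \<subseteq> {pzero B}"
      using keys_mr_map [of \<phi> "g - f"] pm_homD(4) [OF hom] by auto
    then show ?thesis using g assms by (simp add: B.zcl_eq_iff mr_map_closed)
  qed
  moreover have "f \<in> A.zcl f" using assms mem by auto
  ultimately show ?thesis
    unfolding Z_map_def B.zcl_def [symmetric] mr_map_def [symmetric] by blast
qed

lemma Z_map_hom: "Z_map B \<phi> \<in> ring_hom (Z_ring A) (Z_ring B)"
proof (rule ring_hom_memI)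
  fix z w assume "z \<in> carrier (Z_ring A)" "w \<in> carrier (Z_ring A)"
  then obtain f g where *: "Poly_Mapping.keys f \<subseteq> carrier A" "z = A.zcl f"
    "Poly_Mapping.keys g \<subseteq> carrier A" "w = A.zcl g" by (elim A.Z_ring_cases)
  have m: "Poly_Mapping.keys (mr_mult A f g) \<subseteq> carrier A"
    using * by (intro keys_mr_mult [where S = "carrier A" and T = "carrier A"]) auto
  have a: "Poly_Mapping.keys (f + g) \<subseteq> carrier A" using * keys_add [of f g] by blast
  show "Z_map B \<phi> (z \<otimes>\<^bsub>Z_ring A\<^esub> w) = Z_map B \<phi> z \<otimes>\<^bsub>Z_ring B\<^esub> Z_map B \<phi> w"
    using * m by (simp add: A.zcl_mult B.zcl_mult Z_map_zcl mr_map_closed mr_map_mult)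
  show "Z_map B \<phi> (z \<oplus>\<^bsub>Z_ring A\<^esub> w) = Z_map B \<phi> z \<oplus>\<^bsub>Z_ring B\<^esub> Z_map B \<phi> w"
    using * a by (simp add: A.zcl_add B.zcl_add Z_map_zcl mr_map_closed)
qed (auto elim!: A.Z_ring_cases simp: Z_map_zcl A.zcl_one B.zcl_one mr_map_closed pm_homD [OF hom])

lemma Z_map_to_Z: "a \<in> carrier A \<Longrightarrow> Z_map B \<phi> (to_Z A a) = to_Z B (\<phi> a)"
  by (simp add: A.to_Z_zcl B.to_Z_zcl Z_map_zcl)

lemma Z_map_closed: "z \<in> carrier (Z_ring A) \<Longrightarrow> Z_map B \<phi> z \<in> carrier (Z_ring B)"
  using ring_hom_closed [OF Z_map_hom] .

text \<open>Each single coincidence \<open>\<phi> a = \<phi> b\<close> is realized in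
  \<open>A\<close> by some denominator; the product of finitely many such denominators realizes all
  of them at once.\<close>

lemma common_equalizer:
  assumes loc: "localization A B \<phi>" and "finite K" "K \<subseteq> carrier A \<times> carrier A"
  shows "\<exists>s\<in>carrier A. \<phi> s \<in> Units B \<and> (\<forall>(a, b)\<in>K. \<phi> a = \<phi> b \<longrightarrow> s \<otimes> a = s \<otimes> b)"
  using assms(2,3)
proof (induction K)
  case empty
  then show ?case using pm_homD(3) [OF hom] by (auto intro!: bexI [of _ "\<one>"])
next
  case (insert p K)
  obtain a b where p: "p = (a, b)" by (cases p)
  obtain s where s: "s \<in> carrier A" "\<phi> s \<in> Units B" "\<And>a b. (a, b) \<in> K \<Longrightarrow> \<phi> a = \<phi> b \<Longrightarrow> s \<otimes> a = s \<otimes> b"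
    using insert.IH insert.prems by blast
  obtain t where t: "t \<in> carrier A" "\<phi> t \<in> Units B" "\<phi> a = \<phi> b \<longrightarrow> t \<otimes> a = t \<otimes> b"
  proof (cases "\<phi> a = \<phi> b")
    case True
    then show ?thesis using localization_eq [OF loc, of a b] insert.prems p that by auto
  next
    case False
    then show ?thesis using that [of s] s by auto
  qed
  have "s \<otimes> t \<otimes> c = s \<otimes> t \<otimes> d" if cd: "(c, d) \<in> insert p K" "\<phi> c = \<phi> d" for c d
  proof (cases "(c, d) \<in> K")
    case True
    then have *: "s \<otimes> c = s \<otimes> d" "c \<in> carrier A" "d \<in> carrier A" using s cd insert.prems by auto
    have "s \<otimes> t \<otimes> e = t \<otimes> (s \<otimes> e)" if "e \<in> carrier A" for e using that s(1) t(1) by (simp add: A.m_ac)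
    then show ?thesis using * by simp
  next
    case False
    then have *: "t \<otimes> c = t \<otimes> d" "c \<in> carrier A" "d \<in> carrier A" using t cd insert.prems p by auto
    then show ?thesis using s(1) t(1) by (simp add: A.m_assoc)
  qed
  then show ?case using s t by (intro bexI [of _ "s \<otimes> t"]) (auto simp: pm_homD [OF hom])
qed

lemma mr_map_clear_denominators:
  assumes loc: "localization A B \<phi>" and "Poly_Mapping.keys g \<subseteq> carrier B"
  shows "\<exists>s\<in>carrier A. \<phi> s \<in> Units B \<and> (\<exists>f. Poly_Mapping.keys f \<subseteq> carrier A \<and>
    mr_map \<phi> f = mr_mult B g (frag_of (\<phi> s)))"
proof -
  note [simp] = pm_homD [OF hom]
  \<comment> \<open>The support condition is part of the claim because the difference step of
    \<open>frag_induction\<close> supplies nothing beyond the claim for the two parts.\<close>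
  have "Poly_Mapping.keys g \<subseteq> carrier B \<and> (\<exists>s\<in>carrier A. \<phi> s \<in> Units B \<and> (\<exists>f. Poly_Mapping.keys f \<subseteq> carrier A \<and>
    mr_map \<phi> f = mr_mult B g (frag_of (\<phi> s))))"
    using assms(2)
  proof (induction g rule: frag_induction)
    case zero
    show ?case by (auto intro!: bexI [of _ "\<one>"] exI [of _ 0])
  next
    case (one b)
    obtain a s where "a \<in> carrier A" "s \<in> carrier A" "\<phi> s \<in> Units B" "b \<otimes>\<^bsub>B\<^esub> \<phi> s = \<phi> a"
      by (rule localization_surj [OF loc one])
    then show ?case using one by (intro conjI bexI [of _ s] exI [of _ "frag_of a"]) auto
  next
    case (diff g h)
    then obtain s t f e where *: "s \<in> carrier A" "\<phi> s \<in> Units B" "Poly_Mapping.keys f \<subseteq> carrier A"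
      "mr_map \<phi> f = mr_mult B g (frag_of (\<phi> s))" "t \<in> carrier A" "\<phi> t \<in> Units B" "Poly_Mapping.keys e \<subseteq> carrier A"
      "mr_map \<phi> e = mr_mult B h (frag_of (\<phi> t))" and gh: "Poly_Mapping.keys g \<subseteq> carrier B" "Poly_Mapping.keys h \<subseteq> carrier B"
      by blast
    let ?d = "mr_mult A f (frag_of t) - mr_mult A e (frag_of s)"
    have "mr_map \<phi> ?d = mr_mult B (g - h) (frag_of (\<phi> (s \<otimes> t)))"
      using * gh by (simp add: mr_map_mult B.mr_assoc B.m_comm)
    moreover have "Poly_Mapping.keys ?d \<subseteq> carrier A"
      using * by (intro keys_diff_subset keys_mr_mult [where S = "carrier A" and T = "carrier A"]) auto
    moreover have "Poly_Mapping.keys (g - h) \<subseteq> carrier B" using gh by (rule keys_diff_subset)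
    ultimately show ?case using * by (intro conjI bexI [of _ "s \<otimes> t"] exI [of _ ?d]) auto
  qed
  then show ?thesis by blast
qed

text \<open>Choose \<open>s\<close> so that terms of \<open>f\<close> with the same image become
  equal after multiplication by \<open>s\<close>. Then \<open>s\<close> times \<open>f\<close>
  depends only on the image of \<open>f\<close>: it is the push forward of
  \<open>mr_map \<phi> f\<close> along a map \<open>\<theta>\<close>. Hence support on
  \<open>pzero B\<close> forces support on \<open>\<theta> (pzero B)\<close>, which is
  \<open>pzero A\<close>.\<close>

lemma mr_map_kernel:
  assumes loc: "localization A B \<phi>" and f: "Poly_Mapping.keys f \<subseteq> carrier A"
    and "Poly_Mapping.keys (mr_map \<phi> f) \<subseteq> {pzero B}"
  shows "\<exists>s\<in>carrier A. \<phi> s \<in> Units B \<and> Poly_Mapping.keys (mr_mult A (frag_of s) f) \<subseteq> {pzero A}"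
proof -
  \<comment> \<open>\<open>pzero A\<close> joins the terms so that a term mapping to zero is itself
    made zero by \<open>s\<close>, and so that \<open>\<theta>\<close> is known at
    \<open>pzero B\<close>.\<close>
  let ?K = "insert (pzero A) (Poly_Mapping.keys f)"
  have K: "?K \<subseteq> carrier A" using f A.pzero_closed by auto
  have "\<exists>s\<in>carrier A. \<phi> s \<in> Units B \<and> (\<forall>(a, b)\<in>?K \<times> ?K. \<phi> a = \<phi> b \<longrightarrow> s \<otimes> a = s \<otimes> b)"
    using K by (intro common_equalizer [OF loc]) (simp, blast)
  then obtain s where s: "s \<in> carrier A" "\<phi> s \<in> Units B"
    and "\<forall>(a, b)\<in>?K \<times> ?K. \<phi> a = \<phi> b \<longrightarrow> s \<otimes> a = s \<otimes> b" by blast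
  then have seq: "s \<otimes> a = s \<otimes> b" if "a \<in> ?K" "b \<in> ?K" "\<phi> a = \<phi> b" for a b
    using that by blast
  \<comment> \<open>Lift an element of \<open>B\<close> to a member of \<open>?K\<close> and
    multiply by \<open>s\<close>; by \<open>seq\<close> the choice of the lift does not
    matter.\<close>
  define \<theta> where "\<theta> c = s \<otimes> (SOME a. a \<in> ?K \<and> \<phi> a = c)" for c
  have \<theta>: "\<theta> (\<phi> a) = s \<otimes> a" if "a \<in> ?K" for a
  proof -
    have "(SOME b. b \<in> ?K \<and> \<phi> b = \<phi> a) \<in> ?K \<and> \<phi> (SOME b. b \<in> ?K \<and> \<phi> b = \<phi> a) = \<phi> a"
      by (rule someI [of _ a]) (use that in blast)
    then show ?thesis unfolding \<theta>_def using seq that by blast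
  qed
  have "mr_mult A (frag_of s) f = frag_extend (\<lambda>a. frag_of (s \<otimes> a)) f" by (simp add: mr_mult_def)
  also have "\<dots> = frag_extend ((frag_of \<circ> \<theta>) \<circ> \<phi>) f"
    by (rule frag_extend_eq) (simp add: \<theta>)
  also have "\<dots> = frag_extend (frag_of \<circ> \<theta>) (mr_map \<phi> f)"
    unfolding mr_map_def using frag_extend_compose [of "frag_of \<circ> \<theta>" \<phi> f] by (simp add: comp_def)
  also have "Poly_Mapping.keys \<dots> \<subseteq> {\<theta> (pzero B)}"
    using keys_frag_extend [of "frag_of \<circ> \<theta>" "mr_map \<phi> f"] assms(3) by auto
  finally show ?thesis
    using s \<theta> [of "pzero A"] by (auto simp: pm_homD [OF hom] A.pzero_absorb)
qed

text \<open>Base change to the integers preserves localizations. The two further statements record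
  that denominators and multipliers can be taken in the monoid \<open>A\<close> itself, which the
  localization property of the rings would forget.\<close>

lemma Z_map_localization:
  assumes loc: "localization A B \<phi>"
  shows "localization (Z_ring A) (Z_ring B) (Z_map B \<phi>)"
    and "z \<in> carrier (Z_ring B) \<Longrightarrow> \<exists>s\<in>carrier A. \<phi> s \<in> Units B \<and>
      (\<exists>w\<in>carrier (Z_ring A). z \<otimes>\<^bsub>Z_ring B\<^esub> to_Z B (\<phi> s) = Z_map B \<phi> w)"
    and "\<lbrakk>x \<in> carrier (Z_ring A); y \<in> carrier (Z_ring A); Z_map B \<phi> x = Z_map B \<phi> y\<rbrakk> \<Longrightarrow>
      \<exists>s\<in>carrier A. \<phi> s \<in> Units B \<and> to_Z A s \<otimes>\<^bsub>Z_ring A\<^esub> x = to_Z A s \<otimes>\<^bsub>Z_ring A\<^esub> y"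
proof -
  note [simp] = pm_homD [OF hom]
  have surj: "\<exists>s\<in>carrier A. \<phi> s \<in> Units B \<and>
      (\<exists>w\<in>carrier (Z_ring A). z \<otimes>\<^bsub>Z_ring B\<^esub> to_Z B (\<phi> s) = Z_map B \<phi> w)"
    if z: "z \<in> carrier (Z_ring B)" for z
  proof -
    obtain g where g: "Poly_Mapping.keys g \<subseteq> carrier B" "z = B.zcl g" by (rule B.Z_ring_cases [OF z])
    obtain s f where "s \<in> carrier A" "\<phi> s \<in> Units B" "Poly_Mapping.keys f \<subseteq> carrier A"
      "mr_map \<phi> f = mr_mult B g (frag_of (\<phi> s))"
      using mr_map_clear_denominators [OF loc g(1)] by blast
    then show ?thesis using g
      by (intro bexI [of _ s] conjI bexI [of _ "A.zcl f"]) (auto simp: B.to_Z_zcl B.zcl_mult Z_map_zcl)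
  qed
  then show "z \<in> carrier (Z_ring B) \<Longrightarrow> \<exists>s\<in>carrier A. \<phi> s \<in> Units B \<and>
      (\<exists>w\<in>carrier (Z_ring A). z \<otimes>\<^bsub>Z_ring B\<^esub> to_Z B (\<phi> s) = Z_map B \<phi> w)" .
  have kernel: "\<exists>s\<in>carrier A. \<phi> s \<in> Units B \<and> to_Z A s \<otimes>\<^bsub>Z_ring A\<^esub> z = to_Z A s \<otimes>\<^bsub>Z_ring A\<^esub> w"
    if zw: "z \<in> carrier (Z_ring A)" "w \<in> carrier (Z_ring A)" "Z_map B \<phi> z = Z_map B \<phi> w" for z w
  proof -
    obtain f g where fg: "Poly_Mapping.keys f \<subseteq> carrier A" "z = A.zcl f" "Poly_Mapping.keys g \<subseteq> carrier A" "w = A.zcl g"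
      using zw by (auto elim!: A.Z_ring_cases)
    then have "Poly_Mapping.keys (mr_map \<phi> (f - g)) \<subseteq> {pzero B}"
      using zw by (simp add: Z_map_zcl B.zcl_eq_iff mr_map_closed)
    then obtain s where s: "s \<in> carrier A" "\<phi> s \<in> Units B"
      "Poly_Mapping.keys (mr_mult A (frag_of s) (f - g)) \<subseteq> {pzero A}"
      using mr_map_kernel [OF loc keys_diff_subset [OF fg(1,3)]] by blast
    have "Poly_Mapping.keys (mr_mult A (frag_of s) f) \<subseteq> carrier A" "Poly_Mapping.keys (mr_mult A (frag_of s) g) \<subseteq> carrier A"
      using s fg keys_mr_mult [of "frag_of s" "carrier A" _ "carrier A" A "carrier A"] by simp_all
    then have "to_Z A s \<otimes>\<^bsub>Z_ring A\<^esub> z = to_Z A s \<otimes>\<^bsub>Z_ring A\<^esub> w"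
      using s fg by (simp add: A.to_Z_zcl A.zcl_mult A.zcl_eq_iff)
    then show ?thesis using s(1,2) by blast
  qed
  then show "\<lbrakk>x \<in> carrier (Z_ring A); y \<in> carrier (Z_ring A); Z_map B \<phi> x = Z_map B \<phi> y\<rbrakk> \<Longrightarrow>
      \<exists>s\<in>carrier A. \<phi> s \<in> Units B \<and> to_Z A s \<otimes>\<^bsub>Z_ring A\<^esub> x = to_Z A s \<otimes>\<^bsub>Z_ring A\<^esub> y" .
  show "localization (Z_ring A) (Z_ring B) (Z_map B \<phi>)"
    unfolding localization_def
  proof (intro conjI ballI impI)
    show "Z_map B \<phi> \<in> hom (Z_ring A) (Z_ring B)" using Z_map_hom by (auto simp: ring_hom_def hom_def)
  next
    fix z assume "z \<in> carrier (Z_ring B)"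
    then obtain s w where *: "s \<in> carrier A" "\<phi> s \<in> Units B" "w \<in> carrier (Z_ring A)"
      "z \<otimes>\<^bsub>Z_ring B\<^esub> to_Z B (\<phi> s) = Z_map B \<phi> w" using surj by blast
    then have "to_Z A s \<in> carrier (Z_ring A)" "Z_map B \<phi> (to_Z A s) \<in> Units (Z_ring B)"
      "z \<otimes>\<^bsub>Z_ring B\<^esub> Z_map B \<phi> (to_Z A s) = Z_map B \<phi> w"
      by (simp_all add: Z_map_to_Z B.to_Z_Units A.to_Z_closed)
    then show "\<exists>a\<in>carrier (Z_ring A). \<exists>s\<in>carrier (Z_ring A). Z_map B \<phi> s \<in> Units (Z_ring B) \<and>
        z \<otimes>\<^bsub>Z_ring B\<^esub> Z_map B \<phi> s = Z_map B \<phi> a"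
      using *(3) by blast
  next
    fix z w assume "z \<in> carrier (Z_ring A)" "w \<in> carrier (Z_ring A)" "Z_map B \<phi> z = Z_map B \<phi> w"
    then obtain s where s: "s \<in> carrier A" "\<phi> s \<in> Units B"
      "to_Z A s \<otimes>\<^bsub>Z_ring A\<^esub> z = to_Z A s \<otimes>\<^bsub>Z_ring A\<^esub> w" using kernel by blast
    then show "\<exists>s\<in>carrier (Z_ring A). Z_map B \<phi> s \<in> Units (Z_ring B) \<and> s \<otimes>\<^bsub>Z_ring A\<^esub> z = s \<otimes>\<^bsub>Z_ring A\<^esub> w"
      using s by (intro bexI [of _ "to_Z A s"]) (auto simp: Z_map_to_Z B.to_Z_Units A.to_Z_closed)
  qed
qed

text \<open>To be liftable, \<open>Q\<close> must avoid every element of the base change that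
  becomes invertible, but the hypothesis speaks only of elements of \<open>A\<close>. An inverse of
  the image of \<open>z\<close> has a denominator \<open>s\<close> from \<open>A\<close>, so a
  multiple of \<open>z\<close> equals \<open>to_Z A s\<close> up to a factor
  \<open>to_Z A t\<close>; with \<open>z\<close> in \<open>Q\<close>, one of these two elements
  would be in \<open>Q\<close>.\<close>

lemma Z_map_lift_prime:
  assumes loc: "localization A B \<phi>" and Q: "primeideal Q (Z_ring A)"
    and disj: "\<And>a. \<lbrakk>a \<in> carrier A; \<phi> a \<in> Units B\<rbrakk> \<Longrightarrow> to_Z A a \<notin> Q"
  obtains P where "primeideal P (Z_ring B)" "Spec_map (Z_ring A) (Z_map B \<phi>) P = Q"
proof -
  interpret ZA: cring "Z_ring A" by (rule A.Z_ring_cring)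
  interpret ZB: cring "Z_ring B" by (rule B.Z_ring_cring)
  interpret Q: primeideal Q "Z_ring A" by (rule Q)
  have "Z_map B \<phi> z \<notin> Units (Z_ring B)" if z: "z \<in> Q" for z
  proof
    assume "Z_map B \<phi> z \<in> Units (Z_ring B)"
    then obtain w where w: "w \<in> carrier (Z_ring B)" "Z_map B \<phi> z \<otimes>\<^bsub>Z_ring B\<^esub> w = \<one>\<^bsub>Z_ring B\<^esub>"
      by (auto simp: Units_def)
    obtain s r where s: "s \<in> carrier A" "\<phi> s \<in> Units B" "r \<in> carrier (Z_ring A)"
      "w \<otimes>\<^bsub>Z_ring B\<^esub> to_Z B (\<phi> s) = Z_map B \<phi> r"
      using Z_map_localization(2) [OF loc w(1)] by blast
    have zc: "z \<in> carrier (Z_ring A)" using Q.Icarr z .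
    have sc: "to_Z B (\<phi> s) \<in> carrier (Z_ring B)" using pm_homD(1) [OF hom s(1)] by (rule B.to_Z_closed)
    have "Z_map B \<phi> (z \<otimes>\<^bsub>Z_ring A\<^esub> r) = (Z_map B \<phi> z \<otimes>\<^bsub>Z_ring B\<^esub> w) \<otimes>\<^bsub>Z_ring B\<^esub> to_Z B (\<phi> s)"
      using zc s(3) w(1) sc Z_map_closed by (simp add: ring_hom_mult [OF Z_map_hom] ZB.m_assoc s(4))
    also have "\<dots> = Z_map B \<phi> (to_Z A s)" using w sc s(1) by (simp add: Z_map_to_Z)
    finally obtain t where t: "t \<in> carrier A" "\<phi> t \<in> Units B"
      "to_Z A t \<otimes>\<^bsub>Z_ring A\<^esub> (z \<otimes>\<^bsub>Z_ring A\<^esub> r) = to_Z A t \<otimes>\<^bsub>Z_ring A\<^esub> to_Z A s"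
      using Z_map_localization(3) [OF loc, of "z \<otimes>\<^bsub>Z_ring A\<^esub> r" "to_Z A s"] zc s(1,3) A.to_Z_closed by auto
    have "to_Z A t \<otimes>\<^bsub>Z_ring A\<^esub> (z \<otimes>\<^bsub>Z_ring A\<^esub> r) \<in> Q"
      using z s(3) t(1) A.to_Z_closed by (intro Q.I_l_closed Q.I_r_closed)
    then have "to_Z A t \<in> Q \<or> to_Z A s \<in> Q"
      using t s(1) A.to_Z_closed by (intro Q.I_prime) auto
    then show False using disj t s by blast
  qed
  then show thesis
    using Spec_map_localization_surj [OF A.Z_ring_cring B.Z_ring_cring Z_map_hom Z_map_localization(1) [OF loc] Q] that
    by blast
qed

end

lemma Z_map_comp:
  assumes "pm_morphism A B \<phi>" "pm_morphism B C \<psi>" "z \<in> carrier (Z_ring A)"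
    and "\<And>a. a \<in> carrier A \<Longrightarrow> \<psi> (\<phi> a) = \<chi> a"
  shows "Z_map C \<psi> (Z_map B \<phi> z) = Z_map C \<chi> z"
proof -
  interpret f: pm_morphism A B \<phi> by fact
  interpret g: pm_morphism B C \<psi> by fact
  have "\<chi> \<in> pm_hom A C"
    using pm_homD [OF f.hom] pm_homD [OF g.hom] assms(4)
    by (intro pm_homI) (auto simp flip: assms(4) simp: f.A.pzero_closed)
  then interpret h: pm_morphism A C \<chi> by unfold_locales
  obtain f where f: "Poly_Mapping.keys f \<subseteq> carrier A" "z = f.A.zcl f" using assms(3) by (rule f.A.Z_ring_cases)
  have "mr_map \<psi> (mr_map \<phi> f) = mr_map \<chi> f"
    using f(1) by (induction f rule: frag_induction) (auto simp: assms(4))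
  then show ?thesis using f by (simp add: f.Z_map_zcl g.Z_map_zcl h.Z_map_zcl f.mr_map_closed)
qed

section \<open>Residue fields of localizations\<close>

lemma ring_iso_Units:
  assumes "cring R" "cring S" and i: "i \<in> ring_iso R S" and x: "x \<in> carrier R"
  shows "i x \<in> Units S \<longleftrightarrow> x \<in> Units R"
proof
  interpret R: cring R by fact
  note iD = ring_iso_memE [OF i]
  show "i x \<in> Units S" if "x \<in> Units R"
    using hom_Units [of R S i x] assms(1,2) iD(1,2,4) \<open>x \<in> Units R\<close> by (auto simp: hom_def cring_def)
  assume "i x \<in> Units S"
  then obtain y where y: "y \<in> carrier S" "y \<otimes>\<^bsub>S\<^esub> i x = \<one>\<^bsub>S\<^esub>" by (auto simp: Units_def)
  obtain z where z: "z \<in> carrier R" "y = i z" using y(1) iD(5) by (auto simp: bij_betw_def)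
  have "i (z \<otimes>\<^bsub>R\<^esub> x) = i \<one>\<^bsub>R\<^esub>" using y(2) z x iD(2,4) by simp
  then have "z \<otimes>\<^bsub>R\<^esub> x = \<one>\<^bsub>R\<^esub>"
    using iD(5) z(1) x by (auto simp: bij_betw_def dest: inj_onD)
  then show "x \<in> Units R" using z(1) x R.m_comm [OF x z(1)] unfolding Units_def by auto
qed

text \<open>\<open>S\<close> is any structure isomorphic to the local ring at \<open>Q\<close>: once
  the local ring itself, once the stalk of X_Z, whose ring axioms are obtained from the isomorphism
  and not from the sheaf.\<close>

lemma localization_residue_map:
  assumes "ring_prime Q R" and i: "i \<in> ring_iso (ring_loc R (carrier R - Q)) S"
    and z: "i \<zero>\<^bsub>ring_loc R (carrier R - Q)\<^esub> = \<zero>\<^bsub>S\<^esub>"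
  defines "h \<equiv> \<lambda>a. (carrier S - Units S) +>\<^bsub>S\<^esub> i (fraction R (carrier R - Q) a \<one>\<^bsub>R\<^esub>)"
  shows "field (S Quot (carrier S - Units S))"
    and "h \<in> pm_hom (mult_pmonoid R) (mult_pmonoid (S Quot (carrier S - Units S)))"
    and "\<lbrakk>a \<in> carrier R; b \<in> carrier R\<rbrakk> \<Longrightarrow> h a = h b \<longleftrightarrow> a \<ominus>\<^bsub>R\<^esub> b \<in> Q"
proof -
  interpret Q: ring_prime Q R by fact
  interpret F: ring_mult_set R "carrier R - Q" by (rule Q.prime_complement)
  let ?L = "ring_loc R (carrier R - Q)" and ?fr = "fraction R (carrier R - Q)"
  interpret L: cring ?L by (rule Q.Loc_cring)
  \<comment> \<open>\<open>ring_iso\<close> says nothing about zero. Transport of the ring axioms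
    yields a ring whose zero is the image of zero, which the hypothesis \<open>z\<close> identifies
    with the zero of \<open>S\<close>.\<close>
  have "S\<lparr>zero := i \<zero>\<^bsub>?L\<^esub>\<rparr> = S" unfolding z by simp
  then interpret S: cring S using L.ring_iso_imp_img_cring [OF i] by simp
  note iD = ring_iso_memE [OF i]
  interpret i: ring_hom_cring ?L S i
    by unfold_locales (use i in \<open>simp add: ring_iso_def\<close>)
  have img: "carrier S = i ` carrier ?L" using iD(5) by (auto simp: bij_betw_def)
  note U = ring_iso_Units [OF L.is_cring S.is_cring i]
  have "\<one>\<^bsub>S\<^esub> \<noteq> \<zero>\<^bsub>S\<^esub>"
    using Q.Loc_one_not_zero inj_onD [OF bij_betw_imp_inj_on [OF iD(5)], of "\<one>\<^bsub>?L\<^esub>" "\<zero>\<^bsub>?L\<^esub>"] iD(4) z by auto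
  moreover have "x \<oplus>\<^bsub>S\<^esub> y \<notin> Units S" if "x \<in> carrier S - Units S" "y \<in> carrier S - Units S" for x y
  proof -
    obtain x' y' where xy: "x' \<in> carrier ?L" "y' \<in> carrier ?L" "x = i x'" "y = i y'"
      using \<open>x \<in> carrier S - Units S\<close> \<open>y \<in> carrier S - Units S\<close> img by auto
    then have "x' \<oplus>\<^bsub>?L\<^esub> y' \<in> carrier ?L - Units ?L"
      using that by (intro Q.Loc_nonunit_add) (simp_all add: U)
    then show ?thesis using U [of "x' \<oplus>\<^bsub>?L\<^esub> y'"] iD(3) [OF xy(1,2)] xy by simp
  qed
  ultimately interpret M: maximalideal "carrier S - Units S" S by (rule S.nonunits_maximalideal)
  show "field (S Quot (carrier S - Units S))" by (rule M.quotient_is_field [OF S.is_cring])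
  have frL: "?fr a \<one>\<^bsub>R\<^esub> \<in> carrier ?L" if "a \<in> carrier R" for a
    using that F.S_one by simp
  then have frh: "i (?fr a \<one>\<^bsub>R\<^esub>) \<in> carrier S" if "a \<in> carrier R" for a
    using that by simp
  have frm: "i (?fr (a \<otimes>\<^bsub>R\<^esub> b) \<one>\<^bsub>R\<^esub>) = i (?fr a \<one>\<^bsub>R\<^esub>) \<otimes>\<^bsub>S\<^esub> i (?fr b \<one>\<^bsub>R\<^esub>)"
    if "a \<in> carrier R" "b \<in> carrier R" for a b
  proof -
    have eq: "?fr (a \<otimes>\<^bsub>R\<^esub> b) \<one>\<^bsub>R\<^esub> = ?fr a \<one>\<^bsub>R\<^esub> \<otimes>\<^bsub>?L\<^esub> ?fr b \<one>\<^bsub>R\<^esub>"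
      using that F.S_one F.fr_mult [of a b "\<one>\<^bsub>R\<^esub>" "\<one>\<^bsub>R\<^esub>"] by simp
    show ?thesis unfolding eq by (rule iD(2) [OF frL frL, OF that])
  qed
  show "h \<in> pm_hom (mult_pmonoid R) (mult_pmonoid (S Quot (carrier S - Units S)))"
  proof (rule pm_homI; unfold mult_pmonoid_simps h_def)
    show "(carrier S - Units S) +>\<^bsub>S\<^esub> i (?fr \<one>\<^bsub>R\<^esub> \<one>\<^bsub>R\<^esub>) = \<one>\<^bsub>S Quot (carrier S - Units S)\<^esub>"
      using ring_hom_one [OF M.rcos_ring_hom] F.ring_loc_one iD(4) by simp
    show "(carrier S - Units S) +>\<^bsub>S\<^esub> i (?fr \<zero>\<^bsub>R\<^esub> \<one>\<^bsub>R\<^esub>) = \<zero>\<^bsub>S Quot (carrier S - Units S)\<^esub>"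
      using ring_hom_zero [OF M.rcos_ring_hom S.ring_axioms M.quotient_is_ring] F.ring_loc_zero z by simp
  qed (use ring_hom_closed [OF M.rcos_ring_hom] ring_hom_mult [OF M.rcos_ring_hom] in \<open>simp_all add: frh frm\<close>)
  show "h a = h b \<longleftrightarrow> a \<ominus>\<^bsub>R\<^esub> b \<in> Q" if ab: "a \<in> carrier R" "b \<in> carrier R"
  proof -
    have "h a = h b \<longleftrightarrow> i (?fr a \<one>\<^bsub>R\<^esub>) \<ominus>\<^bsub>S\<^esub> i (?fr b \<one>\<^bsub>R\<^esub>) \<in> carrier S - Units S"
      unfolding h_def by (rule S.quotient_eq_iff_same_a_r_cos [OF M.is_ideal frh frh, OF ab, symmetric])
    also have "i (?fr a \<one>\<^bsub>R\<^esub>) \<ominus>\<^bsub>S\<^esub> i (?fr b \<one>\<^bsub>R\<^esub>) = i (?fr a \<one>\<^bsub>R\<^esub> \<ominus>\<^bsub>?L\<^esub> ?fr b \<one>\<^bsub>R\<^esub>)"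
      using frL [OF ab(1)] frL [OF ab(2)] by (simp add: L.minus_eq S.minus_eq)
    also have "\<dots> \<in> carrier S - Units S \<longleftrightarrow> ?fr a \<one>\<^bsub>R\<^esub> \<ominus>\<^bsub>?L\<^esub> ?fr b \<one>\<^bsub>R\<^esub> \<in> carrier ?L - Units ?L"
      using U [OF L.minus_closed [OF frL frL], OF ab] L.minus_closed [OF frL frL, OF ab] by simp
    also have "\<dots> \<longleftrightarrow> a \<ominus>\<^bsub>R\<^esub> b \<in> Q" by (rule Q.Loc_diff_nonunit_iff [OF ab])
    finally show ?thesis .
  qed
qed

section \<open>The strong prime congruence attached to a prime of the base change\<close>

context pm
begin

lemma gamma_affine_iff:
  assumes "primeideal Q (Z_ring A)"
  shows "(a, b) \<in> gamma_affine A Q \<longleftrightarrow>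
    a \<in> carrier A \<and> b \<in> carrier A \<and> to_Z A a \<ominus>\<^bsub>Z_ring A\<^esub> to_Z A b \<in> Q"
proof -
  interpret Q: primeideal Q "Z_ring A" by fact
  show ?thesis
    using Q.quotient_eq_iff_same_a_r_cos [OF Q.is_ideal, of "to_Z A a" "to_Z A b"] to_Z_closed
    by (auto simp: gamma_affine_def)
qed

text \<open>The quotient embeds into the residue field at \<open>Q\<close>, since two elements of
  \<open>A\<close> have the same residue exactly when their difference lies in
  \<open>Q\<close>.\<close>

lemma gamma_affine_strong_prime:
  assumes "primeideal Q (Z_ring A)" shows "strong_prime_congruence A (gamma_affine A Q)"
proof -
  interpret Z: cring "Z_ring A" by (rule Z_ring_cring)
  have Q: "ring_prime Q (Z_ring A)" using assms by (rule ring_prime.intro)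
  let ?L = "ring_loc (Z_ring A) (carrier (Z_ring A) - Q)"
  let ?K = "?L Quot (carrier ?L - Units ?L)"
  define h where "h a = (carrier ?L - Units ?L) +>\<^bsub>?L\<^esub> fraction (Z_ring A) (carrier (Z_ring A) - Q) a \<one>\<^bsub>Z_ring A\<^esub>" for a
  \<comment> \<open>Here the local ring itself is the isomorphic copy, through the identity.\<close>
  note f = localization_residue_map [OF Q ring_iso_set_refl id_apply, unfolded id_apply, folded h_def]
  interpret K: field ?K by (rule f(1))
  have K: "pointed_monoid (mult_pmonoid ?K)" by (rule mult_pmonoid_pointed [OF K.is_cring])
  have hom: "h \<circ> to_Z A \<in> pm_hom A (mult_pmonoid ?K)"
    using pm_homD [OF f(2)] by (intro pm_homI) (auto simp: to_Z_closed to_Z_mult to_Z_one to_Z_zero)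
  have "a \<in> carrier A \<and> b \<in> carrier A \<and> (h \<circ> to_Z A) a = (h \<circ> to_Z A) b \<longleftrightarrow> (a, b) \<in> gamma_affine A Q" for a b
    by (simp add: gamma_affine_iff [OF assms] f(3) to_Z_closed cong: conj_cong)
  then have c: "gamma_affine A Q = {(a, b). a \<in> carrier A \<and> b \<in> carrier A \<and> (h \<circ> to_Z A) a = (h \<circ> to_Z A) b}"
    by (simp only:) simp
  note q = pm_quot_induced [OF pointed_monoid_axioms K hom c]
  from q(4) obtain k where "k \<in> pm_hom (pm_quot A (gamma_affine A Q)) (mult_pmonoid ?K)"
    "inj_on k (carrier (pm_quot A (gamma_affine A Q)))" by blast
  then have "pointed_domain (pm_quot A (gamma_affine A Q))"
    by (rule pointed_domainI [OF q(2) f(1)])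
  with q(1) show ?thesis by (simp add: strong_prime_congruence_def)
qed

text \<open>The affine form of the identity between the projection from X_Z and its factorization
  through \<open>SCong\<close>.\<close>

lemma null_ideal_gamma_affine:
  assumes "primeideal Q (Z_ring A)" shows "null_ideal A (gamma_affine A Q) = Z_contract A Q"
proof -
  interpret Z: cring "Z_ring A" by (rule Z_ring_cring)
  show ?thesis
    by (auto simp: null_ideal_def Z_contract_def gamma_affine_iff [OF assms] pzero_closed to_Z_zero
        to_Z_closed Z.minus_eq)
qed

end

section \<open>Stalks of a sheaf of pointed monoids\<close>

text \<open>Transports the localization property, together with invertibility, back along a
  bijective homomorphism. In the application \<open>k\<close> is the germ map at the closed point of
  an affine open.\<close>

lemma localization_comp_iso:
  assumes loc: "localization A C \<psi>" and "comm_monoid B" "comm_monoid C"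
    and \<phi>: "\<phi> \<in> hom A B" and k: "k \<in> hom B C" "k \<one>\<^bsub>B\<^esub> = \<one>\<^bsub>C\<^esub>" "bij_betw k (carrier B) (carrier C)"
    and comp: "\<And>a. a \<in> carrier A \<Longrightarrow> k (\<phi> a) = \<psi> a"
  shows "localization A B \<phi>" "b \<in> carrier B \<Longrightarrow> b \<in> Units B \<longleftrightarrow> k b \<in> Units C"
proof -
  interpret B: comm_monoid B by fact
  interpret C: comm_monoid C by fact
  have inj: "x = y" if "x \<in> carrier B" "y \<in> carrier B" "k x = k y" for x y
    using that k(3) by (auto simp: bij_betw_def inj_on_def)
  have \<phi>c: "\<phi> a \<in> carrier B" if "a \<in> carrier A" for a using \<phi> that by (auto simp: hom_def)
  have U: "b \<in> Units B \<longleftrightarrow> k b \<in> Units C" if b: "b \<in> carrier B" for b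
  proof
    assume "k b \<in> Units C"
    then obtain c where c: "c \<in> carrier C" "c \<otimes>\<^bsub>C\<^esub> k b = \<one>\<^bsub>C\<^esub>" by (auto simp: Units_def)
    have "c \<in> k ` carrier B" using c(1) k(3) by (simp add: bij_betw_def)
    then obtain d where d: "d \<in> carrier B" "k d = c" by blast
    then have "d \<otimes>\<^bsub>B\<^esub> b = \<one>\<^bsub>B\<^esub>" using b c k by (intro inj) (auto simp: hom_mult)
    then show "b \<in> Units B" using d b B.m_comm [of d b] by (auto simp: Units_def intro!: bexI [of _ d])
  qed (use hom_Units [OF assms(2,3) k(1,2)] in blast)
  then show "b \<in> carrier B \<Longrightarrow> b \<in> Units B \<longleftrightarrow> k b \<in> Units C" .
  show "localization A B \<phi>"
    unfolding localization_def
  proof (intro conjI ballI impI)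
    fix b assume b: "b \<in> carrier B"
    then have "k b \<in> carrier C" using k by (auto simp: hom_def)
    then obtain a s where *: "a \<in> carrier A" "s \<in> carrier A" "\<psi> s \<in> Units C" "k b \<otimes>\<^bsub>C\<^esub> \<psi> s = \<psi> a"
      by (rule localization_surj [OF loc])
    then have "b \<otimes>\<^bsub>B\<^esub> \<phi> s = \<phi> a" using b k by (intro inj) (auto simp: hom_mult comp \<phi>c)
    moreover have "\<phi> s \<in> Units B" using * U comp \<phi>c by auto
    ultimately show "\<exists>a\<in>carrier A. \<exists>s\<in>carrier A. \<phi> s \<in> Units B \<and> b \<otimes>\<^bsub>B\<^esub> \<phi> s = \<phi> a"
      using * by blast
  next
    fix a b assume ab: "a \<in> carrier A" "b \<in> carrier A" "\<phi> a = \<phi> b"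
    then have "\<psi> a = \<psi> b" by (simp flip: comp)
    then obtain s where "s \<in> carrier A" "\<psi> s \<in> Units C" "s \<otimes>\<^bsub>A\<^esub> a = s \<otimes>\<^bsub>A\<^esub> b"
      using ab by (elim localization_eq [OF loc, rotated 2])
    then show "\<exists>s\<in>carrier A. \<phi> s \<in> Units B \<and> s \<otimes>\<^bsub>A\<^esub> a = s \<otimes>\<^bsub>A\<^esub> b"
      using U comp \<phi>c by auto
  qed (fact \<phi>)
qed

text \<open>If a localization of \<open>A\<close> factors through another one, the second factor is
  a localization too: a coincidence in \<open>C\<close> is reduced to one between elements of
  \<open>A\<close>, and the unit \<open>\<phi> s\<close> is cancelled in \<open>B\<close>.\<close>

lemma localization_cancel:
  assumes A: "comm_monoid A" "comm_monoid B" "comm_monoid C"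
    and loc: "localization A C \<psi>" and loc': "localization A B \<phi>"
    and k: "k \<in> hom B C" "k \<one>\<^bsub>B\<^esub> = \<one>\<^bsub>C\<^esub>"
    and comp: "\<And>a. a \<in> carrier A \<Longrightarrow> k (\<phi> a) = \<psi> a"
  shows "localization B C k"
  unfolding localization_def
proof (intro conjI ballI impI)
  interpret A: comm_monoid A by fact
  interpret B: comm_monoid B by fact
  interpret C: comm_monoid C by fact
  note \<phi> = localization_closed [OF loc'] localization_mult [OF loc']
  {
    fix c assume "c \<in> carrier C"
    then obtain a s where *: "a \<in> carrier A" "s \<in> carrier A" "\<psi> s \<in> Units C" "c \<otimes>\<^bsub>C\<^esub> \<psi> s = \<psi> a"
      by (rule localization_surj [OF loc])
    then have "\<phi> s \<in> carrier B" "\<phi> a \<in> carrier B" "k (\<phi> s) \<in> Units C" "c \<otimes>\<^bsub>C\<^esub> k (\<phi> s) = k (\<phi> a)"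
      by (simp_all add: comp \<phi>)
    then show "\<exists>a\<in>carrier B. \<exists>s\<in>carrier B. k s \<in> Units C \<and> c \<otimes>\<^bsub>C\<^esub> k s = k a" by blast
  }
  fix b d assume bd: "b \<in> carrier B" "d \<in> carrier B" "k b = k d"
  obtain a e s where a: "a \<in> carrier A" "e \<in> carrier A" "s \<in> carrier A" "\<phi> s \<in> Units B"
    "b \<otimes>\<^bsub>B\<^esub> \<phi> s = \<phi> a" "d \<otimes>\<^bsub>B\<^esub> \<phi> s = \<phi> e"
    by (rule localization_common_denominator [OF A(1,2) loc' bd(1,2)])
  have "\<psi> a = k b \<otimes>\<^bsub>C\<^esub> k (\<phi> s)" "\<psi> e = k d \<otimes>\<^bsub>C\<^esub> k (\<phi> s)"
    using a bd k(1) by (simp_all flip: comp a(5,6) add: hom_mult \<phi>)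
  then have "\<psi> a = \<psi> e" using bd by simp
  then obtain t where t: "t \<in> carrier A" "\<psi> t \<in> Units C" "t \<otimes>\<^bsub>A\<^esub> a = t \<otimes>\<^bsub>A\<^esub> e"
    using a by (elim localization_eq [OF loc, rotated 2])
  have "(\<phi> t \<otimes>\<^bsub>B\<^esub> b) \<otimes>\<^bsub>B\<^esub> \<phi> s = (\<phi> t \<otimes>\<^bsub>B\<^esub> d) \<otimes>\<^bsub>B\<^esub> \<phi> s"
    using arg_cong [OF t(3), of \<phi>] a(1-4) t(1) bd by (simp add: \<phi> B.m_assoc a(5,6))
  then have "\<phi> s \<otimes>\<^bsub>B\<^esub> (\<phi> t \<otimes>\<^bsub>B\<^esub> b) = \<phi> s \<otimes>\<^bsub>B\<^esub> (\<phi> t \<otimes>\<^bsub>B\<^esub> d)"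
    using a(3,4) t(1) bd \<phi>(1) by (simp add: B.m_comm [of "\<phi> s"])
  then have "\<phi> t \<otimes>\<^bsub>B\<^esub> b = \<phi> t \<otimes>\<^bsub>B\<^esub> d"
    using a(4) t(1) bd \<phi>(1) by (subst (asm) B.Units_l_cancel) auto
  then show "\<exists>s\<in>carrier B. k s \<in> Units C \<and> s \<otimes>\<^bsub>B\<^esub> b = s \<otimes>\<^bsub>B\<^esub> d"
    using t(1,2) comp \<phi>(1) by (intro bexI [of _ "\<phi> t"]) simp_all
qed (fact k)

context pm_sheaf
begin

abbreviation "Op U \<equiv> openin (spc X) U"

lemma sec_pm: "Op U \<Longrightarrow> pm (sec X U)"
  by (rule pm.intro) (rule sec_pointed_monoid)

lemma sec_comm: "Op U \<Longrightarrow> comm_monoid (sec X U)"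
  using sec_pointed_monoid pointed_monoidD by blast

lemma res_closed: "\<lbrakk>Op U; Op V; V \<subseteq> U; s \<in> carrier (sec X U)\<rbrakk> \<Longrightarrow> res X U V s \<in> carrier (sec X V)"
  using pm_homD(1) [OF res_hom] .

lemma res_mult: "\<lbrakk>Op U; Op V; V \<subseteq> U; s \<in> carrier (sec X U); t \<in> carrier (sec X U)\<rbrakk> \<Longrightarrow>
    res X U V (s \<otimes>\<^bsub>sec X U\<^esub> t) = res X U V s \<otimes>\<^bsub>sec X V\<^esub> res X U V t"
  using pm_homD(2) [OF res_hom] .

lemma sec_mult_closed: "\<lbrakk>Op U; s \<in> carrier (sec X U); t \<in> carrier (sec X U)\<rbrakk> \<Longrightarrow> s \<otimes>\<^bsub>sec X U\<^esub> t \<in> carrier (sec X U)"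
  using sec_comm comm_monoid.axioms(1) monoid.m_closed by metis

lemma sec_one_closed: "Op U \<Longrightarrow> \<one>\<^bsub>sec X U\<^esub> \<in> carrier (sec X U)"
  using sec_comm comm_monoid.axioms(1) monoid.one_closed by metis

lemma germ_self: "\<lbrakk>Op U; x \<in> U; s \<in> carrier (sec X U)\<rbrakk> \<Longrightarrow> (U, s) \<in> germ X x U s"
  unfolding germ_def by blast

lemma res_eq_mono:
  assumes "Op U" "s \<in> carrier (sec X U)" "Op V" "t \<in> carrier (sec X V)"
    and "Op W" "W \<subseteq> U" "W \<subseteq> V" "res X U W s = res X V W t" "Op W'" "W' \<subseteq> W"
  shows "res X U W' s = res X V W' t"
proof -
  have "res X U W' s = res X W W' (res X U W s)" using assms(1,2,5,6,9,10) by (simp add: res_comp)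
  also have "\<dots> = res X V W' t" unfolding assms(8) using assms(3-5,7,9,10) by (simp add: res_comp)
  finally show ?thesis .
qed

text \<open>Transitivity of equality of germs: intersect the two neighbourhoods.\<close>

lemma germ_mono:
  assumes U: "Op U" "s \<in> carrier (sec X U)" and V: "Op V" "t \<in> carrier (sec X V)"
    and W: "Op W" "x \<in> W" "W \<subseteq> U \<inter> V" "res X U W s = res X V W t"
  shows "germ X x U s \<subseteq> germ X x V t"
proof (clarsimp simp: germ_def)
  fix V' t' W' assume *: "Op V'" "x \<in> V'" "t' \<in> carrier (sec X V')" "Op W'" "x \<in> W'" "W' \<subseteq> U" "W' \<subseteq> V'"
    "res X U W' s = res X V' W' t'"
  have "Op (W \<inter> W')" using W * by (auto intro: openin_Int)
  then have "res X U (W \<inter> W') s = res X V (W \<inter> W') t" "res X U (W \<inter> W') s = res X V' (W \<inter> W') t'"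
    using W by (intro res_eq_mono [OF U V W(1) _ _ W(4)] res_eq_mono [OF U *(1,3) *(4) _ _ *(8)]; use * in auto)+
  then have "res X V (W \<inter> W') t = res X V' (W \<inter> W') t'" by simp
  then show "\<exists>W. Op W \<and> x \<in> W \<and> W \<subseteq> V \<and> W \<subseteq> V' \<and> res X V W t = res X V' W t'"
    using W * by (intro exI [of _ "W \<inter> W'"]) (auto intro: openin_Int)
qed

lemma germ_eq_iff:
  assumes U: "Op U" "x \<in> U" "s \<in> carrier (sec X U)" and V: "Op V" "x \<in> V" "t \<in> carrier (sec X V)"
  shows "germ X x U s = germ X x V t \<longleftrightarrow>
    (\<exists>W. Op W \<and> x \<in> W \<and> W \<subseteq> U \<inter> V \<and> res X U W s = res X V W t)"
proof
  assume "germ X x U s = germ X x V t"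
  then have "(V, t) \<in> germ X x U s" using germ_self V by simp
  then show "\<exists>W. Op W \<and> x \<in> W \<and> W \<subseteq> U \<inter> V \<and> res X U W s = res X V W t" by (auto simp: germ_def)
next
  assume "\<exists>W. Op W \<and> x \<in> W \<and> W \<subseteq> U \<inter> V \<and> res X U W s = res X V W t"
  then obtain W where "Op W" "x \<in> W" "W \<subseteq> U \<inter> V" "res X U W s = res X V W t" by blast
  then show "germ X x U s = germ X x V t"
    using germ_mono [of U s V t W x] germ_mono [of V t U s W x] assms by auto
qed

lemma mem_germ_iff:
  assumes "Op U" "x \<in> U" "s \<in> carrier (sec X U)"
  shows "(V, t) \<in> germ X x U s \<longleftrightarrow>
    Op V \<and> x \<in> V \<and> t \<in> carrier (sec X V) \<and> germ X x V t = germ X x U s"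
proof (cases "Op V \<and> x \<in> V \<and> t \<in> carrier (sec X V)")
  case True
  then have "germ X x U s = germ X x V t \<longleftrightarrow> (V, t) \<in> germ X x U s"
    using assms by (subst germ_eq_iff) (auto simp: germ_def)
  then show ?thesis using True by auto
qed (auto simp: germ_def)

lemma germ_res:
  assumes "Op U" "Op V" "V \<subseteq> U" "x \<in> V" "s \<in> carrier (sec X U)"
  shows "germ X x V (res X U V s) = germ X x U s"
  using assms by (subst germ_eq_iff) (auto simp: res_closed res_id intro!: exI [of _ V])

lemma germ_closed: "\<lbrakk>Op U; x \<in> U; s \<in> carrier (sec X U)\<rbrakk> \<Longrightarrow> germ X x U s \<in> carrier (pm_stalk X x)"
  by (auto simp: pm_stalk_def stalk_carrier_def)

lemma stalk_cases_within:
  assumes "g \<in> carrier (pm_stalk X x)" "Op U" "x \<in> U"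
  obtains V s where "Op V" "x \<in> V" "V \<subseteq> U" "s \<in> carrier (sec X V)" "g = germ X x V s"
proof -
  obtain V s where V: "Op V" "x \<in> V" "s \<in> carrier (sec X V)" "g = germ X x V s"
    using assms(1) by (auto simp: pm_stalk_def stalk_carrier_def)
  have "g = germ X x (U \<inter> V) (res X V (U \<inter> V) s)"
    using V assms by (simp add: germ_res openin_Int)
  then show thesis
    using that [of "U \<inter> V" "res X V (U \<inter> V) s"] V assms by (simp add: res_closed openin_Int)
qed

text \<open>As with fractions, the product is a union over representatives, here over all
  neighbourhoods and sections with the given germs. All these products have the same restriction to
  some smaller neighbourhood as the one on the right, so they contribute the same germ.\<close>

lemma stalk_mult:
  assumes U: "Op U" "x \<in> U" "s \<in> carrier (sec X U)" and V: "Op V" "x \<in> V" "t \<in> carrier (sec X V)"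
  shows "germ X x U s \<otimes>\<^bsub>pm_stalk X x\<^esub> germ X x V t =
    germ X x (U \<inter> V) (res X U (U \<inter> V) s \<otimes>\<^bsub>sec X (U \<inter> V)\<^esub> res X V (U \<inter> V) t)"
    (is "_ = ?r")
proof -
  have "germ X x (U' \<inter> V') (res X U' (U' \<inter> V') s' \<otimes>\<^bsub>sec X (U' \<inter> V')\<^esub> res X V' (U' \<inter> V') t') = ?r"
    if "(U', s') \<in> germ X x U s" "(V', t') \<in> germ X x V t" for U' s' V' t'
  proof -
    from that obtain W1 W2 where *: "Op U'" "x \<in> U'" "s' \<in> carrier (sec X U')" "Op V'" "x \<in> V'" "t' \<in> carrier (sec X V')"
      "Op W1" "x \<in> W1" "W1 \<subseteq> U \<inter> U'" "res X U W1 s = res X U' W1 s'"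
      "Op W2" "x \<in> W2" "W2 \<subseteq> V \<inter> V'" "res X V W2 t = res X V' W2 t'"
      by (auto simp: germ_def)
    let ?W = "W1 \<inter> W2"
    have o: "Op ?W" "Op (U \<inter> V)" "Op (U' \<inter> V')" using * U V by (auto intro: openin_Int)
    have s: "res X U ?W s = res X U' ?W s'"
      by (rule res_eq_mono [OF U(1,3) *(1,3,7) _ _ *(10) o(1)]) (use *(9) in auto)
    have t: "res X V ?W t = res X V' ?W t'"
      by (rule res_eq_mono [OF V(1,3) *(4,6,11) _ _ *(14) o(1)]) (use *(13) in auto)
    have sub: "?W \<subseteq> U" "?W \<subseteq> V" "?W \<subseteq> U'" "?W \<subseteq> V'" using * by auto
    have "res X (U' \<inter> V') ?W (res X U' (U' \<inter> V') s' \<otimes>\<^bsub>sec X (U' \<inter> V')\<^esub> res X V' (U' \<inter> V') t')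
      = res X U' ?W s' \<otimes>\<^bsub>sec X ?W\<^esub> res X V' ?W t'"
      using *(1-6) o sub by (simp add: res_mult res_closed res_comp)
    also have "\<dots> = res X (U \<inter> V) ?W (res X U (U \<inter> V) s \<otimes>\<^bsub>sec X (U \<inter> V)\<^esub> res X V (U \<inter> V) t)"
      using U V o sub by (simp add: res_mult res_closed res_comp flip: s t)
    finally show ?thesis
      using *(1-6) *(8) *(12) U V o sub by (subst germ_eq_iff) (auto simp: sec_mult_closed res_closed intro!: exI [of _ ?W])
  qed
  note const = this
  have ne: "germ X x U s \<noteq> {}" "germ X x V t \<noteq> {}"
    using germ_self U V by blast+
  have "germ X x U s \<otimes>\<^bsub>pm_stalk X x\<^esub> germ X x V t = (\<Union>p\<in>germ X x U s. \<Union>q\<in>germ X x V t.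
      germ X x (fst p \<inter> fst q) (res X (fst p) (fst p \<inter> fst q) (snd p) \<otimes>\<^bsub>sec X (fst p \<inter> fst q)\<^esub> res X (fst q) (fst p \<inter> fst q) (snd q)))"
    by (simp add: pm_stalk_def stalk_op_def case_prod_unfold)
  also have "\<dots> = (\<Union>p\<in>germ X x U s. \<Union>q\<in>germ X x V t. ?r)"
    by (intro SUP_cong refl const) simp_all
  also have "\<dots> = ?r" using ne by simp
  finally show ?thesis .
qed

lemma germ_mult:
  assumes "Op U" "x \<in> U" "s \<in> carrier (sec X U)" "t \<in> carrier (sec X U)"
  shows "germ X x U s \<otimes>\<^bsub>pm_stalk X x\<^esub> germ X x U t = germ X x U (s \<otimes>\<^bsub>sec X U\<^esub> t)"
  using stalk_mult [of U x s U t] assms by (simp add: res_id)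

text \<open>The definition uses sections over the whole space; restriction lets any neighbourhood
  serve.\<close>

lemma stalk_one: "\<lbrakk>Op U; x \<in> U\<rbrakk> \<Longrightarrow> \<one>\<^bsub>pm_stalk X x\<^esub> = germ X x U \<one>\<^bsub>sec X U\<^esub>"
  and stalk_zero: "\<lbrakk>Op U; x \<in> U\<rbrakk> \<Longrightarrow> pzero (pm_stalk X x) = germ X x U (pzero (sec X U))"
proof -
  assume U: "Op U" "x \<in> U"
  let ?T = "topspace (spc X)"
  have *: "Op ?T" "U \<subseteq> ?T" using U by (auto simp: openin_subset)
  note h = res_hom [OF *(1) U(1) *(2)]
  interpret T: pm "sec X ?T" using sec_pm * by simp
  show "\<one>\<^bsub>pm_stalk X x\<^esub> = germ X x U \<one>\<^bsub>sec X U\<^esub>"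
    using germ_res [of ?T U x "\<one>\<^bsub>sec X ?T\<^esub>"] U * pm_homD(3) [OF h] by (simp add: pm_stalk_def)
  show "pzero (pm_stalk X x) = germ X x U (pzero (sec X U))"
    using germ_res [of ?T U x "pzero (sec X ?T)"] U * pm_homD(4) [OF h] T.pzero_closed by (simp add: pm_stalk_def)
qed

lemma stalk_common:
  assumes "x \<in> topspace (spc X)" "g \<in> carrier (pm_stalk X x)" "h \<in> carrier (pm_stalk X x)" "k \<in> carrier (pm_stalk X x)"
  obtains U r s t where "Op U" "x \<in> U" "r \<in> carrier (sec X U)" "s \<in> carrier (sec X U)" "t \<in> carrier (sec X U)"
    "g = germ X x U r" "h = germ X x U s" "k = germ X x U t"
proof -
  obtain U r where U: "Op U" "x \<in> U" "r \<in> carrier (sec X U)" "g = germ X x U r"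
    using stalk_cases_within [OF assms(2) openin_topspace assms(1)] by blast
  obtain V s where V: "Op V" "x \<in> V" "V \<subseteq> U" "s \<in> carrier (sec X V)" "h = germ X x V s"
    using stalk_cases_within [OF assms(3) U(1,2)] by blast
  obtain W t where W: "Op W" "x \<in> W" "W \<subseteq> V" "t \<in> carrier (sec X W)" "k = germ X x W t"
    using stalk_cases_within [OF assms(4) V(1,2)] by blast
  have "g = germ X x W (res X U W r)" "h = germ X x W (res X V W s)"
    using U V W by (auto simp: germ_res)
  then show thesis
    using that [of W "res X U W r" "res X V W s" t] U V W by (auto simp: res_closed)
qed

text \<open>Finitely many germs are realized over one open set by \<open>stalk_common\<close>, so
  the axioms are inherited from its section monoid.\<close>

lemma stalk_pm:
  assumes x: "x \<in> topspace (spc X)" shows "pm (pm_stalk X x)"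
proof (intro pm.intro pointed_monoid.intro pointed_monoid_axioms.intro comm_monoidI)
  let ?S = "pm_stalk X x"
  show "\<one>\<^bsub>?S\<^esub> \<in> carrier ?S" "pzero ?S \<in> carrier ?S"
    using x stalk_one [OF openin_topspace x] stalk_zero [OF openin_topspace x]
      pm.axioms [OF sec_pm [OF openin_topspace]]
    by (auto intro!: germ_closed sec_one_closed pointed_monoid.pzero_closed)
  fix g h k assume g: "g \<in> carrier ?S"
  {
    assume h: "h \<in> carrier ?S" and k: "k \<in> carrier ?S"
    obtain U r s t where *: "Op U" "x \<in> U" "r \<in> carrier (sec X U)" "s \<in> carrier (sec X U)" "t \<in> carrier (sec X U)"
      "g = germ X x U r" "h = germ X x U s" "k = germ X x U t" by (rule stalk_common [OF x g h k])
    interpret U: pm "sec X U" using sec_pm * by simp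
    show "g \<otimes>\<^bsub>?S\<^esub> h \<otimes>\<^bsub>?S\<^esub> k = g \<otimes>\<^bsub>?S\<^esub> (h \<otimes>\<^bsub>?S\<^esub> k)" using * by (simp add: germ_mult U.m_assoc)
  }
  {
    assume h: "h \<in> carrier ?S"
    obtain U r s t where *: "Op U" "x \<in> U" "r \<in> carrier (sec X U)" "s \<in> carrier (sec X U)" "t \<in> carrier (sec X U)"
      "g = germ X x U r" "h = germ X x U s" "g = germ X x U t" by (rule stalk_common [OF x g h g])
    interpret U: pm "sec X U" using sec_pm * by simp
    show "g \<otimes>\<^bsub>?S\<^esub> h \<in> carrier ?S" using * by (simp add: germ_mult germ_closed del: *(8))
    show "g \<otimes>\<^bsub>?S\<^esub> h = h \<otimes>\<^bsub>?S\<^esub> g" using *(1-4) unfolding *(6,7) by (simp add: germ_mult U.m_comm)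
  }
  obtain U r where *: "Op U" "x \<in> U" "r \<in> carrier (sec X U)" "g = germ X x U r"
    by (rule stalk_common [OF x g g g])
  interpret U: pm "sec X U" using sec_pm * by simp
  show "\<one>\<^bsub>?S\<^esub> \<otimes>\<^bsub>?S\<^esub> g = g" using * by (simp add: germ_mult stalk_one [of U])
  show "g \<otimes>\<^bsub>?S\<^esub> pzero ?S = pzero ?S" using * by (simp add: germ_mult stalk_zero [of U] U.pzero_closed U.pzero_absorb)
qed

lemma topI: "\<lbrakk>Op U; x \<in> U\<rbrakk> \<Longrightarrow> x \<in> topspace (spc X)"
  using openin_subset by blast

lemma stalk_comm: "\<lbrakk>Op U; x \<in> U\<rbrakk> \<Longrightarrow> comm_monoid (pm_stalk X x)"
  using pm.axioms [OF stalk_pm [OF topI]] pointed_monoidD by blast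

lemma germ_hom: "\<lbrakk>Op U; x \<in> U\<rbrakk> \<Longrightarrow> germ X x U \<in> pm_hom (sec X U) (pm_stalk X x)"
  by (rule pm_homI) (auto simp: germ_closed germ_mult stalk_one stalk_zero)

lemma germ_pm_morphism: "\<lbrakk>Op U; x \<in> U\<rbrakk> \<Longrightarrow> pm_morphism (sec X U) (pm_stalk X x) (germ X x U)"
  by (intro pm_morphism.intro pm_morphism_axioms.intro sec_pm stalk_pm topI germ_hom)

lemma res_pm_morphism: "\<lbrakk>Op U; Op V; V \<subseteq> U\<rbrakk> \<Longrightarrow> pm_morphism (sec X U) (sec X V) (res X U V)"
  by (intro pm_morphism.intro pm_morphism_axioms.intro sec_pm res_hom)

text \<open>The open sets on which \<open>s\<close> and \<open>t\<close> agree cover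
  \<open>U\<close>, so locality applies. Together with \<open>gluing_germ\<close> this lets a
  section be handled as the family of its germs.\<close>

lemma locality_germ:
  assumes U: "Op U" "s \<in> carrier (sec X U)" "t \<in> carrier (sec X U)"
    and eq: "\<And>x. x \<in> U \<Longrightarrow> germ X x U s = germ X x U t"
  shows "s = t"
proof -
  define \<V> where "\<V> = {W. Op W \<and> W \<subseteq> U \<and> res X U W s = res X U W t}"
  have "\<exists>W\<in>\<V>. x \<in> W" if "x \<in> U" for x
    using eq [OF that] that U by (auto simp: germ_eq_iff \<V>_def)
  then have un: "\<Union>\<V> = U" by (auto simp: \<V>_def)
  show "s = t"
    by (rule locality [of \<V>]) (use U in \<open>auto simp: un\<close>, auto simp: \<V>_def)
qed

text \<open>Sections over the covering sets agree on overlaps because their germs there are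
  prescribed by \<open>f\<close>.\<close>

lemma gluing_germ:
  assumes W: "Op W" and loc: "\<And>x. x \<in> W \<Longrightarrow> \<exists>V s. Op V \<and> x \<in> V \<and> V \<subseteq> W \<and> s \<in> carrier (sec X V) \<and>
      (\<forall>y\<in>V. germ X y V s = f y)"
  obtains s where "s \<in> carrier (sec X W)" "\<And>y. y \<in> W \<Longrightarrow> germ X y W s = f y"
proof -
  define \<V> where "\<V> = {V. Op V \<and> V \<subseteq> W \<and> (\<exists>s\<in>carrier (sec X V). \<forall>y\<in>V. germ X y V s = f y)}"
  have un: "\<Union>\<V> = W" using loc by (fastforce simp: \<V>_def)
  have "\<forall>V\<in>\<V>. \<exists>s. s \<in> carrier (sec X V) \<and> (\<forall>y\<in>V. germ X y V s = f y)" by (auto simp: \<V>_def)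
  then obtain F where F: "\<And>V. V \<in> \<V> \<Longrightarrow> F V \<in> carrier (sec X V)"
    "\<And>V y. \<lbrakk>V \<in> \<V>; y \<in> V\<rbrakk> \<Longrightarrow> germ X y V (F V) = f y" by (metis bchoice)
  have o: "V \<in> \<V> \<Longrightarrow> Op V" for V by (auto simp: \<V>_def)
  have "res X V (V \<inter> V') (F V) = res X V' (V \<inter> V') (F V')" if "V \<in> \<V>" "V' \<in> \<V>" for V V'
    using that F o by (intro locality_germ [of "V \<inter> V'"]) (auto simp: germ_res res_closed openin_Int)
  then have "\<exists>s\<in>carrier (sec X (\<Union>\<V>)). \<forall>V\<in>\<V>. res X (\<Union>\<V>) V s = F V"
    by (intro gluing o F(1))
  then obtain s where s: "s \<in> carrier (sec X W)" "\<And>V. V \<in> \<V> \<Longrightarrow> res X W V s = F V"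
    unfolding un by blast
  have "germ X y W s = f y" if y: "y \<in> W" for y
  proof -
    obtain V where V: "V \<in> \<V>" "y \<in> V" "V \<subseteq> W" using y un by blast
    have "germ X y W s = germ X y V (res X W V s)" using V W o s(1) by (simp add: germ_res)
    then show ?thesis using s(2) F(2) V by simp
  qed
  then show thesis using that s by blast
qed

lemma germ_eq_near:
  assumes U: "Op U" "x \<in> U" "s \<in> carrier (sec X U)" and V: "Op V" "x \<in> V" "t \<in> carrier (sec X V)"
    and eq: "germ X x U s = germ X x V t"
  obtains W where "Op W" "x \<in> W" "W \<subseteq> U \<inter> V" "\<And>y. y \<in> W \<Longrightarrow> germ X y U s = germ X y V t"
proof -
  obtain W where W: "Op W" "x \<in> W" "W \<subseteq> U \<inter> V" "res X U W s = res X V W t"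
    using eq germ_eq_iff [OF U V] by auto
  have "germ X y U s = germ X y V t" if "y \<in> W" for y
    using germ_res [of U W y s] germ_res [of V W y t] W U V that by auto
  then show thesis using that W by blast
qed

lemma unit_germ_inverse:
  assumes U: "Op U" "x \<in> U" "f \<in> carrier (sec X U)" and u: "germ X x U f \<in> Units (pm_stalk X x)"
  obtains W t where "Op W" "x \<in> W" "W \<subseteq> U" "t \<in> carrier (sec X W)"
    "\<And>y. y \<in> W \<Longrightarrow> germ X y W t \<otimes>\<^bsub>pm_stalk X y\<^esub> germ X y U f = \<one>\<^bsub>pm_stalk X y\<^esub>"
proof -
  interpret S: pm "pm_stalk X x" using stalk_pm topI U by blast
  obtain g where g: "g \<in> carrier (pm_stalk X x)" "g \<otimes>\<^bsub>pm_stalk X x\<^esub> germ X x U f = \<one>\<^bsub>pm_stalk X x\<^esub>"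
    using u by (auto simp: Units_def)
  obtain V t where V: "Op V" "x \<in> V" "V \<subseteq> U" "t \<in> carrier (sec X V)" "g = germ X x V t"
    by (rule stalk_cases_within [OF g(1) U(1,2)])
  have m: "germ X y V t \<otimes>\<^bsub>pm_stalk X y\<^esub> germ X y U f = germ X y V (t \<otimes>\<^bsub>sec X V\<^esub> res X U V f)" if "y \<in> V" for y
    using germ_res [of U V y f] germ_mult [of V y t "res X U V f"] U V that by (simp add: res_closed)
  have "germ X x V (t \<otimes>\<^bsub>sec X V\<^esub> res X U V f) = germ X x V \<one>\<^bsub>sec X V\<^esub>"
    using m [OF V(2)] g V stalk_one [of V x] by simp
  then obtain W where W: "Op W" "x \<in> W" "W \<subseteq> V \<inter> V"
    "\<And>y. y \<in> W \<Longrightarrow> germ X y V (t \<otimes>\<^bsub>sec X V\<^esub> res X U V f) = germ X y V \<one>\<^bsub>sec X V\<^esub>"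
    using U V by (elim germ_eq_near [rotated 6]) (auto simp: sec_mult_closed sec_one_closed res_closed)
  show thesis
  proof (rule that [of W "res X V W t"])
    fix y assume "y \<in> W"
    then have y: "y \<in> W" "y \<in> V" using W by auto
    then show "germ X y W (res X V W t) \<otimes>\<^bsub>pm_stalk X y\<^esub> germ X y U f = \<one>\<^bsub>pm_stalk X y\<^esub>"
      using m [of y] W V stalk_one [of V y] by (auto simp: germ_res)
  qed (use W V in \<open>auto simp: res_closed\<close>)
qed

text \<open>The inverse of a germ extends to a neighbourhood, so invertibility is an open condition.
  This makes the basic open sets of a chart open in X.\<close>

lemma open_unit_germs:
  assumes U: "Op U" "f \<in> carrier (sec X U)"
  shows "Op {x \<in> U. germ X x U f \<in> Units (pm_stalk X x)}"
proof (subst openin_subopen, clarify)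
  fix x assume x: "x \<in> U" "germ X x U f \<in> Units (pm_stalk X x)"
  obtain W t where W: "Op W" "x \<in> W" "W \<subseteq> U" "t \<in> carrier (sec X W)"
    "\<And>y. y \<in> W \<Longrightarrow> germ X y W t \<otimes>\<^bsub>pm_stalk X y\<^esub> germ X y U f = \<one>\<^bsub>pm_stalk X y\<^esub>"
    using unit_germ_inverse [OF U(1) x(1) U(2) x(2)] by blast
  have "germ X y U f \<in> Units (pm_stalk X y)" if "y \<in> W" for y
  proof -
    interpret S: pm "pm_stalk X y" using stalk_pm topI W that by blast
    have "germ X y W t \<otimes>\<^bsub>pm_stalk X y\<^esub> germ X y U f \<in> Units (pm_stalk X y)" using W(5) [OF that] by simp
    then show ?thesis
      using S.Units_mult_iff [of "germ X y W t" "germ X y U f"] germ_closed W(1-4) U that by auto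
  qed
  then show "\<exists>T. Op T \<and> x \<in> T \<and> T \<subseteq> {x \<in> U. germ X x U f \<in> Units (pm_stalk X x)}"
    using W by blast
qed

end

section \<open>Affine open subsets\<close>

context pm
begin

text \<open>The presence of some prime \<open>Q\<close> ensures that the zero is not a unit; the
  remaining axioms are \<open>Units_mult_iff\<close>. In contrast to rings, no sums occur, so a
  pointed monoid with a prime always has a largest one.\<close>

lemma nonunits_prime:
  assumes "pm_prime_ideal A Q" shows "pm_prime_ideal A (carrier A - Units A)"
proof -
  have z: "pzero A \<notin> Units A"
  proof
    assume "pzero A \<in> Units A"
    then have "inv pzero A \<otimes> pzero A \<in> Q"
      using assms by (intro pm_prime_mult_iff [THEN iffD2, OF pointed_monoid_axioms assms])
        (auto simp: pm_prime_ideal_def pm_ideal_def pzero_closed)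
    then show False
      using \<open>pzero A \<in> Units A\<close> pm_prime_ideal_one [OF pointed_monoid_axioms assms] by simp
  qed
  have "\<one> \<in> carrier A" "\<one> \<notin> carrier A - Units A" by simp_all
  then have "carrier A - Units A \<noteq> carrier A" by metis
  then show ?thesis
    using z pzero_closed by (simp add: pm_prime_ideal_def pm_ideal_def Units_mult_iff)
qed

text \<open>The elements that divide no power of \<open>h\<close> form the largest prime avoiding
  \<open>h\<close>; it is the prime of the closed point of the basic open set of
  \<open>h\<close>.\<close>

lemma prime_avoiding_powers:
  assumes "h \<in> carrier A" "pm_prime_ideal A Q" "h \<notin> Q"
  shows "pm_prime_ideal A {a \<in> carrier A. \<forall>n::nat. \<forall>b\<in>carrier A. a \<otimes> b \<noteq> h [^] n}" (is "pm_prime_ideal A ?T")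
proof -
  have pow: "h [^] n \<notin> Q" for n :: nat
    using assms pm_prime_ideal_one [OF pointed_monoid_axioms assms(2)]
    by (induction n) (auto simp: pm_prime_mult_iff [OF pointed_monoid_axioms assms(2)])
  have z: "pzero A \<in> Q" using assms(2) by (auto simp: pm_prime_ideal_def pm_ideal_def)
  have zT: "pzero A \<in> ?T"
  proof (intro CollectI conjI allI ballI notI)
    fix n :: nat and b assume "b \<in> carrier A" "pzero A \<otimes> b = h [^] n"
    then have "h [^] n = pzero A" using pzero_absorb [of b] m_comm [of b "pzero A"] pzero_closed by simp
    then show False using pow [of n] z by simp
  qed (rule pzero_closed)
  have l: "a \<otimes> i \<in> ?T" if ai: "a \<in> carrier A" "i \<in> ?T" for a i
  proof (intro CollectI conjI allI ballI notI)
    fix n :: nat and b assume b: "b \<in> carrier A" "a \<otimes> i \<otimes> b = h [^] n"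
    have "i \<otimes> (a \<otimes> b) = a \<otimes> i \<otimes> b" using ai b(1) by (simp add: m_ac)
    then show False using ai b by auto
  qed (use ai in auto)
  have "\<one> \<otimes> \<one> = h [^] (0::nat)" by simp
  then have "\<one> \<notin> ?T" using one_closed by blast
  then have ne: "?T \<noteq> carrier A" using one_closed by blast
  have pr: "a \<in> ?T \<or> b \<in> ?T" if ab: "a \<in> carrier A" "b \<in> carrier A" "a \<otimes> b \<in> ?T" for a b
  proof (rule ccontr)
    assume "\<not> ?thesis"
    then obtain m n :: nat and c d where cd: "c \<in> carrier A" "d \<in> carrier A" "a \<otimes> c = h [^] m" "b \<otimes> d = h [^] n"
      using ab by blast
    then have "(a \<otimes> b) \<otimes> (c \<otimes> d) = h [^] (m + n)"
      using ab(1,2) assms(1) by (simp add: nat_pow_mult [symmetric] m_ac flip: cd(3,4))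
    moreover have "c \<otimes> d \<in> carrier A" using cd by simp
    ultimately show False using ab(3) by blast
  qed
  have sub: "?T \<subseteq> carrier A" by (rule Collect_restrict)
  show ?thesis unfolding pm_prime_ideal_def pm_ideal_def
    by (intro conjI ballI impI) (fact sub zT l ne pr)+
qed

end

lemma pm_prime_vimage:
  assumes "pointed_monoid A" "pointed_monoid B" "h \<in> pm_hom A B" "pm_prime_ideal B Q"
  shows "pm_prime_ideal A {a \<in> carrier A. h a \<in> Q}"
proof -
  interpret A: pointed_monoid A by fact
  have "\<one>\<^bsub>A\<^esub> \<notin> {a \<in> carrier A. h a \<in> Q}"
    using pm_prime_ideal_one [OF assms(2,4)] pm_homD [OF assms(3)] by simp
  then have "{a \<in> carrier A. h a \<in> Q} \<noteq> carrier A" using A.one_closed by blast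
  then show ?thesis
    using assms(4) pm_homD [OF assms(3)] A.pzero_closed
    by (auto simp: pm_prime_ideal_def pm_ideal_def)
qed

text \<open>An intrinsic description of the affine open subsets, see \<open>affine_opens_eq_charts\<close> below.\<close>

definition chart :: "('p, 's) pm_space \<Rightarrow> 'p set \<Rightarrow> bool" where
  "chart X U \<longleftrightarrow> openin (spc X) U \<and>
     bij_betw (prime_of_point X U) U {P. pm_prime_ideal (sec X U) P} \<and>
     (\<forall>W u. openin (spc X) W \<and> u \<in> W \<and> u \<in> U \<longrightarrow>
        (\<exists>h\<in>carrier (sec X U). h \<notin> prime_of_point X U u \<and>
          (\<forall>u'\<in>U. h \<notin> prime_of_point X U u' \<longrightarrow> u' \<in> W))) \<and>
     (\<forall>u\<in>U. localization (sec X U) (pm_stalk X u) (germ X u U))"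

section \<open>Points, closed points and basic open subsets of charts\<close>

context pm_sheaf
begin

lemma mem_prime_of_point:
  "f \<in> prime_of_point X U u \<longleftrightarrow> f \<in> carrier (sec X U) \<and> germ X u U f \<notin> Units (pm_stalk X u)"
  by (simp add: prime_of_point_def)

lemma prime_of_point_res:
  assumes "Op U" "Op V" "V \<subseteq> U" "v \<in> V" "a \<in> carrier (sec X U)"
  shows "res X U V a \<in> prime_of_point X V v \<longleftrightarrow> a \<in> prime_of_point X U v"
  using assms by (simp add: mem_prime_of_point res_closed germ_res)

lemma chartD:
  assumes "chart X U"
  shows "Op U" "\<And>u. u \<in> U \<Longrightarrow> pm_prime_ideal (sec X U) (prime_of_point X U u)"
    "\<And>u v. \<lbrakk>u \<in> U; v \<in> U; prime_of_point X U u = prime_of_point X U v\<rbrakk> \<Longrightarrow> u = v"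
    "\<And>u. u \<in> U \<Longrightarrow> localization (sec X U) (pm_stalk X u) (germ X u U)"
  using assms by (auto simp: chart_def bij_betw_def inj_on_def)

lemma chart_point:
  assumes "chart X U" "pm_prime_ideal (sec X U) P"
  obtains u where "u \<in> U" "prime_of_point X U u = P"
proof -
  have "P \<in> prime_of_point X U ` U" using assms by (simp add: chart_def bij_betw_def)
  then show thesis using that by blast
qed

lemma chart_nbhd:
  assumes "chart X U" "Op W" "u \<in> W" "u \<in> U"
  obtains h where "h \<in> carrier (sec X U)" "h \<notin> prime_of_point X U u"
    "\<And>u'. \<lbrakk>u' \<in> U; h \<notin> prime_of_point X U u'\<rbrakk> \<Longrightarrow> u' \<in> W"
proof -
  have "\<forall>W u. Op W \<and> u \<in> W \<and> u \<in> U \<longrightarrow> (\<exists>h\<in>carrier (sec X U). h \<notin> prime_of_point X U u \<and>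
      (\<forall>u'\<in>U. h \<notin> prime_of_point X U u' \<longrightarrow> u' \<in> W))"
    using assms(1) unfolding chart_def by (elim conjE)
  then have "\<exists>h\<in>carrier (sec X U). h \<notin> prime_of_point X U u \<and> (\<forall>u'\<in>U. h \<notin> prime_of_point X U u' \<longrightarrow> u' \<in> W)"
    using assms(2-4) by simp
  then show thesis using that by blast
qed

lemma basic_open:
  assumes "Op U" "h \<in> carrier (sec X U)"
  shows "Op {u \<in> U. h \<notin> prime_of_point X U u}"
  using open_unit_germs [OF assms] assms by (simp add: mem_prime_of_point)

lemma unit_notin_prime_of_point:
  assumes "Op U" "u \<in> U" "h \<in> Units (sec X U)"
  shows "h \<notin> prime_of_point X U u"
  using hom_Units [OF sec_comm stalk_comm, of U U u "germ X u U" h] germ_hom [of U u] assms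
  by (auto simp: mem_prime_of_point pm_hom_def)

text \<open>No open neighbourhood of \<open>v\<close> misses a point of \<open>V\<close>. For affine
  \<open>V\<close> this describes the unique closed point, given by the prime of all nonunits, and
  the stalk at \<open>v\<close> is then the monoid of sections over \<open>V\<close>.\<close>

definition center :: "'p set \<Rightarrow> 'p \<Rightarrow> bool" where
  "center V v \<longleftrightarrow> v \<in> V \<and> (\<forall>W. Op W \<and> v \<in> W \<longrightarrow> V \<subseteq> W)"

text \<open>At the point of the prime of nonunits a basic neighbourhood is defined by a unit, hence
  is all of \<open>U\<close>.\<close>

lemma chart_center:
  assumes U: "chart X U" "u \<in> U"
  obtains v where "center U v"
proof -
  interpret pm "sec X U" using sec_pm chartD U by blast
  obtain v where v: "v \<in> U" "prime_of_point X U v = carrier (sec X U) - Units (sec X U)"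
    by (rule chart_point [OF U(1) nonunits_prime [OF chartD(2) [OF U]]])
  have "U \<subseteq> W" if W: "Op W" "v \<in> W" for W
  proof -
    obtain h where h: "h \<in> carrier (sec X U)" "h \<notin> prime_of_point X U v"
      "\<And>u'. \<lbrakk>u' \<in> U; h \<notin> prime_of_point X U u'\<rbrakk> \<Longrightarrow> u' \<in> W"
      using chart_nbhd [OF U(1) W v(1)] by blast
    then have "h \<in> Units (sec X U)" using v by auto
    then show ?thesis using h(3) unit_notin_prime_of_point [OF chartD(1) [OF U(1)]] by blast
  qed
  then have "center U v" using v(1) unfolding center_def by blast
  then show thesis by (rule that)
qed

text \<open>A neighbourhood of \<open>v\<close> inside \<open>V\<close> is \<open>V\<close> itself,
  so neither representing a germ nor comparing two germs involves any shrinking.\<close>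

lemma center_germ_bij:
  assumes V: "Op V" "center V v"
  shows "bij_betw (germ X v V) (carrier (sec X V)) (carrier (pm_stalk X v))"
proof (rule bij_betwI')
  have v: "v \<in> V" using V by (simp add: center_def)
  fix s t assume "s \<in> carrier (sec X V)" "t \<in> carrier (sec X V)"
  then show "germ X v V s = germ X v V t \<longleftrightarrow> s = t"
  proof -
    assume st: "s \<in> carrier (sec X V)" "t \<in> carrier (sec X V)"
    have "s = t" if e: "germ X v V s = germ X v V t"
    proof -
      obtain W where W: "Op W" "v \<in> W" "W \<subseteq> V \<inter> V" "res X V W s = res X V W t"
        using e st V v by (auto simp: germ_eq_iff)
      then have "W = V" using V by (auto simp: center_def)
      then show ?thesis using W st V by (simp add: res_id)
    qed
    then show ?thesis by blast
  qed
next
  fix s assume "s \<in> carrier (sec X V)"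
  then show "germ X v V s \<in> carrier (pm_stalk X v)" using V by (auto simp: center_def germ_closed)
next
  fix g assume g: "g \<in> carrier (pm_stalk X v)"
  have v: "v \<in> V" using V by (simp add: center_def)
  obtain W s where W: "Op W" "v \<in> W" "W \<subseteq> V" "s \<in> carrier (sec X W)" "g = germ X v W s"
    by (rule stalk_cases_within [OF g V(1) v])
  then have "W = V" using V by (auto simp: center_def)
  then show "\<exists>s\<in>carrier (sec X V). g = germ X v V s" using W by blast
qed

text \<open>The map from sections over \<open>U\<close> to the stalk at \<open>v\<close> is a
  localization because \<open>U\<close> is a chart, and that stalk is the section monoid of
  \<open>V\<close> by \<open>center_germ_bij\<close>.\<close>

lemma center_localization:
  assumes U: "chart X U" and V: "Op V" "V \<subseteq> U" "center V v"
  shows "localization (sec X U) (sec X V) (res X U V)"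
    and "s \<in> carrier (sec X U) \<Longrightarrow> res X U V s \<in> Units (sec X V) \<longleftrightarrow> s \<notin> prime_of_point X U v"
proof -
  have v: "v \<in> V" "v \<in> U" using V by (auto simp: center_def)
  have *: "Op U" by (rule chartD(1) [OF U])
  have h: "germ X v V \<in> hom (sec X V) (pm_stalk X v)" "germ X v V \<one>\<^bsub>sec X V\<^esub> = \<one>\<^bsub>pm_stalk X v\<^esub>"
    using germ_hom [OF V(1) v(1)] by (auto simp: pm_hom_def)
  have r: "res X U V \<in> hom (sec X U) (sec X V)" using res_hom [OF * V(1,2)] by (auto simp: pm_hom_def)
  note iso = localization_comp_iso [OF chartD(4) [OF U v(2)] sec_comm [OF V(1)] stalk_comm [OF V(1) v(1)]
      r h center_germ_bij [OF V(1,3)] germ_res [OF * V(1,2) v(1)]]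
  show "localization (sec X U) (sec X V) (res X U V)" by (rule iso(1))
  assume s: "s \<in> carrier (sec X U)"
  have "res X U V s \<in> carrier (sec X V)" using res_closed * V s by simp
  then show "res X U V s \<in> Units (sec X V) \<longleftrightarrow> s \<notin> prime_of_point X U v"
    using iso(2) germ_res [OF * V(1,2) v(1) s] s by (simp add: mem_prime_of_point)
qed

text \<open>Take the prime of all elements that divide no power of \<open>h\<close>. An element
  \<open>k\<close> outside it divides a power of \<open>h\<close>, so the basic open set of
  \<open>k\<close> contains that of \<open>h\<close>.\<close>

lemma basic_open_center:
  assumes U: "chart X U" and h: "h \<in> carrier (sec X U)" and u: "u \<in> U" "h \<notin> prime_of_point X U u"
  obtains v where "center {u \<in> U. h \<notin> prime_of_point X U u} v"
proof -
  interpret pm "sec X U" using sec_pm chartD U by blast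
  let ?A = "sec X U"
  let ?T = "{a \<in> carrier ?A. \<forall>n::nat. \<forall>b\<in>carrier ?A. a \<otimes>\<^bsub>?A\<^esub> b \<noteq> h [^]\<^bsub>?A\<^esub> n}"
  obtain v where v: "v \<in> U" "prime_of_point X U v = ?T"
    by (rule chart_point [OF U prime_avoiding_powers [OF h chartD(2) [OF U u(1)] u(2)]])
  have "h \<otimes>\<^bsub>?A\<^esub> \<one>\<^bsub>?A\<^esub> = h [^]\<^bsub>?A\<^esub> (1::nat)" using h by (simp add: nat_pow_def)
  then have "h \<notin> prime_of_point X U v" unfolding v(2) using one_closed by blast
  moreover have "{u \<in> U. h \<notin> prime_of_point X U u} \<subseteq> W" if W: "Op W" "v \<in> W" for W
  proof clarify
    fix w assume w: "w \<in> U" "h \<notin> prime_of_point X U w"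
    obtain k where k: "k \<in> carrier ?A" "k \<notin> prime_of_point X U v"
      "\<And>u'. \<lbrakk>u' \<in> U; k \<notin> prime_of_point X U u'\<rbrakk> \<Longrightarrow> u' \<in> W"
      using chart_nbhd [OF U W v(1)] by blast
    then obtain n :: nat and b where b: "b \<in> carrier ?A" "k \<otimes>\<^bsub>?A\<^esub> b = h [^]\<^bsub>?A\<^esub> n"
      unfolding v(2) by blast
    note pr = pm_prime_mult_iff [OF pointed_monoid_axioms chartD(2) [OF U w(1)]]
    have "h [^]\<^bsub>?A\<^esub> n \<notin> prime_of_point X U w" for n :: nat
      using h w(2) pm_prime_ideal_one [OF pointed_monoid_axioms chartD(2) [OF U w(1)]]
      by (induction n) (auto simp: pr)
    then have "k \<notin> prime_of_point X U w" using b k(1) pr [of k b] by auto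
    then show "w \<in> W" using k w by blast
  qed
  ultimately have "center {u \<in> U. h \<notin> prime_of_point X U u} v" using v(1) unfolding center_def by blast
  then show thesis by (rule that)
qed

text \<open>Since the basic open set has a closed point, its sections are a localization of those
  over \<open>U\<close>; each clause of \<open>chart\<close> is carried over along this
  localization.\<close>

lemma chart_basic_open:
  assumes U: "chart X U" and h: "h \<in> carrier (sec X U)"
    and u: "u \<in> U" "h \<notin> prime_of_point X U u"
  shows "chart X {u \<in> U. h \<notin> prime_of_point X U u}" (is "chart X ?V")
proof -
  obtain v where v: "center ?V v" by (rule basic_open_center [OF U h u])
  have o: "Op U" "Op ?V" "?V \<subseteq> U" using chartD [OF U] basic_open h by auto
  note loc = center_localization [OF U o(2,3) v]
  have hu: "res X U ?V h \<in> Units (sec X ?V)" using loc(2) [OF h] v by (auto simp: center_def)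
  have locV: "localization (sec X ?V) (pm_stalk X w) (germ X w ?V)" if w: "w \<in> ?V" for w
  proof (rule localization_cancel [OF sec_comm [OF o(1)] sec_comm [OF o(2)] stalk_comm [OF o(2) w] chartD(4) [OF U] loc(1)])
    show "germ X w ?V \<in> hom (sec X ?V) (pm_stalk X w)" "germ X w ?V \<one>\<^bsub>sec X ?V\<^esub> = \<one>\<^bsub>pm_stalk X w\<^esub>"
      using germ_hom [OF o(2) w] by (auto simp: pm_hom_def)
  qed (use o w in \<open>auto simp: germ_res\<close>)
  have Vpr: "pm_prime_ideal (sec X ?V) (prime_of_point X ?V w)" if w: "w \<in> ?V" for w
  proof -
    interpret S: pm "pm_stalk X w" using stalk_pm topI [OF o(2) w] by blast
    have "pzero (pm_stalk X w) \<notin> Units (pm_stalk X w)"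
    proof -
      have "pzero (sec X U) \<in> prime_of_point X U w"
        using chartD(2) [OF U, of w] w by (auto simp: pm_prime_ideal_def pm_ideal_def)
      then show ?thesis using w stalk_zero [OF o(1), of w] by (auto simp: mem_prime_of_point)
    qed
    then have "pm_prime_ideal (pm_stalk X w) (carrier (pm_stalk X w) - Units (pm_stalk X w))"
      using S.pzero_closed S.one_closed S.Units_one_closed
      unfolding pm_prime_ideal_def pm_ideal_def by (auto simp: S.Units_mult_iff)
    from pm_prime_vimage [OF pm.axioms [OF sec_pm [OF o(2)]] pm.axioms [OF S.pm_axioms] germ_hom [OF o(2) w] this]
    show ?thesis
      using germ_closed [OF o(2) w] by (simp add: prime_of_point_def cong: conj_cong)
  qed
  have surj: "\<exists>w\<in>?V. prime_of_point X ?V w = P" if P: "pm_prime_ideal (sec X ?V) P" for P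
  proof -
    have "pm_prime_ideal (sec X U) {a \<in> carrier (sec X U). res X U ?V a \<in> P}"
      by (rule pm_prime_vimage [OF pm.axioms [OF sec_pm [OF o(1)]] pm.axioms [OF sec_pm [OF o(2)]] res_hom [OF o] P])
    \<comment> \<open>The contraction of \<open>P\<close> to \<open>U\<close> misses
      \<open>h\<close>, which becomes a unit on \<open>?V\<close>, so its point lies in
      \<open>?V\<close>. The prime of \<open>w\<close> then agrees with \<open>P\<close> because
      every section over \<open>?V\<close> is a fraction of sections over \<open>U\<close>.\<close>
    then obtain w where w: "w \<in> U" "prime_of_point X U w = {a \<in> carrier (sec X U). res X U ?V a \<in> P}"
      by (rule chart_point [OF U])
    interpret V: pm "sec X ?V" using sec_pm o by simp
    have notP: "s \<notin> P" if "s \<in> Units (sec X ?V)" for s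
    proof
      assume "s \<in> P"
      then have "inv\<^bsub>sec X ?V\<^esub> s \<otimes>\<^bsub>sec X ?V\<^esub> s \<in> P"
        using pm_prime_mult_iff [OF V.pointed_monoid_axioms P, of "inv\<^bsub>sec X ?V\<^esub> s" s] that V.Units_closed [OF that] by simp
      then show False using that pm_prime_ideal_one [OF V.pointed_monoid_axioms P] by simp
    qed
    have wV: "w \<in> ?V" using w notP [OF hu] by auto
    have "b \<in> P \<longleftrightarrow> b \<in> prime_of_point X ?V w" if b: "b \<in> carrier (sec X ?V)" for b
    proof -
      obtain a s where a: "a \<in> carrier (sec X U)" "s \<in> carrier (sec X U)" "res X U ?V s \<in> Units (sec X ?V)"
        "b \<otimes>\<^bsub>sec X ?V\<^esub> res X U ?V s = res X U ?V a"
        by (rule localization_surj [OF loc(1) b])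
      have "b \<in> P \<longleftrightarrow> res X U ?V a \<in> P"
        using pm_prime_mult_iff [OF V.pointed_monoid_axioms P b, of "res X U ?V s"] a notP by auto
      moreover have "b \<in> prime_of_point X ?V w \<longleftrightarrow> res X U ?V a \<in> prime_of_point X ?V w"
        using pm_prime_mult_iff [OF V.pointed_monoid_axioms Vpr [OF wV] b, of "res X U ?V s"] a
          unit_notin_prime_of_point [OF o(2) wV] by auto
      moreover have "res X U ?V a \<in> prime_of_point X ?V w \<longleftrightarrow> res X U ?V a \<in> P"
        unfolding prime_of_point_res [OF o wV a(1)] w(2) using a by simp
      ultimately show ?thesis by blast
    qed
    moreover have "P \<subseteq> carrier (sec X ?V)" using P by (auto simp: pm_prime_ideal_def pm_ideal_def)
    moreover have "prime_of_point X ?V w \<subseteq> carrier (sec X ?V)" by (auto simp: mem_prime_of_point)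
    ultimately show ?thesis using wV by (intro bexI [of _ w]) auto
  qed
  have inj: "w = w'" if w: "w \<in> ?V" "w' \<in> ?V" "prime_of_point X ?V w = prime_of_point X ?V w'" for w w'
  proof (rule chartD(3) [OF U])
    have "a \<in> prime_of_point X U w \<longleftrightarrow> a \<in> prime_of_point X U w'" for a
    proof (cases "a \<in> carrier (sec X U)")
      case True
      then show ?thesis using prime_of_point_res [OF o w(1) True] prime_of_point_res [OF o w(2) True] w(3) by simp
    qed (simp add: mem_prime_of_point)
    then show "prime_of_point X U w = prime_of_point X U w'" by blast
  qed (use w in auto)
  have "bij_betw (prime_of_point X ?V) ?V {P. pm_prime_ideal (sec X ?V) P}"
    unfolding bij_betw_def inj_on_def using inj surj Vpr by blast
  moreover have "\<exists>k\<in>carrier (sec X ?V). k \<notin> prime_of_point X ?V w \<and>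
      (\<forall>u'\<in>?V. k \<notin> prime_of_point X ?V u' \<longrightarrow> u' \<in> W)" if W: "Op W" "w \<in> W" "w \<in> ?V" for W w
  proof -
    obtain k where k: "k \<in> carrier (sec X U)" "k \<notin> prime_of_point X U w"
      "\<And>u'. \<lbrakk>u' \<in> U; k \<notin> prime_of_point X U u'\<rbrakk> \<Longrightarrow> u' \<in> W"
      using chart_nbhd [OF U W(1,2)] W(3) by blast
    then show ?thesis
      using res_closed [OF o k(1)] prime_of_point_res [OF o _ k(1)] W(3)
      by (intro bexI [of _ "res X U ?V k"]) auto
  qed
  ultimately show ?thesis unfolding chart_def using o(2) locV by blast
qed

lemma chart_Int:
  assumes "chart X U" "chart X V" "u \<in> U" "u \<in> V"
  obtains W where "chart X W" "u \<in> W" "W \<subseteq> U" "W \<subseteq> V"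
proof -
  obtain h where h: "h \<in> carrier (sec X U)" "h \<notin> prime_of_point X U u"
    "\<And>u'. \<lbrakk>u' \<in> U; h \<notin> prime_of_point X U u'\<rbrakk> \<Longrightarrow> u' \<in> V"
    using chart_nbhd [OF assms(1) chartD(1) [OF assms(2)] assms(4,3)] by blast
  show thesis
    by (rule that [OF chart_basic_open [OF assms(1) h(1) assms(3) h(2)]]) (use assms h in auto)
qed

lemma chart_within:
  assumes "chart X U" "Op V" "u \<in> U" "u \<in> V"
  obtains W where "chart X W" "u \<in> W" "W \<subseteq> U" "W \<subseteq> V"
proof -
  obtain h where h: "h \<in> carrier (sec X U)" "h \<notin> prime_of_point X U u"
    "\<And>u'. \<lbrakk>u' \<in> U; h \<notin> prime_of_point X U u'\<rbrakk> \<Longrightarrow> u' \<in> V"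
    using chart_nbhd [OF assms(1,2) assms(4,3)] by blast
  show thesis
    by (rule that [OF chart_basic_open [OF assms(1) h(1) assms(3) h(2)]]) (use assms h in auto)
qed

text \<open>A basic open set of \<open>U\<close> that contains the closed point of \<open>V\<close>
  contains all of \<open>V\<close>; choosing one inside \<open>V\<close> gives equality. So affine
  opens in affine opens are basic, which is false for schemes in general.\<close>

lemma chart_subset:
  assumes U: "chart X U" and V: "chart X V" "V \<subseteq> U" "w \<in> V"
  shows "localization (sec X U) (sec X V) (res X U V)"
    and "\<exists>h\<in>carrier (sec X U). V = {u \<in> U. h \<notin> prime_of_point X U u}"
proof -
  obtain v where v: "center V v" by (rule chart_center [OF V(1,3)])
  have o: "Op U" "Op V" using chartD U V by auto
  show "localization (sec X U) (sec X V) (res X U V)"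
    by (rule center_localization [OF U o(2) V(2) v])
  obtain h where h: "h \<in> carrier (sec X U)" "h \<notin> prime_of_point X U v"
    "\<And>u'. \<lbrakk>u' \<in> U; h \<notin> prime_of_point X U u'\<rbrakk> \<Longrightarrow> u' \<in> V"
    using chart_nbhd [OF U o(2)] v V(2) by (auto simp: center_def)
  have "V \<subseteq> {u \<in> U. h \<notin> prime_of_point X U u}"
    using basic_open [OF o(1) h(1)] v h V(2) unfolding center_def by blast
  then have "V = {u \<in> U. h \<notin> prime_of_point X U u}" using h(3) by blast
  then show "\<exists>h\<in>carrier (sec X U). V = {u \<in> U. h \<notin> prime_of_point X U u}" using h(1) by blast
qed

lemma point_of_prime_eq:
  assumes "chart X U" "u \<in> U"
  shows "point_of_prime X U (prime_of_point X U u) = u"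
  unfolding point_of_prime_def using assms chartD(3) [OF assms(1)] by (intro the_equality) auto

end

section \<open>The affine opens are exactly the charts\<close>

lemma MSpec_simps:
  "spc (MSpec A) = MSpec_top A"
  "carrier (sec (MSpec A) W) = local_fractions A (MSpec_top A) W"
  "s \<otimes>\<^bsub>sec (MSpec A) W\<^esub> t = (\<lambda>P\<in>W. fraction_mult A (carrier A - P) (s P) (t P))"
  "\<one>\<^bsub>sec (MSpec A) W\<^esub> = (\<lambda>P\<in>W. fraction A (carrier A - P) \<one>\<^bsub>A\<^esub> \<one>\<^bsub>A\<^esub>)"
  "pzero (sec (MSpec A) W) = (\<lambda>P\<in>W. fraction A (carrier A - P) (pzero A) \<one>\<^bsub>A\<^esub>)"
  "res (MSpec A) V W s = restrict s W"
  by (simp_all add: MSpec_def pm_loc_def)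

lemma pm_isoD:
  assumes "h \<in> pm_iso A B"
  shows "a \<in> carrier A \<Longrightarrow> h a \<in> carrier B"
    and "\<lbrakk>a \<in> carrier A; b \<in> carrier A\<rbrakk> \<Longrightarrow> h (a \<otimes>\<^bsub>A\<^esub> b) = h a \<otimes>\<^bsub>B\<^esub> h b"
    and "h \<one>\<^bsub>A\<^esub> = \<one>\<^bsub>B\<^esub>" and "h (pzero A) = pzero B"
    and "\<lbrakk>a \<in> carrier A; b \<in> carrier A; h a = h b\<rbrakk> \<Longrightarrow> a = b"
    and "c \<in> carrier B \<Longrightarrow> \<exists>a\<in>carrier A. h a = c"
proof -
  assume "c \<in> carrier B"
  then have "c \<in> h ` carrier A" using assms by (simp add: pm_iso_def bij_betw_def)
  then show "\<exists>a\<in>carrier A. h a = c" by blast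
qed (use assms in \<open>auto simp: pm_iso_def pm_hom_def hom_def bij_betw_def inj_on_def\<close>)

lemma local_fractions_cases:
  assumes "s \<in> local_fractions A T V" "P \<in> V"
  obtains W a h where "openin T W" "P \<in> W" "W \<subseteq> V" "a \<in> carrier A" "h \<in> carrier A"
    "\<And>Q. Q \<in> W \<Longrightarrow> h \<notin> Q" "\<And>Q. Q \<in> W \<Longrightarrow> s Q = fraction A (carrier A - Q) a h"
proof -
  have "\<exists>W. openin T W \<and> P \<in> W \<and> W \<subseteq> V \<and> (\<exists>a \<in> carrier A. \<exists>h \<in> carrier A.
          \<forall>Q\<in>W. h \<notin> Q \<and> s Q = fraction A (carrier A - Q) a h)"
    using assms unfolding local_fractions_def by simp
  then show thesis using that by (elim exE conjE bexE) simp
qed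

definition cfrac :: "'a pmonoid \<Rightarrow> 'a set set \<Rightarrow> 'a \<Rightarrow> 'a \<Rightarrow> 'a set \<Rightarrow> ('a \<times> 'a) set" where
  "cfrac A W a h = (\<lambda>P\<in>W. fraction A (carrier A - P) a h)"

lemma cfrac_local_fractions:
  assumes "openin (MSpec_top A) W" "a \<in> carrier A" "h \<in> carrier A" "\<And>P. P \<in> W \<Longrightarrow> h \<notin> P"
  shows "cfrac A W a h \<in> local_fractions A (MSpec_top A) W"
  unfolding local_fractions_def
proof (intro CollectI conjI ballI)
  show "cfrac A W a h \<in> extensional W" by (simp add: cfrac_def)
  fix P assume "P \<in> W"
  then show "\<exists>W'. openin (MSpec_top A) W' \<and> P \<in> W' \<and> W' \<subseteq> W \<and>
      (\<exists>a'\<in>carrier A. \<exists>h'\<in>carrier A. \<forall>Q\<in>W'. h' \<notin> Q \<and> cfrac A W a h Q = fraction A (carrier A - Q) a' h')"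
    using assms by (intro exI [of _ W] conjI bexI [of _ a] bexI [of _ h] ballI) (simp_all add: cfrac_def)
qed

context pm
begin

lemma MSpec_open_prime: "\<lbrakk>openin (MSpec_top A) W; P \<in> W\<rbrakk> \<Longrightarrow> pm_prime_ideal A P"
  using openin_MSpec [OF pointed_monoid_axioms, of W] by auto

lemma cfrac_mult:
  assumes W: "openin (MSpec_top A) W" and "a \<in> carrier A" "b \<in> carrier A" "h \<in> carrier A" "k \<in> carrier A"
    "\<And>P. P \<in> W \<Longrightarrow> h \<notin> P" "\<And>P. P \<in> W \<Longrightarrow> k \<notin> P"
  shows "cfrac A W a h \<otimes>\<^bsub>sec (MSpec A) W\<^esub> cfrac A W b k = cfrac A W (a \<otimes> b) (h \<otimes> k)"
proof -
  have "fraction_mult A (carrier A - P) (cfrac A W a h P) (cfrac A W b k P) = fraction A (carrier A - P) (a \<otimes> b) (h \<otimes> k)"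
    if P: "P \<in> W" for P
  proof -
    interpret mult_set A "carrier A - P"
      by (rule pm_prime_mult_set [OF pointed_monoid_axioms MSpec_open_prime [OF W P]])
    show ?thesis using assms P by (simp add: cfrac_def fraction_mult_eq)
  qed
  then show ?thesis unfolding MSpec_simps by (subst cfrac_def [of A W "a \<otimes> b"]) (rule restrict_ext)
qed

lemma cfrac_eqI:
  assumes W: "openin (MSpec_top A) W" and "a \<in> carrier A" "b \<in> carrier A" "h \<in> carrier A" "k \<in> carrier A"
    "\<And>P. P \<in> W \<Longrightarrow> h \<notin> P" "\<And>P. P \<in> W \<Longrightarrow> k \<notin> P" "a \<otimes> k = b \<otimes> h"
  shows "cfrac A W a h = cfrac A W b k"
  unfolding cfrac_def
proof (rule restrict_ext)
  fix P assume P: "P \<in> W"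
  interpret mult_set A "carrier A - P"
    by (rule pm_prime_mult_set [OF pointed_monoid_axioms MSpec_open_prime [OF W P]])
  show "fraction A (carrier A - P) a h = fraction A (carrier A - P) b k"
    using assms P by (intro fraction_eqI) auto
qed

end

context pm_sheaf
begin

text \<open>The monoid \<open>A\<close> is only isomorphic to the sections over \<open>U\<close>.
  The map \<open>\<alpha>\<close> sends \<open>a\<close> to the section \<open>a/1\<close>; the
  facts \<open>K1\<close> to \<open>K4\<close> describe germs at \<open>u\<close> as fractions of
  \<open>A\<close> at the prime \<open>\<phi> u\<close>, and the clauses of \<open>chart\<close> are
  read off through \<open>\<alpha>\<close>.\<close>

lemma affine_imp_chart:
  fixes A :: "'s pmonoid"
  assumes U: "Op U" and A: "pointed_monoid A" and iso: "pm_space_iso (open_subspace X U) (MSpec A) \<phi> \<psi>"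
  shows "chart X U"
proof -
  interpret A: pm A using A by (rule pm.intro)
  let ?M = "MSpec_top A"
  let ?T = "{P. pm_prime_ideal A P}"
  let ?S = "subtopology (spc X) U"
  define pre where "pre W = {x \<in> U. \<phi> x \<in> W}" for W
  have sp: "topspace ?S = U" "spc (open_subspace X U) = ?S" "sec (open_subspace X U) = sec X"
    "res (open_subspace X U) = res X"
    using U openin_subset [OF U] by (auto simp: open_subspace_def)
  have top: "topspace ?M = ?T" by (rule topspace_MSpec [OF A])
  have homeo: "homeomorphic_map ?S ?M \<phi>"
    and \<psi>: "\<And>W. openin ?M W \<Longrightarrow> \<psi> W \<in> pm_iso (sec (MSpec A) W) (sec X (pre W))"
    and nat: "\<And>V W s. \<lbrakk>openin ?M V; openin ?M W; W \<subseteq> V; s \<in> local_fractions A ?M V\<rbrakk> \<Longrightarrow>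
        \<psi> W (restrict s W) = res X (pre V) (pre W) (\<psi> V s)"
    using iso unfolding pm_space_iso_def Let_def sp MSpec_simps pre_def by blast+
  have img: "\<phi> ` U = ?T" and inj: "inj_on \<phi> U"
    using homeomorphic_imp_surjective_map [OF homeo] homeomorphic_imp_injective_map [OF homeo]
    unfolding sp top by simp_all
  have \<phi>P: "pm_prime_ideal A (\<phi> u)" if "u \<in> U" for u using img that by auto
  have preO: "Op (pre W)" if "openin ?M W" for W
  proof -
    have "openin ?S {x \<in> topspace ?S. \<phi> x \<in> W}"
      by (rule openin_continuous_map_preimage [OF homeomorphic_imp_continuous_map [OF homeo] that])
    then have "openin ?S (pre W)" unfolding sp pre_def .
    then show ?thesis using U by (simp add: openin_open_subtopology)
  qed
  have imgO: "openin ?M (\<phi> ` W)" and pre_img: "pre (\<phi> ` W) = W" if "Op W" "W \<subseteq> U" for W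
  proof -
    have "openin ?S W" using that U by (simp add: openin_open_subtopology)
    then show "openin ?M (\<phi> ` W)" using homeomorphic_imp_open_map [OF homeo] by (simp add: open_map_def)
    show "pre (\<phi> ` W) = W" using inj that by (auto simp: pre_def inj_on_def)
  qed
  have TO: "openin ?M ?T" using openin_topspace [of ?M] by (simp add: top)
  have preT: "pre ?T = U" using \<phi>P by (auto simp: pre_def)
  note one_notin = pm_prime_ideal_one [OF A]
  note WP = A.MSpec_open_prime
  have one_T: "\<one>\<^bsub>A\<^esub> \<notin> P" if "P \<in> ?T" for P using that one_notin by simp
  define \<alpha> where "\<alpha> a = \<psi> ?T (cfrac A ?T a \<one>\<^bsub>A\<^esub>)" for a
  have cT: "cfrac A ?T a \<one>\<^bsub>A\<^esub> \<in> carrier (sec (MSpec A) ?T)" if "a \<in> carrier A" for a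
    unfolding MSpec_simps by (intro cfrac_local_fractions TO that A.one_closed) (use one_notin in blast)
  have \<alpha>_hom: "\<alpha> \<in> pm_hom A (sec X U)"
  proof (rule pm_homI)
    show "\<alpha> a \<in> carrier (sec X U)" if "a \<in> carrier A" for a
      using pm_isoD(1) [OF \<psi> [OF TO] cT [OF that]] by (simp add: \<alpha>_def preT)
    show "\<alpha> (a \<otimes>\<^bsub>A\<^esub> b) = \<alpha> a \<otimes>\<^bsub>sec X U\<^esub> \<alpha> b" if ab: "a \<in> carrier A" "b \<in> carrier A" for a b
      using pm_isoD(2) [OF \<psi> [OF TO] cT [OF ab(1)] cT [OF ab(2)]]
        A.cfrac_mult [OF TO ab A.one_closed A.one_closed one_T one_T]
      by (simp add: \<alpha>_def preT)
    show "\<alpha> \<one>\<^bsub>A\<^esub> = \<one>\<^bsub>sec X U\<^esub>" "\<alpha> (pzero A) = pzero (sec X U)"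
      using pm_isoD(3,4) [OF \<psi> [OF TO]] by (simp_all add: \<alpha>_def preT MSpec_simps cfrac_def)
  qed
  note \<alpha> = pm_homD [OF \<alpha>_hom]
  have \<alpha>_res: "res X U (pre W) (\<alpha> a) = \<psi> W (cfrac A W a \<one>\<^bsub>A\<^esub>)" if W: "openin ?M W" and a: "a \<in> carrier A" for W a
  proof -
    have "W \<subseteq> ?T" using WP [OF W] by auto
    moreover have "restrict (cfrac A ?T a \<one>\<^bsub>A\<^esub>) W = cfrac A W a \<one>\<^bsub>A\<^esub>"
      using calculation by (intro ext) (auto simp: cfrac_def restrict_def)
    moreover have "\<psi> W (restrict (cfrac A ?T a \<one>\<^bsub>A\<^esub>) W) = res X (pre ?T) (pre W) (\<psi> ?T (cfrac A ?T a \<one>\<^bsub>A\<^esub>))"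
      by (rule nat [OF TO W calculation(1) cT [OF a, unfolded MSpec_simps]])
    ultimately show ?thesis unfolding \<alpha>_def preT by simp
  qed
  \<comment> \<open>The section \<open>a/h\<close> times the global section of \<open>h\<close> is
    the section of \<open>a\<close>; transported to X, this feeds \<open>K1\<close> and
    \<open>K2\<close>.\<close>
  have clear: "\<psi> W (cfrac A W a h) \<otimes>\<^bsub>sec X (pre W)\<^esub> res X U (pre W) (\<alpha> h) = res X U (pre W) (\<alpha> a)"
    if W: "openin ?M W" and ah: "a \<in> carrier A" "h \<in> carrier A" and h: "\<And>P. P \<in> W \<Longrightarrow> h \<notin> P" for W a h
  proof -
    have one: "\<And>P. P \<in> W \<Longrightarrow> \<one>\<^bsub>A\<^esub> \<notin> P" using WP [OF W] one_notin by blast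
    have c: "cfrac A W a h \<in> carrier (sec (MSpec A) W)" "cfrac A W h \<one>\<^bsub>A\<^esub> \<in> carrier (sec (MSpec A) W)"
      using W ah h one by (simp_all add: MSpec_simps cfrac_local_fractions)
    have "\<psi> W (cfrac A W a h) \<otimes>\<^bsub>sec X (pre W)\<^esub> \<psi> W (cfrac A W h \<one>\<^bsub>A\<^esub>) =
        \<psi> W (cfrac A W (a \<otimes>\<^bsub>A\<^esub> h) (h \<otimes>\<^bsub>A\<^esub> \<one>\<^bsub>A\<^esub>))"
      using pm_isoD(2) [OF \<psi> [OF W] c] W ah h one by (simp add: A.cfrac_mult)
    also have "cfrac A W (a \<otimes>\<^bsub>A\<^esub> h) (h \<otimes>\<^bsub>A\<^esub> \<one>\<^bsub>A\<^esub>) = cfrac A W a \<one>\<^bsub>A\<^esub>"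
      using W ah h one by (intro A.cfrac_eqI) auto
    finally show ?thesis using \<alpha>_res [OF W] ah by simp
  qed
  \<comment> \<open>The section \<open>1/h\<close> exists on the basic open set of \<open>h\<close>
    and provides the inverse.\<close>
  have K1: "germ X u U (\<alpha> h) \<in> Units (pm_stalk X u)" if u: "u \<in> U" and h: "h \<in> carrier A" "h \<notin> \<phi> u" for u h
  proof -
    let ?W = "{P. pm_prime_ideal A P \<and> h \<notin> P}"
    have W: "openin ?M ?W" unfolding openin_MSpec [OF A] using h by blast
    have uW: "u \<in> pre ?W" using u h \<phi>P by (simp add: pre_def)
    have sub: "pre ?W \<subseteq> U" by (auto simp: pre_def)
    interpret S: pm "pm_stalk X u" using stalk_pm topI U u by blast
    let ?t = "\<psi> ?W (cfrac A ?W \<one>\<^bsub>A\<^esub> h)"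
    have t: "?t \<in> carrier (sec X (pre ?W))"
      unfolding MSpec_simps
      by (rule pm_isoD(1) [OF \<psi> [OF W], unfolded MSpec_simps], rule cfrac_local_fractions [OF W A.one_closed h(1)]) simp
    have "germ X u (pre ?W) ?t \<otimes>\<^bsub>pm_stalk X u\<^esub> germ X u U (\<alpha> h) = germ X u U (\<alpha> \<one>\<^bsub>A\<^esub>)"
      using arg_cong [OF clear [OF W, of "\<one>\<^bsub>A\<^esub>" h], of "germ X u (pre ?W)"] h t uW preO [OF W] U sub \<alpha>
        germ_res [OF U preO [OF W] sub uW sec_one_closed [OF U]]
      by (simp add: germ_res res_closed flip: germ_mult)
    then have "germ X u (pre ?W) ?t \<otimes>\<^bsub>pm_stalk X u\<^esub> germ X u U (\<alpha> h) \<in> Units (pm_stalk X u)"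
      using stalk_one [OF U u] \<alpha>(3) S.Units_one_closed by simp
    then show ?thesis
      using S.Units_mult_iff germ_closed [OF preO [OF W] uW t] germ_closed [OF U u \<alpha>(1) [OF h(1)]] by blast
  qed
  \<comment> \<open>Sections of the structure sheaf are locally single fractions, so every germ is a
    fraction after shrinking.\<close>
  have K2: "\<exists>a\<in>carrier A. \<exists>h\<in>carrier A. h \<notin> \<phi> u \<and>
      g \<otimes>\<^bsub>pm_stalk X u\<^esub> germ X u U (\<alpha> h) = germ X u U (\<alpha> a)"
    if u: "u \<in> U" and g: "g \<in> carrier (pm_stalk X u)" for u g
  proof -
    obtain V t where V: "Op V" "u \<in> V" "V \<subseteq> U" "t \<in> carrier (sec X V)" "g = germ X u V t"
      by (rule stalk_cases_within [OF g U u])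
    note W = imgO [OF V(1,3)] and pW = pre_img [OF V(1,3)]
    obtain s where s: "s \<in> local_fractions A ?M (\<phi> ` V)" "\<psi> (\<phi> ` V) s = t"
      using pm_isoD(6) [OF \<psi> [OF W], of t] V(4) by (auto simp: pW MSpec_simps)
    obtain W' a h where W': "openin ?M W'" "\<phi> u \<in> W'" "W' \<subseteq> \<phi> ` V" "a \<in> carrier A" "h \<in> carrier A"
      "\<And>Q. Q \<in> W' \<Longrightarrow> h \<notin> Q" "\<And>Q. Q \<in> W' \<Longrightarrow> s Q = fraction A (carrier A - Q) a h"
      by (rule local_fractions_cases [OF s(1) imageI [OF V(2)]]) blast
    have "restrict s W' = cfrac A W' a h"
      unfolding cfrac_def by (rule restrict_ext) (rule W'(7))
    then have rt: "res X V (pre W') t = \<psi> W' (cfrac A W' a h)"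
      using nat [OF W W'(1,3) s(1)] by (simp add: pW s(2))
    have uW: "u \<in> pre W'" "pre W' \<subseteq> V" "pre W' \<subseteq> U" using u W'(2,3) pW by (auto simp: pre_def)
    have "germ X u (pre W') (res X V (pre W') t) \<otimes>\<^bsub>pm_stalk X u\<^esub> germ X u (pre W') (res X U (pre W') (\<alpha> h)) =
        germ X u (pre W') (res X U (pre W') (\<alpha> a))"
      using clear [OF W'(1,4,5,6)] uW preO [OF W'(1)] V U \<alpha>(1) W'(4,5)
      by (subst germ_mult) (simp_all add: res_closed rt [symmetric])
    then have "g \<otimes>\<^bsub>pm_stalk X u\<^esub> germ X u U (\<alpha> h) = germ X u U (\<alpha> a)"
      using uW preO [OF W'(1)] V U \<alpha>(1) W'(4,5) by (simp add: germ_res)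
    then show ?thesis using W' by blast
  qed
  have K3: "\<exists>k\<in>carrier A. k \<notin> \<phi> u \<and> k \<otimes>\<^bsub>A\<^esub> a = k \<otimes>\<^bsub>A\<^esub> b"
    if u: "u \<in> U" and ab: "a \<in> carrier A" "b \<in> carrier A" and eq: "germ X u U (\<alpha> a) = germ X u U (\<alpha> b)" for u a b
  proof -
    obtain V where V: "Op V" "u \<in> V" "V \<subseteq> U" "res X U V (\<alpha> a) = res X U V (\<alpha> b)"
      using eq germ_eq_iff [OF U u \<alpha>(1) [OF ab(1)] U u \<alpha>(1) [OF ab(2)]] by auto
    note W = imgO [OF V(1,3)] and pW = pre_img [OF V(1,3)]
    have "\<psi> (\<phi> ` V) (cfrac A (\<phi> ` V) a \<one>\<^bsub>A\<^esub>) = \<psi> (\<phi> ` V) (cfrac A (\<phi> ` V) b \<one>\<^bsub>A\<^esub>)"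
      using V(4) \<alpha>_res [OF W] ab by (simp add: pW)
    moreover have "cfrac A (\<phi> ` V) c \<one>\<^bsub>A\<^esub> \<in> carrier (sec (MSpec A) (\<phi> ` V))" if "c \<in> carrier A" for c
      using W that one_notin WP [OF W] unfolding MSpec_simps by (intro cfrac_local_fractions) auto
    ultimately have ce: "cfrac A (\<phi> ` V) a \<one>\<^bsub>A\<^esub> = cfrac A (\<phi> ` V) b \<one>\<^bsub>A\<^esub>"
      using pm_isoD(5) [OF \<psi> [OF W]] ab by blast
    have f: "fraction A (carrier A - \<phi> u) a \<one>\<^bsub>A\<^esub> = fraction A (carrier A - \<phi> u) b \<one>\<^bsub>A\<^esub>"
      using fun_cong [OF ce, of "\<phi> u"] imageI [OF V(2), of \<phi>] by (simp add: cfrac_def)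
    interpret mult_set A "carrier A - \<phi> u" by (rule pm_prime_mult_set [OF A \<phi>P [OF u]])
    show ?thesis using f ab S_one by (auto simp: fraction_eq_iff)
  qed
  \<comment> \<open>The new half is the converse of \<open>K1\<close>: an inverse of the germ is a
    fraction \<open>b/h\<close> by \<open>K2\<close>, and \<open>K3\<close> turns the relation into
    one in \<open>A\<close> whose right hand side avoids the prime.\<close>
  have K4: "germ X u U (\<alpha> a) \<in> Units (pm_stalk X u) \<longleftrightarrow> a \<notin> \<phi> u" if u: "u \<in> U" and a: "a \<in> carrier A" for u a
  proof
    interpret S: pm "pm_stalk X u" using stalk_pm topI U u by blast
    note pr = pm_prime_mult_iff [OF A \<phi>P [OF u]]
    have ga: "germ X u U (\<alpha> a) \<in> carrier (pm_stalk X u)" using U u \<alpha>(1) a by (simp add: germ_closed)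
    assume "germ X u U (\<alpha> a) \<in> Units (pm_stalk X u)"
    then obtain g where g: "g \<in> carrier (pm_stalk X u)" "g \<otimes>\<^bsub>pm_stalk X u\<^esub> germ X u U (\<alpha> a) = \<one>\<^bsub>pm_stalk X u\<^esub>"
      by (auto simp: Units_def)
    obtain b h where b: "b \<in> carrier A" "h \<in> carrier A" "h \<notin> \<phi> u"
      "g \<otimes>\<^bsub>pm_stalk X u\<^esub> germ X u U (\<alpha> h) = germ X u U (\<alpha> b)" using K2 [OF u g(1)] by blast
    have gh: "germ X u U (\<alpha> h) \<in> carrier (pm_stalk X u)" using U u \<alpha>(1) b by (simp add: germ_closed)
    have "germ X u U (\<alpha> (b \<otimes>\<^bsub>A\<^esub> a)) = germ X u U (\<alpha> b) \<otimes>\<^bsub>pm_stalk X u\<^esub> germ X u U (\<alpha> a)"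
      using U u a b \<alpha> by (simp add: germ_mult)
    also have "\<dots> = (g \<otimes>\<^bsub>pm_stalk X u\<^esub> germ X u U (\<alpha> a)) \<otimes>\<^bsub>pm_stalk X u\<^esub> germ X u U (\<alpha> h)"
      unfolding b(4) [symmetric] using g(1) ga gh by (simp add: S.m_ac)
    also have "\<dots> = germ X u U (\<alpha> h)" using g gh by simp
    finally obtain k where k: "k \<in> carrier A" "k \<notin> \<phi> u" "k \<otimes>\<^bsub>A\<^esub> (b \<otimes>\<^bsub>A\<^esub> a) = k \<otimes>\<^bsub>A\<^esub> h"
      using K3 [OF u, of "b \<otimes>\<^bsub>A\<^esub> a" h] a b by auto
    then have "k \<otimes>\<^bsub>A\<^esub> (b \<otimes>\<^bsub>A\<^esub> a) \<notin> \<phi> u" using b by (simp add: pr)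
    then show "a \<notin> \<phi> u" using a b k(1) by (simp add: pr)
  qed (use K1 u a in blast)
  \<comment> \<open>A section over the whole spectrum is a single fraction near the prime of
    nonunits, whose only neighbourhood is the whole spectrum, and its denominator is a unit. If
    there is no prime at all, there is only one section.\<close>
  have \<alpha>_surj: "\<exists>a\<in>carrier A. \<alpha> a = s" if s: "s \<in> carrier (sec X U)" for s
  proof -
    obtain s' where s': "s' \<in> local_fractions A ?M ?T" "\<psi> ?T s' = s"
      using pm_isoD(6) [OF \<psi> [OF TO], of s] s by (auto simp: preT MSpec_simps)
    show ?thesis
    proof (cases "?T = {}")
      case True
      then have "s' = cfrac A ?T \<one>\<^bsub>A\<^esub> \<one>\<^bsub>A\<^esub>"
        using s'(1) by (auto simp: local_fractions_def cfrac_def extensional_def)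
      then have "\<alpha> \<one>\<^bsub>A\<^esub> = s" using s' by (simp add: \<alpha>_def)
      then show ?thesis using A.one_closed by blast
    next
      case False
      then obtain Q where Q: "pm_prime_ideal A Q" by blast
      have nT: "carrier A - Units A \<in> ?T" using A.nonunits_prime [OF Q] by simp
      obtain W' a h where W': "openin ?M W'" "carrier A - Units A \<in> W'" "a \<in> carrier A" "h \<in> carrier A"
        "\<And>Q. Q \<in> W' \<Longrightarrow> h \<notin> Q" "\<And>Q. Q \<in> W' \<Longrightarrow> s' Q = fraction A (carrier A - Q) a h"
        by (rule local_fractions_cases [OF s'(1) nT]) blast
      have hU: "h \<in> Units A" using W'(4) W'(5) [OF W'(2)] by simp
      obtain k where k: "k \<in> carrier A" "k \<in> Units A" "\<And>P. pm_prime_ideal A P \<Longrightarrow> k \<notin> P \<Longrightarrow> P \<in> W'"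
      proof -
        obtain k where "k \<in> carrier A" "k \<notin> carrier A - Units A" "\<And>P. pm_prime_ideal A P \<Longrightarrow> k \<notin> P \<Longrightarrow> P \<in> W'"
          using bspec [OF W'(1) [unfolded openin_MSpec [OF A]] W'(2)] by blast
        then show thesis using that by blast
      qed
      have unit_notin: "u \<notin> P" if "u \<in> Units A" "pm_prime_ideal A P" for u P
      proof
        assume "u \<in> P"
        then have "inv\<^bsub>A\<^esub> u \<otimes>\<^bsub>A\<^esub> u \<in> P"
          using pm_prime_mult_iff [OF A that(2), of "inv\<^bsub>A\<^esub> u" u] that(1) A.Units_closed by simp
        then show False using that one_notin by simp
      qed
      have WT: "P \<in> W'" if "pm_prime_ideal A P" for P using k unit_notin that by blast
      have "s' = cfrac A ?T a h"
      proof (rule extensionalityI [of _ ?T])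
        show "s' \<in> extensional ?T" using s'(1) by (simp add: local_fractions_def)
      qed (use W'(6) WT in \<open>auto simp: cfrac_def\<close>)
      also have "\<dots> = cfrac A ?T (a \<otimes>\<^bsub>A\<^esub> inv\<^bsub>A\<^esub> h) \<one>\<^bsub>A\<^esub>"
        using TO W'(3,4,5) WT one_notin hU by (intro A.cfrac_eqI) (auto simp: A.m_assoc)
      finally have "\<alpha> (a \<otimes>\<^bsub>A\<^esub> inv\<^bsub>A\<^esub> h) = s" using s'(2) by (simp add: \<alpha>_def)
      then show ?thesis using W'(3) hU by auto
    qed
  qed
  have mem: "\<alpha> a \<in> prime_of_point X U u \<longleftrightarrow> a \<in> \<phi> u" if "u \<in> U" "a \<in> carrier A" for u a
    using K4 [OF that] \<alpha>(1) [OF that(2)] by (simp add: mem_prime_of_point)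
  have sub: "\<phi> u \<subseteq> carrier A" if "u \<in> U" for u
    using \<phi>P [OF that] by (auto simp: pm_prime_ideal_def pm_ideal_def)
  have prime: "prime_of_point X U u = \<alpha> ` \<phi> u" if u: "u \<in> U" for u
  proof (intro equalityI subsetI)
    fix f assume f: "f \<in> prime_of_point X U u"
    then obtain a where "a \<in> carrier A" "\<alpha> a = f" using \<alpha>_surj by (auto simp: mem_prime_of_point)
    then show "f \<in> \<alpha> ` \<phi> u" using f mem [OF u] by blast
  qed (use mem [OF u] sub [OF u] in blast)
  have pt_inj: "u = v" if uv: "u \<in> U" "v \<in> U" "prime_of_point X U u = prime_of_point X U v" for u v
  proof -
    have "\<phi> u = \<phi> v" using mem [OF uv(1)] mem [OF uv(2)] uv(3) sub [OF uv(1)] sub [OF uv(2)] by blast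
    then show ?thesis using inj uv by (auto simp: inj_on_def)
  qed
  have U': "pointed_monoid (sec X U)" using sec_pointed_monoid U .
  have pt_surj: "\<exists>u\<in>U. prime_of_point X U u = P" if P: "pm_prime_ideal (sec X U) P" for P
  proof -
    have "{a \<in> carrier A. \<alpha> a \<in> P} \<in> \<phi> ` U"
      using pm_prime_vimage [OF A U' \<alpha>_hom P] img by simp
    then obtain u where u: "u \<in> U" "\<phi> u = {a \<in> carrier A. \<alpha> a \<in> P}" by auto
    have "P \<subseteq> carrier (sec X U)" using P by (auto simp: pm_prime_ideal_def pm_ideal_def)
    then have "\<alpha> ` \<phi> u = P" using \<alpha>_surj unfolding u(2) by fastforce
    then show ?thesis using prime u by blast
  qed
  have pt_prime: "pm_prime_ideal (sec X U) (prime_of_point X U u)" if u: "u \<in> U" for u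
  proof -
    interpret S: pm "pm_stalk X u" using stalk_pm topI U u by blast
    have "pzero A \<in> \<phi> u" using \<phi>P [OF u] by (auto simp: pm_prime_ideal_def pm_ideal_def)
    then have "pzero (pm_stalk X u) \<notin> Units (pm_stalk X u)"
      using K4 [OF u A.pzero_closed] \<alpha>(4) stalk_zero [OF U u] by simp
    then have "pm_prime_ideal (pm_stalk X u) (carrier (pm_stalk X u) - Units (pm_stalk X u))"
      using S.pzero_closed S.one_closed S.Units_one_closed
      unfolding pm_prime_ideal_def pm_ideal_def by (auto simp: S.Units_mult_iff)
    from pm_prime_vimage [OF U' S.pointed_monoid_axioms germ_hom [OF U u] this]
    show ?thesis using germ_closed [OF U u] by (simp add: prime_of_point_def cong: conj_cong)
  qed
  have "bij_betw (prime_of_point X U) U {P. pm_prime_ideal (sec X U) P}"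
    unfolding bij_betw_def inj_on_def using pt_inj pt_surj pt_prime by blast
  moreover have "\<exists>h\<in>carrier (sec X U). h \<notin> prime_of_point X U u \<and> (\<forall>u'\<in>U. h \<notin> prime_of_point X U u' \<longrightarrow> u' \<in> W)"
    if W: "Op W" "u \<in> W" "u \<in> U" for W u
  proof -
    have o: "Op (U \<inter> W)" "U \<inter> W \<subseteq> U" using W U by (auto intro: openin_Int)
    then obtain h where h: "h \<in> carrier A" "h \<notin> \<phi> u" "\<And>P. pm_prime_ideal A P \<Longrightarrow> h \<notin> P \<Longrightarrow> P \<in> \<phi> ` (U \<inter> W)"
      using imgO [OF o] W(2,3) unfolding openin_MSpec [OF A] by blast
    have "u' \<in> W" if "u' \<in> U" "\<alpha> h \<notin> prime_of_point X U u'" for u'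
    proof -
      have "\<phi> u' \<in> \<phi> ` (U \<inter> W)" using h mem that \<phi>P by blast
      then show ?thesis using inj that by (auto simp: inj_on_def)
    qed
    then show ?thesis using mem [OF W(3) h(1)] h \<alpha>(1) by (intro bexI [of _ "\<alpha> h"]) auto
  qed
  moreover have "localization (sec X U) (pm_stalk X u) (germ X u U)" if u: "u \<in> U" for u
    unfolding localization_def
  proof (intro conjI ballI impI)
    show "germ X u U \<in> hom (sec X U) (pm_stalk X u)" using germ_hom [OF U u] by (simp add: pm_hom_def)
  next
    fix g assume "g \<in> carrier (pm_stalk X u)"
    then obtain a h where "a \<in> carrier A" "h \<in> carrier A" "h \<notin> \<phi> u"
      "g \<otimes>\<^bsub>pm_stalk X u\<^esub> germ X u U (\<alpha> h) = germ X u U (\<alpha> a)" using K2 [OF u] by blast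
    then show "\<exists>a\<in>carrier (sec X U). \<exists>s\<in>carrier (sec X U). germ X u U s \<in> Units (pm_stalk X u) \<and>
        g \<otimes>\<^bsub>pm_stalk X u\<^esub> germ X u U s = germ X u U a"
      using \<alpha>(1) K1 [OF u] by blast
  next
    fix s t assume st: "s \<in> carrier (sec X U)" "t \<in> carrier (sec X U)" "germ X u U s = germ X u U t"
    then obtain a b where ab: "a \<in> carrier A" "\<alpha> a = s" "b \<in> carrier A" "\<alpha> b = t" using \<alpha>_surj by blast
    then obtain k where k: "k \<in> carrier A" "k \<notin> \<phi> u" "k \<otimes>\<^bsub>A\<^esub> a = k \<otimes>\<^bsub>A\<^esub> b" using K3 [OF u] st(3) by blast
    then have "\<alpha> k \<otimes>\<^bsub>sec X U\<^esub> s = \<alpha> k \<otimes>\<^bsub>sec X U\<^esub> t" using ab \<alpha>(2) by metis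
    then show "\<exists>k\<in>carrier (sec X U). germ X u U k \<in> Units (pm_stalk X u) \<and> k \<otimes>\<^bsub>sec X U\<^esub> s = k \<otimes>\<^bsub>sec X U\<^esub> t"
      using k \<alpha>(1) K1 [OF u] by blast
  qed
  ultimately show ?thesis unfolding chart_def using U by blast
qed

text \<open>Here \<open>A\<close> is the section monoid of \<open>U\<close>, and
  \<open>prime_of_point\<close> is the homeomorphism. An element of the stalk at \<open>u\<close> is
  turned into the set of all fractions that represent it, which is a class in the localization at
  the prime of \<open>u\<close>; sections are then compared through their germs.\<close>

lemma chart_imp_affine:
  assumes chart: "chart X U"
  shows "U \<in> affine_opens X"
proof -
  let ?A = "sec X U"
  have U: "Op U" by (rule chartD(1) [OF chart])
  have A: "pointed_monoid ?A" using sec_pointed_monoid U .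
  interpret A: pm ?A using A by (rule pm.intro)
  let ?\<phi> = "prime_of_point X U"
  let ?M = "MSpec_top ?A"
  let ?S = "subtopology (spc X) U"
  have tS: "topspace ?S = U" using openin_subset [OF U] by auto
  have top: "topspace ?M = {P. pm_prime_ideal ?A P}" by (rule topspace_MSpec [OF A])
  note \<phi>P = chartD(2) [OF chart]
  have img: "?\<phi> ` U = {P. pm_prime_ideal ?A P}" and inj: "inj_on ?\<phi> U"
    using chart by (auto simp: chart_def bij_betw_def)
  define pre where "pre W = {u \<in> U. ?\<phi> u \<in> W}" for W
  have preO: "Op (pre W)" if W: "openin ?M W" for W
  proof (subst openin_subopen, rule ballI)
    fix u assume u: "u \<in> pre W"
    then obtain h where h: "h \<in> carrier ?A" "h \<notin> ?\<phi> u" "\<And>P. pm_prime_ideal ?A P \<Longrightarrow> h \<notin> P \<Longrightarrow> P \<in> W"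
      using W unfolding openin_MSpec [OF A] pre_def by blast
    then show "\<exists>T. Op T \<and> u \<in> T \<and> T \<subseteq> pre W"
      using u \<phi>P basic_open [OF U h(1)] by (intro exI [of _ "{u \<in> U. h \<notin> ?\<phi> u}"]) (auto simp: pre_def)
  qed
  have imgO: "openin ?M (?\<phi> ` W)" if W: "Op W" "W \<subseteq> U" for W
    unfolding openin_MSpec [OF A]
  proof
    fix P assume "P \<in> ?\<phi> ` W"
    then obtain u where u: "u \<in> W" "u \<in> U" "P = ?\<phi> u" using W by blast
    obtain h where h: "h \<in> carrier ?A" "h \<notin> ?\<phi> u" "\<And>u'. \<lbrakk>u' \<in> U; h \<notin> ?\<phi> u'\<rbrakk> \<Longrightarrow> u' \<in> W"
      using chart_nbhd [OF chart W(1) u(1,2)] by blast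
    have "P' \<in> ?\<phi> ` W" if P': "pm_prime_ideal ?A P'" "h \<notin> P'" for P'
    proof -
      obtain v where "v \<in> U" "?\<phi> v = P'" by (rule chart_point [OF chart P'(1)])
      then show ?thesis using h(3) P'(2) by auto
    qed
    then show "pm_prime_ideal ?A P \<and> (\<exists>h\<in>carrier ?A. h \<notin> P \<and> (\<forall>P'. pm_prime_ideal ?A P' \<longrightarrow> h \<notin> P' \<longrightarrow> P' \<in> ?\<phi> ` W))"
      using u h \<phi>P by blast
  qed
  have homeo: "homeomorphic_map ?S ?M ?\<phi>"
  proof (rule bijective_open_imp_homeomorphic_map)
    show "continuous_map ?S ?M ?\<phi>"
      unfolding continuous_map_def tS
    proof (intro conjI allI impI)
      show "?\<phi> \<in> U \<rightarrow> topspace ?M" using \<phi>P by (simp add: top)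
      fix W assume "openin ?M W"
      then show "openin ?S {x \<in> U. ?\<phi> x \<in> W}"
        using preO [of W] U by (auto simp: pre_def openin_open_subtopology)
    qed
    show "open_map ?S ?M ?\<phi>"
      using imgO U by (simp add: open_map_def openin_open_subtopology)
    show "?\<phi> ` topspace ?S = topspace ?M" "inj_on ?\<phi> (topspace ?S)"
      using img inj by (simp_all only: tS top)
  qed
  define pt where "pt = the_inv_into U ?\<phi>"
  have pt: "pt (?\<phi> u) = u" if "u \<in> U" for u unfolding pt_def using the_inv_into_f_f [OF inj that] .
  have pt_pre: "pt P \<in> U" "?\<phi> (pt P) = P" "pt P \<in> pre W" if W: "openin ?M W" "P \<in> W" for W P
  proof -
    have "pm_prime_ideal ?A P" by (rule A.MSpec_open_prime [OF W])
    then have "P \<in> ?\<phi> ` U" using img by simp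
    then obtain u where u: "u \<in> U" "P = ?\<phi> u" by blast
    then show "pt P \<in> U" "?\<phi> (pt P) = P" "pt P \<in> pre W" using pt W by (auto simp: pre_def)
  qed
  have preU: "pre W \<subseteq> U" for W by (auto simp: pre_def)
  let ?g = "\<lambda>u. germ X u U"
  let ?m = "\<lambda>u. mult (pm_stalk X u)"
  define fs where "fs g u = {(a, h). a \<in> carrier ?A \<and> h \<in> carrier ?A \<and> h \<notin> ?\<phi> u \<and> ?m u g (?g u h) = ?g u a}" for g u
  have gc: "?g u a \<in> carrier (pm_stalk X u)" if "u \<in> U" "a \<in> carrier ?A" for u a using germ_closed [OF U that] .
  have gm: "?m u (?g u a) (?g u b) = ?g u (a \<otimes>\<^bsub>?A\<^esub> b)" if "u \<in> U" "a \<in> carrier ?A" "b \<in> carrier ?A" for u a b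
    using germ_mult [OF U that] .
  have gu: "?g u h \<in> Units (pm_stalk X u) \<longleftrightarrow> h \<notin> ?\<phi> u" if "u \<in> U" "h \<in> carrier ?A" for u h
    using that by (simp add: mem_prime_of_point)
  \<comment> \<open>The unit germ of \<open>h\<close> is cancelled, and the localization property of
    the chart turns the comparison of two representations into an equation between sections over
    \<open>U\<close>.\<close>
  have fs_eq: "fs g u = fraction ?A (carrier ?A - ?\<phi> u) a h"
    if u: "u \<in> U" and g: "g \<in> carrier (pm_stalk X u)" and ah: "(a, h) \<in> fs g u" for g u a h
  proof -
    interpret S: pm "pm_stalk X u" using stalk_pm topI U u by blast
    have ah': "a \<in> carrier ?A" "h \<in> carrier ?A" "h \<notin> ?\<phi> u" "?m u g (?g u h) = ?g u a"
      using ah by (auto simp: fs_def)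
    have "?m u g (?g u k) = ?g u b \<longleftrightarrow> (\<exists>v\<in>carrier ?A - ?\<phi> u. v \<otimes>\<^bsub>?A\<^esub> (a \<otimes>\<^bsub>?A\<^esub> k) = v \<otimes>\<^bsub>?A\<^esub> (b \<otimes>\<^bsub>?A\<^esub> h))"
      if bk: "b \<in> carrier ?A" "k \<in> carrier ?A" "k \<notin> ?\<phi> u" for b k
    proof -
      have "?m u g (?g u k) = ?g u b \<longleftrightarrow> ?m u (?g u h) (?m u g (?g u k)) = ?m u (?g u h) (?g u b)"
        using gu [OF u ah'(2)] ah' bk gc [OF u] g by (subst S.Units_l_cancel) auto
      also have "?m u (?g u h) (?m u g (?g u k)) = ?m u (?m u g (?g u h)) (?g u k)"
        using gc [OF u ah'(2)] gc [OF u bk(2)] g by (simp add: S.m_ac)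
      also have "\<dots> = ?g u (a \<otimes>\<^bsub>?A\<^esub> k)" using ah' bk u by (simp add: gm)
      also have "?m u (?g u h) (?g u b) = ?g u (b \<otimes>\<^bsub>?A\<^esub> h)" using ah' bk u by (simp add: gm A.m_comm)
      also have "(?g u (a \<otimes>\<^bsub>?A\<^esub> k) = ?g u (b \<otimes>\<^bsub>?A\<^esub> h)) \<longleftrightarrow> (\<exists>v\<in>carrier ?A - ?\<phi> u. v \<otimes>\<^bsub>?A\<^esub> (a \<otimes>\<^bsub>?A\<^esub> k) = v \<otimes>\<^bsub>?A\<^esub> (b \<otimes>\<^bsub>?A\<^esub> h))"
      proof
        assume "?g u (a \<otimes>\<^bsub>?A\<^esub> k) = ?g u (b \<otimes>\<^bsub>?A\<^esub> h)"
        then obtain v where "v \<in> carrier ?A" "?g u v \<in> Units (pm_stalk X u)" "v \<otimes>\<^bsub>?A\<^esub> (a \<otimes>\<^bsub>?A\<^esub> k) = v \<otimes>\<^bsub>?A\<^esub> (b \<otimes>\<^bsub>?A\<^esub> h)"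
          using ah' bk by (elim localization_eq [OF chartD(4) [OF chart u], rotated 2]) auto
        then show "\<exists>v\<in>carrier ?A - ?\<phi> u. v \<otimes>\<^bsub>?A\<^esub> (a \<otimes>\<^bsub>?A\<^esub> k) = v \<otimes>\<^bsub>?A\<^esub> (b \<otimes>\<^bsub>?A\<^esub> h)"
          using gu [OF u] by blast
      next
        assume "\<exists>v\<in>carrier ?A - ?\<phi> u. v \<otimes>\<^bsub>?A\<^esub> (a \<otimes>\<^bsub>?A\<^esub> k) = v \<otimes>\<^bsub>?A\<^esub> (b \<otimes>\<^bsub>?A\<^esub> h)"
        then obtain v where v: "v \<in> carrier ?A" "v \<notin> ?\<phi> u" "v \<otimes>\<^bsub>?A\<^esub> (a \<otimes>\<^bsub>?A\<^esub> k) = v \<otimes>\<^bsub>?A\<^esub> (b \<otimes>\<^bsub>?A\<^esub> h)" by blast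
        have "?m u (?g u v) (?g u (a \<otimes>\<^bsub>?A\<^esub> k)) = ?m u (?g u v) (?g u (b \<otimes>\<^bsub>?A\<^esub> h))"
          using v ah' bk u by (simp add: gm)
        then show "?g u (a \<otimes>\<^bsub>?A\<^esub> k) = ?g u (b \<otimes>\<^bsub>?A\<^esub> h)"
          using gu [OF u v(1)] v(2) ah' bk gc [OF u] by (subst (asm) S.Units_l_cancel) auto
      qed
      finally show ?thesis .
    qed
    then show ?thesis unfolding fs_def fraction_def by auto
  qed
  have fs_ex: "\<exists>a h. (a, h) \<in> fs g u" if u: "u \<in> U" and g: "g \<in> carrier (pm_stalk X u)" for g u
  proof -
    obtain a h where "a \<in> carrier ?A" "h \<in> carrier ?A" "?g u h \<in> Units (pm_stalk X u)" "?m u g (?g u h) = ?g u a"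
      by (rule localization_surj [OF chartD(4) [OF chart u] g])
    then have "(a, h) \<in> fs g u" using gu [OF u] by (simp add: fs_def)
    then show ?thesis by blast
  qed
  have fs_inj: "g = g'" if u: "u \<in> U" and g: "g \<in> carrier (pm_stalk X u)" "g' \<in> carrier (pm_stalk X u)"
    and eq: "(a, h) \<in> fs g u" "(a, h) \<in> fs g' u" for g g' u a h
  proof -
    interpret S: pm "pm_stalk X u" using stalk_pm topI U u by blast
    have *: "h \<in> carrier ?A" "?g u h \<in> Units (pm_stalk X u)" "?m u g (?g u h) = ?m u g' (?g u h)"
      using eq gu [OF u] by (auto simp: fs_def)
    then have "?m u (?g u h) g = ?m u (?g u h) g'" using g S.Units_closed [OF *(2)] by (simp add: S.m_comm)
    then show ?thesis using *(2) g S.Units_l_cancel by blast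
  qed
  define \<chi> where "\<chi> W t = (\<lambda>P\<in>W. fs (germ X (pt P) (pre W) t) (pt P))" for W t
  have gt: "germ X (pt P) (pre W) t \<in> carrier (pm_stalk X (pt P))"
    if "openin ?M W" "P \<in> W" "t \<in> carrier (sec X (pre W))" for W P t
    using germ_closed [OF preO [OF that(1)] pt_pre(3) [OF that(1,2)] that(3)] .
  \<comment> \<open>A representation of a germ as a fraction persists at nearby points where
    \<open>h\<close> stays invertible; this is the local condition in
    \<open>local_fractions\<close>.\<close>
  have near: "\<exists>N. openin ?M N \<and> P \<in> N \<and> N \<subseteq> W \<and> (\<forall>Q\<in>N. (a, h) \<in> fs (germ X (pt Q) (pre W) t) (pt Q))"
    if W: "openin ?M W" "P \<in> W" and t: "t \<in> carrier (sec X (pre W))" and ah: "(a, h) \<in> fs (germ X (pt P) (pre W) t) (pt P)"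
    for W P t a h
  proof -
    let ?u = "pt P" and ?V = "pre W"
    note u = pt_pre [OF W] and V = preO [OF W(1)]
    have ah': "a \<in> carrier ?A" "h \<in> carrier ?A" "h \<notin> ?\<phi> ?u" "?m ?u (germ X ?u ?V t) (?g ?u h) = ?g ?u a"
      using ah by (auto simp: fs_def)
    have m: "?m v (germ X v ?V t) (?g v h) = germ X v ?V (t \<otimes>\<^bsub>sec X ?V\<^esub> res X U ?V h)" if "v \<in> ?V" for v
      using germ_res [OF U V preU that ah'(2)] germ_mult [OF V that t res_closed [OF U V preU ah'(2)]] by simp
    have "germ X ?u ?V (t \<otimes>\<^bsub>sec X ?V\<^esub> res X U ?V h) = ?g ?u a" using m [OF u(3)] ah'(4) by simp
    then obtain N where N: "Op N" "?u \<in> N" "N \<subseteq> ?V \<inter> U"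
      "\<And>y. y \<in> N \<Longrightarrow> germ X y ?V (t \<otimes>\<^bsub>sec X ?V\<^esub> res X U ?V h) = ?g y a"
      using germ_eq_near [OF V u(3) _ U u(1) ah'(1)] sec_mult_closed [OF V t res_closed [OF U V preU ah'(2)]] by blast
    let ?N = "N \<inter> {v \<in> U. h \<notin> ?\<phi> v}"
    have "Op ?N" using N(1) basic_open [OF U ah'(2)] by (rule openin_Int)
    then have "openin ?M (?\<phi> ` ?N)" by (rule imgO) blast
    moreover have "P \<in> ?\<phi> ` ?N" using u N(2) ah'(3) by (metis (mono_tags, lifting) Int_iff imageI mem_Collect_eq)
    moreover have "?\<phi> ` ?N \<subseteq> W" using N(3) by (auto simp: pre_def)
    moreover have "(a, h) \<in> fs (germ X (pt Q) ?V t) (pt Q)" if "Q \<in> ?\<phi> ` ?N" for Q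
    proof -
      obtain v where v: "v \<in> N" "v \<in> U" "h \<notin> ?\<phi> v" "Q = ?\<phi> v" using \<open>Q \<in> ?\<phi> ` ?N\<close> by blast
      then have "v \<in> ?V" using N(3) by blast
      then show ?thesis using v ah' N(4) [OF v(1)] m [of v] pt [OF v(2)] by (simp add: fs_def)
    qed
    ultimately show ?thesis by blast
  qed
  have chi_closed: "\<chi> W t \<in> local_fractions ?A ?M W" if W: "openin ?M W" and t: "t \<in> carrier (sec X (pre W))" for W t
    unfolding local_fractions_def
  proof (intro CollectI conjI ballI)
    show "\<chi> W t \<in> extensional W" by (simp add: \<chi>_def)
    fix P assume P: "P \<in> W"
    obtain a h where ah: "(a, h) \<in> fs (germ X (pt P) (pre W) t) (pt P)"
      using fs_ex [OF pt_pre(1) [OF W P] gt [OF W P t]] by blast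
    obtain N where N: "openin ?M N" "P \<in> N" "N \<subseteq> W" "\<And>Q. Q \<in> N \<Longrightarrow> (a, h) \<in> fs (germ X (pt Q) (pre W) t) (pt Q)"
      using near [OF W P t ah] by blast
    have "h \<notin> Q \<and> \<chi> W t Q = fraction ?A (carrier ?A - Q) a h" if Q: "Q \<in> N" for Q
    proof -
      have QW: "Q \<in> W" using N(3) Q by blast
      have "h \<notin> ?\<phi> (pt Q)" using N(4) [OF Q] by (simp add: fs_def)
      then show ?thesis
        using fs_eq [OF pt_pre(1) [OF W QW] gt [OF W QW t] N(4) [OF Q]] QW pt_pre(2) [OF W QW]
        by (simp add: \<chi>_def)
    qed
    moreover have "a \<in> carrier ?A" "h \<in> carrier ?A" using ah by (auto simp: fs_def)
    ultimately show "\<exists>N. openin ?M N \<and> P \<in> N \<and> N \<subseteq> W \<and>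
        (\<exists>a\<in>carrier ?A. \<exists>h\<in>carrier ?A. \<forall>Q\<in>N. h \<notin> Q \<and> \<chi> W t Q = fraction ?A (carrier ?A - Q) a h)"
      using N by blast
  qed
  have fs_val: "fs g u = fraction ?A (carrier ?A - ?\<phi> u) a \<one>\<^bsub>?A\<^esub>"
    if u: "u \<in> U" and g: "g = ?g u a" and a: "a \<in> carrier ?A" for g u a
  proof -
    interpret S: pm "pm_stalk X u" using stalk_pm topI U u by blast
    show ?thesis
      using pm_prime_ideal_one [OF A \<phi>P [OF u]] u a gm [OF u a A.one_closed] gc [OF u a]
      by (intro fs_eq) (auto simp: fs_def g)
  qed
  have chi_iso: "\<chi> W \<in> pm_iso (sec X (pre W)) (sec (MSpec ?A) W)" if W: "openin ?M W" for W
  proof -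
    have V: "Op (pre W)" by (rule preO [OF W])
    interpret V: pm "sec X (pre W)" using sec_pm V .
    have "\<chi> W \<in> pm_hom (sec X (pre W)) (sec (MSpec ?A) W)"
    proof (rule pm_homI)
      show "\<chi> W t \<in> carrier (sec (MSpec ?A) W)" if "t \<in> carrier (sec X (pre W))" for t
        using chi_closed [OF W that] by (simp add: MSpec_simps)
    next
      fix s t assume st: "s \<in> carrier (sec X (pre W))" "t \<in> carrier (sec X (pre W))"
      show "\<chi> W (s \<otimes>\<^bsub>sec X (pre W)\<^esub> t) = \<chi> W s \<otimes>\<^bsub>sec (MSpec ?A) W\<^esub> \<chi> W t"
        unfolding MSpec_simps \<chi>_def
      proof (rule restrict_ext)
        fix P assume P: "P \<in> W"
        let ?u = "pt P"
        note u = pt_pre [OF W P]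
        interpret S: pm "pm_stalk X ?u" using stalk_pm topI U u(1) by blast
        interpret m: mult_set ?A "carrier ?A - P" using pm_prime_mult_set [OF A \<phi>P [OF u(1)]] u(2) by simp
        let ?gs = "germ X ?u (pre W) s" and ?gt = "germ X ?u (pre W) t"
        note gs = gt [OF W P st(1)] and gt' = gt [OF W P st(2)]
        obtain a h where ah: "(a, h) \<in> fs ?gs ?u" using fs_ex [OF u(1) gs] by blast
        obtain b k where bk: "(b, k) \<in> fs ?gt ?u" using fs_ex [OF u(1) gt'] by blast
        have ahbk: "a \<in> carrier ?A" "h \<in> carrier ?A" "h \<notin> P" "b \<in> carrier ?A" "k \<in> carrier ?A" "k \<notin> P"
          "?m ?u ?gs (?g ?u h) = ?g ?u a" "?m ?u ?gt (?g ?u k) = ?g ?u b"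
          using ah bk u(2) by (auto simp: fs_def)
        have "?m ?u (?m ?u ?gs ?gt) (?m ?u (?g ?u h) (?g ?u k)) = ?m ?u (?m ?u ?gs (?g ?u h)) (?m ?u ?gt (?g ?u k))"
          using gs gt' gc [OF u(1) ahbk(2)] gc [OF u(1) ahbk(5)] by (simp add: S.m_ac)
        then have "?m ?u (?m ?u ?gs ?gt) (?g ?u (h \<otimes>\<^bsub>?A\<^esub> k)) = ?g ?u (a \<otimes>\<^bsub>?A\<^esub> b)"
          using ahbk u(1) by (simp add: gm)
        then have "(a \<otimes>\<^bsub>?A\<^esub> b, h \<otimes>\<^bsub>?A\<^esub> k) \<in> fs (?m ?u ?gs ?gt) ?u"
          using ahbk u(1) m.S_mult [of h k] by (simp add: fs_def u(2))
        then have "fs (?m ?u ?gs ?gt) ?u = fraction ?A (carrier ?A - P) (a \<otimes>\<^bsub>?A\<^esub> b) (h \<otimes>\<^bsub>?A\<^esub> k)"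
          using fs_eq [OF u(1) S.m_closed [OF gs gt']] u(2) by simp
        also have "\<dots> = fraction_mult ?A (carrier ?A - P) (fs ?gs ?u) (fs ?gt ?u)"
          using fs_eq [OF u(1) gs ah] fs_eq [OF u(1) gt' bk] u(2) ahbk by (simp add: m.fraction_mult_eq)
        finally show "fs (germ X ?u (pre W) (s \<otimes>\<^bsub>sec X (pre W)\<^esub> t)) ?u =
            fraction_mult ?A (carrier ?A - P) ((\<lambda>P\<in>W. fs (germ X (pt P) (pre W) s) (pt P)) P) ((\<lambda>P\<in>W. fs (germ X (pt P) (pre W) t) (pt P)) P)"
          using germ_mult [OF V u(3) st] P by simp
      qed
    next
      have "fs (germ X (pt P) (pre W) \<one>\<^bsub>sec X (pre W)\<^esub>) (pt P) = fraction ?A (carrier ?A - P) \<one>\<^bsub>?A\<^esub> \<one>\<^bsub>?A\<^esub>"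
        "fs (germ X (pt P) (pre W) (pzero (sec X (pre W)))) (pt P) = fraction ?A (carrier ?A - P) (pzero ?A) \<one>\<^bsub>?A\<^esub>"
        if P: "P \<in> W" for P
      proof -
        note u = pt_pre [OF W P]
        show "fs (germ X (pt P) (pre W) \<one>\<^bsub>sec X (pre W)\<^esub>) (pt P) = fraction ?A (carrier ?A - P) \<one>\<^bsub>?A\<^esub> \<one>\<^bsub>?A\<^esub>"
          using fs_val [OF u(1) _ A.one_closed] stalk_one [OF V u(3)] stalk_one [OF U u(1)] u(2) by simp
        show "fs (germ X (pt P) (pre W) (pzero (sec X (pre W)))) (pt P) = fraction ?A (carrier ?A - P) (pzero ?A) \<one>\<^bsub>?A\<^esub>"
          using fs_val [OF u(1) _ A.pzero_closed] stalk_zero [OF V u(3)] stalk_zero [OF U u(1)] u(2) by simp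
      qed
      then show "\<chi> W \<one>\<^bsub>sec X (pre W)\<^esub> = \<one>\<^bsub>sec (MSpec ?A) W\<^esub>" "\<chi> W (pzero (sec X (pre W))) = pzero (sec (MSpec ?A) W)"
        unfolding MSpec_simps \<chi>_def by (auto cong: restrict_cong)
    qed
    moreover have "s = t" if st: "s \<in> carrier (sec X (pre W))" "t \<in> carrier (sec X (pre W))" "\<chi> W s = \<chi> W t" for s t
    proof (rule locality_germ [OF V st(1,2)])
      fix u assume u: "u \<in> pre W"
      then have uU: "u \<in> U" and P: "?\<phi> u \<in> W" by (auto simp: pre_def)
      note pu = pt [OF uU]
      have "fs (germ X u (pre W) s) u = fs (germ X u (pre W) t) u"
        using fun_cong [OF st(3), of "?\<phi> u"] P pu by (simp add: \<chi>_def)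
      then show "germ X u (pre W) s = germ X u (pre W) t"
      proof -
        assume eq: "fs (germ X u (pre W) s) u = fs (germ X u (pre W) t) u"
        obtain a h where ah: "(a, h) \<in> fs (germ X u (pre W) s) u" using fs_ex [OF uU germ_closed [OF V u st(1)]] by blast
        then have "(a, h) \<in> fs (germ X u (pre W) t) u" using eq by simp
        then show ?thesis by (rule fs_inj [OF uU germ_closed [OF V u st(1)] germ_closed [OF V u st(2)] ah])
      qed
    qed
    \<comment> \<open>Surjectivity of \<open>\<chi> W\<close>. The germs prescribed by the fractions
      \<open>s\<close> are unique by \<open>fs_inj\<close>; near each point they are the germs of a
      section, namely \<open>a\<close> times a local inverse of \<open>h\<close>, so they
      glue.\<close>
    moreover have "\<exists>t\<in>carrier (sec X (pre W)). \<chi> W t = s" if s: "s \<in> local_fractions ?A ?M W" for s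
    proof -
      define f where "f u = (SOME g. g \<in> carrier (pm_stalk X u) \<and> fs g u = s (?\<phi> u))" for u
      have "\<exists>V t. Op V \<and> u \<in> V \<and> V \<subseteq> pre W \<and> t \<in> carrier (sec X V) \<and> (\<forall>y\<in>V. germ X y V t = f y \<and> fs (f y) y = s (?\<phi> y))"
        if u: "u \<in> pre W" for u
      proof -
        have uU: "u \<in> U" and P: "?\<phi> u \<in> W" using u by (auto simp: pre_def)
        obtain N a h where N: "openin ?M N" "?\<phi> u \<in> N" "N \<subseteq> W" "a \<in> carrier ?A" "h \<in> carrier ?A"
          "\<And>Q. Q \<in> N \<Longrightarrow> h \<notin> Q" "\<And>Q. Q \<in> N \<Longrightarrow> s Q = fraction ?A (carrier ?A - Q) a h"
          by (rule local_fractions_cases [OF s P]) blast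
        have "?g u h \<in> Units (pm_stalk X u)" using gu [OF uU N(5)] N(2,6) by blast
        then obtain W' t where W': "Op W'" "u \<in> W'" "W' \<subseteq> U" "t \<in> carrier (sec X W')"
          "\<And>y. y \<in> W' \<Longrightarrow> ?m y (germ X y W' t) (?g y h) = \<one>\<^bsub>pm_stalk X y\<^esub>"
          by (rule unit_germ_inverse [OF U uU N(5)]) blast
        let ?V = "W' \<inter> pre N"
        have V': "Op ?V" "u \<in> ?V" "?V \<subseteq> pre W" "?V \<subseteq> U" "?V \<subseteq> W'"
          using W'(1,2) preO [OF N(1)] N(2,3) uU by (auto simp: pre_def intro: openin_Int)
        let ?t = "res X W' ?V t \<otimes>\<^bsub>sec X ?V\<^esub> res X U ?V a"
        have tc: "?t \<in> carrier (sec X ?V)"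
          by (intro sec_mult_closed V'(1) res_closed W'(1,4) V'(4,5) U N(4))
        have "germ X y ?V ?t = f y \<and> fs (f y) y = s (?\<phi> y)" if y: "y \<in> ?V" for y
        proof -
          have yU: "y \<in> U" and yW: "y \<in> W'" and yN: "?\<phi> y \<in> N" using y V'(4) by (auto simp: pre_def)
          interpret S: pm "pm_stalk X y" using stalk_pm topI U yU by blast
          have tcl: "germ X y W' t \<in> carrier (pm_stalk X y)" using germ_closed [OF W'(1) yW W'(4)] .
          have "germ X y ?V ?t = ?m y (germ X y W' t) (?g y a)"
            using germ_mult [OF V'(1) y res_closed [OF W'(1) V'(1,5) W'(4)] res_closed [OF U V'(1,4) N(4)]]
              germ_res [OF W'(1) V'(1,5) y W'(4)] germ_res [OF U V'(1,4) y N(4)] by simp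
          then have "?m y (germ X y ?V ?t) (?g y h) = ?m y (?m y (germ X y W' t) (?g y h)) (?g y a)"
            using tcl gc [OF yU N(4)] gc [OF yU N(5)] by (simp add: S.m_ac)
          also have "\<dots> = ?g y a" using W'(5) [OF yW] gc [OF yU N(4)] by simp
          finally have "(a, h) \<in> fs (germ X y ?V ?t) y" using N(4,5,6) yN by (simp add: fs_def)
          then have fst: "fs (germ X y ?V ?t) y = s (?\<phi> y)"
            using fs_eq [OF yU germ_closed [OF V'(1) y tc]] N(7) [OF yN] by simp
          have f: "f y \<in> carrier (pm_stalk X y) \<and> fs (f y) y = s (?\<phi> y)"
            unfolding f_def by (rule someI [of _ "germ X y ?V ?t"]) (use fst germ_closed [OF V'(1) y tc] in blast)
          obtain b k where bk: "(b, k) \<in> fs (germ X y ?V ?t) y" using fs_ex [OF yU germ_closed [OF V'(1) y tc]] by blast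
          then have "(b, k) \<in> fs (f y) y" using fst f by simp
          then show ?thesis using fs_inj [OF yU germ_closed [OF V'(1) y tc] _ bk] f by blast
        qed
        then show ?thesis using V' tc by blast
      qed
      note loc = this
      have "\<exists>V t. Op V \<and> u \<in> V \<and> V \<subseteq> pre W \<and> t \<in> carrier (sec X V) \<and> (\<forall>y\<in>V. germ X y V t = f y)"
        if u: "u \<in> pre W" for u
        using loc [OF u] by meson
      note loc' = this
      obtain t where t: "t \<in> carrier (sec X (pre W))" "\<And>y. y \<in> pre W \<Longrightarrow> germ X y (pre W) t = f y"
        using gluing_germ [OF V loc'] by blast
      have "\<chi> W t = s"
      proof (rule extensionalityI [of _ W])
        show "s \<in> extensional W" using s by (simp add: local_fractions_def)
        fix P assume P: "P \<in> W"
        note u = pt_pre [OF W P]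
        have "fs (f (pt P)) (pt P) = s P" using loc [OF u(3)] u(2) by force
        then show "\<chi> W t P = s P" using P t(2) [OF u(3)] by (simp add: \<chi>_def)
      qed (simp add: \<chi>_def)
      then show ?thesis using t by blast
    qed
    ultimately show ?thesis
      using chi_closed [OF W] unfolding pm_iso_def bij_betw_def inj_on_def MSpec_simps by blast
  qed
  \<comment> \<open>\<open>pm_space_iso\<close> asks for the map on sections from the spectrum to X,
    so \<open>\<chi>\<close> is inverted.\<close>
  define \<psi> where "\<psi> W = inv_into (carrier (sec X (pre W))) (\<chi> W)" for W
  have psi: "\<psi> W s \<in> carrier (sec X (pre W))" "\<chi> W (\<psi> W s) = s"
    if "openin ?M W" "s \<in> local_fractions ?A ?M W" for W s
    using chi_iso [OF that(1)] that(2) unfolding \<psi>_def pm_iso_def bij_betw_def MSpec_simps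
    by (auto simp: inv_into_into f_inv_into_f)
  have psi_iso: "\<psi> W \<in> pm_iso (sec (MSpec ?A) W) (sec X (pre W))" if W: "openin ?M W" for W
  proof -
    interpret V: pm "sec X (pre W)" using sec_pm preO [OF W] .
    note \<chi> = pm_isoD [OF chi_iso [OF W], unfolded MSpec_simps(2)]
    have psi_chi: "\<psi> W (\<chi> W t) = t" if "t \<in> carrier (sec X (pre W))" for t
      using \<chi>(5) psi [OF W \<chi>(1) [OF that]] that by blast
    have "\<psi> W \<in> pm_hom (sec (MSpec ?A) W) (sec X (pre W))"
    proof (rule pm_homI; (unfold MSpec_simps(2))?)
      show "\<psi> W s \<in> carrier (sec X (pre W))" if "s \<in> local_fractions ?A ?M W" for s using psi [OF W that] by blast
      fix s t assume st: "s \<in> local_fractions ?A ?M W" "t \<in> local_fractions ?A ?M W"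
      have "s \<otimes>\<^bsub>sec (MSpec ?A) W\<^esub> t = \<chi> W (\<psi> W s \<otimes>\<^bsub>sec X (pre W)\<^esub> \<psi> W t)"
        using \<chi>(2) psi [OF W st(1)] psi [OF W st(2)] by simp
      then show "\<psi> W (s \<otimes>\<^bsub>sec (MSpec ?A) W\<^esub> t) = \<psi> W s \<otimes>\<^bsub>sec X (pre W)\<^esub> \<psi> W t"
        using psi_chi psi [OF W st(1)] psi [OF W st(2)] by simp
    qed (use psi_chi \<chi>(3,4) V.pzero_closed in \<open>simp_all flip: \<chi>(3,4)\<close>)
    moreover have "bij_betw (\<psi> W) (carrier (sec (MSpec ?A) W)) (carrier (sec X (pre W)))"
      unfolding \<psi>_def using chi_iso [OF W] by (intro bij_betw_inv_into) (simp add: pm_iso_def)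
    ultimately show ?thesis by (simp add: pm_iso_def)
  qed
  have nat: "\<psi> W (restrict s W) = res X (pre V) (pre W) (\<psi> V s)"
    if V: "openin ?M V" and W: "openin ?M W" "W \<subseteq> V" and s: "s \<in> local_fractions ?A ?M V" for V W s
  proof -
    have sub: "pre W \<subseteq> pre V" using W by (auto simp: pre_def)
    note o = preO [OF V] preO [OF W(1)]
    let ?t = "res X (pre V) (pre W) (\<psi> V s)"
    have t: "?t \<in> carrier (sec X (pre W))" by (intro res_closed o sub psi(1) [OF V s])
    have "\<chi> W ?t = restrict s W"
    proof (rule extensionalityI [of _ W])
      fix P assume P: "P \<in> W"
      have "\<chi> V (\<psi> V s) P = s P" using psi(2) [OF V s] by simp
      then show "\<chi> W ?t P = restrict s W P"
        using P W(2) germ_res [OF o sub pt_pre(3) [OF W(1) P] psi(1) [OF V s]] by (auto simp: \<chi>_def)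
    qed (simp_all add: \<chi>_def)
    then have "\<psi> W (restrict s W) = \<psi> W (\<chi> W ?t)" by simp
    also have "\<dots> = ?t" using pm_isoD(5) [OF chi_iso [OF W(1)]] psi [OF W(1) chi_closed [OF W(1) t]] t by blast
    finally show ?thesis .
  qed
  have sp: "spc (open_subspace X U) = ?S" "sec (open_subspace X U) = sec X"
    "res (open_subspace X U) = res X" by (simp_all add: open_subspace_def)
  have "pm_space_iso (open_subspace X U) (MSpec ?A) ?\<phi> \<psi>"
    unfolding pm_space_iso_def Let_def sp MSpec_simps tS pre_def [symmetric]
    using homeo psi_iso nat by blast
  then show ?thesis unfolding affine_opens_def using U A by blast
qed

text \<open>Replaces the existential definition, with its arbitrary \<open>A\<close>, by a condition
  in terms of the section monoid over \<open>U\<close> itself, which is the monoid that the colimits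
  use.\<close>

lemma affine_opens_eq_charts: "affine_opens X = {U. chart X U}"
  using affine_imp_chart chart_imp_affine by (auto simp: affine_opens_def)

end

section \<open>Colimits of spaces\<close>

lemma colim_equiv: "equiv (colim_union \<U> T) (colim_rel \<U> T t)"
proof -
  define R where "R = {((V, e), (U, t V U e)) | U V e. U \<in> \<U> \<and> V \<in> \<U> \<and> V \<subseteq> U \<and> e \<in> topspace (T V)}"
  have eq: "colim_rel \<U> T t = Restr ((R \<union> R\<inverse>)\<^sup>*) (colim_union \<U> T)"
    by (simp add: colim_rel_def R_def Let_def)
  have "sym ((R \<union> R\<inverse>)\<^sup>*)" by (rule sym_rtrancl [OF sym_Un_converse])
  then have "sym (colim_rel \<U> T t)" unfolding eq sym_def by blast
  moreover have "trans (colim_rel \<U> T t)"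
    unfolding eq by (intro BNF_Wellorder_Constructions.trans_Restr trans_rtrancl)
  ultimately show ?thesis unfolding equiv_def refl_on_def by (auto simp: eq)
qed

text \<open>\<open>colim_top\<close> is defined through \<open>topology\<close>, so its open sets
  are the intended ones only after the axioms of a topology have been verified.\<close>

lemma openin_colim:
  "openin (colim_top \<U> T t) W \<longleftrightarrow> W \<subseteq> colim_union \<U> T // colim_rel \<U> T t \<and>
     (\<forall>U\<in>\<U>. openin (T U) {e \<in> topspace (T U). colim_in \<U> T t U e \<in> W})" (is "_ \<longleftrightarrow> ?L W")
proof -
  have "istopology ?L"
    unfolding istopology_def
  proof (intro conjI allI impI)
    fix S S' assume S: "?L S" and S': "?L S'"
    have "{e \<in> topspace (T U). colim_in \<U> T t U e \<in> S \<inter> S'} =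
        {e \<in> topspace (T U). colim_in \<U> T t U e \<in> S} \<inter> {e \<in> topspace (T U). colim_in \<U> T t U e \<in> S'}" for U
      by blast
    then show "S \<inter> S' \<subseteq> colim_union \<U> T // colim_rel \<U> T t"
      "\<forall>U\<in>\<U>. openin (T U) {e \<in> topspace (T U). colim_in \<U> T t U e \<in> S \<inter> S'}"
      using S S' by (auto intro: openin_Int)
  next
    fix K assume K: "\<forall>S\<in>K. ?L S"
    have "{e \<in> topspace (T U). colim_in \<U> T t U e \<in> \<Union>K} =
        (\<Union>S\<in>K. {e \<in> topspace (T U). colim_in \<U> T t U e \<in> S})" for U by blast
    then show "\<Union>K \<subseteq> colim_union \<U> T // colim_rel \<U> T t"
      "\<forall>U\<in>\<U>. openin (T U) {e \<in> topspace (T U). colim_in \<U> T t U e \<in> \<Union>K}"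
      using K by auto
  qed
  then show ?thesis unfolding colim_top_def by (simp add: topology_inverse')
qed

lemma colim_in_mem: "\<lbrakk>U \<in> \<U>; e \<in> topspace (T U)\<rbrakk> \<Longrightarrow> colim_in \<U> T t U e \<in> colim_union \<U> T // colim_rel \<U> T t"
  by (auto simp: colim_in_def colim_union_def intro!: quotientI)

lemma topspace_colim: "topspace (colim_top \<U> T t) = colim_union \<U> T // colim_rel \<U> T t"
proof
  show "topspace (colim_top \<U> T t) \<subseteq> colim_union \<U> T // colim_rel \<U> T t"
    using iffD1 [OF openin_colim [of \<U> T t "topspace (colim_top \<U> T t)"] openin_topspace] by (rule conjunct1)
  have "{e \<in> topspace (T U). colim_in \<U> T t U e \<in> colim_union \<U> T // colim_rel \<U> T t} = topspace (T U)"
    if "U \<in> \<U>" for U using colim_in_mem [OF that] by auto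
  then have "openin (colim_top \<U> T t) (colim_union \<U> T // colim_rel \<U> T t)"
    unfolding openin_colim by simp
  then show "colim_union \<U> T // colim_rel \<U> T t \<subseteq> topspace (colim_top \<U> T t)" by (rule openin_subset)
qed

lemma colim_in_topspace: "\<lbrakk>U \<in> \<U>; e \<in> topspace (T U)\<rbrakk> \<Longrightarrow> colim_in \<U> T t U e \<in> topspace (colim_top \<U> T t)"
  unfolding topspace_colim by (rule colim_in_mem)

lemma colim_cases:
  assumes "x \<in> topspace (colim_top \<U> T t)"
  obtains U e where "U \<in> \<U>" "e \<in> topspace (T U)" "x = colim_in \<U> T t U e"
  using assms unfolding topspace_colim colim_in_def colim_union_def by (auto elim!: quotientE)

lemma mem_colim_in:
  assumes "U \<in> \<U>" "e \<in> topspace (T U)"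
  shows "(V, d) \<in> colim_in \<U> T t U e \<longleftrightarrow> V \<in> \<U> \<and> d \<in> topspace (T V) \<and> colim_in \<U> T t V d = colim_in \<U> T t U e"
proof -
  have "((U, e), (V, d)) \<in> colim_rel \<U> T t \<longleftrightarrow>
      colim_rel \<U> T t `` {(U, e)} = colim_rel \<U> T t `` {(V, d)} \<and> (U, e) \<in> colim_union \<U> T \<and> (V, d) \<in> colim_union \<U> T"
    by (rule equiv_class_eq_iff [OF colim_equiv])
  then show ?thesis using assms by (auto simp: colim_in_def colim_union_def)
qed

lemma colim_in_step:
  assumes "U \<in> \<U>" "V \<in> \<U>" "V \<subseteq> U" "e \<in> topspace (T V)" "t V U e \<in> topspace (T U)"
  shows "colim_in \<U> T t V e = colim_in \<U> T t U (t V U e)"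
proof -
  have "((V, e), (U, t V U e)) \<in> colim_rel \<U> T t"
    unfolding colim_rel_def Let_def colim_union_def using assms by (auto intro!: r_into_rtrancl)
  then show ?thesis unfolding colim_in_def by (rule equiv_class_eq [OF colim_equiv])
qed

text \<open>Identified points are joined by a zigzag of transition maps, and a function compatible
  with single steps is constant along it. This is the means of separating points of a
  colimit.\<close>

lemma colim_invariant:
  assumes F: "\<And>U V e. \<lbrakk>U \<in> \<U>; V \<in> \<U>; V \<subseteq> U; e \<in> topspace (T V)\<rbrakk> \<Longrightarrow> F V e = F U (t V U e)"
    and "U \<in> \<U>" "e \<in> topspace (T U)" "V \<in> \<U>" "d \<in> topspace (T V)"
    and eq: "colim_in \<U> T t U e = colim_in \<U> T t V d"
  shows "F U e = F V d"
proof -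
  define R where "R = {((V, e), (U, t V U e)) | U V e. U \<in> \<U> \<and> V \<in> \<U> \<and> V \<subseteq> U \<and> e \<in> topspace (T V)}"
  have "((U, e), (V, d)) \<in> colim_rel \<U> T t"
    using mem_colim_in [of U \<U> e T V d t] assms(2-5) eq by (simp add: colim_in_def)
  then have "((U, e), (V, d)) \<in> (R \<union> R\<inverse>)\<^sup>*"
    by (simp add: colim_rel_def R_def Let_def)
  then have "case_prod F (U, e) = case_prod F (V, d)"
  proof (induction rule: rtrancl_induct)
    case (step y z)
    have R: "case_prod F p = case_prod F q" if "(p, q) \<in> R" for p q
      using that F by (auto simp: R_def)
    from step(2) have "(y, z) \<in> R \<or> (z, y) \<in> R" by simp
    then have "case_prod F y = case_prod F z"
    proof
      assume "(z, y) \<in> R" then show ?thesis by (rule R [symmetric])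
    qed (rule R)
    with step.IH show ?case by (rule trans)
  qed simp
  then show ?thesis by simp
qed

text \<open>Evaluates the maps that are defined on a colimit through \<open>the_elem\<close>:
  compatibility makes the image of a class a singleton.\<close>

lemma colim_the_elem:
  assumes F: "\<And>U V e. \<lbrakk>U \<in> \<U>; V \<in> \<U>; V \<subseteq> U; e \<in> topspace (T V)\<rbrakk> \<Longrightarrow> F V e = F U (t V U e)"
    and Ue: "U \<in> \<U>" "e \<in> topspace (T U)"
  shows "the_elem ((\<lambda>(V, d). F V d) ` colim_in \<U> T t U e) = F U e"
proof -
  have "F V d = F U e" if "(V, d) \<in> colim_in \<U> T t U e" for V d
  proof -
    have "V \<in> \<U>" "d \<in> topspace (T V)" "colim_in \<U> T t V d = colim_in \<U> T t U e"
      using that mem_colim_in [of U \<U> e T V d t] Ue by auto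
    then show ?thesis using colim_invariant [of \<U> T F t V d U e, OF F] Ue by blast
  qed
  note * = this
  have "(\<lambda>(V, d). F V d) ` colim_in \<U> T t U e = (\<lambda>_. F U e) ` colim_in \<U> T t U e"
    by (rule image_cong [OF refl]) (use * in \<open>simp add: split_beta\<close>)
  also have "\<dots> = {F U e}"
    by (rule image_constant [of "(U, e)"]) (use mem_colim_in [of U \<U> e T U e t] Ue in simp)
  finally show ?thesis by simp
qed

section \<open>Points of the base change\<close>

text \<open>
  A point of \<open>X\<^sub>\<int>\<close> is described without reference to a chart by its image \<open>u\<close> in \<open>X\<close> and the prime
  \<open>q\<close> of the base change of the stalk at \<open>u\<close> whose localization is the local ring of the point.
\<close>

definition loc_point :: "('p, 's) pm_space \<Rightarrow> 'p \<Rightarrow> ('p set \<times> 's) set zelem set \<Rightarrow> bool" where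
  "loc_point X u q \<longleftrightarrow> u \<in> topspace (spc X) \<and> primeideal q (Z_ring (pm_stalk X u)) \<and>
     (\<forall>g\<in>carrier (pm_stalk X u). to_Z (pm_stalk X u) g \<in> q \<longleftrightarrow> g \<notin> Units (pm_stalk X u))"

abbreviation ZA :: "('p, 's) pm_space \<Rightarrow> 'p set \<Rightarrow> 's zelem ring" where
  "ZA X U \<equiv> Z_ring (sec X U)"

abbreviation ZO :: "('p, 's) pm_space \<Rightarrow> 'p \<Rightarrow> ('p set \<times> 's) set zelem ring" where
  "ZO X u \<equiv> Z_ring (pm_stalk X u)"

abbreviation zg :: "('p, 's) pm_space \<Rightarrow> 'p \<Rightarrow> 'p set \<Rightarrow> 's zelem \<Rightarrow> ('p set \<times> 's) set zelem" where
  "zg X u U \<equiv> Z_map (pm_stalk X u) (germ X u U)"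

abbreviation zr :: "('p, 's) pm_space \<Rightarrow> 'p set \<Rightarrow> 'p set \<Rightarrow> 's zelem \<Rightarrow> 's zelem" where
  "zr X U V \<equiv> Z_map (sec X V) (res X U V)"

definition chart_prime :: "('p, 's) pm_space \<Rightarrow> 'p set \<Rightarrow> 'p \<Rightarrow> ('p set \<times> 's) set zelem set \<Rightarrow> 's zelem set" where
  "chart_prime X U u q = Spec_map (ZA X U) (zg X u U) q"

text \<open>The chart is an arbitrary choice; \<open>bc_in_chart_prime\<close> shows that every
  affine neighbourhood of \<open>u\<close> gives the same point.\<close>

definition bc_point :: "('p, 's) pm_space \<Rightarrow> 'p \<Rightarrow> ('p set \<times> 's) set zelem set \<Rightarrow> ('p, 's) bc_pt" where
  "bc_point X u q = (let U = (SOME U. U \<in> affine_opens X \<and> u \<in> U) in bc_in X U (chart_prime X U u q))"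

text \<open>Inverse to \<open>chart_prime X U\<close>. Its value is preserved by the transition
  maps, so it is the invariant that separates the points of X_Z.\<close>

definition stalk_coords :: "('p, 's) pm_space \<Rightarrow> 'p set \<Rightarrow> 's zelem set \<Rightarrow> 'p \<times> ('p set \<times> 's) set zelem set" where
  "stalk_coords X U Q = (SOME p. fst p \<in> U \<and> loc_point X (fst p) (snd p) \<and> chart_prime X U (fst p) (snd p) = Q)"

lemma (in primeideal) unit_mult_mem_iff:
  assumes "a \<in> carrier R" "s \<in> Units R"
  shows "a \<otimes> s \<in> I \<longleftrightarrow> a \<in> I"
  using assms I_prime [of a s] Units_notin [of s] I_r_closed [of a s] by auto

section \<open>Coordinates for the points of X_Z\<close>

context monoid_scheme
begin

lemma affine_chart: "U \<in> affine_opens X \<longleftrightarrow> chart X U"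
  by (simp add: affine_opens_eq_charts)

lemma affine_open: "U \<in> affine_opens X \<Longrightarrow> Op U"
  by (simp add: affine_opens_def)

lemma exists_affine: "u \<in> topspace (spc X) \<Longrightarrow> \<exists>U\<in>affine_opens X. u \<in> U"
  by (rule locally_affine)

lemma affine_Int:
  assumes "U \<in> affine_opens X" "V \<in> affine_opens X" "u \<in> U" "u \<in> V"
  obtains W where "W \<in> affine_opens X" "u \<in> W" "W \<subseteq> U" "W \<subseteq> V"
  using assms chart_Int unfolding affine_chart by blast

lemma ZA_cring: "Op U \<Longrightarrow> cring (ZA X U)"
  using pm.Z_ring_cring sec_pm by blast

lemma ZO_cring: "u \<in> topspace (spc X) \<Longrightarrow> cring (ZO X u)"
  using pm.Z_ring_cring stalk_pm by blast

lemma zg_hom: "\<lbrakk>Op U; u \<in> U\<rbrakk> \<Longrightarrow> zg X u U \<in> ring_hom (ZA X U) (ZO X u)"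
  using pm_morphism.Z_map_hom [OF germ_pm_morphism] .

lemma zg_closed: "\<lbrakk>Op U; u \<in> U; f \<in> carrier (ZA X U)\<rbrakk> \<Longrightarrow> zg X u U f \<in> carrier (ZO X u)"
  using ring_hom_closed [OF zg_hom] .

lemma zr_hom: "\<lbrakk>Op U; Op V; V \<subseteq> U\<rbrakk> \<Longrightarrow> zr X U V \<in> ring_hom (ZA X U) (ZA X V)"
  using pm_morphism.Z_map_hom [OF res_pm_morphism] .

lemma zr_closed: "\<lbrakk>Op U; Op V; V \<subseteq> U; f \<in> carrier (ZA X U)\<rbrakk> \<Longrightarrow> zr X U V f \<in> carrier (ZA X V)"
  using ring_hom_closed [OF zr_hom] .

lemma zg_zr: "\<lbrakk>Op U; Op V; V \<subseteq> U; u \<in> V; f \<in> carrier (ZA X U)\<rbrakk> \<Longrightarrow> zg X u V (zr X U V f) = zg X u U f"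
  using germ_res by (intro Z_map_comp [OF res_pm_morphism germ_pm_morphism]) auto

lemma zg_to_Z: "\<lbrakk>Op U; u \<in> U; a \<in> carrier (sec X U)\<rbrakk> \<Longrightarrow> zg X u U (to_Z (sec X U) a) = to_Z (pm_stalk X u) (germ X u U a)"
  using pm_morphism.Z_map_to_Z [OF germ_pm_morphism] .

lemma zg_localization: "\<lbrakk>U \<in> affine_opens X; u \<in> U\<rbrakk> \<Longrightarrow> localization (ZA X U) (ZO X u) (zg X u U)"
  using pm_morphism.Z_map_localization(1) [OF germ_pm_morphism [OF affine_open]] chartD(4) affine_chart by blast

lemma loc_pointD:
  assumes "loc_point X u q"
  shows "u \<in> topspace (spc X)" "primeideal q (ZO X u)"
    "g \<in> carrier (pm_stalk X u) \<Longrightarrow> to_Z (pm_stalk X u) g \<in> q \<longleftrightarrow> g \<notin> Units (pm_stalk X u)"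
  using assms by (auto simp: loc_point_def)

lemma mem_chart_prime: "f \<in> chart_prime X U u q \<longleftrightarrow> f \<in> carrier (ZA X U) \<and> zg X u U f \<in> q"
  by (simp add: chart_prime_def Spec_map_def)

lemma chart_prime_primeideal:
  assumes "Op U" "u \<in> U" "loc_point X u q"
  shows "primeideal (chart_prime X U u q) (ZA X U)"
  unfolding chart_prime_def
  using Spec_map_primeideal [OF ZA_cring ZO_cring zg_hom] assms loc_pointD by blast

text \<open>Here the condition of \<open>loc_point\<close> on monoid elements enters: it forces the
  prime to lie over \<open>u\<close> itself and not over a generization of \<open>u\<close>.\<close>

lemma Z_contract_chart_prime:
  assumes "Op U" "u \<in> U" "loc_point X u q"
  shows "Z_contract (sec X U) (chart_prime X U u q) = prime_of_point X U u"
  using assms germ_closed [OF assms(1,2)] pm.to_Z_closed [OF sec_pm [OF assms(1)]]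
  by (auto simp: Z_contract_def mem_chart_prime mem_prime_of_point zg_to_Z loc_pointD(3))

lemma chart_prime_res:
  assumes "Op U" "Op V" "V \<subseteq> U" "u \<in> V"
  shows "Spec_map (ZA X U) (zr X U V) (chart_prime X V u q) = chart_prime X U u q"
  using assms zr_closed [OF assms(1-3)] by (auto simp: Spec_map_def mem_chart_prime zg_zr)

text \<open>The contraction of \<open>Q\<close> to the monoid is a prime and so belongs to a point
  \<open>u\<close>. Sections invertible at \<open>u\<close> are outside that prime, hence
  \<open>Q\<close> survives in the localization at \<open>u\<close> and lifts to
  \<open>q\<close>.\<close>

lemma chart_prime_exists:
  assumes U: "U \<in> affine_opens X" and Q: "primeideal Q (ZA X U)"
  shows "\<exists>u q. u \<in> U \<and> loc_point X u q \<and> chart_prime X U u q = Q"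
proof -
  have c: "chart X U" using U by (simp add: affine_chart)
  have o: "Op U" using U by (rule affine_open)
  interpret A: pm "sec X U" using sec_pm o .
  obtain u where u: "u \<in> U" "prime_of_point X U u = Z_contract (sec X U) Q"
    by (rule chart_point [OF c A.Z_contract_prime [OF Q]])
  interpret g: pm_morphism "sec X U" "pm_stalk X u" "germ X u U" by (rule germ_pm_morphism [OF o u(1)])
  note loc = chartD(4) [OF c u(1)]
  have "to_Z (sec X U) a \<notin> Q" if a: "a \<in> carrier (sec X U)" "germ X u U a \<in> Units (pm_stalk X u)" for a
  proof -
    have "a \<notin> Z_contract (sec X U) Q" unfolding u(2) [symmetric] using a by (simp add: mem_prime_of_point)
    then show ?thesis using a by (simp add: Z_contract_def)
  qed
  then obtain q where q: "primeideal q (ZO X u)" "Spec_map (ZA X U) (zg X u U) q = Q"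
    by (rule g.Z_map_lift_prime [OF loc Q])
  interpret q: primeideal q "ZO X u" by (rule q)
  have mem: "to_Z (pm_stalk X u) (germ X u U a) \<in> q \<longleftrightarrow> germ X u U a \<notin> Units (pm_stalk X u)"
    if a: "a \<in> carrier (sec X U)" for a
  proof -
    have "to_Z (pm_stalk X u) (germ X u U a) \<in> q \<longleftrightarrow> to_Z (sec X U) a \<in> Q"
      using q(2) a A.to_Z_closed by (auto simp: Spec_map_def zg_to_Z [OF o u(1)])
    also have "\<dots> \<longleftrightarrow> a \<in> prime_of_point X U u" unfolding u(2) using a by (simp add: Z_contract_def)
    finally show ?thesis using a by (simp add: mem_prime_of_point)
  qed
  \<comment> \<open>The condition on \<open>q\<close> is known for germs of sections over
    \<open>U\<close>; a general germ is such a germ up to a unit.\<close>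
  have "to_Z (pm_stalk X u) g \<in> q \<longleftrightarrow> g \<notin> Units (pm_stalk X u)" if gc: "g \<in> carrier (pm_stalk X u)" for g
  proof -
    obtain a s where a: "a \<in> carrier (sec X U)" "s \<in> carrier (sec X U)" "germ X u U s \<in> Units (pm_stalk X u)"
      "g \<otimes>\<^bsub>pm_stalk X u\<^esub> germ X u U s = germ X u U a"
      by (rule localization_surj [OF loc gc])
    have "to_Z (pm_stalk X u) g \<in> q \<longleftrightarrow> to_Z (pm_stalk X u) g \<otimes>\<^bsub>ZO X u\<^esub> to_Z (pm_stalk X u) (germ X u U s) \<in> q"
      using q.unit_mult_mem_iff gc a(3) g.B.to_Z_closed g.B.to_Z_Units by simp
    also have "\<dots> \<longleftrightarrow> to_Z (pm_stalk X u) (germ X u U a) \<in> q"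
      using gc a(2) germ_closed [OF o u(1)] by (simp add: g.B.to_Z_mult flip: a(4))
    also have "\<dots> \<longleftrightarrow> g \<notin> Units (pm_stalk X u)"
      using mem [OF a(1)] g.B.Units_mult_iff [of g "germ X u U s"] gc a germ_closed [OF o u(1) a(2)] by auto
    finally show ?thesis .
  qed
  then have "loc_point X u q" using q(1) topI [OF o u(1)] by (simp add: loc_point_def)
  then show ?thesis using u(1) q(2) by (auto simp: chart_prime_def)
qed

text \<open>\<open>u\<close> is recovered from the contraction to the monoid; then \<open>q\<close>
  is determined because the base change of the chart localizes to that of the stalk.\<close>

lemma chart_prime_inj:
  assumes U: "U \<in> affine_opens X" and u: "u \<in> U" "loc_point X u q" "v \<in> U" "loc_point X v r"
    and eq: "chart_prime X U u q = chart_prime X U v r"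
  shows "u = v \<and> q = r"
proof -
  have o: "Op U" using U by (rule affine_open)
  have "prime_of_point X U u = prime_of_point X U v"
    using Z_contract_chart_prime [OF o u(1,2)] Z_contract_chart_prime [OF o u(3,4)] eq by simp
  then have uv: "u = v" using chartD(3) U u affine_chart by blast
  have "q = r"
    using Spec_map_localization_inj [OF ZA_cring [OF o] ZO_cring zg_localization [OF U u(1)], of q r]
      loc_pointD(1,2) [OF u(2)] loc_pointD(2) [OF u(4)] eq uv by (simp add: chart_prime_def)
  then show ?thesis using uv by simp
qed

lemma stalk_coords_chart_prime:
  assumes "U \<in> affine_opens X" "u \<in> U" "loc_point X u q"
  shows "stalk_coords X U (chart_prime X U u q) = (u, q)"
proof -
  let ?P = "\<lambda>p. fst p \<in> U \<and> loc_point X (fst p) (snd p) \<and> chart_prime X U (fst p) (snd p) = chart_prime X U u q"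
  have "?P (SOME p. ?P p)" by (rule someI [of ?P "(u, q)"]) (simp add: assms)
  then have "?P (stalk_coords X U (chart_prime X U u q))" unfolding stalk_coords_def .
  then have "fst (stalk_coords X U (chart_prime X U u q)) = u \<and> snd (stalk_coords X U (chart_prime X U u q)) = q"
    by (intro chart_prime_inj [OF assms(1) _ _ assms(2,3)]) auto
  then show ?thesis by (simp add: prod_eq_iff)
qed

lemma topspace_Spec_ZA: "U \<in> affine_opens X \<Longrightarrow> topspace (Spec_top (ZA X U)) = {Q. primeideal Q (ZA X U)}"
  using topspace_Spec ZA_cring affine_open by blast

lemma chart_prime_cases:
  assumes "U \<in> affine_opens X" "e \<in> topspace (Spec_top (ZA X U))"
  obtains u q where "u \<in> U" "loc_point X u q" "chart_prime X U u q = e"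
proof -
  have "primeideal e (ZA X U)" using assms by (simp add: topspace_Spec_ZA)
  then show thesis using chart_prime_exists [OF assms(1)] that by blast
qed

lemma bc_invariant:
  assumes "U \<in> affine_opens X" "V \<in> affine_opens X" "V \<subseteq> U" "e \<in> topspace (Spec_top (ZA X V))"
  shows "stalk_coords X V e = stalk_coords X U (Spec_map (ZA X U) (zr X U V) e)"
    and "Spec_map (ZA X U) (zr X U V) e \<in> topspace (Spec_top (ZA X U))"
proof -
  note o = affine_open [OF assms(1)] affine_open [OF assms(2)]
  obtain u q where u: "u \<in> V" "loc_point X u q" "chart_prime X V u q = e"
    by (rule chart_prime_cases [OF assms(2,4)])
  have uU: "u \<in> U" using u assms by blast
  have eq: "Spec_map (ZA X U) (zr X U V) e = chart_prime X U u q"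
    unfolding u(3) [symmetric] by (rule chart_prime_res [OF o assms(3) u(1)])
  show "stalk_coords X V e = stalk_coords X U (Spec_map (ZA X U) (zr X U V) e)"
    unfolding eq using stalk_coords_chart_prime [OF assms(2) u(1,2)] stalk_coords_chart_prime [OF assms(1) uU u(2)] u(3) by simp
  show "Spec_map (ZA X U) (zr X U V) e \<in> topspace (Spec_top (ZA X U))"
    unfolding eq using chart_prime_primeideal [OF o(1) uU u(2)] assms by (simp add: topspace_Spec_ZA)
qed

lemma chart_prime_topspace:
  "\<lbrakk>U \<in> affine_opens X; u \<in> U; loc_point X u q\<rbrakk> \<Longrightarrow> chart_prime X U u q \<in> topspace (Spec_top (ZA X U))"
  using chart_prime_primeideal affine_open by (simp add: topspace_Spec_ZA)

text \<open>Both sides are compared with a smaller chart around \<open>u\<close>, where each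
  inclusion is a single step of the colimit relation.\<close>

lemma bc_in_eq:
  assumes "U \<in> affine_opens X" "V \<in> affine_opens X" "u \<in> U" "u \<in> V" "loc_point X u q"
  shows "bc_in X U (chart_prime X U u q) = bc_in X V (chart_prime X V u q)"
proof -
  have sub: "bc_in X W (chart_prime X W u q) = bc_in X U (chart_prime X U u q)"
    if "U \<in> affine_opens X" "W \<in> affine_opens X" "W \<subseteq> U" "u \<in> W" for U W
  proof -
    have "u \<in> U" using that by blast
    then show ?thesis
      unfolding bc_in_def chart_prime_res [OF affine_open [OF that(1)] affine_open [OF that(2)] that(3,4), symmetric]
      using that assms(5) chart_prime_topspace bc_invariant(2) [OF that(1-3)]
      by (intro colim_in_step) auto
  qed
  obtain W where "W \<in> affine_opens X" "u \<in> W" "W \<subseteq> U" "W \<subseteq> V" by (rule affine_Int [OF assms(1-4)])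
  then show ?thesis using sub [of U W] sub [of V W] assms by simp
qed

lemma bc_in_chart_prime:
  assumes "U \<in> affine_opens X" "u \<in> U" "loc_point X u q"
  shows "bc_in X U (chart_prime X U u q) = bc_point X u q"
proof -
  have "(SOME U. U \<in> affine_opens X \<and> u \<in> U) \<in> affine_opens X \<and> u \<in> (SOME U. U \<in> affine_opens X \<and> u \<in> U)"
    by (rule someI [of _ U]) (use assms in simp)
  then show ?thesis unfolding bc_point_def Let_def using assms by (intro bc_in_eq) blast+
qed

text \<open>\<open>stalk_coords\<close> is compatible with the transition maps and returns the
  coordinates of the point in any chart that contains its image.\<close>

lemma bc_point_inj:
  assumes "loc_point X u q" "loc_point X v r" "bc_point X u q = bc_point X v r"
  shows "u = v" "q = r"
proof -
  obtain U where U: "U \<in> affine_opens X" "u \<in> U" using exists_affine loc_pointD(1) [OF assms(1)] by blast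
  obtain V where V: "V \<in> affine_opens X" "v \<in> V" using exists_affine loc_pointD(1) [OF assms(2)] by blast
  have "bc_in X U (chart_prime X U u q) = bc_in X V (chart_prime X V v r)"
    using bc_in_chart_prime U V assms by simp
  then have eq: "colim_in (affine_opens X) (\<lambda>U. Spec_top (ZA X U)) (\<lambda>V U. Spec_map (ZA X U) (zr X U V)) U (chart_prime X U u q) =
      colim_in (affine_opens X) (\<lambda>U. Spec_top (ZA X U)) (\<lambda>V U. Spec_map (ZA X U) (zr X U V)) V (chart_prime X V v r)"
    unfolding bc_in_def .
  have "stalk_coords X U (chart_prime X U u q) = stalk_coords X V (chart_prime X V v r)"
    by (rule colim_invariant [where F = "stalk_coords X" and T = "\<lambda>U. Spec_top (ZA X U)", OF _ U(1) chart_prime_topspace [OF U assms(1)]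
          V(1) chart_prime_topspace [OF V assms(2)] eq]) (rule bc_invariant(1))
  then have "(u, q) = (v, r)" using stalk_coords_chart_prime U V assms by simp
  then show "u = v" "q = r" by simp_all
qed

lemma bc_top_cases:
  assumes "y \<in> topspace (bc_top X)"
  obtains u q where "loc_point X u q" "y = bc_point X u q"
proof -
  obtain U e where U: "U \<in> affine_opens X" "e \<in> topspace (Spec_top (ZA X U))" "y = bc_in X U e"
    using assms unfolding bc_top_def bc_in_def by (rule colim_cases)
  obtain u q where "u \<in> U" "loc_point X u q" "chart_prime X U u q = e"
    by (rule chart_prime_cases [OF U(1,2)])
  then show thesis using that bc_in_chart_prime U by blast
qed

lemma bc_point_topspace: "loc_point X u q \<Longrightarrow> bc_point X u q \<in> topspace (bc_top X)"
proof -
  assume l: "loc_point X u q"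
  obtain U where U: "U \<in> affine_opens X" "u \<in> U" using exists_affine loc_pointD(1) [OF l] by blast
  have "bc_in X U (chart_prime X U u q) \<in> topspace (bc_top X)"
    unfolding bc_top_def bc_in_def by (rule colim_in_topspace [where T = "\<lambda>U. Spec_top (ZA X U)", OF U(1) chart_prime_topspace [OF U l]])
  then show ?thesis using bc_in_chart_prime [OF U l] by simp
qed

text \<open>The function in the definition of \<open>bc_proj\<close> is the first component of
  \<open>stalk_coords\<close>, hence compatible with the transition maps.\<close>

lemma bc_proj_bc_point:
  assumes l: "loc_point X u q" shows "bc_proj X (bc_point X u q) = u"
proof -
  obtain U where U: "U \<in> affine_opens X" "u \<in> U" using exists_affine loc_pointD(1) [OF l] by blast
  have F: "point_of_prime X V (Z_contract (sec X V) e) = fst (stalk_coords X V e)"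
    if V: "V \<in> affine_opens X" "e \<in> topspace (Spec_top (ZA X V))" for V e
  proof -
    obtain v r where v: "v \<in> V" "loc_point X v r" "chart_prime X V v r = e"
      by (rule chart_prime_cases [OF V])
    have "chart X V" using V affine_chart by simp
    then show ?thesis
      using Z_contract_chart_prime [OF affine_open [OF V(1)] v(1,2)] v(3) point_of_prime_eq [OF _ v(1)]
        stalk_coords_chart_prime [OF V(1) v(1,2)] by simp
  qed
  have "the_elem ((\<lambda>(U, Q). point_of_prime X U (Z_contract (sec X U) Q)) ` bc_in X U (chart_prime X U u q))
      = point_of_prime X U (Z_contract (sec X U) (chart_prime X U u q))"
    unfolding bc_in_def
  proof (rule colim_the_elem)
    fix U V e assume UV: "U \<in> affine_opens X" "V \<in> affine_opens X" "V \<subseteq> U" "e \<in> topspace (Spec_top (ZA X V))"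
    show "point_of_prime X V (Z_contract (sec X V) e) =
        point_of_prime X U (Z_contract (sec X U) (Spec_map (ZA X U) (zr X U V) e))"
      unfolding F [OF UV(2,4)] F [OF UV(1) bc_invariant(2) [OF UV]] bc_invariant(1) [OF UV] ..
  qed (use U chart_prime_topspace [OF U l] in auto)
  then show ?thesis
    using F [OF U(1) chart_prime_topspace [OF U l]] stalk_coords_chart_prime [OF U l] bc_in_chart_prime [OF U l]
    by (simp add: bc_proj_def)
qed

lemma openin_bc:
  "openin (bc_top X) W \<longleftrightarrow> W \<subseteq> topspace (bc_top X) \<and>
    (\<forall>U\<in>affine_opens X. openin (Spec_top (ZA X U)) (bc_pre X U W))"
  unfolding bc_top_def topspace_colim openin_colim bc_pre_def bc_in_def ..

lemma mem_bc_pre: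
  assumes "U \<in> affine_opens X" "primeideal Q (ZA X U)"
  shows "Q \<in> bc_pre X U W \<longleftrightarrow> bc_in X U Q \<in> W"
  using assms by (simp add: bc_pre_def topspace_Spec_ZA)

text \<open>The image in X_Z of the basic open set of \<open>f\<close> in the chart
  \<open>U\<close>, described through coordinates so that membership can be tested from any other
  chart.\<close>

definition bc_basic :: "'p set \<Rightarrow> 's zelem \<Rightarrow> ('p, 's) bc_pt set" where
  "bc_basic U f = {bc_point X u q | u q. u \<in> U \<and> loc_point X u q \<and> zg X u U f \<notin> q}"

lemma bc_point_basic:
  assumes "loc_point X u q"
  shows "bc_point X u q \<in> bc_basic U f \<longleftrightarrow> u \<in> U \<and> zg X u U f \<notin> q"
proof
  assume "bc_point X u q \<in> bc_basic U f"
  then obtain v r where v: "bc_point X u q = bc_point X v r" "v \<in> U" "loc_point X v r" "zg X v U f \<notin> r"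
    by (auto simp: bc_basic_def)
  show "u \<in> U \<and> zg X u U f \<notin> q" using bc_point_inj [OF assms v(3,1)] v by simp
qed (use assms in \<open>auto simp: bc_basic_def\<close>)

text \<open>Prepares \<open>openin_bc_basic\<close>, where an open set found in a smaller chart has
  to be described by one function of the larger chart.\<close>

lemma open_in_chart:
  assumes U: "U \<in> affine_opens X" and V: "V \<in> affine_opens X" "V \<subseteq> U" "u \<in> V" and f: "f \<in> carrier (ZA X V)"
  obtains h w s where "h \<in> carrier (sec X U)" "V = {v \<in> U. h \<notin> prime_of_point X U v}"
    "w \<in> carrier (ZA X U)" "s \<in> carrier (sec X U)" "res X U V s \<in> Units (sec X V)"
    "f \<otimes>\<^bsub>ZA X V\<^esub> to_Z (sec X V) (res X U V s) = zr X U V w"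
proof -
  have c: "chart X U" "chart X V" using U V affine_chart by auto
  obtain h where h: "h \<in> carrier (sec X U)" "V = {v \<in> U. h \<notin> prime_of_point X U v}"
    using chart_subset(2) [OF c V(2,3)] by blast
  obtain s w where "s \<in> carrier (sec X U)" "res X U V s \<in> Units (sec X V)" "w \<in> carrier (ZA X U)"
    "f \<otimes>\<^bsub>ZA X V\<^esub> to_Z (sec X V) (res X U V s) = zr X U V w"
    using pm_morphism.Z_map_localization(2) [OF res_pm_morphism [OF chartD(1) [OF c(1)] chartD(1) [OF c(2)] V(2)]
        chart_subset(1) [OF c V(2,3)] f] by blast
  then show thesis using that h by blast
qed

text \<open>Openness in the colimit has to be tested in every chart \<open>U'\<close>, not just in
  \<open>U\<close>. Near a point, pass to an affine \<open>V\<close> inside both, write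
  \<open>f\<close> on \<open>V\<close> as \<open>w\<close> divided by a unit from the monoid, and
  take the product of \<open>w\<close> with the \<open>h\<close> that cuts out \<open>V\<close> in
  \<open>U'\<close>.\<close>

lemma openin_bc_basic:
  assumes U: "U \<in> affine_opens X" and f: "f \<in> carrier (ZA X U)"
  shows "openin (bc_top X) (bc_basic U f)"
  unfolding openin_bc
proof (intro conjI ballI)
  show "bc_basic U f \<subseteq> topspace (bc_top X)" using bc_point_topspace by (auto simp: bc_basic_def)
  fix U' assume U': "U' \<in> affine_opens X"
  have o: "Op U" "Op U'" using U U' affine_open by auto
  show "openin (Spec_top (ZA X U')) (bc_pre X U' (bc_basic U f))"
    unfolding openin_Spec [OF ZA_cring [OF o(2)]]
  proof
    fix Q assume Q: "Q \<in> bc_pre X U' (bc_basic U f)"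
    then have Qp: "primeideal Q (ZA X U')" using U' by (simp add: bc_pre_def topspace_Spec_ZA)
    obtain u q where u: "u \<in> U'" "loc_point X u q" "chart_prime X U' u q = Q" using chart_prime_exists [OF U' Qp] by blast
    have "bc_point X u q \<in> bc_basic U f"
      using Q bc_in_chart_prime [OF U' u(1,2)] u(3) by (simp add: bc_pre_def)
    then have uU: "u \<in> U" "zg X u U f \<notin> q" using bc_point_basic [OF u(2)] by auto
    obtain V where V: "V \<in> affine_opens X" "u \<in> V" "V \<subseteq> U" "V \<subseteq> U'" by (rule affine_Int [OF U U' uU(1) u(1)])
    have oV: "Op V" using V affine_open by blast
    let ?z = "zr X U V f"
    have z: "?z \<in> carrier (ZA X V)" by (rule zr_closed [OF o(1) oV V(3) f])
    obtain h w s where h: "h \<in> carrier (sec X U')" "V = {v \<in> U'. h \<notin> prime_of_point X U' v}"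
      "w \<in> carrier (ZA X U')" "s \<in> carrier (sec X U')" "res X U' V s \<in> Units (sec X V)"
      "?z \<otimes>\<^bsub>ZA X V\<^esub> to_Z (sec X V) (res X U' V s) = zr X U' V w"
      by (rule open_in_chart [OF U' V(1,4,2) z])
    interpret A: pm "sec X U'" using sec_pm o by blast
    interpret B: pm "sec X V" using sec_pm oV by blast
    interpret ZU: cring "ZA X U'" by (rule A.Z_ring_cring)
    have hc: "to_Z (sec X U') h \<in> carrier (ZA X U')" using A.to_Z_closed h(1) .
    have key: "zg X v U' w \<in> r \<longleftrightarrow> zg X v U f \<in> r" if v: "v \<in> V" and l: "loc_point X v r" for v r
    proof -
      interpret r: primeideal r "ZO X v" by (rule loc_pointD(2) [OF l])
      interpret S: pm "pm_stalk X v" using stalk_pm loc_pointD(1) [OF l] .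
      have sc: "res X U' V s \<in> carrier (sec X V)" using h(5) by (rule B.Units_closed)
      have un: "zg X v V (to_Z (sec X V) (res X U' V s)) \<in> Units (ZO X v)"
        unfolding zg_to_Z [OF oV v sc]
        using pm_hom_Units [OF B.pointed_monoid_axioms S.pointed_monoid_axioms germ_hom [OF oV v] h(5)] by (rule S.to_Z_Units)
      have "zg X v U' w = zg X v V ?z \<otimes>\<^bsub>ZO X v\<^esub> zg X v V (to_Z (sec X V) (res X U' V s))"
        using zg_zr [OF o(2) oV V(4) v h(3)] ring_hom_mult [OF zg_hom [OF oV v] z B.to_Z_closed [OF sc]] h(6) by simp
      also have "zg X v V ?z = zg X v U f" by (rule zg_zr [OF o(1) oV V(3) v f])
      finally show ?thesis using r.unit_mult_mem_iff [OF _ un] zg_closed [OF o(1) _ f, of v] v V(3) by auto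
    qed
    have mem: "to_Z (sec X U') h \<otimes>\<^bsub>ZA X U'\<^esub> w \<notin> chart_prime X U' v r \<longleftrightarrow> v \<in> V \<and> zg X v U f \<notin> r"
      if v: "v \<in> U'" and l: "loc_point X v r" for v r
    proof -
      interpret P: primeideal "chart_prime X U' v r" "ZA X U'" by (rule chart_prime_primeideal [OF o(2) v l])
      have "to_Z (sec X U') h \<otimes>\<^bsub>ZA X U'\<^esub> w \<notin> chart_prime X U' v r \<longleftrightarrow>
          to_Z (sec X U') h \<notin> chart_prime X U' v r \<and> w \<notin> chart_prime X U' v r"
        using P.I_prime [OF hc h(3)] P.I_l_closed [OF _ hc] P.I_r_closed [OF _ h(3)] by blast
      also have "to_Z (sec X U') h \<notin> chart_prime X U' v r \<longleftrightarrow> h \<notin> prime_of_point X U' v"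
        using Z_contract_chart_prime [OF o(2) v l] h(1) by (auto simp: Z_contract_def)
      also have "h \<notin> prime_of_point X U' v \<longleftrightarrow> v \<in> V" using h(2) v by blast
      finally show ?thesis using key [OF _ l] h(3) by (auto simp: mem_chart_prime)
    qed
    have "Q' \<in> bc_pre X U' (bc_basic U f)"
      if Q': "primeideal Q' (ZA X U')" "to_Z (sec X U') h \<otimes>\<^bsub>ZA X U'\<^esub> w \<notin> Q'" for Q'
    proof -
      obtain v r where v: "v \<in> U'" "loc_point X v r" "chart_prime X U' v r = Q'" using chart_prime_exists [OF U' Q'(1)] by blast
      then have "v \<in> U" "zg X v U f \<notin> r" using mem [OF v(1,2)] Q'(2) V(3) by auto
      then show ?thesis
        using bc_in_chart_prime [OF U' v(1,2)] bc_point_basic [OF v(2)] v(3) mem_bc_pre [OF U' Q'(1)] by simp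
    qed
    moreover have "to_Z (sec X U') h \<otimes>\<^bsub>ZA X U'\<^esub> w \<notin> Q" using mem [OF u(1,2)] u(3) V(2) uU(2) by simp
    ultimately show "primeideal Q (ZA X U') \<and> (\<exists>f'\<in>carrier (ZA X U'). f' \<notin> Q \<and>
        (\<forall>Q'. primeideal Q' (ZA X U') \<longrightarrow> f' \<notin> Q' \<longrightarrow> Q' \<in> bc_pre X U' (bc_basic U f)))"
      using Qp ZU.m_closed [OF hc h(3)] by blast
  qed
qed

end

section \<open>Strong prime congruences of a monoid scheme\<close>

text \<open>Composing the quotient map with the embedding of the quotient into a field exhibits the
  congruence as a kernel. In this form nonzero images can be cancelled and quotient classes
  disappear.\<close>

lemma (in pm) strong_prime_kernel:
  assumes "strong_prime_congruence A c"
  obtains K :: "('a set signed_sum \<times> 'a set signed_sum) ring" and h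
  where "field K" "h \<in> pm_hom A (mult_pmonoid K)"
    "\<And>a b. (a, b) \<in> c \<longleftrightarrow> a \<in> carrier A \<and> b \<in> carrier A \<and> h a = h b"
proof -
  have c: "congruence A c" and d: "pointed_domain (pm_quot A c)"
    using assms by (auto simp: strong_prime_congruence_def)
  have eq: "equiv (carrier A) c" and l: "\<And>a b l. \<lbrakk>(a, b) \<in> c; l \<in> carrier A\<rbrakk> \<Longrightarrow> (l \<otimes> a, l \<otimes> b) \<in> c"
    using c by (auto simp: congruence_def)
  obtain K :: "('a set signed_sum \<times> 'a set signed_sum) ring" and S k where K: "field K" "submonoid S K"
    "k \<in> pm_iso (pm_quot A c) ((mult_pmonoid K)\<lparr>carrier := S\<rparr>)"
    using d unfolding pointed_domain_def by blast
  have S: "S \<subseteq> carrier K" using submonoid.subset K(2) .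
  note k = pm_isoD [OF K(3)]
  have cl: "c `` {a} \<in> carrier (pm_quot A c)" if "a \<in> carrier A" for a
    using that by (auto simp: pm_quot_def intro: quotientI)
  have mult: "c `` {a} \<otimes>\<^bsub>pm_quot A c\<^esub> c `` {b} = c `` {a \<otimes> b}" if ab: "a \<in> carrier A" "b \<in> carrier A" for a b
  proof -
    have const: "c `` {a' \<otimes> b'} = c `` {a \<otimes> b}" if "a' \<in> c `` {a}" "b' \<in> c `` {b}" for a' b'
    proof -
      have ab': "(a, a') \<in> c" "(b, b') \<in> c" using that by auto
      then have "a' \<in> carrier A" "b' \<in> carrier A" using eq by (auto simp: equiv_def)
      then have "(a \<otimes> b, a \<otimes> b') \<in> c" "(a \<otimes> b', a' \<otimes> b') \<in> c"
        using l [OF ab'(2) ab(1)] l [OF ab'(1), of b'] ab m_comm by auto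
      then have "(a \<otimes> b, a' \<otimes> b') \<in> c" using eq unfolding equiv_def by (meson transE)
      then show ?thesis using equiv_class_eq [OF eq] by blast
    qed
    have "a \<in> c `` {a}" "b \<in> c `` {b}" using ab equiv_class_self [OF eq] by auto
    then have ne: "c `` {a} \<noteq> {}" "c `` {b} \<noteq> {}" by blast+
    have "c `` {a} \<otimes>\<^bsub>pm_quot A c\<^esub> c `` {b} = (\<Union>a'\<in>c `` {a}. \<Union>b'\<in>c `` {b}. c `` {a' \<otimes> b'})"
      by (simp add: pm_quot_def)
    also have "\<dots> = (\<Union>a'\<in>c `` {a}. \<Union>b'\<in>c `` {b}. c `` {a \<otimes> b})"
      by (intro SUP_cong refl const)
    also have "\<dots> = c `` {a \<otimes> b}" using ne by simp
    finally show ?thesis .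
  qed
  define h where "h a = k (c `` {a})" for a
  have "h \<in> pm_hom A (mult_pmonoid K)"
  proof (rule pm_homI)
    show "h a \<in> carrier (mult_pmonoid K)" if "a \<in> carrier A" for a
      using k(1) [OF cl [OF that]] S by (auto simp: h_def)
    show "h (a \<otimes> b) = h a \<otimes>\<^bsub>mult_pmonoid K\<^esub> h b" if "a \<in> carrier A" "b \<in> carrier A" for a b
      using k(2) [OF cl cl, of a b] that by (simp add: h_def mult)
    show "h \<one> = \<one>\<^bsub>mult_pmonoid K\<^esub>" "h (pzero A) = pzero (mult_pmonoid K)"
      using k(3,4) by (simp_all add: h_def pm_quot_def)
  qed
  moreover have "(a, b) \<in> c \<longleftrightarrow> a \<in> carrier A \<and> b \<in> carrier A \<and> h a = h b" for a b
    unfolding equiv_class_eq_iff [OF eq] h_def using k(5) cl by metis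
  ultimately show thesis using K(1) that by blast
qed

lemma (in pm) null_ideal_prime:
  assumes c: "strong_prime_congruence A c" shows "pm_prime_ideal A (null_ideal A c)"
proof -
  obtain K :: "('a set signed_sum \<times> 'a set signed_sum) ring" and h where K: "field K" "h \<in> pm_hom A (mult_pmonoid K)"
    "\<And>a b. (a, b) \<in> c \<longleftrightarrow> a \<in> carrier A \<and> b \<in> carrier A \<and> h a = h b"
    using strong_prime_kernel [OF c] by blast
  interpret K: field K by fact
  note h = pm_homD [OF K(2), simplified]
  have n: "a \<in> null_ideal A c \<longleftrightarrow> a \<in> carrier A \<and> h a = \<zero>\<^bsub>K\<^esub>" for a
    using h pzero_closed by (auto simp: null_ideal_def K(3))
  have "\<one> \<notin> null_ideal A c" using h by (simp add: n)
  then have "null_ideal A c \<noteq> carrier A" using one_closed by blast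
  then show ?thesis
    unfolding pm_prime_ideal_def pm_ideal_def using h pzero_closed K.integral
    by (auto simp: n)
qed

text \<open>The pair of \<open>\<one>\<close> and the zero is in no strong prime congruence, so one
  of the generating sets is everything.\<close>

lemma (in pm) topspace_SCong: "topspace (SCong A) = {c. strong_prime_congruence A c}"
proof (intro equalityI subsetI)
  fix c assume "c \<in> {c. strong_prime_congruence A c}"
  then have c: "strong_prime_congruence A c" by simp
  have "\<one> \<notin> null_ideal A c" by (rule pm_prime_ideal_one [OF pointed_monoid_axioms null_ideal_prime [OF c]])
  then have "c \<in> {c. strong_prime_congruence A c \<and> (\<one>, pzero A) \<notin> c}" using c by (simp add: null_ideal_def)
  then show "c \<in> topspace (SCong A)" unfolding SCong_def topology_generated_by_topspace using pzero_closed by blast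
qed (auto simp: SCong_def)

text \<open>For a congruence \<open>c\<close> this is the congruence it generates on the stalk, in
  explicit form: pairs that become related after clearing a common denominator. It lives on the
  stalk and so can be compared between charts; together with the image point it separates the points
  of SCong X.\<close>

definition stalk_cong :: "('p, 's) pm_space \<Rightarrow> 'p set \<Rightarrow> 'p \<Rightarrow> ('s \<times> 's) set \<Rightarrow> (('p set \<times> 's) set \<times> ('p set \<times> 's) set) set" where
  "stalk_cong X U u c = {(g, g'). g \<in> carrier (pm_stalk X u) \<and> g' \<in> carrier (pm_stalk X u) \<and>
     (\<exists>h\<in>carrier (sec X U). germ X u U h \<in> Units (pm_stalk X u) \<and>
       (\<exists>a b. (a, b) \<in> c \<and> g \<otimes>\<^bsub>pm_stalk X u\<^esub> germ X u U h = germ X u U a \<and>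
          g' \<otimes>\<^bsub>pm_stalk X u\<^esub> germ X u U h = germ X u U b))}"

definition cong_point :: "('p, 's) pm_space \<Rightarrow> 'p set \<Rightarrow> ('s \<times> 's) set \<Rightarrow> 'p" where
  "cong_point X U c = point_of_prime X U (null_ideal (sec X U) c)"

context monoid_scheme
begin

lemma cong_point:
  assumes U: "U \<in> affine_opens X" and c: "strong_prime_congruence (sec X U) c"
  shows "cong_point X U c \<in> U" "prime_of_point X U (cong_point X U c) = null_ideal (sec X U) c"
proof -
  have ch: "chart X U" using U affine_chart by simp
  interpret A: pm "sec X U" using sec_pm affine_open U by blast
  obtain u where "u \<in> U" "prime_of_point X U u = null_ideal (sec X U) c"
    by (rule chart_point [OF ch A.null_ideal_prime [OF c]])
  then show "cong_point X U c \<in> U" "prime_of_point X U (cong_point X U c) = null_ideal (sec X U) c"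
    using point_of_prime_eq [OF ch, of u] by (simp_all add: cong_point_def)
qed

lemma cong_point_pullback:
  assumes U: "U \<in> affine_opens X" and V: "V \<in> affine_opens X" "V \<subseteq> U" and c: "strong_prime_congruence (sec X V) c"
  shows "cong_point X U (congruence_pullback (sec X U) (res X U V) c) = cong_point X V c"
proof -
  have o: "Op U" "Op V" using U V affine_open by auto
  let ?v = "cong_point X V c"
  interpret A: pm "sec X U" using sec_pm o by blast
  note v = cong_point [OF V(1) c]
  have "null_ideal (sec X U) (congruence_pullback (sec X U) (res X U V) c) = prime_of_point X U ?v"
  proof (rule Set.set_eqI)
    fix a
    show "a \<in> null_ideal (sec X U) (congruence_pullback (sec X U) (res X U V) c) \<longleftrightarrow> a \<in> prime_of_point X U ?v"
    proof (cases "a \<in> carrier (sec X U)")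
      case True
      then show ?thesis
        using prime_of_point_res [OF o V(2) v(1) True] v(2) res_closed [OF o V(2)] pm_homD(4) [OF res_hom [OF o V(2)]] A.pzero_closed
        by (auto simp: null_ideal_def congruence_pullback_def)
    qed (simp add: null_ideal_def mem_prime_of_point)
  qed
  moreover have "chart X U" using U affine_chart by simp
  ultimately show ?thesis
    using point_of_prime_eq [of U ?v] v(1) V(2) by (auto simp: cong_point_def [of X U])
qed

text \<open>In one direction restriction of the sections suffices. In the other, \<open>a\<close>,
  \<open>b\<close> and the denominator \<open>h\<close> over \<open>V\<close> need not extend to
  \<open>U\<close>; they are cleared by sections over \<open>U\<close> that are units on
  \<open>V\<close>.\<close>

lemma stalk_cong_pullback:
  assumes U: "U \<in> affine_opens X" and V: "V \<in> affine_opens X" "V \<subseteq> U" "u \<in> V"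
    and c: "congruence (sec X V) c"
  shows "stalk_cong X U u (congruence_pullback (sec X U) (res X U V) c) = stalk_cong X V u c"
proof -
  have o: "Op U" "Op V" using U V affine_open by auto
  interpret A: pm "sec X U" using sec_pm o by blast
  interpret B: pm "sec X V" using sec_pm o by blast
  interpret S: pm "pm_stalk X u" using stalk_pm topI [OF o(2) V(3)] .
  have uU: "u \<in> U" using V by blast
  have ch: "chart X U" "chart X V" using U V affine_chart by auto
  note loc = chart_subset(1) [OF ch V(2,3)]
  note gr = germ_res [OF o V(2,3)]
  let ?c = "congruence_pullback (sec X U) (res X U V) c"
  show ?thesis
  proof (intro equalityI subrelI)
    fix g g' assume "(g, g') \<in> stalk_cong X U u ?c"
    then obtain h a b where *: "g \<in> carrier (pm_stalk X u)" "g' \<in> carrier (pm_stalk X u)" "h \<in> carrier (sec X U)"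
      "germ X u U h \<in> Units (pm_stalk X u)" "(a, b) \<in> ?c" "g \<otimes>\<^bsub>pm_stalk X u\<^esub> germ X u U h = germ X u U a"
      "g' \<otimes>\<^bsub>pm_stalk X u\<^esub> germ X u U h = germ X u U b" by (auto simp: stalk_cong_def)
    then have "a \<in> carrier (sec X U)" "b \<in> carrier (sec X U)" "(res X U V a, res X U V b) \<in> c"
      by (auto simp: congruence_pullback_def)
    moreover have "res X U V h \<in> carrier (sec X V)" using res_closed [OF o V(2) *(3)] .
    ultimately show "(g, g') \<in> stalk_cong X V u c"
      unfolding stalk_cong_def using *(1-4,6,7) gr
      by (intro CollectI case_prodI conjI bexI [of _ "res X U V h"] exI [of _ "res X U V a"] exI [of _ "res X U V b"]) simp_all
  next
    fix g g' assume "(g, g') \<in> stalk_cong X V u c"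
    then obtain h a b where *: "g \<in> carrier (pm_stalk X u)" "g' \<in> carrier (pm_stalk X u)" "h \<in> carrier (sec X V)"
      "germ X u V h \<in> Units (pm_stalk X u)" "(a, b) \<in> c" "g \<otimes>\<^bsub>pm_stalk X u\<^esub> germ X u V h = germ X u V a"
      "g' \<otimes>\<^bsub>pm_stalk X u\<^esub> germ X u V h = germ X u V b" by (auto simp: stalk_cong_def)
    have ab: "a \<in> carrier (sec X V)" "b \<in> carrier (sec X V)" using c *(5) by (auto simp: congruence_def equiv_def)
    \<comment> \<open>\<open>s\<close> clears \<open>a\<close> and \<open>b\<close>, then
      \<open>t\<close> clears the product of \<open>h\<close> and \<open>s\<close>. The new
      denominator \<open>h'\<close> has as germ the product of those of \<open>h\<close>,
      \<open>s\<close> and \<open>t\<close>, which is still a unit.\<close>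
    obtain a' b' s where s: "a' \<in> carrier (sec X U)" "b' \<in> carrier (sec X U)" "s \<in> carrier (sec X U)"
      "res X U V s \<in> Units (sec X V)" "a \<otimes>\<^bsub>sec X V\<^esub> res X U V s = res X U V a'" "b \<otimes>\<^bsub>sec X V\<^esub> res X U V s = res X U V b'"
      by (rule localization_common_denominator [OF sec_comm [OF o(1)] sec_comm [OF o(2)] loc ab])
    have rs: "res X U V s \<in> carrier (sec X V)" using s(4) by (rule B.Units_closed)
    obtain h' t where t: "h' \<in> carrier (sec X U)" "t \<in> carrier (sec X U)" "res X U V t \<in> Units (sec X V)"
      "(h \<otimes>\<^bsub>sec X V\<^esub> res X U V s) \<otimes>\<^bsub>sec X V\<^esub> res X U V t = res X U V h'"
      by (rule localization_surj [OF loc B.m_closed [OF *(3) rs]])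
    have rt: "res X U V t \<in> carrier (sec X V)" using t(3) by (rule B.Units_closed)
    note gc = germ_closed [OF o(2) V(3)] and gm = germ_mult [OF o(2) V(3)]
    have un: "germ X u V v \<in> Units (pm_stalk X u)" if "v \<in> Units (sec X V)" for v
      using pm_hom_Units [OF B.pointed_monoid_axioms S.pointed_monoid_axioms germ_hom [OF o(2) V(3)] that] .
    have h': "germ X u U h' = germ X u V h \<otimes>\<^bsub>pm_stalk X u\<^esub> (germ X u V (res X U V s) \<otimes>\<^bsub>pm_stalk X u\<^esub> germ X u V (res X U V t))"
      unfolding gr [OF t(1), symmetric] t(4) [symmetric]
      using *(3) rs rt gc by (simp add: S.m_assoc flip: gm)
    then have "germ X u U h' \<in> Units (pm_stalk X u)" using *(4) un s(4) t(3) by simp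
    moreover have eq: "k \<otimes>\<^bsub>pm_stalk X u\<^esub> germ X u U h' = germ X u U (d' \<otimes>\<^bsub>sec X U\<^esub> t)"
      if k: "k \<in> carrier (pm_stalk X u)" "k \<otimes>\<^bsub>pm_stalk X u\<^esub> germ X u V h = germ X u V d" "d \<in> carrier (sec X V)"
        "d' \<in> carrier (sec X U)" "d \<otimes>\<^bsub>sec X V\<^esub> res X U V s = res X U V d'" for k d d'
    proof -
      have "k \<otimes>\<^bsub>pm_stalk X u\<^esub> germ X u U h' = (k \<otimes>\<^bsub>pm_stalk X u\<^esub> germ X u V h) \<otimes>\<^bsub>pm_stalk X u\<^esub>
          germ X u V (res X U V s) \<otimes>\<^bsub>pm_stalk X u\<^esub> germ X u V (res X U V t)"
        unfolding h' using k(1) gc *(3) rs rt by (simp add: S.m_assoc)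
      also have "\<dots> = germ X u V (res X U V d') \<otimes>\<^bsub>pm_stalk X u\<^esub> germ X u V (res X U V t)"
        unfolding k(2) using gm [OF k(3) rs] k(5) by simp
      also have "\<dots> = germ X u U (d' \<otimes>\<^bsub>sec X U\<^esub> t)"
        using gr [OF k(4)] gr [OF t(2)] germ_mult [OF o(1) uU k(4) t(2)] by simp
      finally show ?thesis .
    qed
    moreover have "(a' \<otimes>\<^bsub>sec X U\<^esub> t, b' \<otimes>\<^bsub>sec X U\<^esub> t) \<in> ?c"
    proof -
      have l: "(l \<otimes>\<^bsub>sec X V\<^esub> a, l \<otimes>\<^bsub>sec X V\<^esub> b) \<in> c" if "l \<in> carrier (sec X V)" for l
        using c *(5) that by (auto simp: congruence_def)
      have "res X U V (d' \<otimes>\<^bsub>sec X U\<^esub> t) = (res X U V s \<otimes>\<^bsub>sec X V\<^esub> res X U V t) \<otimes>\<^bsub>sec X V\<^esub> d"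
        if "d \<in> carrier (sec X V)" "d' \<in> carrier (sec X U)" "d \<otimes>\<^bsub>sec X V\<^esub> res X U V s = res X U V d'" for d d'
        using that rs rt t(2) by (simp add: res_mult [OF o V(2)] B.m_ac flip: that(3))
      then show ?thesis
        using l [of "res X U V s \<otimes>\<^bsub>sec X V\<^esub> res X U V t"] rs rt s t(2) ab by (simp add: congruence_pullback_def)
    qed
    ultimately show "(g, g') \<in> stalk_cong X U u ?c"
      unfolding stalk_cong_def using *(1,2) t(1) eq [OF *(1,6) ab(1) s(1,5)] eq [OF *(2,7) ab(2) s(2,6)] by blast
  qed
qed

text \<open>Denominators lie outside the null ideal, so they are nonzero in the field whose kernel
  is \<open>c\<close> and cancel there. Hence extending \<open>c\<close> to the stalk loses no
  information.\<close>

lemma stalk_cong_recover: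
  assumes U: "U \<in> affine_opens X" and c: "strong_prime_congruence (sec X U) c"
  shows "(a, b) \<in> c \<longleftrightarrow> a \<in> carrier (sec X U) \<and> b \<in> carrier (sec X U) \<and>
    (germ X (cong_point X U c) U a, germ X (cong_point X U c) U b) \<in> stalk_cong X U (cong_point X U c) c"
    (is "_ \<longleftrightarrow> ?r")
proof -
  have o: "Op U" using U affine_open by blast
  have ch: "chart X U" using U affine_chart by simp
  interpret A: pm "sec X U" using sec_pm o by blast
  let ?u = "cong_point X U c"
  note u = cong_point [OF U c]
  interpret S: pm "pm_stalk X ?u" using stalk_pm topI [OF o u(1)] .
  note gc = germ_closed [OF o u(1)] and gm = germ_mult [OF o u(1)]
  obtain K :: "('s set signed_sum \<times> 's set signed_sum) ring" and k where K: "field K" "k \<in> pm_hom (sec X U) (mult_pmonoid K)"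
    "\<And>a b. (a, b) \<in> c \<longleftrightarrow> a \<in> carrier (sec X U) \<and> b \<in> carrier (sec X U) \<and> k a = k b"
    using A.strong_prime_kernel [OF c] by blast
  interpret K: field K by fact
  note k = pm_homD [OF K(2), simplified]
  have nz: "k h \<noteq> \<zero>\<^bsub>K\<^esub>" if "h \<in> carrier (sec X U)" "germ X ?u U h \<in> Units (pm_stalk X ?u)" for h
  proof -
    have "h \<notin> null_ideal (sec X U) c" using that u(2) by (auto simp: mem_prime_of_point)
    then show ?thesis using that(1) k(4) A.pzero_closed by (simp add: null_ideal_def K(3))
  qed
  show ?thesis
  proof
    assume ab: "(a, b) \<in> c"
    then have cl: "a \<in> carrier (sec X U)" "b \<in> carrier (sec X U)" using K(3) by auto
    have "germ X ?u U \<one>\<^bsub>sec X U\<^esub> = \<one>\<^bsub>pm_stalk X ?u\<^esub>" using stalk_one [OF o u(1)] by simp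
    then show ?r
      unfolding stalk_cong_def using cl ab gc
      by (intro CollectI case_prodI conjI bexI [of _ "\<one>\<^bsub>sec X U\<^esub>"] exI [where x = a] exI [where x = b]) simp_all
  next
    assume ?r
    then obtain h a' b' where *: "a \<in> carrier (sec X U)" "b \<in> carrier (sec X U)" "h \<in> carrier (sec X U)"
      "germ X ?u U h \<in> Units (pm_stalk X ?u)" "(a', b') \<in> c"
      "germ X ?u U a \<otimes>\<^bsub>pm_stalk X ?u\<^esub> germ X ?u U h = germ X ?u U a'"
      "germ X ?u U b \<otimes>\<^bsub>pm_stalk X ?u\<^esub> germ X ?u U h = germ X ?u U b'" by (auto simp: stalk_cong_def)
    have cl: "a' \<in> carrier (sec X U)" "b' \<in> carrier (sec X U)" "k a' = k b'" using *(5) K(3) by auto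
    have eq: "k d \<otimes>\<^bsub>K\<^esub> k h = k d'"
      if d: "d \<in> carrier (sec X U)" "d' \<in> carrier (sec X U)"
        "germ X ?u U d \<otimes>\<^bsub>pm_stalk X ?u\<^esub> germ X ?u U h = germ X ?u U d'" for d d'
    proof -
      have "germ X ?u U (d \<otimes>\<^bsub>sec X U\<^esub> h) = germ X ?u U d'" using d *(3) gm by simp
      then obtain t where t: "t \<in> carrier (sec X U)" "germ X ?u U t \<in> Units (pm_stalk X ?u)"
        "t \<otimes>\<^bsub>sec X U\<^esub> (d \<otimes>\<^bsub>sec X U\<^esub> h) = t \<otimes>\<^bsub>sec X U\<^esub> d'"
        using d *(3) by (elim localization_eq [OF chartD(4) [OF ch u(1)], rotated 2]) auto
      have "k t \<otimes>\<^bsub>K\<^esub> (k d \<otimes>\<^bsub>K\<^esub> k h) = k t \<otimes>\<^bsub>K\<^esub> k d'"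
        using arg_cong [OF t(3), of k] t(1) d *(3) by (simp add: k)
      then show ?thesis using K.m_lcancel nz [OF t(1,2)] k(1) t(1) d *(3) by auto
    qed
    have "k a \<otimes>\<^bsub>K\<^esub> k h = k b \<otimes>\<^bsub>K\<^esub> k h" using eq [OF *(1) cl(1) *(6)] eq [OF *(2) cl(2) *(7)] cl(3) by simp
    then have "k a = k b" using K.m_rcancel nz [OF *(3,4)] k(1) * by auto
    then show "(a, b) \<in> c" using * K(3) by blast
  qed
qed

text \<open>The image point and the extended congruence are unchanged by the transition maps, and
  \<open>stalk_cong_recover\<close> reads \<open>c\<close> off from them.\<close>

lemma SCong_in_inj:
  assumes U: "U \<in> affine_opens X" and c: "c \<in> topspace (SCong (sec X U))" "d \<in> topspace (SCong (sec X U))"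
    and eq: "SCong_in X U c = SCong_in X U d"
  shows "c = d"
proof -
  have sp: "topspace (SCong (sec X V)) = {c. strong_prime_congruence (sec X V) c}" if "V \<in> affine_opens X" for V
    using pm.topspace_SCong [OF sec_pm [OF affine_open [OF that]]] .
  define F where "F U c = (cong_point X U c, stalk_cong X U (cong_point X U c) c)" for U c
  have Fcd: "F U c = F U d"
  proof (rule colim_invariant [where F = F and T = "\<lambda>U. SCong (sec X U)" and t = "\<lambda>V U. congruence_pullback (sec X U) (res X U V)"])
    fix U V e assume *: "U \<in> affine_opens X" "V \<in> affine_opens X" "V \<subseteq> U" "e \<in> topspace (SCong (sec X V))"
    then have e: "strong_prime_congruence (sec X V) e" using sp by simp
    then have "congruence (sec X V) e" by (simp add: strong_prime_congruence_def)
    then show "F V e = F U (congruence_pullback (sec X U) (res X U V) e)"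
      using cong_point_pullback [OF *(1-3) e] stalk_cong_pullback [OF *(1-3) cong_point(1) [OF *(2) e]]
      by (simp add: F_def)
  qed (use U c eq in \<open>simp_all add: SCong_in_def\<close>)
  have "cong_point X U c = cong_point X U d" "stalk_cong X U (cong_point X U c) c = stalk_cong X U (cong_point X U d) d"
    using arg_cong [OF Fcd, of fst] arg_cong [OF Fcd, of snd] by (simp_all only: F_def fst_conv snd_conv)
  then have "(a, b) \<in> c \<longleftrightarrow> (a, b) \<in> d" for a b
    using stalk_cong_recover [OF U, of c a b] stalk_cong_recover [OF U, of d a b] c sp [OF U] by simp
  then show ?thesis by auto
qed

lemma SCong_proj_SCong_in:
  assumes U: "U \<in> affine_opens X" and c: "c \<in> topspace (SCong (sec X U))"
  shows "SCong_proj X (SCong_in X U c) = cong_point X U c"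
  unfolding SCong_proj_def SCong_in_def cong_point_def
proof (rule colim_the_elem [where F = "\<lambda>U c. point_of_prime X U (null_ideal (sec X U) c)" and T = "\<lambda>U. SCong (sec X U)"])
  fix U V e assume *: "U \<in> affine_opens X" "V \<in> affine_opens X" "V \<subseteq> U" "e \<in> topspace (SCong (sec X V))"
  then have e: "strong_prime_congruence (sec X V) e" using pm.topspace_SCong [OF sec_pm [OF affine_open [OF *(2)]]] by simp
  show "point_of_prime X V (null_ideal (sec X V) e) =
    point_of_prime X U (null_ideal (sec X U) (congruence_pullback (sec X U) (res X U V) e))"
    using cong_point_pullback [OF *(1-3) e] by (simp add: cong_point_def)
qed (use U c in auto)

lemma scong_at_SCong_in:
  assumes U: "U \<in> affine_opens X" and c: "c \<in> topspace (SCong (sec X U))"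
  shows "scong_at X (SCong_in X U c) U = c"
  unfolding scong_at_def using c SCong_in_inj [OF U] by (intro the_equality) auto

section \<open>The map from the base change to the strong prime congruences\<close>

lemma gamma_affine_SCong:
  assumes "U \<in> affine_opens X" "primeideal Q (ZA X U)"
  shows "gamma_affine (sec X U) Q \<in> topspace (SCong (sec X U))"
  using pm.gamma_affine_strong_prime [OF sec_pm] pm.topspace_SCong [OF sec_pm] assms affine_open by blast

text \<open>The point is that \<open>gamma_affine\<close> commutes with the transition maps:
  contraction of primes corresponds to pullback of congruences, because ring homomorphisms respect
  differences.\<close>

lemma gamma_bc_in:
  assumes U: "U \<in> affine_opens X" and Q: "primeideal Q (ZA X U)"
  shows "gamma X (bc_in X U Q) = SCong_in X U (gamma_affine (sec X U) Q)"
  unfolding gamma_def bc_in_def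
proof (rule colim_the_elem [where F = "\<lambda>U Q. SCong_in X U (gamma_affine (sec X U) Q)" and T = "\<lambda>U. Spec_top (ZA X U)"])
  fix U V Q assume *: "U \<in> affine_opens X" "V \<in> affine_opens X" "V \<subseteq> U" "Q \<in> topspace (Spec_top (ZA X V))"
  have o: "Op U" "Op V" using * affine_open by auto
  interpret A: pm "sec X U" using sec_pm o by blast
  interpret B: pm "sec X V" using sec_pm o by blast
  interpret r: pm_morphism "sec X U" "sec X V" "res X U V" by (rule res_pm_morphism [OF o *(3)])
  let ?P = "Spec_map (ZA X U) (zr X U V) Q"
  have Q: "primeideal Q (ZA X V)" using * by (simp add: topspace_Spec_ZA)
  have P: "primeideal ?P (ZA X U)" using bc_invariant(2) [OF *] * by (simp add: topspace_Spec_ZA)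
  interpret ZU: cring "ZA X U" by (rule A.Z_ring_cring)
  interpret ZV: cring "ZA X V" by (rule B.Z_ring_cring)
  interpret h: ring_hom_cring "ZA X U" "ZA X V" "zr X U V" by unfold_locales (rule zr_hom [OF o *(3)])
  have "gamma_affine (sec X U) ?P = congruence_pullback (sec X U) (res X U V) (gamma_affine (sec X V) Q)"
  proof (intro equalityI subrelI)
    have m: "f \<in> ?P \<longleftrightarrow> f \<in> carrier (ZA X U) \<and> zr X U V f \<in> Q" for f by (simp add: Spec_map_def)
    fix a b
    have "(a, b) \<in> gamma_affine (sec X U) ?P \<longleftrightarrow>
        (a, b) \<in> congruence_pullback (sec X U) (res X U V) (gamma_affine (sec X V) Q)"
      unfolding A.gamma_affine_iff [OF P] congruence_pullback_def B.gamma_affine_iff [OF Q] m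
      using res_closed [OF o *(3)] by (auto simp: A.to_Z_closed B.to_Z_closed r.Z_map_to_Z a_minus_def)
    then show "(a, b) \<in> gamma_affine (sec X U) ?P \<Longrightarrow>
        (a, b) \<in> congruence_pullback (sec X U) (res X U V) (gamma_affine (sec X V) Q)"
      and "(a, b) \<in> congruence_pullback (sec X U) (res X U V) (gamma_affine (sec X V) Q) \<Longrightarrow>
        (a, b) \<in> gamma_affine (sec X U) ?P" by simp_all
  qed
  then show "SCong_in X V (gamma_affine (sec X V) Q) = SCong_in X U (gamma_affine (sec X U) ?P)"
    unfolding SCong_in_def
    using colim_in_step [where T = "\<lambda>U. SCong (sec X U)" and t = "\<lambda>V U. congruence_pullback (sec X U) (res X U V)",
        OF *(1-3) gamma_affine_SCong [OF *(2) Q]] gamma_affine_SCong [OF *(1) P] by simp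
qed (use U Q in \<open>simp_all add: topspace_Spec_ZA\<close>)

lemma gamma_topspace: "y \<in> topspace (bc_top X) \<Longrightarrow> gamma X y \<in> topspace (SCong_X X)"
proof -
  assume "y \<in> topspace (bc_top X)"
  then obtain U Q where U: "U \<in> affine_opens X" "Q \<in> topspace (Spec_top (ZA X U))" "y = bc_in X U Q"
    unfolding bc_top_def bc_in_def by (rule colim_cases)
  then have Q: "primeideal Q (ZA X U)" by (simp add: topspace_Spec_ZA)
  show ?thesis
    unfolding U(3) gamma_bc_in [OF U(1) Q] SCong_X_def SCong_in_def
    by (rule colim_in_topspace [where T = "\<lambda>U. SCong (sec X U)", OF U(1) gamma_affine_SCong [OF U(1) Q]])
qed

text \<open>The generating open set of \<open>(a, b)\<close> pulls back to the basic open set of the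
  difference of \<open>a\<close> and \<open>b\<close>.\<close>

lemma gamma_affine_continuous:
  assumes U: "U \<in> affine_opens X"
  shows "continuous_map (Spec_top (ZA X U)) (SCong (sec X U)) (gamma_affine (sec X U))"
  unfolding SCong_def
proof (rule continuous_on_generated_topo)
  have o: "Op U" using U affine_open by blast
  interpret A: pm "sec X U" using sec_pm o by blast
  interpret Z: cring "ZA X U" by (rule A.Z_ring_cring)
  have tS: "topspace (Spec_top (ZA X U)) = {Q. primeideal Q (ZA X U)}" using topspace_Spec_ZA [OF U] .
  fix W assume "W \<in> {{c. strong_prime_congruence (sec X U) c \<and> (a, b) \<notin> c} |a b. a \<in> carrier (sec X U) \<and> b \<in> carrier (sec X U)}"
  then obtain a b where ab: "a \<in> carrier (sec X U)" "b \<in> carrier (sec X U)"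
    "W = {c. strong_prime_congruence (sec X U) c \<and> (a, b) \<notin> c}" by blast
  let ?f = "to_Z (sec X U) a \<ominus>\<^bsub>ZA X U\<^esub> to_Z (sec X U) b"
  have "gamma_affine (sec X U) -` W \<inter> topspace (Spec_top (ZA X U)) = {Q. primeideal Q (ZA X U) \<and> ?f \<notin> Q}"
    using ab A.gamma_affine_strong_prime by (auto simp: tS A.gamma_affine_iff)
  moreover have "?f \<in> carrier (ZA X U)" using ab A.to_Z_closed by simp
  ultimately show "openin (Spec_top (ZA X U)) (gamma_affine (sec X U) -` W \<inter> topspace (Spec_top (ZA X U)))"
    unfolding openin_Spec [OF Z.is_cring] by blast
next
  show "gamma_affine (sec X U) ` topspace (Spec_top (ZA X U)) \<subseteq>
    \<Union>{{c. strong_prime_congruence (sec X U) c \<and> (a, b) \<notin> c} |a b. a \<in> carrier (sec X U) \<and> b \<in> carrier (sec X U)}"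
    using gamma_affine_SCong [OF U] topspace_Spec_ZA [OF U] unfolding SCong_def topology_generated_by_topspace by blast
qed

lemma gamma_continuous: "continuous_map (bc_top X) (SCong_X X) (gamma X)"
  unfolding continuous_map_def
proof (intro conjI allI impI)
  show "gamma X \<in> topspace (bc_top X) \<rightarrow> topspace (SCong_X X)" using gamma_topspace by blast
  fix W assume "openin (SCong_X X) W"
  then have W: "openin (SCong (sec X U)) {c \<in> topspace (SCong (sec X U)). SCong_in X U c \<in> W}" if "U \<in> affine_opens X" for U
    using that unfolding SCong_X_def openin_colim SCong_in_def by blast
  show "openin (bc_top X) {y \<in> topspace (bc_top X). gamma X y \<in> W}"
    unfolding openin_bc
  proof (intro conjI ballI)
    fix U assume U: "U \<in> affine_opens X"
    have "bc_in X U Q \<in> topspace (bc_top X)" if "Q \<in> topspace (Spec_top (ZA X U))" for Q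
      unfolding bc_top_def bc_in_def by (rule colim_in_topspace [where T = "\<lambda>U. Spec_top (ZA X U)", OF U that])
    then have "bc_pre X U {y \<in> topspace (bc_top X). gamma X y \<in> W} =
        {Q \<in> topspace (Spec_top (ZA X U)). gamma_affine (sec X U) Q \<in> {c \<in> topspace (SCong (sec X U)). SCong_in X U c \<in> W}}"
      using gamma_bc_in [OF U] gamma_affine_SCong [OF U] topspace_Spec_ZA [OF U] by (auto simp: bc_pre_def)
    then show "openin (Spec_top (ZA X U)) (bc_pre X U {y \<in> topspace (bc_top X). gamma X y \<in> W})"
      using openin_continuous_map_preimage [OF gamma_affine_continuous [OF U] W [OF U]] by simp
  qed blast
qed

text \<open>As \<open>bc_proj\<close> also sends the point to \<open>u\<close>, the second statement
  is the factorization of the projection from X_Z through SCong X.\<close>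

lemma gamma_bc_point:
  assumes l: "loc_point X u q" and U: "U \<in> affine_opens X" "u \<in> U"
  shows "gamma X (bc_point X u q) = SCong_in X U (gamma_affine (sec X U) (chart_prime X U u q))"
    and "SCong_proj X (gamma X (bc_point X u q)) = u"
    and "scong_at X (gamma X (bc_point X u q)) U = gamma_affine (sec X U) (chart_prime X U u q)"
proof -
  have o: "Op U" using U affine_open by blast
  interpret A: pm "sec X U" using sec_pm o by blast
  have p: "primeideal (chart_prime X U u q) (ZA X U)" by (rule chart_prime_primeideal [OF o U(2) l])
  note c = gamma_affine_SCong [OF U(1) p]
  show eq: "gamma X (bc_point X u q) = SCong_in X U (gamma_affine (sec X U) (chart_prime X U u q))"
    using gamma_bc_in [OF U(1) p] bc_in_chart_prime [OF U l] by simp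
  have "chart X U" using U affine_chart by simp
  then show "SCong_proj X (gamma X (bc_point X u q)) = u"
    unfolding eq SCong_proj_SCong_in [OF U(1) c] cong_point_def A.null_ideal_gamma_affine [OF p]
      Z_contract_chart_prime [OF o U(2) l] using point_of_prime_eq U(2) by blast
  show "scong_at X (gamma X (bc_point X u q)) U = gamma_affine (sec X U) (chart_prime X U u q)"
    unfolding eq by (rule scong_at_SCong_in [OF U(1) c])
qed

end

section \<open>Sections of the base change\<close>

abbreviation LL :: "('p, 's) pm_space \<Rightarrow> 'p \<Rightarrow> ('p set \<times> 's) set zelem set \<Rightarrow> (('p set \<times> 's) set zelem \<times> ('p set \<times> 's) set zelem) set ring" where
  "LL X u q \<equiv> ring_loc (ZO X u) (carrier (ZO X u) - q)"

abbreviation LF :: "('p, 's) pm_space \<Rightarrow> 'p \<Rightarrow> ('p set \<times> 's) set zelem set \<Rightarrow> ('p set \<times> 's) set zelem \<Rightarrow>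
    ('p set \<times> 's) set zelem \<Rightarrow> (('p set \<times> 's) set zelem \<times> ('p set \<times> 's) set zelem) set" where
  "LF X u q \<equiv> fraction (ZO X u) (carrier (ZO X u) - q)"

abbreviation CL :: "('p, 's) pm_space \<Rightarrow> 'p set \<Rightarrow> 's zelem set \<Rightarrow> ('s zelem \<times> 's zelem) set ring" where
  "CL X U Q \<equiv> ring_loc (ZA X U) (carrier (ZA X U) - Q)"

abbreviation CF :: "('p, 's) pm_space \<Rightarrow> 'p set \<Rightarrow> 's zelem set \<Rightarrow> 's zelem \<Rightarrow> 's zelem \<Rightarrow> ('s zelem \<times> 's zelem) set" where
  "CF X U Q \<equiv> fraction (ZA X U) (carrier (ZA X U) - Q)"

text \<open>
  The stalk of \<open>X\<^sub>\<int>\<close> at a point \<open>(u, q)\<close> will be \<open>LL X u q\<close>, and \<open>chart_val\<close> rewrites an element of it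
  as a fraction of elements of the chart \<open>U\<close>.
\<close>

definition chart_val :: "('p, 's) pm_space \<Rightarrow> 'p set \<Rightarrow> 'p \<Rightarrow> ('p set \<times> 's) set zelem set \<Rightarrow>
    (('p set \<times> 's) set zelem \<times> ('p set \<times> 's) set zelem) set \<Rightarrow> ('s zelem \<times> 's zelem) set" where
  "chart_val X U u q z = {(b, k). b \<in> carrier (ZA X U) \<and> k \<in> carrier (ZA X U) \<and> zg X u U k \<notin> q \<and>
     LF X u q (zg X u U b) (zg X u U k) = z}"

lemma Spec_simps:
  "spc (Spec R) = Spec_top R"
  "carrier (sec (Spec R) W) = local_fractions R (Spec_top R) W"
  "s \<otimes>\<^bsub>sec (Spec R) W\<^esub> t = (\<lambda>P\<in>W. s P \<otimes>\<^bsub>ring_loc R (carrier R - P)\<^esub> t P)"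
  "\<one>\<^bsub>sec (Spec R) W\<^esub> = (\<lambda>P\<in>W. \<one>\<^bsub>ring_loc R (carrier R - P)\<^esub>)"
  "\<zero>\<^bsub>sec (Spec R) W\<^esub> = (\<lambda>P\<in>W. \<zero>\<^bsub>ring_loc R (carrier R - P)\<^esub>)"
  "s \<oplus>\<^bsub>sec (Spec R) W\<^esub> t = (\<lambda>P\<in>W. s P \<oplus>\<^bsub>ring_loc R (carrier R - P)\<^esub> t P)"
  by (simp_all add: Spec_def)

context monoid_scheme
begin

lemma loc_ring_prime: "loc_point X u q \<Longrightarrow> ring_prime q (ZO X u)"
  by (rule ring_prime.intro) (rule loc_pointD(2))

lemma chart_ring_prime: "\<lbrakk>U \<in> affine_opens X; u \<in> U; loc_point X u q\<rbrakk> \<Longrightarrow> ring_prime (chart_prime X U u q) (ZA X U)"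
  by (rule ring_prime.intro) (rule chart_prime_primeideal [OF affine_open])

lemma loc_mult_set: "loc_point X u q \<Longrightarrow> ring_mult_set (ZO X u) (carrier (ZO X u) - q)"
  using ring_prime.prime_complement [OF loc_ring_prime] .

lemma chart_mult_set: "\<lbrakk>U \<in> affine_opens X; u \<in> U; loc_point X u q\<rbrakk> \<Longrightarrow>
    ring_mult_set (ZA X U) (carrier (ZA X U) - chart_prime X U u q)"
  using ring_prime.prime_complement [OF chart_ring_prime] .

section \<open>Translating between the local ring of a chart and that of a stalk\<close>

context
  fixes U u q assumes U: "U \<in> affine_opens X" "u \<in> U" and l: "loc_point X u q"
begin

text \<open>By \<open>fraction_localization_eq\<close> the local ring of X_Z at the point is the
  same whether formed from the chart or from the stalk; \<open>chart_val\<close> is the resulting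
  translation.\<close>

lemma chart_val_LF:
  assumes b: "b \<in> carrier (ZA X U)" and k: "k \<in> carrier (ZA X U)" "zg X u U k \<notin> q"
  shows "chart_val X U u q (LF X u q (zg X u U b) (zg X u U k)) = CF X U (chart_prime X U u q) b k"
proof -
  interpret S: ring_mult_set "ZO X u" "carrier (ZO X u) - q" by (rule loc_mult_set [OF l])
  interpret A: ring_mult_set "ZA X U" "carrier (ZA X U) - chart_prime X U u q" by (rule chart_mult_set [OF U l])
  interpret q: primeideal q "ZO X u" by (rule loc_pointD(2) [OF l])
  have Un: "Units (ZO X u) \<subseteq> carrier (ZO X u) - q" using q.Units_notin by blast
  have S: "carrier (ZA X U) - chart_prime X U u q = {a \<in> carrier (ZA X U). zg X u U a \<in> carrier (ZO X u) - q}"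
    using zg_closed [OF affine_open [OF U(1)] U(2)] by (auto simp: mem_chart_prime)
  have iff: "LF X u q (zg X u U c) (zg X u U m) = LF X u q (zg X u U b) (zg X u U k) \<longleftrightarrow>
      CF X U (chart_prime X U u q) c m = CF X U (chart_prime X U u q) b k"
    if "c \<in> carrier (ZA X U)" "m \<in> carrier (ZA X U)" "zg X u U m \<notin> q" for c m
    by (rule fraction_localization_eq [OF A.comm_monoid_axioms S.mult_set_axioms zg_localization [OF U] Un A.mult_set_axioms S])
      (use that b k in \<open>auto simp: mem_chart_prime\<close>)
  have km: "k \<in> carrier (ZA X U) - chart_prime X U u q" using k by (simp add: mem_chart_prime)
  show ?thesis
  proof (intro equalityI subrelI)
    fix c m assume "(c, m) \<in> chart_val X U u q (LF X u q (zg X u U b) (zg X u U k))"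
    then show "(c, m) \<in> CF X U (chart_prime X U u q) b k"
      unfolding A.mem_fraction_iff [OF b km] chart_val_def using iff by (auto simp: mem_chart_prime)
  next
    fix c m assume "(c, m) \<in> CF X U (chart_prime X U u q) b k"
    then have "c \<in> carrier (ZA X U)" "m \<in> carrier (ZA X U)" "zg X u U m \<notin> q"
      "CF X U (chart_prime X U u q) c m = CF X U (chart_prime X U u q) b k"
      unfolding A.mem_fraction_iff [OF b km] by (auto simp: mem_chart_prime)
    then show "(c, m) \<in> chart_val X U u q (LF X u q (zg X u U b) (zg X u U k))"
      unfolding chart_val_def using iff by simp
  qed
qed

lemma LF_cases:
  assumes "z \<in> carrier (LL X u q)"
  obtains b k where "b \<in> carrier (ZA X U)" "k \<in> carrier (ZA X U)" "zg X u U k \<notin> q" "z = LF X u q (zg X u U b) (zg X u U k)"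
proof -
  interpret S: ring_mult_set "ZO X u" "carrier (ZO X u) - q" by (rule loc_mult_set [OF l])
  interpret A: cring "ZA X U" using ZA_cring affine_open U by blast
  interpret q: primeideal q "ZO X u" by (rule loc_pointD(2) [OF l])
  have Un: "Units (ZO X u) \<subseteq> carrier (ZO X u) - q" using q.Units_notin by blast
  obtain b t where b: "b \<in> carrier (ZO X u)" "t \<in> carrier (ZO X u) - q" "z = LF X u q b t"
    using assms by (rule S.ring_loc_cases)
  obtain a h where "a \<in> carrier (ZA X U)" "h \<in> carrier (ZA X U)" "zg X u U h \<in> carrier (ZO X u) - q"
    "LF X u q b t = LF X u q (zg X u U a) (zg X u U h)"
    by (rule fraction_localization_surj [OF A.comm_monoid_axioms S.mult_set_axioms zg_localization [OF U] Un b(1,2)])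
  then show thesis using that b(3) by blast
qed

lemma LF_closed:
  "\<lbrakk>b \<in> carrier (ZA X U); k \<in> carrier (ZA X U); zg X u U k \<notin> q\<rbrakk> \<Longrightarrow> LF X u q (zg X u U b) (zg X u U k) \<in> carrier (LL X u q)"
  using ring_mult_set.fr_closed [OF loc_mult_set [OF l]] zg_closed [OF affine_open [OF U(1)] U(2)] by simp

lemma chart_val_inj:
  assumes "z \<in> carrier (LL X u q)" "chart_val X U u q z = chart_val X U u q w"
  shows "z = w"
proof -
  obtain b k where "b \<in> carrier (ZA X U)" "k \<in> carrier (ZA X U)" "zg X u U k \<notin> q" "z = LF X u q (zg X u U b) (zg X u U k)"
    by (rule LF_cases [OF assms(1)])
  then have "(b, k) \<in> chart_val X U u q z" by (simp add: chart_val_def)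
  then have "(b, k) \<in> chart_val X U u q z" "(b, k) \<in> chart_val X U u q w" using assms(2) by simp_all
  then show ?thesis by (simp add: chart_val_def)
qed

lemma zg_mult_notin:
  assumes "h \<in> carrier (ZA X U)" "zg X u U h \<notin> q" "k \<in> carrier (ZA X U)" "zg X u U k \<notin> q"
  shows "zg X u U (h \<otimes>\<^bsub>ZA X U\<^esub> k) \<notin> q"
proof -
  interpret q: primeideal q "ZO X u" by (rule loc_pointD(2) [OF l])
  show ?thesis
    unfolding ring_hom_mult [OF zg_hom [OF affine_open [OF U(1)] U(2)] assms(1,3)]
    using q.I_prime [OF zg_closed [OF affine_open [OF U(1)] U(2) assms(1)] zg_closed [OF affine_open [OF U(1)] U(2) assms(3)]]
      assms by blast
qed

lemma LF_mult:
  assumes "b \<in> carrier (ZA X U)" "k \<in> carrier (ZA X U)" "zg X u U k \<notin> q"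
    "c \<in> carrier (ZA X U)" "m \<in> carrier (ZA X U)" "zg X u U m \<notin> q"
  shows "LF X u q (zg X u U b) (zg X u U k) \<otimes>\<^bsub>LL X u q\<^esub> LF X u q (zg X u U c) (zg X u U m) =
      LF X u q (zg X u U (b \<otimes>\<^bsub>ZA X U\<^esub> c)) (zg X u U (k \<otimes>\<^bsub>ZA X U\<^esub> m))"
    and "LF X u q (zg X u U b) (zg X u U k) \<oplus>\<^bsub>LL X u q\<^esub> LF X u q (zg X u U c) (zg X u U m) =
      LF X u q (zg X u U ((b \<otimes>\<^bsub>ZA X U\<^esub> m) \<oplus>\<^bsub>ZA X U\<^esub> (c \<otimes>\<^bsub>ZA X U\<^esub> k))) (zg X u U (k \<otimes>\<^bsub>ZA X U\<^esub> m))"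
proof -
  interpret S: ring_mult_set "ZO X u" "carrier (ZO X u) - q" by (rule loc_mult_set [OF l])
  interpret A: cring "ZA X U" using ZA_cring affine_open U by blast
  note h = zg_hom [OF affine_open [OF U(1)] U(2)] and cl = zg_closed [OF affine_open [OF U(1)] U(2)]
  show "LF X u q (zg X u U b) (zg X u U k) \<otimes>\<^bsub>LL X u q\<^esub> LF X u q (zg X u U c) (zg X u U m) =
      LF X u q (zg X u U (b \<otimes>\<^bsub>ZA X U\<^esub> c)) (zg X u U (k \<otimes>\<^bsub>ZA X U\<^esub> m))"
    using assms cl by (simp add: S.fr_mult ring_hom_mult [OF h])
  show "LF X u q (zg X u U b) (zg X u U k) \<oplus>\<^bsub>LL X u q\<^esub> LF X u q (zg X u U c) (zg X u U m) =
      LF X u q (zg X u U ((b \<otimes>\<^bsub>ZA X U\<^esub> m) \<oplus>\<^bsub>ZA X U\<^esub> (c \<otimes>\<^bsub>ZA X U\<^esub> k))) (zg X u U (k \<otimes>\<^bsub>ZA X U\<^esub> m))"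
    using assms cl by (simp add: S.fr_add ring_hom_mult [OF h] ring_hom_add [OF h])
qed

lemma chart_val_ops:
  assumes z: "z \<in> carrier (LL X u q)" and w: "w \<in> carrier (LL X u q)"
  shows "chart_val X U u q z \<otimes>\<^bsub>CL X U (chart_prime X U u q)\<^esub> chart_val X U u q w = chart_val X U u q (z \<otimes>\<^bsub>LL X u q\<^esub> w)"
    and "chart_val X U u q z \<oplus>\<^bsub>CL X U (chart_prime X U u q)\<^esub> chart_val X U u q w = chart_val X U u q (z \<oplus>\<^bsub>LL X u q\<^esub> w)"
proof -
  interpret A: ring_mult_set "ZA X U" "carrier (ZA X U) - chart_prime X U u q" by (rule chart_mult_set [OF U l])
  obtain b k where b: "b \<in> carrier (ZA X U)" "k \<in> carrier (ZA X U)" "zg X u U k \<notin> q" "z = LF X u q (zg X u U b) (zg X u U k)"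
    by (rule LF_cases [OF z])
  obtain c m where c: "c \<in> carrier (ZA X U)" "m \<in> carrier (ZA X U)" "zg X u U m \<notin> q" "w = LF X u q (zg X u U c) (zg X u U m)"
    by (rule LF_cases [OF w])
  have km: "k \<otimes>\<^bsub>ZA X U\<^esub> m \<in> carrier (ZA X U)" "zg X u U (k \<otimes>\<^bsub>ZA X U\<^esub> m) \<notin> q"
    using b c zg_mult_notin by auto
  have s: "k \<in> carrier (ZA X U) - chart_prime X U u q" "m \<in> carrier (ZA X U) - chart_prime X U u q"
    using b c by (auto simp: mem_chart_prime)
  show "chart_val X U u q z \<otimes>\<^bsub>CL X U (chart_prime X U u q)\<^esub> chart_val X U u q w = chart_val X U u q (z \<otimes>\<^bsub>LL X u q\<^esub> w)"
    unfolding b(4) c(4) LF_mult(1) [OF b(1-3) c(1-3)] chart_val_LF [OF b(1-3)] chart_val_LF [OF c(1-3)]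
      chart_val_LF [OF A.m_closed [OF b(1) c(1)] km] by (rule A.fr_mult [OF b(1) c(1) s])
  have bc: "(b \<otimes>\<^bsub>ZA X U\<^esub> m) \<oplus>\<^bsub>ZA X U\<^esub> (c \<otimes>\<^bsub>ZA X U\<^esub> k) \<in> carrier (ZA X U)" using b c by simp
  show "chart_val X U u q z \<oplus>\<^bsub>CL X U (chart_prime X U u q)\<^esub> chart_val X U u q w = chart_val X U u q (z \<oplus>\<^bsub>LL X u q\<^esub> w)"
    unfolding b(4) c(4) LF_mult(2) [OF b(1-3) c(1-3)] chart_val_LF [OF b(1-3)] chart_val_LF [OF c(1-3)]
      chart_val_LF [OF bc km] by (rule A.fr_add [OF b(1) c(1) s])
qed

lemma zg_one_notin: "zg X u U \<one>\<^bsub>ZA X U\<^esub> \<notin> q"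
  using ring_hom_one [OF zg_hom [OF affine_open [OF U(1)] U(2)]] primeideal.one_notin [OF loc_pointD(2) [OF l]] by simp

lemma chart_val_one_zero:
  "chart_val X U u q \<one>\<^bsub>LL X u q\<^esub> = \<one>\<^bsub>CL X U (chart_prime X U u q)\<^esub>"
  "chart_val X U u q \<zero>\<^bsub>LL X u q\<^esub> = \<zero>\<^bsub>CL X U (chart_prime X U u q)\<^esub>"
  "\<one>\<^bsub>LL X u q\<^esub> = LF X u q (zg X u U \<one>\<^bsub>ZA X U\<^esub>) (zg X u U \<one>\<^bsub>ZA X U\<^esub>)"
  "\<zero>\<^bsub>LL X u q\<^esub> = LF X u q (zg X u U \<zero>\<^bsub>ZA X U\<^esub>) (zg X u U \<one>\<^bsub>ZA X U\<^esub>)"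
proof -
  interpret S: ring_mult_set "ZO X u" "carrier (ZO X u) - q" by (rule loc_mult_set [OF l])
  interpret A: ring_mult_set "ZA X U" "carrier (ZA X U) - chart_prime X U u q" by (rule chart_mult_set [OF U l])
  interpret h: ring_hom_cring "ZA X U" "ZO X u" "zg X u U"
    by unfold_locales (rule zg_hom [OF affine_open [OF U(1)] U(2)])
  show 1: "\<one>\<^bsub>LL X u q\<^esub> = LF X u q (zg X u U \<one>\<^bsub>ZA X U\<^esub>) (zg X u U \<one>\<^bsub>ZA X U\<^esub>)"
    and 0: "\<zero>\<^bsub>LL X u q\<^esub> = LF X u q (zg X u U \<zero>\<^bsub>ZA X U\<^esub>) (zg X u U \<one>\<^bsub>ZA X U\<^esub>)"
    by (simp_all add: S.ring_loc_one S.ring_loc_zero)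
  show "chart_val X U u q \<one>\<^bsub>LL X u q\<^esub> = \<one>\<^bsub>CL X U (chart_prime X U u q)\<^esub>"
    unfolding 1 A.ring_loc_one by (rule chart_val_LF [OF A.one_closed A.one_closed zg_one_notin])
  show "chart_val X U u q \<zero>\<^bsub>LL X u q\<^esub> = \<zero>\<^bsub>CL X U (chart_prime X U u q)\<^esub>"
    unfolding 0 A.ring_loc_zero by (rule chart_val_LF [OF A.zero_closed A.one_closed zg_one_notin])
qed

text \<open>The transition map between the local rings of two charts becomes the identity once
  elements are read in the stalk. Every representative contributes the whole class, so the union in
  \<open>Spec_pullback\<close> is that class.\<close>

lemma chart_val_pullback:
  assumes V: "V \<in> affine_opens X" "V \<subseteq> U" "u \<in> V" and z: "z \<in> carrier (LL X u q)"
  shows "(\<Union>(b, k)\<in>chart_val X U u q z. CF X V (chart_prime X V u q) (zr X U V b) (zr X U V k)) = chart_val X V u q z"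
proof -
  note o = affine_open [OF U(1)] affine_open [OF V(1)]
  have one: "CF X V (chart_prime X V u q) (zr X U V b) (zr X U V k) = chart_val X V u q z"
    if bk: "(b, k) \<in> chart_val X U u q z" for b k
  proof -
    interpret S: ring_mult_set "ZO X u" "carrier (ZO X u) - q" by (rule loc_mult_set [OF l])
    have *: "b \<in> carrier (ZA X U)" "k \<in> carrier (ZA X U)" "zg X u U k \<notin> q" "LF X u q (zg X u U b) (zg X u U k) = z"
      using bk by (auto simp: chart_val_def)
    interpret A: ring_mult_set "ZA X V" "carrier (ZA X V) - chart_prime X V u q" by (rule chart_mult_set [OF V(1,3) l])
    interpret q: primeideal q "ZO X u" by (rule loc_pointD(2) [OF l])
    have Un: "Units (ZO X u) \<subseteq> carrier (ZO X u) - q" using q.Units_notin by blast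
    have zb: "zr X U V b \<in> carrier (ZA X V)" "zr X U V k \<in> carrier (ZA X V)" using zr_closed [OF o V(2)] * by auto
    have zz: "zg X u V (zr X U V b) = zg X u U b" "zg X u V (zr X U V k) = zg X u U k"
      using zg_zr [OF o V(2,3)] * by auto
    have S: "carrier (ZA X V) - chart_prime X V u q = {a \<in> carrier (ZA X V). zg X u V a \<in> carrier (ZO X u) - q}"
      using zg_closed [OF o(2) V(3)] by (auto simp: mem_chart_prime)
    have iff: "LF X u q (zg X u V c) (zg X u V m) = LF X u q (zg X u V (zr X U V b)) (zg X u V (zr X U V k)) \<longleftrightarrow>
        CF X V (chart_prime X V u q) c m = CF X V (chart_prime X V u q) (zr X U V b) (zr X U V k)"
      if "c \<in> carrier (ZA X V)" "m \<in> carrier (ZA X V)" "zg X u V m \<notin> q" for c m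
      by (rule fraction_localization_eq [OF A.comm_monoid_axioms S.mult_set_axioms zg_localization [OF V(1,3)] Un A.mult_set_axioms S])
        (use that zb zz * in \<open>auto simp: mem_chart_prime\<close>)
    have km: "zr X U V k \<in> carrier (ZA X V) - chart_prime X V u q" using zb zz * by (simp add: mem_chart_prime)
    show ?thesis
    proof (intro equalityI subrelI)
      fix c m assume "(c, m) \<in> CF X V (chart_prime X V u q) (zr X U V b) (zr X U V k)"
      then have "c \<in> carrier (ZA X V)" "m \<in> carrier (ZA X V)" "zg X u V m \<notin> q"
        "CF X V (chart_prime X V u q) c m = CF X V (chart_prime X V u q) (zr X U V b) (zr X U V k)"
        unfolding A.mem_fraction_iff [OF zb(1) km] by (auto simp: mem_chart_prime)
      then show "(c, m) \<in> chart_val X V u q z" unfolding chart_val_def using iff * zz by simp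
    next
      fix c m assume "(c, m) \<in> chart_val X V u q z"
      then show "(c, m) \<in> CF X V (chart_prime X V u q) (zr X U V b) (zr X U V k)"
        unfolding A.mem_fraction_iff [OF zb(1) km] chart_val_def using iff * zz by (auto simp: mem_chart_prime)
    qed
  qed
  obtain b k where "b \<in> carrier (ZA X U)" "k \<in> carrier (ZA X U)" "zg X u U k \<notin> q" "z = LF X u q (zg X u U b) (zg X u U k)"
    by (rule LF_cases [OF z])
  then have "(b, k) \<in> chart_val X U u q z" by (simp add: chart_val_def)
  then have ne: "chart_val X U u q z \<noteq> {}" by blast
  have "(\<Union>p\<in>chart_val X U u q z. case_prod (\<lambda>b k. CF X V (chart_prime X V u q) (zr X U V b) (zr X U V k)) p)
      = (\<Union>p\<in>chart_val X U u q z. chart_val X V u q z)"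
    by (intro SUP_cong refl) (use one in \<open>simp add: split_beta\<close>)
  then show ?thesis using ne by simp
qed

end

text \<open>The value is prescribed in every chart \<open>U'\<close> around the point although the
  fraction comes from \<open>U\<close>: a section of X_Z is a family over all charts, and comparing
  germs involves all of them at once.\<close>

definition bc_given :: "('p, 's) bc_pt set \<Rightarrow> ('p, 's) bc_sec \<Rightarrow> 'p set \<Rightarrow> 's zelem \<Rightarrow> 's zelem \<Rightarrow> bool" where
  "bc_given W p U a h \<longleftrightarrow> (\<forall>u q. loc_point X u q \<longrightarrow> bc_point X u q \<in> W \<longrightarrow> u \<in> U \<and> zg X u U h \<notin> q \<and>
     (\<forall>U'\<in>affine_opens X. u \<in> U' \<longrightarrow>
        p U' (chart_prime X U' u q) = chart_val X U' u q (LF X u q (zg X u U a) (zg X u U h))))"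

lemma bc_givenD:
  assumes "bc_given W p U a h" "loc_point X u q" "bc_point X u q \<in> W"
  shows "u \<in> U" "zg X u U h \<notin> q"
    "\<lbrakk>U' \<in> affine_opens X; u \<in> U'\<rbrakk> \<Longrightarrow> p U' (chart_prime X U' u q) = chart_val X U' u q (LF X u q (zg X u U a) (zg X u U h))"
  using assms unfolding bc_given_def by blast+

text \<open>Says that the germ of \<open>p\<close> at the point is \<open>z\<close>. A fraction over
  a neighbourhood is demanded, and not just the value at the point, because only this determines
  \<open>p\<close> near the point.\<close>

definition bc_rep :: "'p \<Rightarrow> ('p set \<times> 's) set zelem set \<Rightarrow> ('p, 's) bc_pt set \<Rightarrow> ('p, 's) bc_sec \<Rightarrow>
    (('p set \<times> 's) set zelem \<times> ('p set \<times> 's) set zelem) set \<Rightarrow> bool" where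
  "bc_rep u q W p z \<longleftrightarrow> (\<exists>U\<in>affine_opens X. \<exists>a\<in>carrier (ZA X U). \<exists>h\<in>carrier (ZA X U). \<exists>W'.
     openin (bc_top X) W' \<and> bc_point X u q \<in> W' \<and> W' \<subseteq> W \<and> bc_given W' p U a h \<and>
     z = LF X u q (zg X u U a) (zg X u U h))"

text \<open>An equality of fractions at one point is witnessed by a multiplier \<open>w\<close>. It
  holds with the same \<open>w\<close> wherever \<open>w\<close> and both denominators stay outside
  the prime, which is a basic open set of a chart inside \<open>U\<close> and
  \<open>V\<close>.\<close>

lemma LF_spread:
  assumes l: "loc_point X u q" and U: "U \<in> affine_opens X" "u \<in> U" and V: "V \<in> affine_opens X" "u \<in> V"
    and a: "a \<in> carrier (ZA X U)" "h \<in> carrier (ZA X U)" "zg X u U h \<notin> q"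
    and b: "b \<in> carrier (ZA X V)" "k \<in> carrier (ZA X V)" "zg X u V k \<notin> q"
    and eq: "LF X u q (zg X u U a) (zg X u U h) = LF X u q (zg X u V b) (zg X u V k)"
  obtains W where "openin (bc_top X) W" "bc_point X u q \<in> W"
    "\<And>v r. \<lbrakk>loc_point X v r; bc_point X v r \<in> W\<rbrakk> \<Longrightarrow> v \<in> U \<and> v \<in> V \<and> zg X v U h \<notin> r \<and> zg X v V k \<notin> r \<and>
        LF X v r (zg X v U a) (zg X v U h) = LF X v r (zg X v V b) (zg X v V k)"
proof -
  obtain N where N: "N \<in> affine_opens X" "u \<in> N" "N \<subseteq> U" "N \<subseteq> V" by (rule affine_Int [OF U(1) V(1) U(2) V(2)])
  note o = affine_open [OF U(1)] affine_open [OF V(1)] affine_open [OF N(1)]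
  let ?a = "zr X U N a" and ?h = "zr X U N h" and ?b = "zr X V N b" and ?k = "zr X V N k"
  have cl: "?a \<in> carrier (ZA X N)" "?h \<in> carrier (ZA X N)" "?b \<in> carrier (ZA X N)" "?k \<in> carrier (ZA X N)"
    using zr_closed [OF o(1,3) N(3)] zr_closed [OF o(2,3) N(4)] a b by auto
  have g: "zg X v N ?a = zg X v U a" "zg X v N ?h = zg X v U h" "zg X v N ?b = zg X v V b" "zg X v N ?k = zg X v V k"
    if "v \<in> N" for v
    using zg_zr [OF o(1,3) N(3) that] zg_zr [OF o(2,3) N(4) that] a b by auto
  interpret A: ring_mult_set "ZA X N" "carrier (ZA X N) - chart_prime X N u q" by (rule chart_mult_set [OF N(1,2) l])
  have s: "?h \<in> carrier (ZA X N) - chart_prime X N u q" "?k \<in> carrier (ZA X N) - chart_prime X N u q"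
    using cl g [OF N(2)] a b by (auto simp: mem_chart_prime)
  have "CF X N (chart_prime X N u q) ?a ?h = CF X N (chart_prime X N u q) ?b ?k"
    using chart_val_LF [OF N(1,2) l cl(1,2)] chart_val_LF [OF N(1,2) l cl(3,4)] g [OF N(2)] a b eq by simp
  then obtain w where w: "w \<in> carrier (ZA X N)" "zg X u N w \<notin> q"
    "w \<otimes>\<^bsub>ZA X N\<^esub> (?a \<otimes>\<^bsub>ZA X N\<^esub> ?k) = w \<otimes>\<^bsub>ZA X N\<^esub> (?b \<otimes>\<^bsub>ZA X N\<^esub> ?h)"
    using A.fraction_eq_iff [OF cl(1,3) s] by (auto simp: mem_chart_prime)
  let ?f = "w \<otimes>\<^bsub>ZA X N\<^esub> (?h \<otimes>\<^bsub>ZA X N\<^esub> ?k)"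
  have f: "?f \<in> carrier (ZA X N)" using w cl by simp
  have eq': "v \<in> U \<and> v \<in> V \<and> zg X v U h \<notin> r \<and> zg X v V k \<notin> r \<and>
        LF X v r (zg X v U a) (zg X v U h) = LF X v r (zg X v V b) (zg X v V k)"
    if m: "loc_point X v r" "bc_point X v r \<in> bc_basic N ?f" for v r
  proof -
    have v: "v \<in> N" "zg X v N ?f \<notin> r" using bc_point_basic [OF m(1)] m(2) by auto
    interpret r: primeideal r "ZO X v" by (rule loc_pointD(2) [OF m(1)])
    interpret S: ring_mult_set "ZO X v" "carrier (ZO X v) - r" by (rule loc_mult_set [OF m(1)])
    note hm = ring_hom_mult [OF zg_hom [OF o(3) v(1)]]
    note c = zg_closed [OF o(3) v(1)]
    have "zg X v N w \<otimes>\<^bsub>ZO X v\<^esub> (zg X v N ?h \<otimes>\<^bsub>ZO X v\<^esub> zg X v N ?k) \<notin> r" using v(2) w(1) cl by (simp add: hm)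
    then have nr: "zg X v N w \<notin> r" "zg X v N ?h \<notin> r" "zg X v N ?k \<notin> r"
      using c [OF w(1)] c [OF cl(2)] c [OF cl(4)] r.I_l_closed r.I_r_closed by auto
    have "zg X v N w \<otimes>\<^bsub>ZO X v\<^esub> (zg X v N ?a \<otimes>\<^bsub>ZO X v\<^esub> zg X v N ?k) = zg X v N w \<otimes>\<^bsub>ZO X v\<^esub> (zg X v N ?b \<otimes>\<^bsub>ZO X v\<^esub> zg X v N ?h)"
      using arg_cong [OF w(3), of "zg X v N"] w(1) cl by (simp add: hm)
    then have "LF X v r (zg X v N ?a) (zg X v N ?h) = LF X v r (zg X v N ?b) (zg X v N ?k)"
      using c w(1) cl nr by (subst S.fraction_eq_iff) auto
    then show ?thesis using nr g [OF v(1)] v(1) N by auto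
  qed
  have "zg X u N ?f \<notin> q"
    using zg_mult_notin [OF N(1,2) l] w(1,2) cl g [OF N(2)] a b by simp
  then have "bc_point X u q \<in> bc_basic N ?f" using bc_point_basic [OF l] N(2) by simp
  then show thesis using that [OF openin_bc_basic [OF N(1) f]] eq' by blast
qed

text \<open>By \<open>LF_spread\<close> the chart and the fraction behind \<open>bc_rep\<close> may
  be exchanged for any others with the same value at the point.\<close>

lemma bc_rep_given:
  assumes l: "loc_point X u q" and rep: "bc_rep u q W p z"
    and V: "V \<in> affine_opens X" "u \<in> V" "b \<in> carrier (ZA X V)" "k \<in> carrier (ZA X V)" "zg X u V k \<notin> q"
      "z = LF X u q (zg X u V b) (zg X u V k)"
  obtains W' where "openin (bc_top X) W'" "bc_point X u q \<in> W'" "W' \<subseteq> W" "bc_given W' p V b k"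
proof -
  obtain U a h W' where U: "U \<in> affine_opens X" "a \<in> carrier (ZA X U)" "h \<in> carrier (ZA X U)" "openin (bc_top X) W'"
    "bc_point X u q \<in> W'" "W' \<subseteq> W" "bc_given W' p U a h" "z = LF X u q (zg X u U a) (zg X u U h)"
    using rep unfolding bc_rep_def by blast
  note g = bc_givenD [OF U(7)]
  obtain N where N: "openin (bc_top X) N" "bc_point X u q \<in> N"
    "\<And>v r. \<lbrakk>loc_point X v r; bc_point X v r \<in> N\<rbrakk> \<Longrightarrow> v \<in> U \<and> v \<in> V \<and> zg X v U h \<notin> r \<and> zg X v V k \<notin> r \<and>
        LF X v r (zg X v U a) (zg X v U h) = LF X v r (zg X v V b) (zg X v V k)"
    using LF_spread [OF l U(1) g(1) [OF l U(5)] V(1,2) U(2,3) g(2) [OF l U(5)] V(3-5)] U(8) V(6) by auto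
  have "bc_given (W' \<inter> N) p V b k"
    unfolding bc_given_def
  proof (intro allI impI)
    fix v r assume vr: "loc_point X v r" "bc_point X v r \<in> W' \<inter> N"
    then have W: "bc_point X v r \<in> W'" "bc_point X v r \<in> N" by auto
    note n = N(3) [OF vr(1) W(2)]
    have "p U' (chart_prime X U' v r) = chart_val X U' v r (LF X v r (zg X v V b) (zg X v V k))"
      if "U' \<in> affine_opens X" "v \<in> U'" for U'
      using g(3) [OF vr(1) W(1) that] n by simp
    then show "v \<in> V \<and> zg X v V k \<notin> r \<and>
     (\<forall>U'\<in>affine_opens X. v \<in> U' \<longrightarrow> p U' (chart_prime X U' v r) = chart_val X U' v r (LF X v r (zg X v V b) (zg X v V k)))"
      using n by blast
  qed
  then show thesis using that [of "W' \<inter> N"] U N by (auto intro: openin_Int)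
qed

lemma bc_rep_cases:
  assumes l: "loc_point X u q" and rep: "bc_rep u q W p z" and V: "V \<in> affine_opens X" "u \<in> V"
  obtains b k W' where "b \<in> carrier (ZA X V)" "k \<in> carrier (ZA X V)" "zg X u V k \<notin> q"
    "z = LF X u q (zg X u V b) (zg X u V k)" "openin (bc_top X) W'" "bc_point X u q \<in> W'" "W' \<subseteq> W" "bc_given W' p V b k"
proof -
  obtain U a h W' where U: "U \<in> affine_opens X" "a \<in> carrier (ZA X U)" "h \<in> carrier (ZA X U)"
    "bc_point X u q \<in> W'" "bc_given W' p U a h" "z = LF X u q (zg X u U a) (zg X u U h)"
    using rep unfolding bc_rep_def by blast
  note g = bc_givenD [OF U(5) l U(4)]
  have "z \<in> carrier (LL X u q)" unfolding U(6) by (rule LF_closed [OF U(1) g(1) l U(2,3) g(2)])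
  then obtain b k where b: "b \<in> carrier (ZA X V)" "k \<in> carrier (ZA X V)" "zg X u V k \<notin> q"
    "z = LF X u q (zg X u V b) (zg X u V k)" by (rule LF_cases [OF V l])
  obtain W' where "openin (bc_top X) W'" "bc_point X u q \<in> W'" "W' \<subseteq> W" "bc_given W' p V b k"
    by (rule bc_rep_given [OF l rep V b])
  then show thesis using that b by blast
qed

lemma bc_repI:
  assumes "U \<in> affine_opens X" "a \<in> carrier (ZA X U)" "h \<in> carrier (ZA X U)" "openin (bc_top X) W'"
    "bc_point X u q \<in> W'" "W' \<subseteq> W" "bc_given W' p U a h" "z = LF X u q (zg X u U a) (zg X u U h)"
  shows "bc_rep u q W p z"
  unfolding bc_rep_def using assms by blast

lemma bc_rep_closed:
  assumes "loc_point X u q" "bc_rep u q W p z" shows "z \<in> carrier (LL X u q)"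
proof -
  obtain U where U: "U \<in> affine_opens X" "u \<in> U" using exists_affine loc_pointD(1) [OF assms(1)] by blast
  obtain b k where "b \<in> carrier (ZA X U)" "k \<in> carrier (ZA X U)" "zg X u U k \<notin> q" "z = LF X u q (zg X u U b) (zg X u U k)"
    using bc_rep_cases [OF assms U] by blast
  then show ?thesis using LF_closed [OF U assms(1)] by blast
qed

definition bc_agree :: "('p, 's) bc_pt set \<Rightarrow> ('p, 's) bc_sec \<Rightarrow> ('p, 's) bc_sec \<Rightarrow> bool" where
  "bc_agree W p p' \<longleftrightarrow> (\<forall>U\<in>affine_opens X. \<forall>Q\<in>bc_pre X U W. p U Q = p' U Q)"

lemma bc_pre_cases:
  assumes "U \<in> affine_opens X" "Q \<in> bc_pre X U W"
  obtains u q where "u \<in> U" "loc_point X u q" "Q = chart_prime X U u q" "bc_point X u q \<in> W"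
proof -
  have Q: "Q \<in> topspace (Spec_top (ZA X U))" "bc_in X U Q \<in> W" using assms(2) by (auto simp: bc_pre_def)
  obtain u q where u: "u \<in> U" "loc_point X u q" "chart_prime X U u q = Q" by (rule chart_prime_cases [OF assms(1) Q(1)])
  show thesis
    by (rule that [OF u(1,2) u(3) [symmetric]]) (use Q(2) bc_in_chart_prime [OF assms(1) u(1,2)] u(3) in simp)
qed

lemma chart_prime_bc_pre:
  assumes "U \<in> affine_opens X" "u \<in> U" "loc_point X u q"
  shows "chart_prime X U u q \<in> bc_pre X U W \<longleftrightarrow> bc_point X u q \<in> W"
  using mem_bc_pre [OF assms(1) chart_prime_primeideal [OF affine_open [OF assms(1)] assms(2,3)]] bc_in_chart_prime [OF assms] by simp

text \<open>By \<open>bc_rep_given\<close> both sections are given near the point by one and the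
  same fraction; so \<open>z\<close> determines the germ.\<close>

lemma bc_rep_agree:
  assumes l: "loc_point X u q" and "bc_rep u q W p z" "bc_rep u q W' p' z"
  obtains N where "openin (bc_top X) N" "bc_point X u q \<in> N" "N \<subseteq> W \<inter> W'" "bc_agree N p p'"
proof -
  obtain U where U: "U \<in> affine_opens X" "u \<in> U" using exists_affine loc_pointD(1) [OF l] by blast
  obtain b k N where N: "b \<in> carrier (ZA X U)" "k \<in> carrier (ZA X U)" "zg X u U k \<notin> q"
    "z = LF X u q (zg X u U b) (zg X u U k)" "openin (bc_top X) N" "bc_point X u q \<in> N" "N \<subseteq> W" "bc_given N p U b k"
    by (rule bc_rep_cases [OF l assms(2) U])
  obtain N' where N': "openin (bc_top X) N'" "bc_point X u q \<in> N'" "N' \<subseteq> W'" "bc_given N' p' U b k"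
    by (rule bc_rep_given [OF l assms(3) U N(1-4)])
  have "bc_agree (N \<inter> N') p p'"
    unfolding bc_agree_def
  proof (intro ballI)
    fix V Q assume V: "V \<in> affine_opens X" and Q: "Q \<in> bc_pre X V (N \<inter> N')"
    obtain v r where v: "v \<in> V" "loc_point X v r" "Q = chart_prime X V v r" "bc_point X v r \<in> N \<inter> N'"
      by (rule bc_pre_cases [OF V Q])
    then show "p V Q = p' V Q"
      using bc_givenD(3) [OF N(8) v(2) _ V v(1)] bc_givenD(3) [OF N'(4) v(2) _ V v(1)] by simp
  qed
  then show thesis using that [of "N \<inter> N'"] N N' by (auto intro: openin_Int)
qed

lemma bc_rep_transfer:
  assumes "bc_rep u q W p z" "openin (bc_top X) N" "bc_point X u q \<in> N" "N \<subseteq> W'" "bc_agree N p p'"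
  shows "bc_rep u q W' p' z"
proof -
  obtain U a h W0 where U: "U \<in> affine_opens X" "a \<in> carrier (ZA X U)" "h \<in> carrier (ZA X U)" "openin (bc_top X) W0"
    "bc_point X u q \<in> W0" "bc_given W0 p U a h" "z = LF X u q (zg X u U a) (zg X u U h)"
    using assms(1) unfolding bc_rep_def by blast
  have "bc_given (W0 \<inter> N) p' U a h"
    unfolding bc_given_def
  proof (intro allI impI)
    fix v r assume v: "loc_point X v r" "bc_point X v r \<in> W0 \<inter> N"
    then have W: "bc_point X v r \<in> W0" "bc_point X v r \<in> N" by auto
    have "p' U' (chart_prime X U' v r) = chart_val X U' v r (LF X v r (zg X v U a) (zg X v U h))"
      if "U' \<in> affine_opens X" "v \<in> U'" for U'
      using bc_givenD(3) [OF U(6) v(1) W(1) that] assms(5) chart_prime_bc_pre [OF that v(1), of N] W(2) that(1)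
      by (simp add: bc_agree_def)
    then show "v \<in> U \<and> zg X v U h \<notin> r \<and> (\<forall>U'\<in>affine_opens X. v \<in> U' \<longrightarrow>
        p' U' (chart_prime X U' v r) = chart_val X U' v r (LF X v r (zg X v U a) (zg X v U h)))"
      using bc_givenD(1,2) [OF U(6) v(1) W(1)] by blast
  qed
  then show ?thesis
    by (intro bc_repI [OF U(1-3) openin_Int [OF U(4) assms(2)] _ _ _ U(7)]) (use U(5) assms(3,4) in auto)
qed

text \<open>The value in a single chart already determines \<open>z\<close>, by
  \<open>chart_val_inj\<close>.\<close>

lemma bc_rep_unique:
  assumes l: "loc_point X u q" and z: "bc_rep u q W p z" "bc_rep u q W' p w"
  shows "z = w"
proof -
  obtain U where U: "U \<in> affine_opens X" "u \<in> U" using exists_affine loc_pointD(1) [OF l] by blast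
  have val: "p U (chart_prime X U u q) = chart_val X U u q z" if "bc_rep u q W p z" for W z
  proof -
    obtain V a h W0 where V: "bc_point X u q \<in> W0" "bc_given W0 p V a h" "z = LF X u q (zg X u V a) (zg X u V h)"
      using \<open>bc_rep u q W p z\<close> unfolding bc_rep_def by blast
    then show ?thesis using bc_givenD(3) [OF V(2) l V(1) U] by simp
  qed
  show ?thesis by (rule chart_val_inj [OF U l bc_rep_closed [OF l z(1)]]) (use val [OF z(1)] val [OF z(2)] in simp)
qed

text \<open>\<open>m\<close> and \<open>s\<close> are constrained only through their values at
  points, which lets the lemma be applied to products and sums of restricted sections.\<close>

lemma bc_rep_ops:
  assumes l: "loc_point X u q" and rep: "bc_rep u q W p z" "bc_rep u q W' p' w"
    and op: "\<And>U v r. \<lbrakk>U \<in> affine_opens X; v \<in> U; loc_point X v r; bc_point X v r \<in> W; bc_point X v r \<in> W'\<rbrakk> \<Longrightarrow>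
      m U (chart_prime X U v r) = p U (chart_prime X U v r) \<otimes>\<^bsub>CL X U (chart_prime X U v r)\<^esub> p' U (chart_prime X U v r)"
    and op': "\<And>U v r. \<lbrakk>U \<in> affine_opens X; v \<in> U; loc_point X v r; bc_point X v r \<in> W; bc_point X v r \<in> W'\<rbrakk> \<Longrightarrow>
      s U (chart_prime X U v r) = p U (chart_prime X U v r) \<oplus>\<^bsub>CL X U (chart_prime X U v r)\<^esub> p' U (chart_prime X U v r)"
  shows "bc_rep u q (W \<inter> W') m (z \<otimes>\<^bsub>LL X u q\<^esub> w)" "bc_rep u q (W \<inter> W') s (z \<oplus>\<^bsub>LL X u q\<^esub> w)"
proof -
  obtain U where U: "U \<in> affine_opens X" "u \<in> U" using exists_affine loc_pointD(1) [OF l] by blast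
  interpret A: cring "ZA X U" using ZA_cring affine_open U by blast
  obtain a h N where N: "a \<in> carrier (ZA X U)" "h \<in> carrier (ZA X U)" "zg X u U h \<notin> q"
    "z = LF X u q (zg X u U a) (zg X u U h)" "openin (bc_top X) N" "bc_point X u q \<in> N" "N \<subseteq> W" "bc_given N p U a h"
    by (rule bc_rep_cases [OF l rep(1) U])
  obtain b k N' where N': "b \<in> carrier (ZA X U)" "k \<in> carrier (ZA X U)" "zg X u U k \<notin> q"
    "w = LF X u q (zg X u U b) (zg X u U k)" "openin (bc_top X) N'" "bc_point X u q \<in> N'" "N' \<subseteq> W'" "bc_given N' p' U b k"
    by (rule bc_rep_cases [OF l rep(2) U])
  let ?ab = "a \<otimes>\<^bsub>ZA X U\<^esub> b" and ?hk = "h \<otimes>\<^bsub>ZA X U\<^esub> k" and ?c = "(a \<otimes>\<^bsub>ZA X U\<^esub> k) \<oplus>\<^bsub>ZA X U\<^esub> (b \<otimes>\<^bsub>ZA X U\<^esub> h)"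
  have vals: "v \<in> U \<and> zg X v U ?hk \<notin> r \<and> (\<forall>U'\<in>affine_opens X. v \<in> U' \<longrightarrow>
      m U' (chart_prime X U' v r) = chart_val X U' v r (LF X v r (zg X v U ?ab) (zg X v U ?hk)) \<and>
      s U' (chart_prime X U' v r) = chart_val X U' v r (LF X v r (zg X v U ?c) (zg X v U ?hk)))"
    if v: "loc_point X v r" "bc_point X v r \<in> N \<inter> N'" for v r
  proof -
    have W: "bc_point X v r \<in> N" "bc_point X v r \<in> N'" "bc_point X v r \<in> W" "bc_point X v r \<in> W'" using v(2) N(7) N'(7) by auto
    note g = bc_givenD [OF N(8) v(1) W(1)] and g' = bc_givenD [OF N'(8) v(1) W(2)]
    note lf = LF_closed [OF U(1) g(1) v(1) N(1,2) g(2)] LF_closed [OF U(1) g(1) v(1) N'(1,2) g'(2)]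
    note lm = LF_mult [OF U(1) g(1) v(1) N(1,2) g(2) N'(1,2) g'(2)]
    have "m U' (chart_prime X U' v r) = chart_val X U' v r (LF X v r (zg X v U ?ab) (zg X v U ?hk)) \<and>
      s U' (chart_prime X U' v r) = chart_val X U' v r (LF X v r (zg X v U ?c) (zg X v U ?hk))"
      if U': "U' \<in> affine_opens X" "v \<in> U'" for U'
      using op [OF U' v(1) W(3,4)] op' [OF U' v(1) W(3,4)] g(3) [OF U'] g'(3) [OF U'] chart_val_ops [OF U' v(1) lf] lm
      by simp
    then show ?thesis using g(1) zg_mult_notin [OF U(1) g(1) v(1) N(2) g(2) N'(2) g'(2)] by blast
  qed
  have o: "openin (bc_top X) (N \<inter> N')" "bc_point X u q \<in> N \<inter> N'" "N \<inter> N' \<subseteq> W \<inter> W'" using N N' by (auto intro: openin_Int)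
  have gm: "bc_given (N \<inter> N') m U ?ab ?hk" and gs: "bc_given (N \<inter> N') s U ?c ?hk"
    unfolding bc_given_def using vals by blast+
  have cl: "?ab \<in> carrier (ZA X U)" "?hk \<in> carrier (ZA X U)" "?c \<in> carrier (ZA X U)" using N N' by simp_all
  note lm = LF_mult [OF U l N(1-3) N'(1-3), folded N(4) N'(4)]
  show "bc_rep u q (W \<inter> W') m (z \<otimes>\<^bsub>LL X u q\<^esub> w)" by (rule bc_repI [OF U(1) cl(1,2) o gm lm(1)])
  show "bc_rep u q (W \<inter> W') s (z \<oplus>\<^bsub>LL X u q\<^esub> w)" by (rule bc_repI [OF U(1) cl(3,2) o gs lm(2)])
qed

text \<open>Compatibility in \<open>bc_sec_carrier\<close> relates only nested charts. Two charts
  around \<open>u\<close> are compared through a smaller one, where \<open>chart_val_inj\<close>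
  forces the same stalk element.\<close>

lemma bc_sec_value:
  assumes s: "s \<in> bc_sec_carrier X W" and W: "openin (bc_top X) W" and l: "loc_point X u q" and x: "bc_point X u q \<in> W"
  obtains z where "z \<in> carrier (LL X u q)"
    "\<And>U. \<lbrakk>U \<in> affine_opens X; u \<in> U\<rbrakk> \<Longrightarrow> s U (chart_prime X U u q) = chart_val X U u q z"
proof -
  have lf: "s U \<in> local_fractions (ZA X U) (Spec_top (ZA X U)) (bc_pre X U W)" if "U \<in> affine_opens X" for U
    using s that by (simp add: bc_sec_carrier_def Spec_simps)
  have ex: "\<exists>z\<in>carrier (LL X u q). s U (chart_prime X U u q) = chart_val X U u q z" if U: "U \<in> affine_opens X" "u \<in> U" for U
  proof -
    have "chart_prime X U u q \<in> bc_pre X U W" using chart_prime_bc_pre [OF U l] x by simp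
    then obtain N a h where "chart_prime X U u q \<in> N" "a \<in> carrier (ZA X U)" "h \<in> carrier (ZA X U)"
      "\<And>Q. Q \<in> N \<Longrightarrow> h \<notin> Q" "\<And>Q. Q \<in> N \<Longrightarrow> s U Q = CF X U Q a h"
      by (rule local_fractions_cases [OF lf [OF U(1)]]) blast
    then have *: "a \<in> carrier (ZA X U)" "h \<in> carrier (ZA X U)" "zg X u U h \<notin> q" "s U (chart_prime X U u q) = CF X U (chart_prime X U u q) a h"
      using mem_chart_prime [of h U u q] by blast+
    show ?thesis
      using LF_closed [OF U l *(1-3)] chart_val_LF [OF U l *(1-3)] *(4) by (intro bexI [of _ "LF X u q (zg X u U a) (zg X u U h)"]) simp_all
  qed
  have coh: "s V (chart_prime X V u q) = chart_val X V u q z"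
    if U: "U \<in> affine_opens X" "V \<in> affine_opens X" "V \<subseteq> U" "u \<in> V" and z: "z \<in> carrier (LL X u q)" "s U (chart_prime X U u q) = chart_val X U u q z"
    for U V z
  proof -
    have uU: "u \<in> U" using U by blast
    have pm: "chart_prime X V u q \<in> bc_pre X V W" using chart_prime_bc_pre [OF U(2,4) l] x by simp
    have "Spec_pullback (ZA X U) (ZA X V) (zr X U V) (bc_pre X V W) (s U) = s V"
      using s U(1-3) by (simp add: bc_sec_carrier_def)
    from fun_cong [OF this, of "chart_prime X V u q"] have "s V (chart_prime X V u q) = (\<Union>(b, k)\<in>s U (Spec_map (ZA X U) (zr X U V) (chart_prime X V u q)).
        CF X V (chart_prime X V u q) (zr X U V b) (zr X U V k))"
      unfolding Spec_pullback_def restrict_apply' [OF pm] by (rule sym)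
    also have "\<dots> = chart_val X V u q z"
      unfolding chart_prime_res [OF affine_open [OF U(1)] affine_open [OF U(2)] U(3,4)] z(2)
      by (rule chart_val_pullback [OF U(1) uU l U(2,3,4) z(1)])
    finally show ?thesis .
  qed
  obtain U where U: "U \<in> affine_opens X" "u \<in> U" using exists_affine loc_pointD(1) [OF l] by blast
  obtain z where z: "z \<in> carrier (LL X u q)" "s U (chart_prime X U u q) = chart_val X U u q z" using ex [OF U] by blast
  have "s V (chart_prime X V u q) = chart_val X V u q z" if V: "V \<in> affine_opens X" "u \<in> V" for V
  proof -
    obtain w where w: "w \<in> carrier (LL X u q)" "s V (chart_prime X V u q) = chart_val X V u q w" using ex [OF V] by blast
    obtain N where N: "N \<in> affine_opens X" "u \<in> N" "N \<subseteq> U" "N \<subseteq> V" by (rule affine_Int [OF U(1) V(1) U(2) V(2)])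
    have "chart_val X N u q z = chart_val X N u q w"
      using coh [OF U(1) N(1,3,2) z] coh [OF V(1) N(1,4,2) w] by simp
    then have "z = w" by (rule chart_val_inj [OF N(1,2) l z(1)])
    then show ?thesis using w by simp
  qed
  then show thesis using that z(1) by blast
qed

text \<open>In one chart a section is locally a fraction by definition of the structure sheaf;
  \<open>bc_sec_value\<close> carries this over to all other charts.\<close>

lemma bc_sec_rep:
  assumes s: "s \<in> bc_sec_carrier X W" and W: "openin (bc_top X) W" and l: "loc_point X u q" and x: "bc_point X u q \<in> W"
  obtains z where "bc_rep u q W s z"
proof -
  obtain U where U: "U \<in> affine_opens X" "u \<in> U" using exists_affine loc_pointD(1) [OF l] by blast
  have o: "Op U" using U affine_open by blast
  have lf: "s U \<in> local_fractions (ZA X U) (Spec_top (ZA X U)) (bc_pre X U W)"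
    using s U by (simp add: bc_sec_carrier_def Spec_simps)
  have pm: "chart_prime X U u q \<in> bc_pre X U W" using chart_prime_bc_pre [OF U l] x by simp
  obtain N a h where N: "openin (Spec_top (ZA X U)) N" "chart_prime X U u q \<in> N" "N \<subseteq> bc_pre X U W" "a \<in> carrier (ZA X U)" "h \<in> carrier (ZA X U)"
    "\<And>Q. Q \<in> N \<Longrightarrow> h \<notin> Q" "\<And>Q. Q \<in> N \<Longrightarrow> s U Q = CF X U Q a h"
    by (rule local_fractions_cases [OF lf pm]) blast
  obtain f where f: "f \<in> carrier (ZA X U)" "f \<notin> chart_prime X U u q" "\<And>Q'. primeideal Q' (ZA X U) \<Longrightarrow> f \<notin> Q' \<Longrightarrow> Q' \<in> N"
    using bspec [OF N(1) [unfolded openin_Spec [OF ZA_cring [OF o]]] N(2)] by blast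
  let ?W = "bc_basic U f"
  have sub: "?W \<subseteq> W" and giv: "bc_given ?W s U a h"
  proof -
    have *: "v \<in> U \<and> zg X v U h \<notin> r \<and> bc_point X v r \<in> W \<and> s U (chart_prime X U v r) = chart_val X U v r (LF X v r (zg X v U a) (zg X v U h))"
      if v: "loc_point X v r" "bc_point X v r \<in> ?W" for v r
    proof -
      have vU: "v \<in> U" "f \<notin> chart_prime X U v r" using bc_point_basic [OF v(1)] v(2) by (auto simp: mem_chart_prime)
      have Q: "chart_prime X U v r \<in> N" using f(3) [OF chart_prime_primeideal [OF o vU(1) v(1)] vU(2)] .
      have h: "zg X v U h \<notin> r" using N(6) [OF Q] N(5) by (simp add: mem_chart_prime)
      have "bc_point X v r \<in> W" using N(3) Q chart_prime_bc_pre [OF U(1) vU(1) v(1)] by blast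
      then show ?thesis using vU h N(7) [OF Q] chart_val_LF [OF U(1) vU(1) v(1) N(4,5) h] by simp
    qed
    show sub: "?W \<subseteq> W" using * by (auto simp: bc_basic_def bc_point_basic)
    show "bc_given ?W s U a h"
      unfolding bc_given_def
    proof (intro allI impI)
      fix v r assume v: "loc_point X v r" "bc_point X v r \<in> ?W"
      note v' = * [OF v]
      obtain z where z: "z \<in> carrier (LL X v r)" "\<And>U. \<lbrakk>U \<in> affine_opens X; v \<in> U\<rbrakk> \<Longrightarrow> s U (chart_prime X U v r) = chart_val X U v r z"
        using bc_sec_value [OF s W v(1)] v' by blast
      have "z = LF X v r (zg X v U a) (zg X v U h)"
        using chart_val_inj [OF U(1) _ v(1) z(1), of "LF X v r (zg X v U a) (zg X v U h)"] z(2) [OF U(1)] v' by simp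
      then show "v \<in> U \<and> zg X v U h \<notin> r \<and> (\<forall>U'\<in>affine_opens X. v \<in> U' \<longrightarrow>
          s U' (chart_prime X U' v r) = chart_val X U' v r (LF X v r (zg X v U a) (zg X v U h)))"
        using v' z(2) by blast
    qed
  qed
  have "bc_point X u q \<in> ?W" using bc_point_basic [OF l] U(2) f(1,2) by (simp add: mem_chart_prime)
  then show thesis
    using that bc_repI [OF U(1) N(4,5) openin_bc_basic [OF U(1) f(1)] _ sub giv refl] by blast
qed

end

lemma base_change_simps:
  "spc (base_change X) = bc_top X"
  "carrier (sec (base_change X) W) = bc_sec_carrier X W"
  "s \<otimes>\<^bsub>sec (base_change X) W\<^esub> t = (\<lambda>U\<in>affine_opens X. \<lambda>P\<in>bc_pre X U W. s U P \<otimes>\<^bsub>CL X U P\<^esub> t U P)"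
  "s \<oplus>\<^bsub>sec (base_change X) W\<^esub> t = (\<lambda>U\<in>affine_opens X. \<lambda>P\<in>bc_pre X U W. s U P \<oplus>\<^bsub>CL X U P\<^esub> t U P)"
  "\<one>\<^bsub>sec (base_change X) W\<^esub> = (\<lambda>U\<in>affine_opens X. \<lambda>P\<in>bc_pre X U W. \<one>\<^bsub>CL X U P\<^esub>)"
  "\<zero>\<^bsub>sec (base_change X) W\<^esub> = (\<lambda>U\<in>affine_opens X. \<lambda>P\<in>bc_pre X U W. \<zero>\<^bsub>CL X U P\<^esub>)"
  "res (base_change X) W W' s = (\<lambda>U\<in>affine_opens X. restrict (s U) (bc_pre X U W'))"
  by (simp_all add: base_change_def Let_def Spec_def)

section \<open>Stalks of the base change\<close>

context monoid_scheme
begin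

text \<open>The fraction \<open>a/h\<close> on the basic open set of \<open>h\<close>, spread to all
  charts by passing through the stalk coordinates. It serves to realize every element of the local
  ring as a germ.\<close>

definition bc_frac :: "'p set \<Rightarrow> 's zelem \<Rightarrow> 's zelem \<Rightarrow> ('p, 's) bc_sec" where
  "bc_frac U a h = (\<lambda>U'\<in>affine_opens X. \<lambda>Q\<in>bc_pre X U' (bc_basic U h).
     let p = stalk_coords X U' Q; v = fst p; r = snd p in chart_val X U' v r (LF X v r (zg X v U a) (zg X v U h)))"

lemma bc_frac_value:
  assumes "U' \<in> affine_opens X" "v \<in> U'" "loc_point X v r" "bc_point X v r \<in> bc_basic U h"
  shows "bc_frac U a h U' (chart_prime X U' v r) = chart_val X U' v r (LF X v r (zg X v U a) (zg X v U h))"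
proof -
  have pm: "chart_prime X U' v r \<in> bc_pre X U' (bc_basic U h)" using chart_prime_bc_pre [OF assms(1-3)] assms(4) by simp
  show ?thesis
    unfolding bc_frac_def restrict_apply' [OF assms(1)] restrict_apply' [OF pm] Let_def stalk_coords_chart_prime [OF assms(1-3)] fst_conv snd_conv ..
qed

lemma bc_frac_given: "bc_given (bc_basic U h) (bc_frac U a h) U a h"
  unfolding bc_given_def
proof (intro allI impI)
  fix v r assume v: "loc_point X v r" "bc_point X v r \<in> bc_basic U h"
  show "v \<in> U \<and> zg X v U h \<notin> r \<and> (\<forall>U'\<in>affine_opens X. v \<in> U' \<longrightarrow>
      bc_frac U a h U' (chart_prime X U' v r) = chart_val X U' v r (LF X v r (zg X v U a) (zg X v U h)))"
    using bc_frac_value [OF _ _ v] bc_point_basic [OF v(1)] v(2) by blast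
qed

text \<open>In a chart other than \<open>U\<close> the fraction has to be rewritten locally with
  numerator and denominator from that chart; \<open>LF_spread\<close> makes this possible on a
  neighbourhood. Compatibility of the charts is \<open>chart_val_pullback\<close>.\<close>

lemma bc_frac_sec:
  assumes U: "U \<in> affine_opens X" and a: "a \<in> carrier (ZA X U)" "h \<in> carrier (ZA X U)"
  shows "bc_frac U a h \<in> bc_sec_carrier X (bc_basic U h)"
proof -
  let ?W = "bc_basic U h" and ?s = "bc_frac U a h"
  have oW: "openin (bc_top X) ?W" by (rule openin_bc_basic [OF U a(2)])
  have lf: "?s U' \<in> local_fractions (ZA X U') (Spec_top (ZA X U')) (bc_pre X U' ?W)" if U': "U' \<in> affine_opens X" for U'
    unfolding local_fractions_def
  proof (intro CollectI conjI ballI)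
    show "?s U' \<in> extensional (bc_pre X U' ?W)" by (simp add: bc_frac_def U')
    fix Q assume Q: "Q \<in> bc_pre X U' ?W"
    obtain u q where u: "u \<in> U'" "loc_point X u q" "Q = chart_prime X U' u q" "bc_point X u q \<in> ?W"
      by (rule bc_pre_cases [OF U' Q])
    have uU: "u \<in> U" "zg X u U h \<notin> q" using bc_point_basic [OF u(2)] u(4) by auto
    obtain b k where b: "b \<in> carrier (ZA X U')" "k \<in> carrier (ZA X U')" "zg X u U' k \<notin> q"
      "LF X u q (zg X u U a) (zg X u U h) = LF X u q (zg X u U' b) (zg X u U' k)"
      by (rule LF_cases [OF U' u(1,2) LF_closed [OF U uU(1) u(2) a uU(2)]])
    obtain N where N: "openin (bc_top X) N" "bc_point X u q \<in> N"
      "\<And>v r. \<lbrakk>loc_point X v r; bc_point X v r \<in> N\<rbrakk> \<Longrightarrow> v \<in> U \<and> v \<in> U' \<and> zg X v U h \<notin> r \<and> zg X v U' k \<notin> r \<and>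
        LF X v r (zg X v U a) (zg X v U h) = LF X v r (zg X v U' b) (zg X v U' k)"
      by (rule LF_spread [OF u(2) U uU(1) U' u(1) a uU(2) b]) blast
    have "openin (bc_top X) (N \<inter> ?W)" using N(1) oW by (rule openin_Int)
    then have 1: "openin (Spec_top (ZA X U')) (bc_pre X U' (N \<inter> ?W))" using U' unfolding openin_bc by blast
    have 2: "Q \<in> bc_pre X U' (N \<inter> ?W)" unfolding u(3) chart_prime_bc_pre [OF U' u(1,2)] using N(2) u(4) by blast
    have 3: "bc_pre X U' (N \<inter> ?W) \<subseteq> bc_pre X U' ?W" by (auto simp: bc_pre_def)
    have 4: "k \<notin> Q' \<and> ?s U' Q' = CF X U' Q' b k" if Q': "Q' \<in> bc_pre X U' (N \<inter> ?W)" for Q'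
    proof -
      obtain v r where v: "v \<in> U'" "loc_point X v r" "Q' = chart_prime X U' v r" "bc_point X v r \<in> N \<inter> ?W"
        by (rule bc_pre_cases [OF U' Q'])
      have W: "bc_point X v r \<in> N" "bc_point X v r \<in> ?W" using v(4) by auto
      note n = N(3) [OF v(2) W(1)]
      then have k: "zg X v U' k \<notin> r" by blast
      show ?thesis
        unfolding v(3) bc_frac_value [OF U' v(1,2) W(2)] using n chart_val_LF [OF U' v(1,2) b(1,2) k] k
        by (simp add: mem_chart_prime)
    qed
    show "\<exists>W. openin (Spec_top (ZA X U')) W \<and> Q \<in> W \<and> W \<subseteq> bc_pre X U' ?W \<and>
        (\<exists>a\<in>carrier (ZA X U'). \<exists>h\<in>carrier (ZA X U'). \<forall>Q\<in>W. h \<notin> Q \<and> ?s U' Q = CF X U' Q a h)"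
    proof (intro exI [of _ "bc_pre X U' (N \<inter> ?W)"] conjI 1 2 3)
      show "\<exists>a\<in>carrier (ZA X U'). \<exists>h\<in>carrier (ZA X U'). \<forall>Q\<in>bc_pre X U' (N \<inter> ?W). h \<notin> Q \<and> ?s U' Q = CF X U' Q a h"
        by (rule bexI [OF _ b(1)], rule bexI [OF _ b(2)], rule ballI, rule 4)
    qed
  qed
  have pull: "Spec_pullback (ZA X U') (ZA X V) (zr X U' V) (bc_pre X V ?W) (?s U') = ?s V"
    if V: "U' \<in> affine_opens X" "V \<in> affine_opens X" "V \<subseteq> U'" for U' V
  proof (rule extensionalityI [of _ "bc_pre X V ?W"])
    show "Spec_pullback (ZA X U') (ZA X V) (zr X U' V) (bc_pre X V ?W) (?s U') \<in> extensional (bc_pre X V ?W)"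
      by (simp add: Spec_pullback_def)
    show "?s V \<in> extensional (bc_pre X V ?W)" by (simp add: bc_frac_def V)
    fix Q assume Q: "Q \<in> bc_pre X V ?W"
    obtain u q where u: "u \<in> V" "loc_point X u q" "Q = chart_prime X V u q" "bc_point X u q \<in> ?W"
      by (rule bc_pre_cases [OF V(2) Q])
    have uU: "u \<in> U" "zg X u U h \<notin> q" using bc_point_basic [OF u(2)] u(4) by auto
    have uU': "u \<in> U'" using u(1) V(3) by blast
    have "Spec_pullback (ZA X U') (ZA X V) (zr X U' V) (bc_pre X V ?W) (?s U') Q =
        (\<Union>(b, k)\<in>?s U' (Spec_map (ZA X U') (zr X U' V) Q). CF X V Q (zr X U' V b) (zr X U' V k))"
      unfolding Spec_pullback_def restrict_apply' [OF Q] ..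
    also have "\<dots> = ?s V Q"
      unfolding u(3) chart_prime_res [OF affine_open [OF V(1)] affine_open [OF V(2)] V(3) u(1)]
        bc_frac_value [OF V(1) uU' u(2,4)] bc_frac_value [OF V(2) u(1,2,4)]
      by (rule chart_val_pullback [OF V(1) uU' u(2) V(2,3) u(1) LF_closed [OF U uU(1) u(2) a uU(2)]])
    finally show "Spec_pullback (ZA X U') (ZA X V) (zr X U' V) (bc_pre X V ?W) (?s U') Q = ?s V Q" .
  qed
  show ?thesis
    unfolding bc_sec_carrier_def using lf pull by (simp add: Spec_simps bc_frac_def)
qed

text \<open>All sections near the point with germ \<open>z\<close>, in the shape of the classes
  built by \<open>germ\<close>; \<open>germ_bc\<close> identifies the two.\<close>

definition bc_germ :: "'p \<Rightarrow> ('p set \<times> 's) set zelem set \<Rightarrow> (('p set \<times> 's) set zelem \<times> ('p set \<times> 's) set zelem) set \<Rightarrow>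
    (('p, 's) bc_pt set \<times> ('p, 's) bc_sec) set" where
  "bc_germ u q z = {(W, s). openin (bc_top X) W \<and> bc_point X u q \<in> W \<and> s \<in> bc_sec_carrier X W \<and> bc_rep u q W s z}"

lemma res_base_change_eq_iff:
  "res (base_change X) W N p = res (base_change X) V N t \<longleftrightarrow> bc_agree N p t"
proof
  assume eq: "res (base_change X) W N p = res (base_change X) V N t"
  show "bc_agree N p t"
    unfolding bc_agree_def
  proof (intro ballI)
    fix U Q assume U: "U \<in> affine_opens X" and Q: "Q \<in> bc_pre X U N"
    have "restrict (p U) (bc_pre X U N) = restrict (t U) (bc_pre X U N)"
      using fun_cong [OF eq, of U] U by (simp add: base_change_simps)
    from fun_cong [OF this, of Q] show "p U Q = t U Q" using Q by simp
  qed
next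
  assume "bc_agree N p t"
  then show "res (base_change X) W N p = res (base_change X) V N t"
    unfolding base_change_simps bc_agree_def by (intro restrict_ext) simp
qed

text \<open>Sections with equal germs have the same \<open>z\<close> by
  \<open>bc_rep_transfer\<close>; the converse is \<open>bc_rep_agree\<close>.\<close>

lemma germ_bc:
  assumes l: "loc_point X u q" and r: "bc_rep u q W p z"
  shows "germ (base_change X) (bc_point X u q) W p = bc_germ u q z"
proof (intro equalityI subrelI)
  fix V t assume "(V, t) \<in> germ (base_change X) (bc_point X u q) W p"
  then obtain N where N: "openin (bc_top X) V" "bc_point X u q \<in> V" "t \<in> bc_sec_carrier X V"
    "openin (bc_top X) N" "bc_point X u q \<in> N" "N \<subseteq> W \<inter> V" "bc_agree N p t"
    unfolding germ_def by (auto simp: base_change_simps(1,2) res_base_change_eq_iff)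
  have "N \<subseteq> V" using N(6) by blast
  then show "(V, t) \<in> bc_germ u q z"
    using N(1-3) bc_rep_transfer [OF r N(4,5) _ N(7)] by (simp add: bc_germ_def)
next
  fix V t assume "(V, t) \<in> bc_germ u q z"
  then have V: "openin (bc_top X) V" "bc_point X u q \<in> V" "t \<in> bc_sec_carrier X V" "bc_rep u q V t z"
    by (auto simp: bc_germ_def)
  obtain N where N: "openin (bc_top X) N" "bc_point X u q \<in> N" "N \<subseteq> W \<inter> V" "bc_agree N p t"
    by (rule bc_rep_agree [OF l r V(4)])
  show "(V, t) \<in> germ (base_change X) (bc_point X u q) W p"
    unfolding germ_def base_change_simps(1,2) res_base_change_eq_iff using V(1-3) N by blast
qed

lemma bc_germ_nonempty:
  assumes l: "loc_point X u q" and z: "z \<in> carrier (LL X u q)"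
  obtains W s where "(W, s) \<in> bc_germ u q z"
proof -
  obtain U where U: "U \<in> affine_opens X" "u \<in> U" using exists_affine loc_pointD(1) [OF l] by blast
  obtain a h where a: "a \<in> carrier (ZA X U)" "h \<in> carrier (ZA X U)" "zg X u U h \<notin> q" "z = LF X u q (zg X u U a) (zg X u U h)"
    by (rule LF_cases [OF U l z])
  note o = openin_bc_basic [OF U(1) a(2)]
  have x: "bc_point X u q \<in> bc_basic U h" using bc_point_basic [OF l] U(2) a(3) by simp
  have "bc_rep u q (bc_basic U h) (bc_frac U a h) z"
    by (rule bc_repI [OF U(1) a(1,2) o x subset_refl bc_frac_given a(4)])
  then have "(bc_basic U h, bc_frac U a h) \<in> bc_germ u q z"
    using o x bc_frac_sec [OF U(1) a(1,2)] by (simp add: bc_germ_def)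
  then show thesis by (rule that)
qed

lemma bc_germ_stalk_carrier:
  assumes l: "loc_point X u q"
  shows "stalk_carrier (base_change X) (bc_point X u q) = bc_germ u q ` carrier (LL X u q)"
proof (intro equalityI subsetI)
  fix g assume "g \<in> stalk_carrier (base_change X) (bc_point X u q)"
  then obtain W s where g: "g = germ (base_change X) (bc_point X u q) W s" "openin (bc_top X) W" "bc_point X u q \<in> W"
    "s \<in> bc_sec_carrier X W"
    unfolding stalk_carrier_def base_change_simps(1,2) by blast
  obtain z where z: "bc_rep u q W s z" by (rule bc_sec_rep [OF g(4,2) l g(3)])
  show "g \<in> bc_germ u q ` carrier (LL X u q)"
    unfolding g(1) germ_bc [OF l z] using bc_rep_closed [OF l z] by (rule imageI)
next
  fix g assume "g \<in> bc_germ u q ` carrier (LL X u q)"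
  then obtain z where z: "z \<in> carrier (LL X u q)" "g = bc_germ u q z" by blast
  obtain W s where "(W, s) \<in> bc_germ u q z" by (rule bc_germ_nonempty [OF l z(1)])
  then have W: "openin (bc_top X) W" "bc_point X u q \<in> W" "s \<in> bc_sec_carrier X W" "bc_rep u q W s z"
    by (auto simp: bc_germ_def)
  show "g \<in> stalk_carrier (base_change X) (bc_point X u q)"
    unfolding stalk_carrier_def base_change_simps(1,2) z(2) germ_bc [OF l W(4), symmetric] using W(1-3) by blast
qed

lemma bc_germ_inj:
  assumes l: "loc_point X u q" and z: "z \<in> carrier (LL X u q)" and eq: "bc_germ u q z = bc_germ u q w"
  shows "z = w"
proof -
  obtain W s where s: "(W, s) \<in> bc_germ u q z" by (rule bc_germ_nonempty [OF l z])
  then have "(W, s) \<in> bc_germ u q w" using eq by simp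
  then have "bc_rep u q W s z" "bc_rep u q W s w" using s by (simp_all add: bc_germ_def)
  then show ?thesis by (rule bc_rep_unique [OF l])
qed

text \<open>Every choice of representatives contributes the same germ, by \<open>bc_rep_ops\<close>
  and \<open>germ_bc\<close>, and representatives exist by \<open>bc_germ_nonempty\<close>.\<close>

lemma bc_germ_ops:
  assumes l: "loc_point X u q" and z: "z \<in> carrier (LL X u q)" and w: "w \<in> carrier (LL X u q)"
  shows "bc_germ u q z \<otimes>\<^bsub>ring_stalk (base_change X) (bc_point X u q)\<^esub> bc_germ u q w = bc_germ u q (z \<otimes>\<^bsub>LL X u q\<^esub> w)"
    and "bc_germ u q z \<oplus>\<^bsub>ring_stalk (base_change X) (bc_point X u q)\<^esub> bc_germ u q w = bc_germ u q (z \<oplus>\<^bsub>LL X u q\<^esub> w)"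
proof -
  let ?B = "base_change X" and ?x = "bc_point X u q"
  have const: "germ ?B ?x (U \<inter> V) (res ?B U (U \<inter> V) s \<otimes>\<^bsub>sec ?B (U \<inter> V)\<^esub> res ?B V (U \<inter> V) t) = bc_germ u q (z \<otimes>\<^bsub>LL X u q\<^esub> w)"
    "germ ?B ?x (U \<inter> V) (res ?B U (U \<inter> V) s \<oplus>\<^bsub>sec ?B (U \<inter> V)\<^esub> res ?B V (U \<inter> V) t) = bc_germ u q (z \<oplus>\<^bsub>LL X u q\<^esub> w)"
    if "(U, s) \<in> bc_germ u q z" "(V, t) \<in> bc_germ u q w" for U s V t
  proof -
    have rep: "bc_rep u q U s z" "bc_rep u q V t w" using that by (auto simp: bc_germ_def)
    have pre: "chart_prime X U' v r \<in> bc_pre X U' (U \<inter> V)"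
      if "U' \<in> affine_opens X" "v \<in> U'" "loc_point X v r" "bc_point X v r \<in> U" "bc_point X v r \<in> V" for U' v r
      using chart_prime_bc_pre [OF that(1-3)] that(4,5) by simp
    have "bc_rep u q (U \<inter> V) (res ?B U (U \<inter> V) s \<otimes>\<^bsub>sec ?B (U \<inter> V)\<^esub> res ?B V (U \<inter> V) t) (z \<otimes>\<^bsub>LL X u q\<^esub> w) \<and>
       bc_rep u q (U \<inter> V) (res ?B U (U \<inter> V) s \<oplus>\<^bsub>sec ?B (U \<inter> V)\<^esub> res ?B V (U \<inter> V) t) (z \<oplus>\<^bsub>LL X u q\<^esub> w)"
      by (intro conjI bc_rep_ops [OF l rep]) (simp_all add: base_change_simps pre)
    then show "germ ?B ?x (U \<inter> V) (res ?B U (U \<inter> V) s \<otimes>\<^bsub>sec ?B (U \<inter> V)\<^esub> res ?B V (U \<inter> V) t) = bc_germ u q (z \<otimes>\<^bsub>LL X u q\<^esub> w)"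
      "germ ?B ?x (U \<inter> V) (res ?B U (U \<inter> V) s \<oplus>\<^bsub>sec ?B (U \<inter> V)\<^esub> res ?B V (U \<inter> V) t) = bc_germ u q (z \<oplus>\<^bsub>LL X u q\<^esub> w)"
      using germ_bc [OF l] by blast+
  qed
  obtain W s where "(W, s) \<in> bc_germ u q z" by (rule bc_germ_nonempty [OF l z])
  then have ne: "bc_germ u q z \<noteq> {}" by blast
  obtain W s where "(W, s) \<in> bc_germ u q w" by (rule bc_germ_nonempty [OF l w])
  then have ne': "bc_germ u q w \<noteq> {}" by blast
  have op: "stalk_op ?B ?x f (bc_germ u q z) (bc_germ u q w) = c"
    if f: "\<And>U s V t. \<lbrakk>(U, s) \<in> bc_germ u q z; (V, t) \<in> bc_germ u q w\<rbrakk> \<Longrightarrow>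
      germ ?B ?x (U \<inter> V) (f (U \<inter> V) (res ?B U (U \<inter> V) s) (res ?B V (U \<inter> V) t)) = c" for f c
  proof -
    have "stalk_op ?B ?x f (bc_germ u q z) (bc_germ u q w) = (\<Union>y\<in>bc_germ u q z. \<Union>y'\<in>bc_germ u q w. c)"
      unfolding stalk_op_def
      by (intro SUP_cong refl, clarify, intro SUP_cong refl, clarify) (rule f)
    also have "\<dots> = c" using ne ne' by simp
    finally show ?thesis .
  qed
  show "bc_germ u q z \<otimes>\<^bsub>ring_stalk ?B ?x\<^esub> bc_germ u q w = bc_germ u q (z \<otimes>\<^bsub>LL X u q\<^esub> w)"
    unfolding ring_stalk_def by simp (rule op, rule const(1))
  show "bc_germ u q z \<oplus>\<^bsub>ring_stalk ?B ?x\<^esub> bc_germ u q w = bc_germ u q (z \<oplus>\<^bsub>LL X u q\<^esub> w)"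
    unfolding ring_stalk_def by simp (rule op, rule const(2))
qed

lemma bc_germ_one_zero:
  assumes l: "loc_point X u q"
  shows "\<one>\<^bsub>ring_stalk (base_change X) (bc_point X u q)\<^esub> = bc_germ u q \<one>\<^bsub>LL X u q\<^esub>"
    and "\<zero>\<^bsub>ring_stalk (base_change X) (bc_point X u q)\<^esub> = bc_germ u q \<zero>\<^bsub>LL X u q\<^esub>"
proof -
  let ?B = "base_change X" and ?x = "bc_point X u q"
  obtain U where U: "U \<in> affine_opens X" "u \<in> U" using exists_affine loc_pointD(1) [OF l] by blast
  interpret A: cring "ZA X U" using ZA_cring affine_open U by blast
  let ?W = "bc_basic U \<one>\<^bsub>ZA X U\<^esub>"
  note o = openin_bc_basic [OF U(1) A.one_closed]
  have x: "?x \<in> ?W" using bc_point_basic [OF l] U(2) zg_one_notin [OF U l] by simp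
  have sub: "?W \<subseteq> topspace (bc_top X)" using o by (rule openin_subset)
  have pre: "chart_prime X U' v r \<in> bc_pre X U' (topspace (bc_top X))"
    if "U' \<in> affine_opens X" "v \<in> U'" "loc_point X v r" for U' v r
    using chart_prime_bc_pre [OF that] bc_point_topspace [OF that(3)] by simp
  have g: "bc_given ?W \<one>\<^bsub>sec ?B (topspace (bc_top X))\<^esub> U \<one>\<^bsub>ZA X U\<^esub> \<one>\<^bsub>ZA X U\<^esub>"
    "bc_given ?W \<zero>\<^bsub>sec ?B (topspace (bc_top X))\<^esub> U \<zero>\<^bsub>ZA X U\<^esub> \<one>\<^bsub>ZA X U\<^esub>"
  proof -
    have "v \<in> U \<and> zg X v U \<one>\<^bsub>ZA X U\<^esub> \<notin> r \<and>
        (\<forall>U'\<in>affine_opens X. v \<in> U' \<longrightarrow>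
          \<one>\<^bsub>sec ?B (topspace (bc_top X))\<^esub> U' (chart_prime X U' v r) = chart_val X U' v r (LF X v r (zg X v U \<one>\<^bsub>ZA X U\<^esub>) (zg X v U \<one>\<^bsub>ZA X U\<^esub>)) \<and>
          \<zero>\<^bsub>sec ?B (topspace (bc_top X))\<^esub> U' (chart_prime X U' v r) = chart_val X U' v r (LF X v r (zg X v U \<zero>\<^bsub>ZA X U\<^esub>) (zg X v U \<one>\<^bsub>ZA X U\<^esub>)))"
      if v: "loc_point X v r" "bc_point X v r \<in> ?W" for v r
    proof -
      have vU: "v \<in> U" "zg X v U \<one>\<^bsub>ZA X U\<^esub> \<notin> r" using bc_point_basic [OF v(1)] v(2) by auto
      have "\<one>\<^bsub>sec ?B (topspace (bc_top X))\<^esub> U' (chart_prime X U' v r) = chart_val X U' v r (LF X v r (zg X v U \<one>\<^bsub>ZA X U\<^esub>) (zg X v U \<one>\<^bsub>ZA X U\<^esub>)) \<and>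
          \<zero>\<^bsub>sec ?B (topspace (bc_top X))\<^esub> U' (chart_prime X U' v r) = chart_val X U' v r (LF X v r (zg X v U \<zero>\<^bsub>ZA X U\<^esub>) (zg X v U \<one>\<^bsub>ZA X U\<^esub>))"
        if U': "U' \<in> affine_opens X" "v \<in> U'" for U'
        unfolding chart_val_one_zero(3,4) [OF U(1) vU(1) v(1), symmetric] chart_val_one_zero(1,2) [OF U' v(1)]
        using U' pre [OF U' v(1)] by (simp add: base_change_simps)
      then show ?thesis using vU by blast
    qed
    then show "bc_given ?W \<one>\<^bsub>sec ?B (topspace (bc_top X))\<^esub> U \<one>\<^bsub>ZA X U\<^esub> \<one>\<^bsub>ZA X U\<^esub>"
      "bc_given ?W \<zero>\<^bsub>sec ?B (topspace (bc_top X))\<^esub> U \<zero>\<^bsub>ZA X U\<^esub> \<one>\<^bsub>ZA X U\<^esub>"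
      unfolding bc_given_def by blast+
  qed
  have "bc_rep u q (topspace (bc_top X)) \<one>\<^bsub>sec ?B (topspace (bc_top X))\<^esub> \<one>\<^bsub>LL X u q\<^esub>"
    by (rule bc_repI [OF U(1) A.one_closed A.one_closed o x sub g(1) chart_val_one_zero(3) [OF U l]])
  from germ_bc [OF l this] show "\<one>\<^bsub>ring_stalk ?B ?x\<^esub> = bc_germ u q \<one>\<^bsub>LL X u q\<^esub>"
    by (simp add: ring_stalk_def base_change_simps(1))
  have "bc_rep u q (topspace (bc_top X)) \<zero>\<^bsub>sec ?B (topspace (bc_top X))\<^esub> \<zero>\<^bsub>LL X u q\<^esub>"
    by (rule bc_repI [OF U(1) A.zero_closed A.one_closed o x sub g(2) chart_val_one_zero(4) [OF U l]])
  from germ_bc [OF l this] show "\<zero>\<^bsub>ring_stalk ?B ?x\<^esub> = bc_germ u q \<zero>\<^bsub>LL X u q\<^esub>"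
    by (simp add: ring_stalk_def base_change_simps(1))
qed

lemma bc_germ_iso:
  assumes l: "loc_point X u q"
  shows "bc_germ u q \<in> ring_iso (LL X u q) (ring_stalk (base_change X) (bc_point X u q))"
proof -
  have c: "carrier (ring_stalk (base_change X) (bc_point X u q)) = bc_germ u q ` carrier (LL X u q)"
    using bc_germ_stalk_carrier [OF l] by (simp add: ring_stalk_def)
  show ?thesis
  proof (rule ring_iso_memI)
    show "bij_betw (bc_germ u q) (carrier (LL X u q)) (carrier (ring_stalk (base_change X) (bc_point X u q)))"
      unfolding c by (intro inj_on_imp_bij_betw inj_onI) (rule bc_germ_inj [OF l])
  qed (simp_all add: c bc_germ_ops [OF l] bc_germ_one_zero [OF l])
qed

end

section \<open>Residue fields and residue pointed groups\<close>

context monoid_scheme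
begin

text \<open>The definition selects the value of a representation \<open>a/h\<close> of the germ
  through \<open>THE\<close>. All representations have the same value since \<open>to_Z\<close> is
  multiplicative, and one exists because the germ map of a chart is a localization.\<close>

lemma bc_proj_value_chart_prime:
  assumes l: "loc_point X v r" and V: "Op V" "v \<in> V" "f \<in> carrier (sec X V)" and U: "U \<in> affine_opens X" "v \<in> U"
  shows "bc_proj_value X V f U (chart_prime X U v r) =
    chart_val X U v r (LF X v r (to_Z (pm_stalk X v) (germ X v V f)) \<one>\<^bsub>ZO X v\<^esub>)" (is "_ = chart_val X U v r ?z")
proof -
  have o: "Op U" and ch: "chart X U" using U affine_open affine_chart by auto
  let ?P = "pm_stalk X v" and ?Q = "chart_prime X U v r"
  interpret A: pm "sec X U" using sec_pm o .
  interpret P: pm ?P using stalk_pm loc_pointD(1) [OF l] .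
  interpret S: ring_mult_set "ZO X v" "carrier (ZO X v) - r" by (rule loc_mult_set [OF l])
  have pt: "point_of_prime X U (Z_contract (sec X U) ?Q) = v"
    using Z_contract_chart_prime [OF o U(2) l] point_of_prime_eq [OF ch U(2)] by simp
  have g: "germ X v V f \<in> carrier ?P" by (rule germ_closed [OF V])
  have notin: "to_Z (sec X U) s \<notin> ?Q \<longleftrightarrow> to_Z ?P (germ X v U s) \<notin> r" if "s \<in> carrier (sec X U)" for s
    using A.to_Z_closed [OF that] zg_to_Z [OF o U(2) that] by (simp add: mem_chart_prime)
  have val: "CF X U ?Q (to_Z (sec X U) a) (to_Z (sec X U) h) = chart_val X U v r ?z"
    if a: "a \<in> carrier (sec X U)" "h \<in> carrier (sec X U)" "to_Z (sec X U) h \<notin> ?Q"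
      "germ X v V f \<otimes>\<^bsub>?P\<^esub> germ X v U h = germ X v U a" for a h
  proof -
    have h: "to_Z ?P (germ X v U h) \<notin> r" using notin a by simp
    have gc: "germ X v U a \<in> carrier ?P" "germ X v U h \<in> carrier ?P" using germ_closed [OF o U(2)] a by auto
    note tc = P.to_Z_closed [OF gc(1)] P.to_Z_closed [OF gc(2)] P.to_Z_closed [OF g]
    have hm: "to_Z ?P (germ X v U h) \<in> carrier (ZO X v) - r" using h tc by simp
    have eq: "to_Z ?P (germ X v U a) = to_Z ?P (germ X v V f) \<otimes>\<^bsub>ZO X v\<^esub> to_Z ?P (germ X v U h)"
      using P.to_Z_mult [OF g gc(2)] a(4) by simp
    have "LF X v r (to_Z ?P (germ X v U a)) (to_Z ?P (germ X v U h)) = ?z"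
      by (rule S.fraction_eqI [OF tc(1,3) hm S.S_one]) (use eq tc in simp)
    then show ?thesis
      using chart_val_LF [OF U l A.to_Z_closed [OF a(1)] A.to_Z_closed [OF a(2)]] h
      by (simp add: zg_to_Z [OF o U(2)] a)
  qed
  obtain a s where a: "a \<in> carrier (sec X U)" "s \<in> carrier (sec X U)" "germ X v U s \<in> Units ?P"
    "germ X v V f \<otimes>\<^bsub>?P\<^esub> germ X v U s = germ X v U a"
    by (rule localization_surj [OF chartD(4) [OF ch U(2)] g])
  have s: "to_Z (sec X U) s \<notin> ?Q"
    using notin [OF a(2)] loc_pointD(3) [OF l germ_closed [OF o U(2) a(2)]] a(3) by simp
  show ?thesis
    unfolding bc_proj_value_def Let_def pt
  proof (rule the_equality)
    show "\<exists>a\<in>carrier (sec X U). \<exists>h\<in>carrier (sec X U). to_Z (sec X U) h \<notin> ?Q \<and>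
        germ X v V f \<otimes>\<^bsub>?P\<^esub> germ X v U h = germ X v U a \<and>
        chart_val X U v r ?z = CF X U ?Q (to_Z (sec X U) a) (to_Z (sec X U) h)"
      by (rule bexI [OF _ a(1)], rule bexI [OF _ a(2)]) (intro conjI s a(4) val [OF a(1,2) s a(4), symmetric])
  next
    fix w assume "\<exists>a\<in>carrier (sec X U). \<exists>h\<in>carrier (sec X U). to_Z (sec X U) h \<notin> ?Q \<and>
        germ X v V f \<otimes>\<^bsub>?P\<^esub> germ X v U h = germ X v U a \<and>
        w = CF X U ?Q (to_Z (sec X U) a) (to_Z (sec X U) h)"
    then obtain a h where a: "a \<in> carrier (sec X U)" "h \<in> carrier (sec X U)" "to_Z (sec X U) h \<notin> ?Q"
      "germ X v V f \<otimes>\<^bsub>?P\<^esub> germ X v U h = germ X v U a" "w = CF X U ?Q (to_Z (sec X U) a) (to_Z (sec X U) h)"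
      by (elim bexE conjE)
    show "w = chart_val X U v r ?z" unfolding a(5) by (rule val [OF a(1-4)])
  qed
qed

text \<open>On an affine neighbourhood of \<open>u\<close> inside \<open>V\<close> the section is
  the image of the restriction of \<open>f\<close>, a fraction with denominator
  \<open>\<one>\<close>.\<close>

lemma bc_proj_rep:
  assumes l: "loc_point X u q" and V: "Op V" "u \<in> V" "f \<in> carrier (sec X V)"
  shows "bc_rep u q (bc_proj_pre X V) (bc_proj_sec X V f)
    (LF X u q (to_Z (pm_stalk X u) (germ X u V f)) \<one>\<^bsub>ZO X u\<^esub>)"
proof -
  obtain U0 where U0: "U0 \<in> affine_opens X" "u \<in> U0" using exists_affine loc_pointD(1) [OF l] by blast
  obtain U where "chart X U" "u \<in> U" "U \<subseteq> U0" "U \<subseteq> V"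
    by (rule chart_within [OF U0(1) [unfolded affine_chart] V(1) U0(2) V(2)])
  then have U: "U \<in> affine_opens X" "u \<in> U" "U \<subseteq> V" by (simp_all add: affine_chart)
  have o: "Op U" using U affine_open by blast
  interpret A: pm "sec X U" using sec_pm o .
  interpret ZU: cring "ZA X U" by (rule A.Z_ring_cring)
  let ?f = "res X V U f" and ?W = "bc_basic U \<one>\<^bsub>ZA X U\<^esub>"
  have f: "?f \<in> carrier (sec X U)" using res_closed [OF V(1) o U(3) V(3)] .
  have num: "zg X v U (to_Z (sec X U) ?f) = to_Z (pm_stalk X v) (germ X v V f)" "zg X v U \<one>\<^bsub>ZA X U\<^esub> = \<one>\<^bsub>ZO X v\<^esub>"
    if "v \<in> U" for v
    using zg_to_Z [OF o that f] germ_res [OF V(1) o U(3) that V(3)] ring_hom_one [OF zg_hom [OF o that]] by simp_all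
  note oW = openin_bc_basic [OF U(1) ZU.one_closed]
  have x: "bc_point X u q \<in> ?W" using bc_point_basic [OF l] U(2) zg_one_notin [OF U(1,2) l] by simp
  have inV: "bc_point X v r \<in> bc_proj_pre X V" if "loc_point X v r" "v \<in> U" for v r
    using bc_point_topspace [OF that(1)] bc_proj_bc_point [OF that(1)] that(2) U(3) by (auto simp: bc_proj_pre_def)
  have sub: "?W \<subseteq> bc_proj_pre X V" using inV by (auto simp: bc_basic_def)
  have g: "bc_given ?W (bc_proj_sec X V f) U (to_Z (sec X U) ?f) \<one>\<^bsub>ZA X U\<^esub>"
    unfolding bc_given_def
  proof (intro allI impI)
    fix v r assume v: "loc_point X v r" "bc_point X v r \<in> ?W"
    have vU: "v \<in> U" "zg X v U \<one>\<^bsub>ZA X U\<^esub> \<notin> r" using bc_point_basic [OF v(1)] v(2) by auto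
    have vV: "v \<in> V" using vU(1) U(3) by blast
    have "bc_proj_sec X V f U' (chart_prime X U' v r) =
        chart_val X U' v r (LF X v r (zg X v U (to_Z (sec X U) ?f)) (zg X v U \<one>\<^bsub>ZA X U\<^esub>))"
      if U': "U' \<in> affine_opens X" "v \<in> U'" for U'
    proof -
      have pm: "chart_prime X U' v r \<in> bc_pre X U' (bc_proj_pre X V)"
        using chart_prime_bc_pre [OF U' v(1)] inV [OF v(1) vU(1)] by simp
      show ?thesis
        unfolding bc_proj_sec_def restrict_apply' [OF U'(1)] restrict_apply' [OF pm] num [OF vU(1)]
        by (rule bc_proj_value_chart_prime [OF v(1) V(1) vV V(3) U'])
    qed
    then show "v \<in> U \<and> zg X v U \<one>\<^bsub>ZA X U\<^esub> \<notin> r \<and> (\<forall>U'\<in>affine_opens X. v \<in> U' \<longrightarrow>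
        bc_proj_sec X V f U' (chart_prime X U' v r) =
        chart_val X U' v r (LF X v r (zg X v U (to_Z (sec X U) ?f)) (zg X v U \<one>\<^bsub>ZA X U\<^esub>)))"
      using vU by blast
  qed
  show ?thesis
    by (rule bc_repI [OF U(1) A.to_Z_closed [OF f] ZU.one_closed oW x sub g]) (simp add: num [OF U(2)])
qed

lemma bc_proj_stalk_eq:
  assumes l: "loc_point X u q" and g: "g \<in> carrier (pm_stalk X u)"
  shows "bc_proj_stalk X (bc_point X u q) g = bc_germ u q (LF X u q (to_Z (pm_stalk X u) g) \<one>\<^bsub>ZO X u\<^esub>)"
proof -
  obtain V f where V: "Op V" "u \<in> V" "f \<in> carrier (sec X V)" "g = germ X u V f"
    using g by (auto simp: pm_stalk_def stalk_carrier_def)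
  have one: "germ (base_change X) (bc_point X u q) (bc_proj_pre X W) (bc_proj_sec X W t) =
      bc_germ u q (LF X u q (to_Z (pm_stalk X u) g) \<one>\<^bsub>ZO X u\<^esub>)" if Wt: "(W, t) \<in> g" for W t
  proof -
    have W: "Op W" "u \<in> W" "t \<in> carrier (sec X W)" "germ X u W t = g"
      using Wt mem_germ_iff [OF V(1-3), of W t] unfolding V(4) by auto
    show ?thesis using germ_bc [OF l bc_proj_rep [OF l W(1-3)]] W(4) by simp
  qed
  have "(V, f) \<in> g" unfolding V(4) using mem_germ_iff [OF V(1-3), of V f] V(1-3) by simp
  then have ne: "g \<noteq> {}" by blast
  have "bc_proj_stalk X (bc_point X u q) g = (\<Union>p\<in>g. bc_germ u q (LF X u q (to_Z (pm_stalk X u) g) \<one>\<^bsub>ZO X u\<^esub>))"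
    unfolding bc_proj_stalk_def by (intro SUP_cong refl, clarify) (rule one)
  then show ?thesis using ne by simp
qed

text \<open>For minimality, a pair of germs is multiplied by a unit germ to become a pair of germs
  of sections over \<open>U\<close>, which lies in \<open>d\<close>; multiplying by the inverse
  returns the original pair.\<close>

lemma stalk_congruence_gamma:
  assumes l: "loc_point X u q" and U: "U \<in> affine_opens X" "u \<in> U"
  shows "stalk_congruence X (gamma X (bc_point X u q)) U = gamma_affine (pm_stalk X u) q"
proof -
  have o: "Op U" and ch: "chart X U" using U affine_open affine_chart by auto
  let ?P = "pm_stalk X u" and ?Q = "chart_prime X U u q"
  interpret A: pm "sec X U" using sec_pm o .
  interpret P: pm ?P using stalk_pm loc_pointD(1) [OF l] .
  interpret ZU: cring "ZA X U" by (rule A.Z_ring_cring)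
  interpret q: primeideal q "ZO X u" by (rule loc_pointD(2) [OF l])
  interpret Z: ring_hom_cring "ZA X U" "ZO X u" "zg X u U"
    by unfold_locales (rule zg_hom [OF o U(2)])
  have p: "primeideal ?Q (ZA X U)" by (rule chart_prime_primeideal [OF o U(2) l])
  note gc = germ_closed [OF o U(2)]
  have iff: "(a, b) \<in> gamma_affine (sec X U) ?Q \<longleftrightarrow> (germ X u U a, germ X u U b) \<in> gamma_affine ?P q"
    if "a \<in> carrier (sec X U)" "b \<in> carrier (sec X U)" for a b
    using that gc A.to_Z_closed
    by (simp add: A.gamma_affine_iff [OF p] P.gamma_affine_iff [OF loc_pointD(2) [OF l]] mem_chart_prime zg_to_Z [OF o U(2)])
  have c: "congruence ?P (gamma_affine ?P q)"
    using P.gamma_affine_strong_prime [OF loc_pointD(2) [OF l]] by (simp add: strong_prime_congruence_def)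
  let ?R = "{(germ X u U a, germ X u U b) | a b. (a, b) \<in> gamma_affine (sec X U) ?Q}"
  have R: "?R \<subseteq> gamma_affine ?P q"
  proof
    fix y assume "y \<in> ?R"
    then obtain a b where ab: "y = (germ X u U a, germ X u U b)" "(a, b) \<in> gamma_affine (sec X U) ?Q" by blast
    then have "a \<in> carrier (sec X U)" "b \<in> carrier (sec X U)" by (simp_all add: gamma_affine_def)
    then show "y \<in> gamma_affine ?P q" using iff ab by simp
  qed
  have min: "gamma_affine ?P q \<subseteq> d" if d: "congruence ?P d" "?R \<subseteq> d" for d
  proof (rule subrelI)
    fix g g' assume gg: "(g, g') \<in> gamma_affine ?P q"
    then have g: "g \<in> carrier ?P" "g' \<in> carrier ?P" by (simp_all add: gamma_affine_def)
    obtain a b s where a: "a \<in> carrier (sec X U)" "b \<in> carrier (sec X U)" "s \<in> carrier (sec X U)" "germ X u U s \<in> Units ?P"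
      "g \<otimes>\<^bsub>?P\<^esub> germ X u U s = germ X u U a" "g' \<otimes>\<^bsub>?P\<^esub> germ X u U s = germ X u U b"
      by (rule localization_common_denominator [OF A.comm_monoid_axioms P.comm_monoid_axioms chartD(4) [OF ch U(2)] g])
    have m: "germ X u U s \<otimes>\<^bsub>?P\<^esub> g = germ X u U a" "germ X u U s \<otimes>\<^bsub>?P\<^esub> g' = germ X u U b"
      using a(5,6) P.m_comm [OF gc [OF a(3)]] g by simp_all
    have "(germ X u U s \<otimes>\<^bsub>?P\<^esub> g, germ X u U s \<otimes>\<^bsub>?P\<^esub> g') \<in> gamma_affine ?P q"
      using c gg gc [OF a(3)] unfolding congruence_def by blast
    then have "(germ X u U a, germ X u U b) \<in> d" unfolding m using iff [OF a(1,2)] d(2) by blast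
    then have "(inv\<^bsub>?P\<^esub> germ X u U s \<otimes>\<^bsub>?P\<^esub> germ X u U a, inv\<^bsub>?P\<^esub> germ X u U s \<otimes>\<^bsub>?P\<^esub> germ X u U b) \<in> d"
      using d(1) P.Units_inv_closed [OF a(4)] unfolding congruence_def by blast
    moreover have "inv\<^bsub>?P\<^esub> germ X u U s \<otimes>\<^bsub>?P\<^esub> (germ X u U s \<otimes>\<^bsub>?P\<^esub> k) = k" if "k \<in> carrier ?P" for k
      using P.m_assoc [of "inv\<^bsub>?P\<^esub> germ X u U s" "germ X u U s" k] P.Units_inv_closed [OF a(4)] P.Units_l_inv [OF a(4)] gc [OF a(3)] that
      by simp
    ultimately show "(g, g') \<in> d" unfolding m [symmetric] using g by simp
  qed
  show ?thesis
    unfolding stalk_congruence_def Let_def gamma_bc_point(2) [OF l U] gamma_bc_point(3) [OF l U] generated_congruence_def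
  proof (rule antisym)
    show "\<Inter>{d. congruence ?P d \<and> ?R \<subseteq> d} \<subseteq> gamma_affine ?P q" by (rule Inter_lower) (simp only: mem_Collect_eq c R simp_thms)
    show "gamma_affine ?P q \<subseteq> \<Inter>{d. congruence ?P d \<and> ?R \<subseteq> d}"
      by (rule Inter_greatest) (elim CollectE conjE, rule min)
  qed
qed

lemma residue_embedding:
  assumes l: "loc_point X u q" and U: "U \<in> affine_opens X" "u \<in> U"
  defines "x \<equiv> bc_point X u q"
  shows "pointed_group (residue_pgroup X (gamma X x) U)"
    and "pointed_group (mult_pmonoid (residue_field (base_change X) x))"
    and "\<exists>k \<in> pm_hom (residue_pgroup X (gamma X x) U) (mult_pmonoid (residue_field (base_change X) x)).
      (\<forall>g \<in> carrier (pm_stalk X u). k (residue_pgroup_map X (gamma X x) U g) =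
         residue_map (base_change X) x (bc_proj_stalk X x g)) \<and>
      inj_on k (carrier (residue_pgroup X (gamma X x) U))"
proof -
  let ?P = "pm_stalk X u" and ?c = "gamma_affine (pm_stalk X u) q"
  interpret P: pm ?P using stalk_pm loc_pointD(1) [OF l] .
  interpret q: primeideal q "ZO X u" by (rule loc_pointD(2) [OF l])
  have sc: "stalk_congruence X (gamma X x) U = ?c" unfolding x_def by (rule stalk_congruence_gamma [OF l U])
  have pg: "residue_pgroup X (gamma X x) U = pm_quot ?P ?c"
    unfolding residue_pgroup_def sc unfolding x_def gamma_bc_point(2) [OF l U] ..
  let ?K = "residue_field (base_change X) x"
  define h where "h a = stalk_maximal_ideal (base_change X) x +>\<^bsub>ring_stalk (base_change X) x\<^esub>
      bc_germ u q (LF X u q a \<one>\<^bsub>ZO X u\<^esub>)" for a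
  \<comment> \<open>The stalk of X_Z plays the part of the ring isomorphic to the local ring,
    through \<open>bc_germ u q\<close>.\<close>
  note f = localization_residue_map [OF loc_ring_prime [OF l] bc_germ_iso [OF l] bc_germ_one_zero(2) [OF l, symmetric],
      folded x_def, folded stalk_maximal_ideal_def, folded residue_field_def h_def]
  interpret K: field ?K by (rule f(1))
  have K: "pointed_monoid (mult_pmonoid ?K)" by (rule mult_pmonoid_pointed [OF K.is_cring])
  show "pointed_group (mult_pmonoid ?K)" by (rule pointed_group_field [OF f(1)])
  have hom: "h \<circ> to_Z ?P \<in> pm_hom ?P (mult_pmonoid ?K)"
    using pm_homD [OF f(2)] by (intro pm_homI) (auto simp: P.to_Z_closed P.to_Z_mult P.to_Z_one P.to_Z_zero)
  have "a \<in> carrier ?P \<and> b \<in> carrier ?P \<and> (h \<circ> to_Z ?P) a = (h \<circ> to_Z ?P) b \<longleftrightarrow> (a, b) \<in> ?c" for a b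
    by (simp add: P.gamma_affine_iff [OF loc_pointD(2) [OF l]] f(3) P.to_Z_closed cong: conj_cong)
  then have c: "?c = {(a, b). a \<in> carrier ?P \<and> b \<in> carrier ?P \<and> (h \<circ> to_Z ?P) a = (h \<circ> to_Z ?P) b}"
    by (simp only:) simp
  note i = pm_quot_induced [OF P.pointed_monoid_axioms K hom c]
  from i(4) obtain k where k: "k \<in> pm_hom (pm_quot ?P ?c) (mult_pmonoid ?K)"
    "\<And>a. a \<in> carrier ?P \<Longrightarrow> k (?c `` {a}) = (h \<circ> to_Z ?P) a" "inj_on k (carrier (pm_quot ?P ?c))" by blast
  have rm: "residue_map (base_change X) x (bc_proj_stalk X x g) = (h \<circ> to_Z ?P) g" if "g \<in> carrier ?P" for g
    unfolding residue_map_def x_def bc_proj_stalk_eq [OF l that] unfolding x_def [symmetric]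
    by (simp add: h_def)
  show "\<exists>k \<in> pm_hom (residue_pgroup X (gamma X x) U) (mult_pmonoid ?K).
      (\<forall>g \<in> carrier ?P. k (residue_pgroup_map X (gamma X x) U g) = residue_map (base_change X) x (bc_proj_stalk X x g)) \<and>
      inj_on k (carrier (residue_pgroup X (gamma X x) U))"
    unfolding pg residue_pgroup_map_def sc
    by (rule bexI [OF _ k(1)]) (use k(2,3) rm in simp)
  have qs: "carrier (pm_quot ?P ?c) = carrier ?P // ?c" "\<one>\<^bsub>pm_quot ?P ?c\<^esub> = ?c `` {\<one>\<^bsub>?P\<^esub>}" "pzero (pm_quot ?P ?c) = ?c `` {pzero ?P}"
    by (simp_all add: pm_quot_def)
  \<comment> \<open>The image of the zero in the field is zero, which is not a unit there.\<close>
  have U1: "pzero (pm_quot ?P ?c) \<notin> Units (pm_quot ?P ?c)"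
  proof
    assume "pzero (pm_quot ?P ?c) \<in> Units (pm_quot ?P ?c)"
    then have "k (pzero (pm_quot ?P ?c)) \<in> Units (mult_pmonoid ?K)" by (rule pm_hom_Units [OF i(2) K k(1)])
    then show False
      using pm_homD(4) [OF k(1)] pointed_group_field [OF f(1)] by (simp add: pointed_group_def)
  qed
  \<comment> \<open>A germ outside the null ideal is a unit of the stalk, by the condition in
    \<open>loc_point\<close>; the class of its inverse is the inverse of its class.\<close>
  have U2: "y \<in> Units (pm_quot ?P ?c)" if y: "y \<in> carrier (pm_quot ?P ?c)" "y \<noteq> pzero (pm_quot ?P ?c)" for y
  proof -
    obtain g where g: "g \<in> carrier ?P" "y = ?c `` {g}" using y(1) unfolding qs(1) by (auto elim: quotientE)
    have "(g, pzero ?P) \<notin> ?c"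
      using y(2) equiv_class_eq [of "carrier ?P" ?c g "pzero ?P"] i(1) unfolding g(2) qs(3) congruence_def by blast
    then have "g \<notin> null_ideal ?P ?c" by (simp add: null_ideal_def)
    then have "g \<in> Units ?P"
      unfolding P.null_ideal_gamma_affine [OF loc_pointD(2) [OF l]] using loc_pointD(3) [OF l g(1)] g(1) by (simp add: Z_contract_def)
    then have ig: "inv\<^bsub>?P\<^esub> g \<in> carrier ?P" "inv\<^bsub>?P\<^esub> g \<otimes>\<^bsub>?P\<^esub> g = \<one>\<^bsub>?P\<^esub>" "g \<otimes>\<^bsub>?P\<^esub> inv\<^bsub>?P\<^esub> g = \<one>\<^bsub>?P\<^esub>"
      using P.Units_inv_closed P.Units_l_inv P.Units_r_inv by auto
    have ic: "?c `` {inv\<^bsub>?P\<^esub> g} \<in> carrier (pm_quot ?P ?c)" unfolding qs(1) using ig(1) by (rule quotientI)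
    have "?c `` {inv\<^bsub>?P\<^esub> g} \<otimes>\<^bsub>pm_quot ?P ?c\<^esub> y = \<one>\<^bsub>pm_quot ?P ?c\<^esub>" "y \<otimes>\<^bsub>pm_quot ?P ?c\<^esub> ?c `` {inv\<^bsub>?P\<^esub> g} = \<one>\<^bsub>pm_quot ?P ?c\<^esub>"
      unfolding g(2) i(3) [OF ig(1) g(1)] i(3) [OF g(1) ig(1)] ig(2,3) qs(2) by (rule refl)+
    then show ?thesis unfolding Units_def using y(1) ic by blast
  qed
  have "Units (pm_quot ?P ?c) \<subseteq> carrier (pm_quot ?P ?c)" by (auto simp: Units_def)
  then have "Units (pm_quot ?P ?c) = carrier (pm_quot ?P ?c) - {pzero (pm_quot ?P ?c)}" using U1 U2 by blast
  then show "pointed_group (residue_pgroup X (gamma X x) U)"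
    unfolding pg pointed_group_def using i(2) by blast
qed

end

theorem proposition4:
  fixes X :: "('p, 's) pm_space"
  assumes "monoid_scheme X"
  shows "continuous_map (spc (base_change X)) (SCong_X X) (gamma X) \<and>
    (\<forall>x \<in> topspace (spc (base_change X)). bc_proj X x = SCong_proj X (gamma X x)) \<and>
    (\<forall>x \<in> topspace (spc (base_change X)). \<forall>U \<in> affine_opens X. bc_proj X x \<in> U \<longrightarrow>
       pointed_group (residue_pgroup X (gamma X x) U) \<and>
       pointed_group (mult_pmonoid (residue_field (base_change X) x)) \<and>
       (\<exists>\<gamma>\<^sub>x \<in> pm_hom (residue_pgroup X (gamma X x) U)
                      (mult_pmonoid (residue_field (base_change X) x)).
          (\<forall>g \<in> carrier (pm_stalk X (bc_proj X x)).
             \<gamma>\<^sub>x (residue_pgroup_map X (gamma X x) U g) =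
               residue_map (base_change X) x (bc_proj_stalk X x g)) \<and>
          inj_on \<gamma>\<^sub>x (carrier (residue_pgroup X (gamma X x) U))))"
proof -
  interpret monoid_scheme X by fact
  have spc: "spc (base_change X) = bc_top X" by (simp add: base_change_simps)
  show ?thesis
    unfolding spc
  proof (intro conjI ballI impI)
    show "continuous_map (bc_top X) (SCong_X X) (gamma X)" by (rule gamma_continuous)
  next
    fix x assume "x \<in> topspace (bc_top X)"
    then obtain u q where x: "loc_point X u q" "x = bc_point X u q" by (rule bc_top_cases)
    obtain U where "U \<in> affine_opens X" "u \<in> U" using exists_affine loc_pointD(1) [OF x(1)] by blast
    then show "bc_proj X x = SCong_proj X (gamma X x)"
      unfolding x(2) by (simp add: bc_proj_bc_point [OF x(1)] gamma_bc_point(2) [OF x(1)])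
  next
    fix x U assume "x \<in> topspace (bc_top X)" and U: "U \<in> affine_opens X" "bc_proj X x \<in> U"
    then obtain u q where x: "loc_point X u q" "x = bc_point X u q" using bc_top_cases by blast
    have u: "bc_proj X x = u" unfolding x(2) by (rule bc_proj_bc_point [OF x(1)])
    note r = residue_embedding [OF x(1) U(1) U(2) [unfolded u], folded x(2)]
    show "pointed_group (residue_pgroup X (gamma X x) U)"
      "pointed_group (mult_pmonoid (residue_field (base_change X) x))"
      "\<exists>\<gamma>\<^sub>x \<in> pm_hom (residue_pgroup X (gamma X x) U)
                      (mult_pmonoid (residue_field (base_change X) x)).
          (\<forall>g \<in> carrier (pm_stalk X (bc_proj X x)).
             \<gamma>\<^sub>x (residue_pgroup_map X (gamma X x) U g) =
               residue_map (base_change X) x (bc_proj_stalk X x g)) \<and>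
          inj_on \<gamma>\<^sub>x (carrier (residue_pgroup X (gamma X x) U))"
      unfolding u by (rule r)+
  qed
qed

end
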